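(* Let $\mathfrak{R}=(D,\mathcal{M},\pi)$ be a matroid-rooted digraph, $D=(V,A)$, $\mathcal{M}=(S,\mathcal{I})$. Suppose that $\mathfrak{R}$ is independent, satisfies the linkage condition, and satisfies at least one of the following two conditions: (F) $\mathcal{M}$ has finite rank, and for every forward-infinite directed path $P$ in $D$ the set $\mathcal{S}(V(P))$ spans $\mathcal{N}(V(P))$; (B) $\mathcal{M}$ has at most countably many components, each of finite rank, and for every backward-infinite directed path $P$ in $D$ the set $\mathcal{S}(V(P))$ spans $\mathcal{N}(V(P))$. Then there exists an independent, maximal branching packing for $\mathfrak{R}$.
   Context: Matroids may be infinite: a matroid $\mathcal{M}=(S,\mathcal{I})$ is a family $\mathcal{I}\subseteq\mathcal{P}(S)$ with $\varnothing\in\mathcal{I}$, closed under subsets, such that if $B$ is a maximal element of $\mathcal{I}$ and $I\in\mathcal{I}$ is not maximal then $I\cup\{i\}\in\mathcal{I}$ for some $i\in B\setminus I$, and such that for $I\in\mathcal{I}$, $I\subseteq X\subseteq S$ the set $\{I'\in\mathcal{I}: I\subseteq I'\subseteq X\}$ has a maximal element. Bases, circuits, components (classes of the equivalence relation generated by "lie in a common circuit"), rank and contraction are as usual; $\mathsf{span}(S')$ is $S'$ together with the loops of the contraction of $S'$. Digraphs may have parallel edges but no loops. Paths are directed, have no repeated vertices, and are finite unless said otherwise. For $X\subseteq V$, $\mathsf{to}_D(X)$ is the set of vertices from which some vertex of $X$ is reachable by a directed path (so $X\subseteq \mathsf{to}_D(X)$). A matroid-rooted digraph is a triple $\mathfrak{R}=(D,\mathcal{M},\pi)$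 with $D=(V,A)$ a digraph, $\mathcal{M}=(S,\mathcal{I})$ a matroid and $\pi:S\to\mathcal{P}(V)\setminus\{\varnothing\}$. For $X\subseteq V$ let $\mathcal{S}(X)=\{i\in S:\pi(i)\cap X\neq\varnothing\}$ and $\mathcal{N}(X)=\mathsf{span}(\mathcal{S}(\mathsf{to}_D(X)))$; for a vertex $v$ write $\mathcal{S}(v),\mathcal{N}(v)$ for $\mathcal{S}(\{v\}),\mathcal{N}(\{v\})$. $\mathfrak{R}$ is independent if $\mathcal{S}(v)\in\mathcal{I}$ for all $v\in V$. For $I\in\mathcal{I}$ and $T\subseteq V$, an $(I,T)$-linkage is a system of pairwise edge-disjoint paths $\{P_i\}_{i\in I}$ with $P_i$ going from a vertex of $\pi(i)$ to a vertex of $T$. $\mathfrak{R}$ satisfies the linkage condition if for every $v\in V$ there is an $(B,\{v\})$-linkage in $D$ for some base $B$ of (the restriction of $\mathcal{M}$ to) $\mathcal{N}(v)$. A branching is a directed forest in which every vertex is reachable by a unique path from its root set, the set of vertices of in-degree $0$. A branching packing for $\mathfrak{R}$ is a system $\{\mathcal{B}_i\}_{i\in S}$ of pairwise edge-disjoint branchings in $D$ such that the root set of $\mathcal{B}_i$ is $\pi(i)$. For $v\in V$ let $\mathcal{S}_{\mathcal{B}}(v)=\{i\in S: v\in V(\mathcal{B}_i)\}$. The packing is independent if $\mathcal{S}_{\mathcal{B}}(v)\in\mathcal{I}$ for all $v$, and maximal if $\mathcal{S}_{\mathcal{B}}(v)$ spans $\mathcal{N}(v)$ for all $v$. *)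

theory Defs
  imports "Graph_Theory.Digraph_Component" "HOL-Library.Countable_Set"
begin

section \<open>Possibly infinite matroids\<close>

definition maximal_in :: "'s set set \<Rightarrow> 's set \<Rightarrow> bool" where
  "maximal_in F B \<longleftrightarrow> B \<in> F \<and> (\<forall>C\<in>F. B \<subseteq> C \<longrightarrow> C = B)"

locale matroid =
  fixes S :: "'s set" and Ind :: "'s set set"
  assumes Ind_subset: "J \<in> Ind \<Longrightarrow> J \<subseteq> S"
    and empty_Ind: "{} \<in> Ind"
    and Ind_down: "J \<in> Ind \<Longrightarrow> K \<subseteq> J \<Longrightarrow> K \<in> Ind"
    and Ind_augment: "maximal_in Ind B \<Longrightarrow> J \<in> Ind \<Longrightarrow> \<not> maximal_in Ind J
      \<Longrightarrow> \<exists>i \<in> B - J. J \<union> {i} \<in> Ind"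
    and Ind_maximal: "J \<in> Ind \<Longrightarrow> J \<subseteq> X \<Longrightarrow> X \<subseteq> S
      \<Longrightarrow> \<exists>B. maximal_in {J' \<in> Ind. J \<subseteq> J' \<and> J' \<subseteq> X} B"

abbreviation matroid_base :: "'s set set \<Rightarrow> 's set \<Rightarrow> bool" where
  "matroid_base \<equiv> maximal_in"

definition restrict_matroid :: "'s set set \<Rightarrow> 's set \<Rightarrow> 's set set" where
  "restrict_matroid Ind X = {J \<in> Ind. J \<subseteq> X}"

text \<open>The contraction of \<open>X\<close> is a matroid on \<open>S - X\<close>. In a matroid it does not matter
  whether \<open>B\<close> below ranges over some or over all bases of the restriction to \<open>X\<close>.\<close>

definition contract_matroid :: "'s set \<Rightarrow> 's set set \<Rightarrow> 's set \<Rightarrow> 's set set" where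
  "contract_matroid S Ind X =
    {J. J \<subseteq> S - X \<and> (\<exists>B. matroid_base (restrict_matroid Ind X) B \<and> J \<union> B \<in> Ind)}"

definition matroid_loops :: "'s set \<Rightarrow> 's set set \<Rightarrow> 's set" where
  "matroid_loops S Ind = {x \<in> S. {x} \<notin> Ind}"

definition matroid_span :: "'s set \<Rightarrow> 's set set \<Rightarrow> 's set \<Rightarrow> 's set" where
  "matroid_span S Ind X = X \<union> matroid_loops (S - X) (contract_matroid S Ind X)"

definition spans :: "'s set \<Rightarrow> 's set set \<Rightarrow> 's set \<Rightarrow> 's set \<Rightarrow> bool" where
  "spans S Ind X Y \<longleftrightarrow> Y \<subseteq> matroid_span S Ind X"

definition matroid_circuit :: "'s set \<Rightarrow> 's set set \<Rightarrow> 's set \<Rightarrow> bool" where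
  "matroid_circuit S Ind C \<longleftrightarrow> C \<subseteq> S \<and> C \<notin> Ind \<and> (\<forall>C'. C' \<subset> C \<longrightarrow> C' \<in> Ind)"

definition common_circuit :: "'s set \<Rightarrow> 's set set \<Rightarrow> 's rel" where
  "common_circuit S Ind = {(x, y). \<exists>C. matroid_circuit S Ind C \<and> x \<in> C \<and> y \<in> C}"

text \<open>The reflexive part makes every element lying in no circuit a component by itself.\<close>

definition component_rel :: "'s set \<Rightarrow> 's set set \<Rightarrow> 's rel" where
  "component_rel S Ind = Id_on S \<union> (common_circuit S Ind)\<^sup>+"

definition matroid_components :: "'s set \<Rightarrow> 's set set \<Rightarrow> 's set set" where
  "matroid_components S Ind = S // component_rel S Ind"

text \<open>All bases of a matroid that has a finite base have the same size.\<close>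

definition finite_rank :: "'s set set \<Rightarrow> bool" where
  "finite_rank Ind \<longleftrightarrow> (\<exists>B. matroid_base Ind B \<and> finite B)"

lemma component_rel_equiv: "equiv S (component_rel S Ind)"
proof -
  have sub: "common_circuit S Ind \<subseteq> S \<times> S"
    by (auto simp: common_circuit_def matroid_circuit_def)
  then have "(common_circuit S Ind)\<^sup>+ \<subseteq> S \<times> S"
    by (rule trancl_subset_Sigma)
  moreover have "sym ((common_circuit S Ind)\<^sup>+)"
    by (rule sym_trancl) (auto simp: sym_def common_circuit_def)
  ultimately show ?thesis
    by (auto simp: equiv_def refl_on_def sym_def trans_def component_rel_def
        intro: trancl_trans)
qed

lemma component_rel_least:
  assumes "equiv S R" and "common_circuit S Ind \<subseteq> R"
  shows "component_rel S Ind \<subseteq> R"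
proof -
  have "(common_circuit S Ind)\<^sup>+ \<subseteq> R\<^sup>+"
    using assms(2) by (auto intro: trancl_mono)
  also have "R\<^sup>+ = R"
    using assms(1) by (simp add: equiv_def trancl_id)
  finally show ?thesis
    using assms(1) by (auto simp: component_rel_def equiv_def refl_on_def)
qed

section \<open>Infinite paths and branchings\<close>

definition to_set :: "('v, 'a) pre_digraph \<Rightarrow> 'v set \<Rightarrow> 'v set" where
  "to_set D X = {u. \<exists>x\<in>X. u \<rightarrow>\<^sup>*\<^bsub>D\<^esub> x}"

text \<open>An infinite path is given by its vertices \<open>x\<close> and its arcs \<open>e\<close>; a backward-infinite
  path is enumerated starting from its last vertex.\<close>

definition forward_infinite_path ::
  "('v, 'a) pre_digraph \<Rightarrow> (nat \<Rightarrow> 'v) \<Rightarrow> (nat \<Rightarrow> 'a) \<Rightarrow> bool" where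
  "forward_infinite_path D x e \<longleftrightarrow> inj x \<and>
    (\<forall>n. e n \<in> arcs D \<and> tail D (e n) = x n \<and> head D (e n) = x (Suc n))"

definition backward_infinite_path ::
  "('v, 'a) pre_digraph \<Rightarrow> (nat \<Rightarrow> 'v) \<Rightarrow> (nat \<Rightarrow> 'a) \<Rightarrow> bool" where
  "backward_infinite_path D x e \<longleftrightarrow> inj x \<and>
    (\<forall>n. e n \<in> arcs D \<and> tail D (e n) = x (Suc n) \<and> head D (e n) = x n)"

text \<open>A cycle of the underlying undirected multigraph: the arc \<open>es ! k\<close>, in either direction,
  joins \<open>vs ! k\<close> to the cyclically next vertex. Loops and pairs of parallel or antiparallel
  arcs count. The library's \<open>forest\<close> excludes directed cycles only.\<close>

definition undirected_cycle :: "('v, 'a) pre_digraph \<Rightarrow> 'v list \<Rightarrow> 'a list \<Rightarrow> bool" where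
  "undirected_cycle G vs es \<longleftrightarrow>
    es \<noteq> [] \<and> length vs = length es \<and> distinct vs \<and> distinct es \<and> set es \<subseteq> arcs G \<and>
    (\<forall>k < length es.
      {tail G (es ! k), head G (es ! k)} = {vs ! k, vs ! (Suc k mod length es)})"

definition directed_forest :: "('v, 'a) pre_digraph \<Rightarrow> bool" where
  "directed_forest G \<longleftrightarrow> wf_digraph G \<and> \<not> (\<exists>vs es. undirected_cycle G vs es)"

text \<open>In-degree zero is expressed by \<open>in_arcs\<close>, as the library's \<open>in_degree\<close> is also zero
  at vertices of infinite in-degree.\<close>

definition root_set :: "('v, 'a) pre_digraph \<Rightarrow> 'v set" where
  "root_set G = {v \<in> verts G. in_arcs G v = {}}"

text \<open>A path is the pair of its first vertex and its arc list.\<close>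

definition branching :: "('v, 'a) pre_digraph \<Rightarrow> bool" where
  "branching G \<longleftrightarrow> directed_forest G \<and>
    (\<forall>v \<in> verts G. \<exists>!P. fst P \<in> root_set G \<and> pre_digraph.apath G (fst P) (snd P) v)"

section \<open>Matroid-rooted digraphs\<close>

locale matroid_rooted_digraph = loopfree_digraph D + matroid S Ind
  for D :: "('v, 'a) pre_digraph" and S :: "'s set" and Ind :: "'s set set" +
  fixes \<pi> :: "'s \<Rightarrow> 'v set"
  assumes pi_subset: "i \<in> S \<Longrightarrow> \<pi> i \<subseteq> verts D"
    and pi_nonempty: "i \<in> S \<Longrightarrow> \<pi> i \<noteq> {}"

definition sources :: "'s set \<Rightarrow> ('s \<Rightarrow> 'v set) \<Rightarrow> 'v set \<Rightarrow> 's set" where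
  "sources S \<pi> X = {i \<in> S. \<pi> i \<inter> X \<noteq> {}}"

definition reach_span ::
  "('v, 'a) pre_digraph \<Rightarrow> 's set \<Rightarrow> 's set set \<Rightarrow> ('s \<Rightarrow> 'v set) \<Rightarrow> 'v set \<Rightarrow> 's set" where
  "reach_span D S Ind \<pi> X = matroid_span S Ind (sources S \<pi> (to_set D X))"

definition independent_mrd ::
  "('v, 'a) pre_digraph \<Rightarrow> 's set \<Rightarrow> 's set set \<Rightarrow> ('s \<Rightarrow> 'v set) \<Rightarrow> bool" where
  "independent_mrd D S Ind \<pi> \<longleftrightarrow> (\<forall>v \<in> verts D. sources S \<pi> {v} \<in> Ind)"

definition linkage ::
  "('v, 'a) pre_digraph \<Rightarrow> ('s \<Rightarrow> 'v set) \<Rightarrow> 's set \<Rightarrow> 'v set \<Rightarrow> ('s \<Rightarrow> 'a list) \<Rightarrow> bool" where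
  "linkage D \<pi> J T P \<longleftrightarrow>
    (\<forall>i\<in>J. \<exists>u \<in> \<pi> i. \<exists>t\<in>T. pre_digraph.apath D u (P i) t) \<and>
    (\<forall>i\<in>J. \<forall>j\<in>J. i \<noteq> j \<longrightarrow> set (P i) \<inter> set (P j) = {})"

definition linkage_condition ::
  "('v, 'a) pre_digraph \<Rightarrow> 's set \<Rightarrow> 's set set \<Rightarrow> ('s \<Rightarrow> 'v set) \<Rightarrow> bool" where
  "linkage_condition D S Ind \<pi> \<longleftrightarrow>
    (\<forall>v \<in> verts D. \<exists>B. matroid_base (restrict_matroid Ind (reach_span D S Ind \<pi> {v})) B \<and>
      (\<exists>P. linkage D \<pi> B {v} P))"

definition condition_F ::
  "('v, 'a) pre_digraph \<Rightarrow> 's set \<Rightarrow> 's set set \<Rightarrow> ('s \<Rightarrow> 'v set) \<Rightarrow> bool" where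
  "condition_F D S Ind \<pi> \<longleftrightarrow> finite_rank Ind \<and>
    (\<forall>x e. forward_infinite_path D x e \<longrightarrow>
      spans S Ind (sources S \<pi> (range x)) (reach_span D S Ind \<pi> (range x)))"

definition condition_B ::
  "('v, 'a) pre_digraph \<Rightarrow> 's set \<Rightarrow> 's set set \<Rightarrow> ('s \<Rightarrow> 'v set) \<Rightarrow> bool" where
  "condition_B D S Ind \<pi> \<longleftrightarrow>
    countable (matroid_components S Ind) \<and>
    (\<forall>C \<in> matroid_components S Ind. finite_rank (restrict_matroid Ind C)) \<and>
    (\<forall>x e. backward_infinite_path D x e \<longrightarrow>
      spans S Ind (sources S \<pi> (range x)) (reach_span D S Ind \<pi> (range x)))"

definition branching_packing ::
  "('v, 'a) pre_digraph \<Rightarrow> 's set \<Rightarrow> ('s \<Rightarrow> 'v set) \<Rightarrow> ('s \<Rightarrow> ('v, 'a) pre_digraph) \<Rightarrow> bool"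
  where
  "branching_packing D S \<pi> \<B> \<longleftrightarrow>
    (\<forall>i\<in>S. branching (\<B> i) \<and> subgraph (\<B> i) D \<and> root_set (\<B> i) = \<pi> i) \<and>
    (\<forall>i\<in>S. \<forall>j\<in>S. i \<noteq> j \<longrightarrow> arcs (\<B> i) \<inter> arcs (\<B> j) = {})"

definition packing_sources :: "'s set \<Rightarrow> ('s \<Rightarrow> ('v, 'a) pre_digraph) \<Rightarrow> 'v \<Rightarrow> 's set" where
  "packing_sources S \<B> v = {i \<in> S. v \<in> verts (\<B> i)}"

definition independent_packing ::
  "('v, 'a) pre_digraph \<Rightarrow> 's set \<Rightarrow> 's set set \<Rightarrow> ('s \<Rightarrow> ('v, 'a) pre_digraph) \<Rightarrow> bool" where
  "independent_packing D S Ind \<B> \<longleftrightarrow> (\<forall>v \<in> verts D. packing_sources S \<B> v \<in> Ind)"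

definition maximal_packing ::
  "('v, 'a) pre_digraph \<Rightarrow> 's set \<Rightarrow> 's set set \<Rightarrow> ('s \<Rightarrow> 'v set) \<Rightarrow>
    ('s \<Rightarrow> ('v, 'a) pre_digraph) \<Rightarrow> bool" where
  "maximal_packing D S Ind \<pi> \<B> \<longleftrightarrow>
    (\<forall>v \<in> verts D. spans S Ind (packing_sources S \<B> v) (reach_span D S Ind \<pi> {v}))"

end

theory Submission
  imports Defs
begin

text \<open>Arcs are labelled one at a time, an arc receiving a label that is present at its tail and not yet
  spanned at its head; the arcs labelled \<open>i\<close> become the branching with root set \<open>\<pi> i\<close>. A labelling
  is feasible if every vertex can still be supplied, by arc-disjoint trails of unlabelled arcs starting
  at vertices that hold the labels, with a base of its flat \<open>N x\<close>. Vertices with the same flat are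
  treated in one network, where vertices with a smaller flat count as holding all of it.

  If labelling an arc destroys feasibility at its head, the residual sets of all complete families
  ending there form a directed system. Its union is a tight region: within it feasibility can be
  judged separately, each entering arc (gate) being a coloop, and the number of its gates is bounded
  by the rank. A vertex \<open>z\<close> that cannot be given a label it still lacks therefore produces another such
  vertex in a smaller region or with a smaller flat, from which \<open>z\<close> is reached by a path that is
  disjoint from the new region up to its first vertex and carries no root of the missing kind. Iterating,
  these paths join to a backward-infinite path contradicting (B). Under (F) the flats and the
  gates that stay forever stabilise; following the remaining gates through the shrinking regions
  yields a forward-infinite path whose roots span the flat inside a region that still has a gate,
  contradicting the bound on gates.

  So each vertex can be completed in finitely many steps for each component. Countably many vertices,
  closed under the vertices of their linkages, are completed in one phase of length \<open>\<omega>\<close>, and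
  Zorn's lemma combines the phases.\<close>

section \<open>Closure operators with summands of bounded rank\<close>

text \<open>The rank may be infinite, so bases cannot be compared by their total size. The matroid
  is therefore split into summands of bounded rank: a single one under (F), the components under
  (B). A dependence lives inside one summand, which makes closure finitary and lets sizes be
  compared summand by summand.

  The residual set of one family depends on that family; the union over all complete families at the
  head does not. As a directed union it is tight for every complete family that ends anywhere inside
  it, and this is what makes nested regions usable.

  A label present in a region may be unable to travel to \<open>z\<close>. While labels are moved,
  the arcs of one trail carrying a wanted label \<open>b\<close> to \<open>z\<close> are therefore
  kept free: if an obstructing region still contains \<open>z\<close>, then \<open>b\<close> is not
  spanned in that region, so the rank of the wanted labels drops, which happens only finitely often.

  Feasibility is used at finite stages only. The limit of a phase keeps the traces of the labels and
  their independence, which suffices because every vertex of the phase is saturated in each summand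
  at some finite stage.\<close>

locale closure_matroid =
  fixes cl :: "'t set \<Rightarrow> 't set" and \<kappa> :: "'t \<Rightarrow> 'k"
  assumes cl_ext: "A \<subseteq> cl A"
    and cl_mono: "A \<subseteq> B \<Longrightarrow> cl A \<subseteq> cl B"
    and cl_idem: "cl (cl A) = cl A"
    and cl_exchange: "y \<in> cl (insert x A) \<Longrightarrow> y \<notin> cl A \<Longrightarrow> x \<in> cl (insert y A)"
    and cl_summand: "x \<in> cl A \<Longrightarrow> x \<in> cl {a \<in> A. \<kappa> a = \<kappa> x}"
    and bounded_rank: "\<exists>n. \<forall>I. (\<forall>x\<in>I. x \<notin> cl (I - {x}) \<and> \<kappa> x = k) \<longrightarrow> finite I \<and> card I \<le> n"
begin

definition indep :: "'t set \<Rightarrow> bool" where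
  "indep I \<longleftrightarrow> (\<forall>x\<in>I. x \<notin> cl (I - {x}))"

text \<open>For independent \<open>B\<close> spanning \<open>t\<close> this is the fundamental
  circuit of \<open>t\<close> without \<open>t\<close>, and \<open>{t}\<close> if \<open>t\<close>
  lies in \<open>B\<close>.\<close>

definition circ :: "'t \<Rightarrow> 't set \<Rightarrow> 't set" where
  "circ t B = {b \<in> B. t \<notin> cl (B - {b})}"

lemma cl_extI: "x \<in> A \<Longrightarrow> x \<in> cl A"
  using cl_ext by blast

lemma cl_least: "A \<subseteq> cl B \<Longrightarrow> cl A \<subseteq> cl B"
  using cl_mono cl_idem by blast

lemma cl_monoD: "x \<in> cl A \<Longrightarrow> A \<subseteq> B \<Longrightarrow> x \<in> cl B"
  using cl_mono by blast

lemma cl_trans: "x \<in> cl A \<Longrightarrow> A \<subseteq> cl B \<Longrightarrow> x \<in> cl B"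
  using cl_least by blast

lemma indep_subset: "indep I \<Longrightarrow> J \<subseteq> I \<Longrightarrow> indep J"
  unfolding indep_def
  by (metis Diff_mono cl_monoD order_refl subsetD)

lemma indep_insert:
  assumes "indep I" "x \<notin> cl I"
  shows "indep (insert x I)"
  unfolding indep_def
proof
  fix y assume y: "y \<in> insert x I"
  show "y \<notin> cl (insert x I - {y})"
  proof (cases "y = x")
    case True
    have "insert x I - {x} \<subseteq> I" by auto
    then show ?thesis using True assms(2) cl_monoD by blast
  next
    case False
    then have yI: "y \<in> I" using y by simp
    have eq: "insert x I - {y} = insert x (I - {y})" using False by auto
    show ?thesis
    proof
      assume "y \<in> cl (insert x I - {y})"
      then have "y \<in> cl (insert x (I - {y}))" using eq by simp
      moreover have "y \<notin> cl (I - {y})" using assms(1) yI by (simp add: indep_def)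
      ultimately have "x \<in> cl (insert y (I - {y}))" by (rule cl_exchange)
      then show False using assms(2) yI by (simp add: insert_absorb)
    qed
  qed
qed

lemma indep_notin: "indep I \<Longrightarrow> x \<in> I \<Longrightarrow> x \<notin> cl (I - {x})"
  by (simp add: indep_def)

lemma indep_finite_summand: "indep I \<Longrightarrow> finite {i \<in> I. \<kappa> i = k}"
proof -
  assume "indep I"
  then have "indep {i \<in> I. \<kappa> i = k}" by (rule indep_subset) auto
  then show ?thesis using bounded_rank[of k] unfolding indep_def by blast
qed

lemma steinitz:
  assumes "finite J" "indep I" "I \<subseteq> cl J"
  shows "finite I \<and> card I \<le> card J"
  using assms
proof (induction "card (J - I)" arbitrary: J rule: less_induct)
  case less
  show ?case
  proof (cases "J \<subseteq> I")
    case True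
    have "I \<subseteq> J"
    proof
      fix x assume x: "x \<in> I"
      show "x \<in> J"
      proof (rule ccontr)
        assume "x \<notin> J"
        then have "J \<subseteq> I - {x}" using True by auto
        then have "x \<in> cl (I - {x})" using less.prems(3) x cl_monoD by blast
        then show False using less.prems(2) x indep_notin by blast
      qed
    qed
    then show ?thesis using less.prems(1) by (meson card_mono finite_subset)
  next
    case False
    then obtain j where j: "j \<in> J" "j \<notin> I" by auto
    show ?thesis
    proof (cases "I \<subseteq> cl (J - {j})")
      case True
      have "card (J - {j} - I) < card (J - I)"
        using j less.prems(1) by (intro psubset_card_mono) auto
      then have "finite I \<and> card I \<le> card (J - {j})"
        using less.hyps[of "J - {j}"] less.prems True by auto
      then show ?thesis using card_mono[of J "J - {j}"] less.prems(1) by auto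
    next
      case False
      then obtain i where i: "i \<in> I" "i \<notin> cl (J - {j})" by auto
      have eqJ: "insert j (J - {j}) = J" using j by auto
      have "i \<in> cl (insert j (J - {j}))" using i less.prems(3) eqJ by auto
      then have ji: "j \<in> cl (insert i (J - {j}))" using i cl_exchange by blast
      let ?J = "insert i (J - {j})"
      have "J \<subseteq> cl ?J"
      proof
        fix x assume "x \<in> J"
        then show "x \<in> cl ?J" using ji cl_extI[of x ?J] by (cases "x = j") auto
      qed
      then have sub: "I \<subseteq> cl ?J" using less.prems(3) cl_least by blast
      have inot: "i \<notin> J"
        using i(1,2) j cl_extI[of i "J - {j}"] by auto
      have "?J - I \<subset> J - I" using i j by auto
      then have "card (?J - I) < card (J - I)" using less.prems(1) by (intro psubset_card_mono) auto
      then have "finite I \<and> card I \<le> card ?J" using less.hyps[of ?J] less.prems sub by auto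
      moreover have "card ?J = card J" using less.prems(1) inot card.remove[OF less.prems(1) j(1)] by simp
      ultimately show ?thesis by simp
    qed
  qed
qed

lemma indep_card_spans:
  assumes "finite J" "indep I" "I \<subseteq> cl J" "card J \<le> card I"
  shows "J \<subseteq> cl I"
proof (rule ccontr)
  assume "\<not> J \<subseteq> cl I"
  then obtain j where j: "j \<in> J" "j \<notin> cl I" by auto
  have "indep (insert j I)" using indep_insert[OF assms(2)] j by blast
  moreover have "insert j I \<subseteq> cl J" using j assms(3) cl_extI by auto
  ultimately have "card (insert j I) \<le> card J" using steinitz[OF assms(1)] by blast
  moreover have "finite I" using steinitz[OF assms(1-3)] by simp
  moreover have "j \<notin> I" using j cl_extI by blast
  ultimately show False using assms(4) by simp
qed

text \<open>The rank bound of the summand permits an independent subset of largest size, which then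
  spans.\<close>

lemma ex_max_indep_summand:
  assumes "\<forall>a\<in>A. \<kappa> a = k"
  obtains I where "I \<subseteq> A" "indep I" "finite I" "A \<subseteq> cl I"
proof -
  obtain n where n: "\<And>I. indep I \<Longrightarrow> (\<forall>x\<in>I. \<kappa> x = k) \<Longrightarrow> finite I \<and> card I \<le> n"
    using bounded_rank[of k] unfolding indep_def by metis
  let ?P = "\<lambda>I. I \<subseteq> A \<and> indep I"
  have P0: "?P {}" by (simp add: indep_def)
  have b: "\<forall>I. ?P I \<longrightarrow> card I \<le> n" using n assms by blast
  obtain I where I: "?P I" "\<forall>J. ?P J \<longrightarrow> card J \<le> card I"
    using ex_has_greatest_nat[of ?P "{}" card "Suc n"] P0 b by (auto simp: less_Suc_eq_le)
  have fin: "finite I" using n I assms by blast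
  have "A \<subseteq> cl I"
  proof (rule ccontr)
    assume "\<not> A \<subseteq> cl I"
    then obtain a where a: "a \<in> A" "a \<notin> cl I" by auto
    then have "?P (insert a I)" using I indep_insert by auto
    then have "card (insert a I) \<le> card I" using I by blast
    moreover have "a \<notin> I" using a cl_extI by blast
    ultimately show False using fin by simp
  qed
  then show ?thesis using that I fin by blast
qed

text \<open>\<open>cl_summand\<close> confines the dependence to the summand of \<open>x\<close>,
  where \<open>A\<close> has a finite spanning subset.\<close>

lemma cl_finitary:
  assumes "x \<in> cl A"
  obtains F where "finite F" "F \<subseteq> A" "x \<in> cl F"
proof -
  obtain I where I: "I \<subseteq> {a \<in> A. \<kappa> a = \<kappa> x}" "indep I" "finite I" "{a \<in> A. \<kappa> a = \<kappa> x} \<subseteq> cl I"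
    by (rule ex_max_indep_summand[of "{a \<in> A. \<kappa> a = \<kappa> x}" "\<kappa> x"]) auto
  have "x \<in> cl I" using cl_summand[OF assms] I(4) cl_trans by blast
  then show ?thesis using that I by blast
qed

lemma indep_Union_chain:
  assumes "\<And>I. I \<in> \<C> \<Longrightarrow> indep I" "\<And>I J. I \<in> \<C> \<Longrightarrow> J \<in> \<C> \<Longrightarrow> I \<subseteq> J \<or> J \<subseteq> I"
  shows "indep (\<Union>\<C>)"
  unfolding indep_def
proof (intro ballI notI)
  fix x assume x: "x \<in> \<Union>\<C>" "x \<in> cl (\<Union>\<C> - {x})"
  obtain F where F: "finite F" "F \<subseteq> \<Union>\<C> - {x}" "x \<in> cl F" using cl_finitary[OF x(2)] by blast
  obtain I0 where I0: "I0 \<in> \<C>" "x \<in> I0" using x by auto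
  have "\<exists>I\<in>\<C>. insert x F \<subseteq> I" using F(1,2)
  proof (induction F rule: finite_induct)
    case empty then show ?case using I0 by auto
  next
    case (insert a F)
    then obtain I where "I \<in> \<C>" "insert x F \<subseteq> I" by auto
    moreover obtain J where "J \<in> \<C>" "a \<in> J" using insert by auto
    ultimately show ?case using assms(2)[of I J] by blast
  qed
  then obtain I where I: "I \<in> \<C>" "insert x F \<subseteq> I" by auto
  have "F \<subseteq> I - {x}" using F(2) I(2) by auto
  then have "x \<in> cl (I - {x})" using F(3) cl_monoD by blast
  then show False using assms(1)[OF I(1)] I indep_notin by blast
qed

text \<open>Zorn's lemma; a chain of independent sets has an independent union because closure is
  finitary.\<close>

lemma extend_indep:
  assumes "indep I" "I \<subseteq> X"
  obtains B where "I \<subseteq> B" "B \<subseteq> X" "indep B" "X \<subseteq> cl B"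
proof -
  let ?F = "{B. I \<subseteq> B \<and> B \<subseteq> X \<and> indep B}"
  have "\<exists>M\<in>?F. \<forall>Y\<in>?F. M \<subseteq> Y \<longrightarrow> Y = M"
  proof (rule subset_Zorn)
    fix \<C> assume c: "subset.chain ?F \<C>"
    show "\<exists>U\<in>?F. \<forall>Y\<in>\<C>. Y \<subseteq> U" 
    proof (cases "\<C> = {}")
      case True then show ?thesis using assms by auto
    next
      case False
      have sub: "\<C> \<subseteq> ?F" and ch: "\<And>I J. I \<in> \<C> \<Longrightarrow> J \<in> \<C> \<Longrightarrow> I \<subseteq> J \<or> J \<subseteq> I"
        using c by (auto simp: subset_chain_def)
      have "indep (\<Union>\<C>)" using sub ch by (intro indep_Union_chain) auto
      then have "\<Union>\<C> \<in> ?F" using sub False by auto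
      then show ?thesis by auto
    qed
  qed
  then obtain M where M: "I \<subseteq> M" "M \<subseteq> X" "indep M" and mx: "\<And>Y. I \<subseteq> Y \<Longrightarrow> Y \<subseteq> X \<Longrightarrow> indep Y \<Longrightarrow> M \<subseteq> Y \<Longrightarrow> Y = M"
    by auto
  have "X \<subseteq> cl M"
  proof
    fix x assume x: "x \<in> X"
    show "x \<in> cl M"
    proof (rule ccontr)
      assume n: "x \<notin> cl M"
      then have "insert x M = M" using M x indep_insert by (intro mx) auto
      then show False using n cl_extI by blast
    qed
  qed
  then show ?thesis using that M by blast
qed

text \<open>This makes the minimal spanning subset inside an independent set unique. An
  \<open>x\<close> in \<open>F - Y\<close> that could not be dropped would, by exchange, be spanned
  by \<open>t\<close> and the rest of \<open>F\<close>, hence by \<open>B - {x}\<close>, since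
  \<open>t\<close> is already spanned by \<open>Y\<close>.\<close>

lemma cl_Int_indep:
  assumes B: "indep B" and XY: "X \<subseteq> B" "Y \<subseteq> B" and t: "t \<in> cl X" "t \<in> cl Y"
  shows "t \<in> cl (X \<inter> Y)"
proof -
  obtain F where F: "finite F" "F \<subseteq> X" "t \<in> cl F" using cl_finitary[OF t(1)] by blast
  have "t \<in> cl (F \<inter> Y)" using F
  proof (induction "card (F - Y)" arbitrary: F rule: less_induct)
    case less
    show ?case
    proof (cases "F \<subseteq> Y")
      case True then show ?thesis using less.prems by (simp add: Int_absorb2)
    next
      case False
      then obtain x where x: "x \<in> F" "x \<notin> Y" by auto
      have "t \<in> cl (F - {x})"
      proof (rule ccontr)
        assume n: "t \<notin> cl (F - {x})"
        have "t \<in> cl (insert x (F - {x}))" using less.prems(3) x by (simp add: insert_absorb)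
        then have "x \<in> cl (insert t (F - {x}))" using n cl_exchange by blast
        moreover have "insert t (F - {x}) \<subseteq> cl (B - {x})"
          using t(2) XY x less.prems(2) by (auto intro: cl_monoD cl_extI)
        ultimately have "x \<in> cl (B - {x})" using cl_trans by blast
        then show False using B XY x less.prems(2) indep_notin by blast
      qed
      moreover have "card (F - {x} - Y) < card (F - Y)"
        using x less.prems(1) by (intro psubset_card_mono) auto
      ultimately have "t \<in> cl ((F - {x}) \<inter> Y)" using less by auto
      then show ?thesis by (rule cl_monoD) auto
    qed
  qed
  then show ?thesis using F by (auto intro: cl_monoD)
qed

section \<open>Fundamental circuits and the exchange of base elements\<close>

lemma circ_subset: "circ t B \<subseteq> B"
  by (auto simp: circ_def)

text \<open>A smallest spanning \<open>F\<close> inside a finite spanning set lies in the circuit: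
  if \<open>t\<close> were spanned by \<open>B - {b}\<close> for some \<open>b\<close> in
  \<open>F\<close>, intersecting with \<open>F\<close> would give a smaller one.\<close>

lemma cl_circ:
  assumes "indep B" "t \<in> cl B"
  shows "t \<in> cl (circ t B)"
proof -
  obtain F0 where F0: "finite F0" "F0 \<subseteq> B" "t \<in> cl F0" using cl_finitary[OF assms(2)] by blast
  have "\<exists>F. (F \<subseteq> F0 \<and> t \<in> cl F) \<and> (\<forall>G. G \<subseteq> F0 \<and> t \<in> cl G \<longrightarrow> card F \<le> card G)"
    using ex_has_least_nat[of "\<lambda>F. F \<subseteq> F0 \<and> t \<in> cl F" F0 card] F0 by auto
  then obtain F where F: "F \<subseteq> F0" "t \<in> cl F" and mn: "\<And>G. G \<subseteq> F0 \<Longrightarrow> t \<in> cl G \<Longrightarrow> card F \<le> card G"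
    by auto
  have "F \<subseteq> circ t B"
  proof
    fix b assume b: "b \<in> F"
    have "t \<notin> cl (B - {b})"
    proof
      assume "t \<in> cl (B - {b})"
      then have "t \<in> cl (F \<inter> (B - {b}))" using assms F F0 by (intro cl_Int_indep[of B]) auto
      moreover have "F \<inter> (B - {b}) = F - {b}" using F F0 by auto
      ultimately have "card F \<le> card (F - {b})" using F by (intro mn) auto
      moreover have "finite F" using F F0 finite_subset by auto
      ultimately show False using b by (metis card_Diff1_less not_le)
    qed
    then show "b \<in> circ t B" using b F F0 by (auto simp: circ_def)
  qed
  then show ?thesis using F cl_monoD by blast
qed

lemma circ_subset_if_cl: "X \<subseteq> B \<Longrightarrow> t \<in> cl X \<Longrightarrow> circ t B \<subseteq> X"
  unfolding circ_def by (auto intro: cl_monoD)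

text \<open>Allows token exchanges to be compared between two families that share the independent
  set \<open>I\<close>.\<close>

lemma circ_eq:
  assumes "indep B" "I \<subseteq> B" "t \<in> cl I"
  shows "circ t B = circ t I"
proof
  have I: "indep I" using assms indep_subset by blast
  show "circ t I \<subseteq> circ t B"
  proof
    fix b assume b: "b \<in> circ t I"
    have "t \<notin> cl (B - {b})"
    proof
      assume "t \<in> cl (B - {b})"
      then have "t \<in> cl (I \<inter> (B - {b}))" using assms by (intro cl_Int_indep[of B]) auto
      moreover have "I \<inter> (B - {b}) = I - {b}" using assms by auto
      ultimately show False using b by (simp add: circ_def)
    qed
    then show "b \<in> circ t B" using b assms by (auto simp: circ_def)
  qed
  show "circ t B \<subseteq> circ t I"
    using circ_subset_if_cl[OF assms(2,3)] assms(2) unfolding circ_def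
    by (auto intro: cl_monoD[of _ "I - {_}"])
qed

lemma swap_base:
  assumes "b \<in> L" "t \<in> cl L" "t \<notin> cl (L - {b})" "indep L"
  shows "indep (insert t (L - {b}))" "cl (insert t (L - {b})) = cl L"
proof -
  show "indep (insert t (L - {b}))"
    using assms indep_subset[of L "L - {b}"] by (intro indep_insert) auto
  have "t \<in> cl (insert b (L - {b}))" using assms by (simp add: insert_absorb)
  then have b: "b \<in> cl (insert t (L - {b}))" using assms(3) cl_exchange by blast
  show "cl (insert t (L - {b})) = cl L"
  proof
    show "cl (insert t (L - {b})) \<subseteq> cl L" using assms cl_ext by (intro cl_least) auto
    show "cl L \<subseteq> cl (insert t (L - {b}))" 
    proof (rule cl_least, rule subsetI)
      fix x assume "x \<in> L"
      then show "x \<in> cl (insert t (L - {b}))"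
        using b cl_extI[of x "insert t (L - {b})"] by (cases "x = b") auto
    qed
  qed
qed

text \<open>\<open>B\<close> misses at most one dimension of \<open>X\<close>, so any element of
  \<open>X\<close> outside \<open>cl B\<close> completes it. Therefore a single augmentation repairs
  a complete family that has lost one member.\<close>

lemma corank_one:
  assumes "X \<subseteq> cl (insert l B)" "t \<in> X" "t \<notin> cl B"
  shows "X \<subseteq> cl (insert t B)"
proof -
  have "l \<in> cl (insert t B)" using assms cl_exchange by blast
  then have "cl (insert l B) \<subseteq> cl (insert t B)" using cl_ext[of "insert t B"] by (intro cl_least) auto
  then show ?thesis using assms by blast
qed

text \<open>Equality of finite dimensions, taken in each summand separately because the total sizes
  may be infinite.\<close>

lemma summand_spans:
  assumes BC: "indep B" "indep C" and sub: "B \<subseteq> cl C"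
    and le: "\<And>k. card {c \<in> C. \<kappa> c = k} \<le> card {b \<in> B. \<kappa> b = k}"
  shows "C \<subseteq> cl B"
proof
  fix c assume c: "c \<in> C"
  let ?k = "\<kappa> c"
  let ?C = "{c \<in> C. \<kappa> c = ?k}" and ?B = "{b \<in> B. \<kappa> b = ?k}"
  have "?B \<subseteq> cl ?C" 
  proof
    fix b assume "b \<in> ?B"
    then have "b \<in> cl C" "\<kappa> b = ?k" using sub by auto
    then show "b \<in> cl ?C" using cl_summand[of b C] by simp
  qed
  moreover have "indep ?B" using BC(1) by (rule indep_subset) auto
  moreover have "finite ?C" using BC indep_finite_summand by blast
  ultimately have "?C \<subseteq> cl ?B" using indep_card_spans le by blast
  then show "c \<in> cl B" using c by (auto intro: cl_monoD)
qed

lemma card_summand_le: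
  assumes "indep B" "indep C" "B \<subseteq> cl C"
  shows "card {b \<in> B. \<kappa> b = k} \<le> card {c \<in> C. \<kappa> c = k}"
proof -
  have "{b \<in> B. \<kappa> b = k} \<subseteq> cl {c \<in> C. \<kappa> c = k}"
  proof
    fix b assume "b \<in> {b \<in> B. \<kappa> b = k}"
    then have "b \<in> cl C" "\<kappa> b = k" using assms by auto
    then show "b \<in> cl {c \<in> C. \<kappa> c = k}" using cl_summand[of b C] by simp
  qed
  moreover have "indep {b \<in> B. \<kappa> b = k}" using assms(1) by (rule indep_subset) auto
  ultimately show ?thesis using steinitz indep_finite_summand assms(2) by blast
qed

end

section \<open>Families of trails and augmentation\<close>

lemma split_map: "map f q = xs @ w # ys \<Longrightarrow> \<exists>q1 c q2. q = q1 @ c # q2 \<and> f c = w \<and> map f q2 = ys"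
proof (induction q arbitrary: xs)
  case (Cons a q)
  show ?case
  proof (cases xs)
    case Nil then show ?thesis using Cons.prems by (intro exI[of _ "[]"] exI[of _ a] exI[of _ q]) simp
  next
    case (Cons x xs')
    then obtain q1 c q2 where "q = q1 @ c # q2" "f c = w" "map f q2 = ys" using Cons.IH[of xs'] Cons.prems by auto
    then show ?thesis by (intro exI[of _ "a # q1"] exI[of _ c] exI[of _ q2]) simp
  qed
qed simp

text \<open>With \<open>src\<close> and \<open>dst\<close> as plain functions a reversed walk is the
  same notion with the two exchanged; backward-infinite paths are obtained in this way.\<close>

primrec arc_walk :: "('a \<Rightarrow> 'v) \<Rightarrow> ('a \<Rightarrow> 'v) \<Rightarrow> 'v \<Rightarrow> 'a list \<Rightarrow> 'v \<Rightarrow> bool" where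
  "arc_walk src dst u [] v = (u = v)"
| "arc_walk src dst u (a # p) v = (src a = u \<and> arc_walk src dst (dst a) p v)"

lemma arc_walk_append: "arc_walk src dst u (p @ q) v \<longleftrightarrow> (\<exists>w. arc_walk src dst u p w \<and> arc_walk src dst w q v)"
  by (induction p arbitrary: u) auto

lemma arc_walk_rev: "arc_walk src dst u p v \<Longrightarrow> arc_walk dst src v (rev p) u"
  by (induction p arbitrary: u) (auto simp: arc_walk_append)

lemma arc_walk_vertices: "arc_walk src dst u p v \<Longrightarrow> map src p @ [v] = u # map dst p"
  by (induction p arbitrary: u) auto

text \<open>Induction on the length: the closed walk between two visits to one vertex is cut
  out.\<close>

lemma arc_walk_simple:
  assumes "arc_walk src dst u p v"
  shows "\<exists>p'. arc_walk src dst u p' v \<and> set p' \<subseteq> set p \<and> distinct (u # map dst p')"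
  using assms
proof (induction "length p" arbitrary: p rule: less_induct)
  case less
  show ?case
  proof (cases "distinct (u # map dst p)")
    case True then show ?thesis using less.prems by blast
  next
    case False
    show ?thesis
    proof (cases "u \<in> dst ` set p")
      case True
      then obtain c where c: "c \<in> set p" "dst c = u" by blast
      obtain \<alpha> \<beta> where ab: "p = \<alpha> @ c # \<beta>" using split_list[OF c(1)] by blast
      have "arc_walk src dst u (\<alpha> @ c # \<beta>) v" using less.prems unfolding ab .
      then have "arc_walk src dst u \<beta> v" using c(2) by (auto simp: arc_walk_append)
      moreover have "length \<beta> < length p" using ab by simp
      ultimately obtain p' where "arc_walk src dst u p' v" "set p' \<subseteq> set \<beta>" "distinct (u # map dst p')"
        using less.hyps by blast
      then show ?thesis using ab by (intro exI[of _ p']) auto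
    next
      case u: False
      then have "\<not> distinct (map dst p)" using False by simp
      then obtain xs ys zs w where "map dst p = xs @ [w] @ ys @ [w] @ zs" using not_distinct_decomp by blast
      then have mq: "map dst p = xs @ w # (ys @ w # zs)" by simp
      obtain q1 c1 r where q1: "p = q1 @ c1 # r" "dst c1 = w" "map dst r = ys @ w # zs" using split_map[OF mq] by blast
      obtain q2 c2 q3 where q2: "r = q2 @ c2 # q3" "dst c2 = w" using split_map[OF q1(3)] by blast
      have "arc_walk src dst u (q1 @ c1 # q2 @ c2 # q3) v" using less.prems unfolding q1(1) q2(1) .
      then have w: "arc_walk src dst u q1 (src c1)" "arc_walk src dst (dst c2) q3 v" by (auto simp: arc_walk_append)
      have "dst c1 = dst c2" using q1(2) q2(2) by (simp only:)
      then have "arc_walk src dst u (q1 @ c1 # q3) v" using w unfolding arc_walk_append by (intro exI[of _ "src c1"]) simp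
      moreover have "length (q1 @ c1 # q3) < length p" using q1(1) q2(1) by simp
      ultimately obtain p' where p': "arc_walk src dst u p' v" "set p' \<subseteq> set (q1 @ c1 # q3)" "distinct (u # map dst p')"
        using less.hyps by blast
      then have "set p' \<subseteq> set p" using q1(1) q2(1) by auto
      then show ?thesis using p' by blast
    qed
  qed
qed

locale network = closure_matroid cl \<kappa>
  for cl :: "'t set \<Rightarrow> 't set" and \<kappa> :: "'t \<Rightarrow> 'k" +
  fixes src dst :: "'a \<Rightarrow> 'v"
begin

abbreviation "walk \<equiv> arc_walk src dst"

definition pverts :: "'v \<Rightarrow> 'a list \<Rightarrow> 'v set" where
  "pverts u p = insert u (dst ` set p)"

lemma walk_append_iff: "walk u p w \<Longrightarrow> walk u (p @ q) v \<longleftrightarrow> walk w q v"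
  by (induction p arbitrary: u) auto

lemma walk_end: "walk u p v \<Longrightarrow> v \<in> pverts u p"
  by (induction p arbitrary: u) (auto simp: pverts_def)

lemma walk_last: "walk u p v \<Longrightarrow> p \<noteq> [] \<Longrightarrow> v = dst (last p)"
  by (induction p arbitrary: u) auto

lemma walk_src: "walk u p v \<Longrightarrow> a \<in> set p \<Longrightarrow> src a \<in> pverts u p"
  by (induction p arbitrary: u) (auto simp: pverts_def)

lemma dst_pverts: "a \<in> set p \<Longrightarrow> dst a \<in> pverts u p"
  by (auto simp: pverts_def)

lemma start_pverts: "u \<in> pverts u p"
  by (auto simp: pverts_def)

lemma pverts_Nil[simp]: "pverts u [] = {u}"
  by (simp add: pverts_def)

lemma pverts_Cons: "pverts u (a # p) = insert u (pverts (dst a) p)"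
  by (simp add: pverts_def)

lemma walk_split_vertex:
  assumes "walk u p v" "w \<in> pverts u p"
  obtains p1 p2 where "p = p1 @ p2" "walk u p1 w" "walk w p2 v"
proof -
  have "\<exists>p1 p2. p = p1 @ p2 \<and> walk u p1 w \<and> walk w p2 v" using assms
  proof (induction p arbitrary: u)
    case Nil then show ?case by auto
  next
    case (Cons a p)
    show ?case
    proof (cases "w = u")
      case True
      then show ?thesis using Cons.prems by (intro exI[of _ "[]"] exI[of _ "a # p"]) auto
    next
      case False
      then have "w \<in> pverts (dst a) p" using Cons.prems by (simp add: pverts_Cons)
      then obtain p1 p2 where "p = p1 @ p2" "walk (dst a) p1 w" "walk w p2 v"
        using Cons.IH[of "dst a"] Cons.prems by auto
      then show ?thesis using Cons.prems by (intro exI[of _ "a # p1"] exI[of _ p2]) auto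
    qed
  qed
  then show ?thesis using that by blast
qed

text \<open>A member is indexed by the token it transports, so one start vertex may serve several
  members. Trails with distinct arcs are used instead of paths, because the recombinations below
  join pieces that share no arc but may share vertices.\<close>

definition fam :: "'a set \<Rightarrow> ('v \<Rightarrow> 't set) \<Rightarrow> 't set \<Rightarrow> ('t \<Rightarrow> 'v) \<Rightarrow> ('t \<Rightarrow> 'a list) \<Rightarrow> bool" where
  "fam A T B U P \<longleftrightarrow> (\<forall>b\<in>B. b \<in> T (U b) \<and> distinct (P b) \<and> set (P b) \<subseteq> A) \<and>
    (\<forall>b\<in>B. \<forall>c\<in>B. b \<noteq> c \<longrightarrow> set (P b) \<inter> set (P c) = {})"

definition used :: "'t set \<Rightarrow> ('t \<Rightarrow> 'a list) \<Rightarrow> 'a set" where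
  "used B P = (\<Union>b\<in>B. set (P b))"

definition ends :: "'t set \<Rightarrow> ('t \<Rightarrow> 'v) \<Rightarrow> ('t \<Rightarrow> 'a list) \<Rightarrow> 'v \<Rightarrow> bool" where
  "ends B U P x \<longleftrightarrow> (\<forall>b\<in>B. walk (U b) (P b) x)"

definition toks :: "('v \<Rightarrow> 't set) \<Rightarrow> 't set" where
  "toks T = \<Union> (range T)"

definition complete :: "'a set \<Rightarrow> ('v \<Rightarrow> 't set) \<Rightarrow> 'v \<Rightarrow> 't set \<Rightarrow> ('t \<Rightarrow> 'v) \<Rightarrow> ('t \<Rightarrow> 'a list) \<Rightarrow> bool" where
  "complete A T x B U P \<longleftrightarrow> fam A T B U P \<and> ends B U P x \<and> indep B \<and> toks T \<subseteq> cl B"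

definition ok :: "'a set \<Rightarrow> ('v \<Rightarrow> 't set) \<Rightarrow> 'v \<Rightarrow> bool" where
  "ok A T x \<longleftrightarrow> (\<exists>B U P. complete A T x B U P)"

text \<open>One step of the residual relation from \<open>w\<close> to \<open>y\<close>: an additional unit of flow arriving
  at \<open>w\<close> can be moved on to \<open>y\<close> by using a free arc, by cancelling a used arc, or by taking over a
  trail of the family that starts at \<open>w\<close> and replacing its token by one at \<open>y\<close>.\<close>

definition resid_arc :: "'a set \<Rightarrow> ('v \<Rightarrow> 't set) \<Rightarrow> 't set \<Rightarrow> ('t \<Rightarrow> 'v) \<Rightarrow> ('t \<Rightarrow> 'a list) \<Rightarrow> 'v rel" where
  "resid_arc A T B U P = {(w, y). (\<exists>a\<in>A. a \<notin> used B P \<and> src a = w \<and> dst a = y) \<or>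
     (\<exists>a\<in>used B P. dst a = w \<and> src a = y) \<or>
     (\<exists>t\<in>T y. t \<in> cl B \<and> (\<exists>b\<in>circ t B. U b = w))}"

definition resid :: "'a set \<Rightarrow> ('v \<Rightarrow> 't set) \<Rightarrow> 't set \<Rightarrow> ('t \<Rightarrow> 'v) \<Rightarrow> ('t \<Rightarrow> 'a list) \<Rightarrow> 'v \<Rightarrow> 'v set" where
  "resid A T B U P x = {w. (w, x) \<in> (resid_arc A T B U P)\<^sup>*}"

lemma famD:
  assumes "fam A T B U P" "b \<in> B"
  shows "b \<in> T (U b)" "distinct (P b)" "set (P b) \<subseteq> A"
  using assms by (auto simp: fam_def)

lemma fam_disj: "fam A T B U P \<Longrightarrow> b \<in> B \<Longrightarrow> c \<in> B \<Longrightarrow> b \<noteq> c \<Longrightarrow> set (P b) \<inter> set (P c) = {}"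
  by (auto simp: fam_def)

lemma used_unique: "fam A T B U P \<Longrightarrow> b \<in> B \<Longrightarrow> c \<in> B \<Longrightarrow> a \<in> set (P b) \<Longrightarrow> a \<in> set (P c) \<Longrightarrow> b = c"
  using fam_disj by blast

text \<open>Residual distance to \<open>x\<close> strictly below \<open>k\<close>: a vertex reaching
  \<open>x\<close> in \<open>k\<close> steps and lying outside this set has distance exactly
  \<open>k\<close>.\<close>

definition near :: "'v rel \<Rightarrow> 'v \<Rightarrow> nat \<Rightarrow> 'v set" where
  "near r x k = {v. \<exists>j<k. (v, x) \<in> r ^^ j}"

lemma near_mono: "j \<le> k \<Longrightarrow> near r x j \<subseteq> near r x k"
  unfolding near_def using less_le_trans by blast

lemma near_step: "(w, y) \<in> r \<Longrightarrow> y \<in> near r x k \<Longrightarrow> w \<in> near r x (Suc k)"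
  unfolding near_def by (auto intro: relpow_Suc_I2)

text \<open>The residual path is followed backwards in order of distance to \<open>x\<close>: the trail of \<open>t\<close> is the only one not
  yet ending in \<open>x\<close>, and nothing has been changed so far at vertices closer to \<open>x\<close> than its end \<open>w\<close>.\<close>

lemma augment_state:
  fixes A T B U P x
  defines "r \<equiv> resid_arc A T B U P"
  assumes "indep B"
    and "fam A T (insert t L) U' P'" "t \<notin> L" "ends L U' P' x"
    and "indep (insert t L)" "cl (insert t L) = K"
    and "walk (U' t) (P' t) w" "(w, x) \<in> r ^^ k" "pverts (U' t) (P' t) \<inter> near r x k = {}"
    and "\<forall>a\<in>A. src a \<in> near r x k \<or> dst a \<in> near r x k \<longrightarrow> (a \<in> used (insert t L) P' \<longleftrightarrow> a \<in> used B P)"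
    and "\<forall>y\<in>near r x k. \<forall>t'\<in>T y. t' \<in> cl B \<longrightarrow> (\<forall>b\<in>circ t' B. b \<in> insert t L \<and> U' b = U b)"
    and B_A: "fam A T B U P" and clB: "B \<subseteq> K"
  shows "\<exists>B' U' P'. fam A T B' U' P' \<and> ends B' U' P' x \<and> indep B' \<and> cl B' = K"
  using assms(3-12)
proof (induction k arbitrary: t L U' P' w rule: less_induct)
  case (less k)
  note F = less.prems(1) and tL = less.prems(2) and E = less.prems(3) and ind = less.prems(4)
    and clK = less.prems(5) and W = less.prems(6) and wx = less.prems(7) and nn = less.prems(8)
    and I1 = less.prems(9) and I2 = less.prems(10)
  show ?case
  proof (cases k)
    case 0
    then have "w = x" using wx by simp
    then have "ends (insert t L) U' P' x" using E W by (auto simp: ends_def)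
    then show ?thesis using F ind clK by blast
  next
    case (Suc m)
    then obtain y where y: "(w, y) \<in> r" "(y, x) \<in> r ^^ m" using wx relpow_Suc_D2 by metis
    have ynk: "y \<in> near r x k" using y(2) Suc by (auto simp: near_def)
    have wnk: "w \<notin> near r x k" using nn walk_end[OF W] by auto
    have ynm: "y \<notin> near r x m" using near_step[OF y(1), of x m] wnk Suc by auto
    have sub: "near r x m \<subseteq> near r x k" using Suc by (intro near_mono) simp
    have mk: "m < k" using Suc by simp
    consider (s1) a where "a \<in> A" "a \<notin> used B P" "src a = w" "dst a = y"
      | (s2) a where "a \<in> used B P" "dst a = w" "src a = y"
      | (s3) t' b where "t' \<in> T y" "t' \<in> cl B" "b \<in> circ t' B" "U b = w"
      using y(1) unfolding r_def resid_arc_def by blast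
    then show ?thesis
    proof cases
      case s1
      have au: "a \<notin> used (insert t L) P'" using I1 s1 ynk by auto
      let ?P = "P'(t := P' t @ [a])"
      have us: "used (insert t L) ?P = insert a (used (insert t L) P')" by (auto simp: used_def split: if_splits)
      have 1: "fam A T (insert t L) U' ?P"
        using F au s1(1) tL unfolding fam_def used_def by auto
      have 2: "ends L U' ?P x" using E tL by (auto simp: ends_def)
      have 3: "walk (U' t) (?P t) y" using W s1 by (auto simp: walk_append_iff)
      have 4: "pverts (U' t) (?P t) \<inter> near r x m = {}"
        using nn ynm sub s1(4) by (auto simp: pverts_def)
      have 5: "\<forall>c\<in>A. src c \<in> near r x m \<or> dst c \<in> near r x m \<longrightarrow> (c \<in> used (insert t L) ?P \<longleftrightarrow> c \<in> used B P)"
        using I1 us s1 ynm wnk sub by auto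
      have 6: "\<forall>y\<in>near r x m. \<forall>t'\<in>T y. t' \<in> cl B \<longrightarrow> (\<forall>b\<in>circ t' B. b \<in> insert t L \<and> U' b = U b)"
        using I2 sub by blast
      show ?thesis using less.IH[OF mk 1 tL 2 ind clK 3 y(2) 4 5 6] .
    next
      \<comment> \<open>The arc \<open>a\<close> lies on the trail of another member
        \<open>c\<close>. The trail of \<open>t\<close> takes over its rest \<open>\<beta>\<close>
        after \<open>a\<close>, and \<open>c\<close> becomes the member that does not yet end in
        \<open>x\<close>.\<close>
      case s2
      have aA: "a \<in> A" using s2 B_A unfolding used_def fam_def by auto
      have "a \<in> used (insert t L) P'" using I1 s2 ynk aA by auto
      then obtain c where c: "c \<in> insert t L" "a \<in> set (P' c)" by (auto simp: used_def)
      have ct: "c \<noteq> t"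
      proof
        assume "c = t"
        then have "src a \<in> pverts (U' t) (P' t)" using c W walk_src by blast
        then show False using nn s2 ynk by auto
      qed
      then have cL: "c \<in> L" using c by auto
      obtain \<alpha> \<beta> where ab: "P' c = \<alpha> @ a # \<beta>" using c split_list by fastforce
      have Wc: "walk (U' c) (\<alpha> @ a # \<beta>) x" using E cL ab by (auto simp: ends_def)
      then have Wa: "walk (U' c) \<alpha> y" and Wb: "walk w \<beta> x" using s2 by (auto simp: arc_walk_append)
      let ?Q = "\<lambda>j. \<exists>v\<in>pverts (U' c) \<alpha>. (v, x) \<in> r ^^ j"
      \<comment> \<open>The remaining piece \<open>\<alpha>\<close> may pass closer to
        \<open>x\<close> than \<open>y\<close> is. It is cut at a vertex of least distance, which
        restores the condition that the open trail avoids all vertices nearer than its end; the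
        distance may thus drop by more than one.\<close>
      define k' where "k' = (LEAST j. ?Q j)"
      have Qm: "?Q m" using walk_end[OF Wa] y(2) by blast
      then have k'm: "k' \<le> m" unfolding k'_def by (rule Least_le)
      have "?Q k'" unfolding k'_def using Qm by (rule LeastI)
      then obtain v where v: "v \<in> pverts (U' c) \<alpha>" "(v, x) \<in> r ^^ k'" by blast
      have nk': "pverts (U' c) \<alpha> \<inter> near r x k' = {}"
        using not_less_Least[of _ ?Q] unfolding near_def k'_def by blast
      obtain \<alpha>1 \<alpha>2 where al: "\<alpha> = \<alpha>1 @ \<alpha>2" "walk (U' c) \<alpha>1 v" "walk v \<alpha>2 y"
        using walk_split_vertex[OF Wa v(1)] by blast
      let ?P = "P'(t := P' t @ \<beta>, c := \<alpha>1)"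
      let ?L = "insert t (L - {c})"
      have eq: "insert c ?L = insert t L" using cL ct by auto
      have subk: "near r x k' \<subseteq> near r x k" using k'm Suc by (intro near_mono) simp
      have dc: "distinct (\<alpha>1 @ \<alpha>2 @ a # \<beta>)" using famD(2)[OF F, of c] cL ab al by auto
      have dt: "distinct (P' t)" using famD(2)[OF F, of t] by auto
      have token_cl: "set (P' t) \<inter> set (P' c) = {}" using fam_disj[OF F, of t c] cL ct by auto
      have Pc: "set (P' c) = set \<alpha>1 \<union> set \<alpha>2 \<union> {a} \<union> set \<beta>" using ab al by auto
      have 1: "fam A T (insert c ?L) U' ?P"
        unfolding eq unfolding fam_def
      proof (intro conjI ballI impI)
        fix b assume b: "b \<in> insert t L"
        show "b \<in> T (U' b)" using famD(1)[OF F b] .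
        show "distinct (?P b)" using famD(2)[OF F b] dc dt token_cl Pc ct by auto
        show "set (?P b) \<subseteq> A" using famD(3)[OF F b] famD(3)[OF F c(1)] Pc ct famD(3)[OF F, of t] by auto
        fix d assume d: "d \<in> insert t L" "b \<noteq> d"
        have bd: "set (P' b) \<inter> set (P' d) = {}" and bc: "b \<noteq> c \<Longrightarrow> set (P' b) \<inter> set (P' c) = {}"
          and dc': "d \<noteq> c \<Longrightarrow> set (P' d) \<inter> set (P' c) = {}"
          using fam_disj[OF F] b d c(1) by auto
        show "set (?P b) \<inter> set (?P d) = {}"
          using bd bc dc' dc d(2) Pc ct by (auto split: if_splits)
      qed
      have cnL: "c \<notin> ?L" using ct by auto
      have 2: "ends ?L U' ?P x" unfolding ends_def
      proof
        fix b assume "b \<in> ?L"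
        then show "walk (U' b) (?P b) x" using E W Wb ct by (auto simp: ends_def walk_append_iff)
      qed
      have 3: "walk (U' c) (?P c) v" using al by simp
      have 4: "pverts (U' c) (?P c) \<inter> near r x k' = {}" using nk' al by (auto simp: pverts_def)
      have us: "used (insert c ?L) ?P = used (insert t L) P' - insert a (set \<alpha>2)"
      proof -
        have "used (insert t L) ?P = set \<alpha>1 \<union> set (P' t) \<union> set \<beta> \<union> used (L - {c}) P'"
          using ct cL tL unfolding used_def by (auto split: if_splits)
        moreover have "used (insert t L) P' = set (P' c) \<union> set (P' t) \<union> used (L - {c}) P'"
          using cL unfolding used_def by auto
        moreover have "used (L - {c}) P' \<inter> set (P' c) = {}"
          using fam_disj[OF F] cL unfolding used_def by blast
        ultimately show ?thesis unfolding eq using Pc dc token_cl by auto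
      qed
      have 5: "\<forall>d\<in>A. src d \<in> near r x k' \<or> dst d \<in> near r x k' \<longrightarrow> (d \<in> used (insert c ?L) ?P \<longleftrightarrow> d \<in> used B P)"
      proof (intro ballI impI)
        fix d assume d: "d \<in> A" "src d \<in> near r x k' \<or> dst d \<in> near r x k'"
        have "d \<noteq> a" using d(2) s2 nk' walk_end[OF Wa] wnk subk by auto
        moreover have "d \<notin> set \<alpha>2"
        proof
          assume "d \<in> set \<alpha>2"
          then have "d \<in> set \<alpha>" using al by simp
          then have "src d \<in> pverts (U' c) \<alpha>" "dst d \<in> pverts (U' c) \<alpha>" using Wa walk_src dst_pverts by blast+
          then show False using d(2) nk' by auto
        qed
        ultimately show "d \<in> used (insert c ?L) ?P \<longleftrightarrow> d \<in> used B P" using us I1 d subk by auto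
      qed
      have 6: "\<forall>y\<in>near r x k'. \<forall>t'\<in>T y. t' \<in> cl B \<longrightarrow> (\<forall>b\<in>circ t' B. b \<in> insert c ?L \<and> U' b = U b)"
        unfolding eq using I2 subk by blast
      have "k' < k" using k'm mk by simp
      then show ?thesis using less.IH[OF _ 1 cnL 2 _ _ 3 v(2) 4 5 6] ind clK unfolding eq by blast
    next
      \<comment> \<open>\<open>t'\<close> replaces \<open>b\<close> in the base. If \<open>b\<close>
        is \<open>t\<close>, its trail is given up; otherwise \<open>t\<close>, having arrived at
        \<open>w\<close>, continues along the trail of \<open>b\<close>. In both cases
        \<open>t'\<close> becomes the open member, at \<open>y\<close> and with an empty
        trail.\<close>
      case s3
      let ?L = "insert t L"
      have C: "circ t' B \<subseteq> ?L" "\<And>b. b \<in> circ t' B \<Longrightarrow> U' b = U b" using I2 ynk s3 by blast+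
      have token_cl: "t' \<in> cl (circ t' B)" using cl_circ[OF assms(2) s3(2)] .
      have bL: "b \<in> ?L" and Ub: "U' b = w" using C s3 by auto
      have t'n: "t' \<notin> cl (?L - {b})"
      proof
        assume "t' \<in> cl (?L - {b})"
        then have "t' \<in> cl ((?L - {b}) \<inter> circ t' B)" using ind C token_cl by (intro cl_Int_indep[of ?L]) auto
        then have "t' \<in> cl (B - {b})" by (rule cl_monoD) (use circ_subset in auto)
        then show False using s3(3) by (simp add: circ_def)
      qed
      have t'K: "t' \<in> cl ?L" using token_cl C cl_monoD by blast
      have sw: "indep (insert t' (?L - {b}))" "cl (insert t' (?L - {b})) = K"
        using swap_base[OF bL t'K t'n ind] clK by auto
      have t'nL: "t' \<notin> ?L - {b}" using t'n cl_extI[of t' "?L - {b}"] by blast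
      \<comment> \<open>The circuit of a token closer to \<open>x\<close> cannot contain
        \<open>b\<close>, for then \<open>w\<close> would be nearer to \<open>x\<close> than it is;
        so the removal of \<open>b\<close> leaves those circuits intact.\<close>
      have 6: "\<forall>y\<in>near r x m. \<forall>t''\<in>T y. t'' \<in> cl B \<longrightarrow> (\<forall>b'\<in>circ t'' B. b' \<in> insert t' (?L - {b}) \<and> (U'(t' := y0)) b' = U b')" for y0
      proof (intro ballI impI)
        fix y'' t'' b' assume q: "y'' \<in> near r x m" "t'' \<in> T y''" "t'' \<in> cl B" "b' \<in> circ t'' B"
        have "b' \<in> ?L" "U' b' = U b'" using I2 sub q by blast+
        moreover have "b' \<noteq> b"
        proof
          assume "b' = b"
          then have "(w, y'') \<in> r" using q s3(4) unfolding r_def resid_arc_def by blast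
          then have "w \<in> near r x (Suc m)" using q(1) near_step by blast
          then show False using wnk Suc by simp
        qed
        ultimately show "b' \<in> insert t' (?L - {b}) \<and> (U'(t' := y0)) b' = U b'" using t'nL by auto
      qed
      show ?thesis
      proof (cases "b = t")
        case True
        let ?P = "P'(t' := [])" and ?U = "U'(t' := y)"
        have eq: "?L - {b} = L" using True tL by auto
        have t'L: "t' \<notin> L" using t'nL eq by simp
        have 1: "fam A T (insert t' L) ?U ?P" using F s3(1) t'L unfolding fam_def by auto
        have 2: "ends L ?U ?P x" using E t'L unfolding ends_def by auto
        have 3: "walk (?U t') (?P t') y" by simp
        have 4: "pverts (?U t') (?P t') \<inter> near r x m = {}" using ynm by simp
        have us: "used (insert t' L) ?P = used L P'" using t'L unfolding used_def by (auto split: if_splits)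
        have 5: "\<forall>d\<in>A. src d \<in> near r x m \<or> dst d \<in> near r x m \<longrightarrow> (d \<in> used (insert t' L) ?P \<longleftrightarrow> d \<in> used B P)"
        proof (intro ballI impI)
          fix d assume d: "d \<in> A" "src d \<in> near r x m \<or> dst d \<in> near r x m"
          have "d \<notin> set (P' t)" using d(2) nn sub walk_src[OF W, of d] dst_pverts[of d "P' t" "U' t"] by blast
          then show "d \<in> used (insert t' L) ?P \<longleftrightarrow> d \<in> used B P" using us I1 d sub by (auto simp: used_def)
        qed
        have 7: "indep (insert t' L)" "cl (insert t' L) = K" using sw eq by auto
        show ?thesis using less.IH[OF mk 1 t'L 2 7 3 y(2) 4 5] 6[of y] eq by simp
      next
        case False
        then have bL': "b \<in> L" using bL by simp
        let ?M = "insert t (L - {b})"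
        let ?P = "P'(t := P' t @ P' b, t' := [])" and ?U = "U'(t' := y)"
        have eq: "?L - {b} = ?M" using False by auto
        have t'M: "t' \<notin> ?M" using t'nL eq by simp
        then have tt: "t' \<noteq> t" by auto
        have tb: "set (P' t) \<inter> set (P' b) = {}" using fam_disj[OF F, of t b] bL' False by auto
        have 1: "fam A T (insert t' ?M) ?U ?P"
          unfolding fam_def
        proof (intro conjI ballI impI)
          fix c assume c: "c \<in> insert t' ?M"
          show "c \<in> T (?U c)" using c famD(1)[OF F, of c] s3(1) by auto
          show "distinct (?P c)" using c famD(2)[OF F, of c] famD(2)[OF F bL] tb by auto
          show "set (?P c) \<subseteq> A" using c famD(3)[OF F, of c] famD(3)[OF F bL] by auto
          fix d assume d: "d \<in> insert t' ?M" "c \<noteq> d"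
          have "c \<noteq> t' \<Longrightarrow> d \<noteq> t' \<Longrightarrow> set (P' c) \<inter> set (P' d) = {}"
            "c \<noteq> t' \<Longrightarrow> set (P' c) \<inter> set (P' b) = {}" "d \<noteq> t' \<Longrightarrow> set (P' d) \<inter> set (P' b) = {}"
            using c d bL' False fam_disj[OF F] by auto
          then show "set (?P c) \<inter> set (?P d) = {}" using d(2) by (auto split: if_splits)
        qed
        have 2: "ends ?M ?U ?P x" unfolding ends_def
        proof
          fix c assume c: "c \<in> ?M"
          then have "c \<noteq> t'" using t'M by auto
          then show "walk (?U c) (?P c) x" using c E W Ub bL' unfolding ends_def
            by (auto simp: walk_append_iff)
        qed
        have 3: "walk (?U t') (?P t') y" by simp
        have 4: "pverts (?U t') (?P t') \<inter> near r x m = {}" using ynm by simp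
        have us: "used (insert t' ?M) ?P = used (insert t L) P'"
        proof -
          have "used (insert t' ?M) ?P = set (P' t) \<union> set (P' b) \<union> used (L - {b}) P'"
            using t'M tt tL unfolding used_def by (auto split: if_splits)
          then show ?thesis using bL' unfolding used_def by auto
        qed
        have 5: "\<forall>d\<in>A. src d \<in> near r x m \<or> dst d \<in> near r x m \<longrightarrow> (d \<in> used (insert t' ?M) ?P \<longleftrightarrow> d \<in> used B P)"
          using us I1 sub by auto
        have 7: "indep (insert t' ?M)" "cl (insert t' ?M) = K" using sw eq by auto
        show ?thesis using less.IH[OF mk 1 t'M 2 7 3 y(2) 4 5] 6[of y] eq by simp
      qed
    qed
  qed
qed

text \<open>The search starts with an empty trail for \<open>t\<close> at \<open>w\<close> and
  follows a shortest residual path; minimality of \<open>k\<close> gives the required disjointness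
  from \<open>near\<close> in the initial state.\<close>

lemma augment:
  assumes "fam A T B U P" "ends B U P x" "indep B"
    and "w \<in> resid A T B U P x" "t \<in> T w" "t \<notin> cl B"
  shows "\<exists>B' U' P'. fam A T B' U' P' \<and> ends B' U' P' x \<and> indep B' \<and> cl B' = cl (insert t B)"
proof -
  let ?r = "resid_arc A T B U P"
  have "\<exists>k. (w, x) \<in> ?r ^^ k" using assms(4) by (simp add: resid_def rtrancl_power)
  then obtain k where k: "(w, x) \<in> ?r ^^ k" and kmin: "\<And>j. j < k \<Longrightarrow> (w, x) \<notin> ?r ^^ j"
    using exists_least_iff[of "\<lambda>k. (w, x) \<in> ?r ^^ k"] by auto
  have tB: "t \<notin> B" using assms(6) cl_extI[of t B] by blast
  let ?U = "U(t := w)" and ?P = "P(t := [])"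
  have 1: "fam A T (insert t B) ?U ?P" using assms(1,5) tB unfolding fam_def by auto
  have 2: "ends B ?U ?P x" using assms(2) tB unfolding ends_def by auto
  have us: "used (insert t B) ?P = used B P" using tB unfolding used_def by (auto split: if_splits)
  have 3: "w \<notin> near ?r x k" using kmin by (auto simp: near_def)
  show ?thesis
    by (rule augment_state[where B = B and U = U and P = P and t = t and L = B and U' = ?U and P' = ?P and w = w and k = k])
      (use assms 1 2 us 3 tB k indep_insert circ_subset in \<open>auto intro: cl_extI dest: subsetD[OF circ_subset]\<close>)
qed

end

section \<open>Gates and inner networks\<close>

lemma split_order: "\<alpha> @ a # \<beta> = \<gamma> @ b # \<delta> \<Longrightarrow> a \<noteq> b \<Longrightarrow> b \<in> set \<beta> \<or> a \<in> set \<delta>"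
proof (induction \<alpha> arbitrary: \<gamma>)
  case Nil then show ?case by (cases \<gamma>) auto
next
  case (Cons c \<alpha>) then show ?case by (cases \<gamma>) auto
qed

lemma split_unique: "\<alpha> @ a # \<beta> = \<gamma> @ a # \<delta> \<Longrightarrow> distinct (\<alpha> @ a # \<beta>) \<Longrightarrow> \<beta> = \<delta>"
proof (induction \<alpha> arbitrary: \<gamma>)
  case Nil then show ?case by (cases \<gamma>) auto
next
  case (Cons c \<alpha>) then show ?case by (cases \<gamma>) auto
qed

context network begin

definition gates :: "'a set \<Rightarrow> 'v set \<Rightarrow> 'a set" where
  "gates A X = {a \<in> A. dst a \<in> X \<and> src a \<notin> X}"

definition inner_arcs :: "'a set \<Rightarrow> 'v set \<Rightarrow> 'a set" where
  "inner_arcs A X = {a \<in> A. dst a \<in> X \<and> src a \<in> X}"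

definition tokX :: "('v \<Rightarrow> 't set) \<Rightarrow> 'v set \<Rightarrow> 't set" where
  "tokX T X = (\<Union>y\<in>X. T y)"

text \<open>The counterpart of a saturated cut: none of the three kinds of residual step leads from
  outside \<open>Y\<close> into \<open>Y\<close>, and \<open>Y\<close> offers no token outside
  \<open>cl B\<close>.\<close>

definition tight :: "'a set \<Rightarrow> ('v \<Rightarrow> 't set) \<Rightarrow> 't set \<Rightarrow> ('t \<Rightarrow> 'v) \<Rightarrow> ('t \<Rightarrow> 'a list) \<Rightarrow> 'v set \<Rightarrow> bool" where
  "tight A T B U P Y \<longleftrightarrow> gates A Y \<subseteq> used B P \<and> (\<forall>a\<in>used B P. src a \<in> Y \<longrightarrow> dst a \<in> Y) \<and>
     tokX T Y \<subseteq> cl {b \<in> B. U b \<in> Y}"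

definition add_token :: "('v \<Rightarrow> 't set) \<Rightarrow> 'v \<Rightarrow> 't \<Rightarrow> 'v \<Rightarrow> 't set" where
  "add_token T h i = T(h := insert i (T h))"

lemma usedI: "b \<in> B \<Longrightarrow> a \<in> set (P b) \<Longrightarrow> a \<in> used B P"
  by (auto simp: used_def)

lemma endsD: "ends B U P x \<Longrightarrow> b \<in> B \<Longrightarrow> walk (U b) (P b) x"
  by (simp add: ends_def)

lemma completeD:
  assumes "complete A T x B U P"
  shows "fam A T B U P" "ends B U P x" "indep B" "toks T \<subseteq> cl B"
  using assms by (auto simp: complete_def)

lemma okI: "complete A T x B U P \<Longrightarrow> ok A T x"
  by (auto simp: ok_def)

lemma toks_add_token: "toks (add_token T h i) = insert i (toks T)"
  unfolding toks_def add_token_def by (auto split: if_splits)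

lemma tokX_toks: "tokX T X \<subseteq> toks T"
  by (auto simp: tokX_def toks_def)

lemma toksI: "t \<in> T y \<Longrightarrow> t \<in> toks T"
  by (auto simp: toks_def)

lemma resid_refl: "x \<in> resid A T B U P x"
  by (simp add: resid_def)

lemma resid_step: "(w, y) \<in> resid_arc A T B U P \<Longrightarrow> y \<in> resid A T B U P x \<Longrightarrow> w \<in> resid A T B U P x"
  unfolding resid_def by (auto intro: converse_rtrancl_into_rtrancl)

lemma resid_free: "a \<in> A \<Longrightarrow> a \<notin> used B P \<Longrightarrow> dst a \<in> resid A T B U P x \<Longrightarrow> src a \<in> resid A T B U P x"
  by (rule resid_step[of _ "dst a"]) (auto simp: resid_arc_def)

lemma resid_free_walk:
  assumes "walk u p v" "set p \<subseteq> A" "set p \<inter> used B P = {}" "v \<in> resid A T B U P x"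
  shows "pverts u p \<subseteq> resid A T B U P x"
  using assms
proof (induction p arbitrary: u)
  case Nil then show ?case by auto
next
  case (Cons a p)
  then have "pverts (dst a) p \<subseteq> resid A T B U P x" by auto
  moreover have "src a \<in> resid A T B U P x"
    using Cons.prems calculation start_pverts[of "dst a" p] by (intro resid_free) auto
  ultimately show ?case using Cons.prems by (auto simp: pverts_Cons)
qed

lemma resid_induct:
  assumes "w \<in> resid A T B U P x" "Q x"
    and "\<And>w y. (w, y) \<in> resid_arc A T B U P \<Longrightarrow> y \<in> resid A T B U P x \<Longrightarrow> w \<in> resid A T B U P x \<Longrightarrow> Q y \<Longrightarrow> Q w"
  shows "Q w"
  using assms(1) unfolding resid_def mem_Collect_eq
proof (induction rule: converse_rtrancl_induct)
  case base then show ?case using assms(2) .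
next
  case (step w y)
  then show ?case using assms(3)[of w y] unfolding resid_def
    by (auto intro: converse_rtrancl_into_rtrancl)
qed

text \<open>Closure under residual predecessors gives the two conditions on arcs. For the third,
  \<open>cov\<close> puts each token of the set into \<open>cl B\<close>, and the members of its
  circuit start in the set because of exchange steps.\<close>

lemma resid_tight:
  assumes "indep B" and cov: "tokX T (resid A T B U P x) \<subseteq> cl B"
  shows "tight A T B U P (resid A T B U P x)"
proof -
  let ?Y = "resid A T B U P x"
  have 1: "gates A ?Y \<subseteq> used B P" using resid_free unfolding gates_def by blast
  have 2: "\<forall>a\<in>used B P. src a \<in> ?Y \<longrightarrow> dst a \<in> ?Y"
  proof (intro ballI impI)
    fix a assume "a \<in> used B P" "src a \<in> ?Y"
    then show "dst a \<in> ?Y" by (intro resid_step[of "dst a" "src a"]) (auto simp: resid_arc_def)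
  qed
  have 3: "tokX T ?Y \<subseteq> cl {b \<in> B. U b \<in> ?Y}"
  proof
    fix t assume "t \<in> tokX T ?Y"
    then obtain y where y: "y \<in> ?Y" "t \<in> T y" and tB: "t \<in> cl B" using cov by (auto simp: tokX_def)
    have "circ t B \<subseteq> {b \<in> B. U b \<in> ?Y}"
    proof
      fix b assume b: "b \<in> circ t B"
      then have "(U b, y) \<in> resid_arc A T B U P" using y tB by (auto simp: resid_arc_def)
      then show "b \<in> {b \<in> B. U b \<in> ?Y}" using resid_step y(1) b circ_subset by blast
    qed
    then show "t \<in> cl {b \<in> B. U b \<in> ?Y}" using cl_circ[OF assms(1) tB] cl_monoD by blast
  qed
  show ?thesis unfolding tight_def using 1 2 3 by blast
qed

lemma walk_first_entry:
  assumes "walk u p y" "y \<in> Y" "u \<notin> Y"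
  shows "\<exists>q \<beta>. p = q @ \<beta> \<and> q \<noteq> [] \<and> dst (last q) \<in> Y \<and> (\<forall>a\<in>set q. src a \<notin> Y) \<and> walk u q (dst (last q))"
  using assms
proof (induction p arbitrary: u)
  case Nil then show ?case by auto
next
  case (Cons a p)
  show ?case
  proof (cases "dst a \<in> Y")
    case True
    then show ?thesis using Cons.prems by (intro exI[of _ "[a]"] exI[of _ p]) auto
  next
    case False
    then obtain q \<beta> where "p = q @ \<beta>" "q \<noteq> []" "dst (last q) \<in> Y" "\<forall>a\<in>set q. src a \<notin> Y" "walk (dst a) q (dst (last q))"
      using Cons.IH[of "dst a"] Cons.prems by auto
    then show ?thesis using Cons.prems by (intro exI[of _ "a # q"] exI[of _ \<beta>]) auto
  qed
qed

lemma walk_stays: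
  assumes "walk u p x" "u \<in> Y" "\<forall>a\<in>set p. src a \<in> Y \<longrightarrow> dst a \<in> Y"
  shows "pverts u p \<subseteq> Y"
  using assms by (induction p arbitrary: u) (auto simp: pverts_Cons)

text \<open>The outer half of a family: trails stopped at their first arc into \<open>Y\<close>.
  These last arcs are gates, distinct for distinct members since the trails share no arc.\<close>

definition entry :: "'a set \<Rightarrow> ('v \<Rightarrow> 't set) \<Rightarrow> 'v set \<Rightarrow> 't set \<Rightarrow> ('t \<Rightarrow> 'v) \<Rightarrow> ('t \<Rightarrow> 'a list) \<Rightarrow> bool" where
  "entry A T Y Ob U p \<longleftrightarrow> fam A T Ob U p \<and> (\<forall>b\<in>Ob. U b \<notin> Y \<and> p b \<noteq> [] \<and> dst (last (p b)) \<in> Y \<and>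
     walk (U b) (p b) (dst (last (p b))) \<and> (\<forall>a\<in>set (p b). src a \<notin> Y))"

lemma entry_of_fam:
  assumes "fam A T B U P" "\<forall>b\<in>B. \<exists>y\<in>Y. walk (U b) (P b) y"
  obtains p where "entry A T Y {b \<in> B. U b \<notin> Y} U p" "\<forall>b\<in>B. U b \<notin> Y \<longrightarrow> (\<exists>\<beta>. P b = p b @ \<beta>)"
proof -
  have "\<forall>b\<in>{b \<in> B. U b \<notin> Y}. \<exists>q. \<exists>\<beta>. P b = q @ \<beta> \<and> q \<noteq> [] \<and> dst (last q) \<in> Y \<and> (\<forall>a\<in>set q. src a \<notin> Y) \<and> walk (U b) q (dst (last q))"
    using assms(2) walk_first_entry by blast
  then obtain p where p: "\<And>b. b \<in> B \<Longrightarrow> U b \<notin> Y \<Longrightarrow> \<exists>\<beta>. P b = p b @ \<beta> \<and> p b \<noteq> [] \<and> dst (last (p b)) \<in> Y \<and> (\<forall>a\<in>set (p b). src a \<notin> Y) \<and> walk (U b) (p b) (dst (last (p b)))"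
    by (metis (mono_tags, lifting) mem_Collect_eq)
  have sub: "set (p b) \<subseteq> set (P b)" "distinct (P b) \<Longrightarrow> distinct (p b)" if b: "b \<in> B" "U b \<notin> Y" for b
    using p[OF b] by auto
  have "fam A T {b \<in> B. U b \<notin> Y} U p"
    unfolding fam_def
  proof (intro conjI ballI impI)
    fix b assume b: "b \<in> {b \<in> B. U b \<notin> Y}"
    then show "b \<in> T (U b)" "distinct (p b)" "set (p b) \<subseteq> A" using famD[OF assms(1), of b] sub[of b] by auto
    fix c assume c: "c \<in> {b \<in> B. U b \<notin> Y}" "b \<noteq> c"
    then show "set (p b) \<inter> set (p c) = {}" using fam_disj[OF assms(1), of b c] b sub[of b] sub[of c] by blast
  qed
  then have "entry A T Y {b \<in> B. U b \<notin> Y} U p" using p unfolding entry_def by blast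
  then show ?thesis using that p by blast
qed

lemma entryD:
  assumes "entry A T Y Ob U p" "b \<in> Ob"
  shows "U b \<notin> Y" "p b \<noteq> []" "dst (last (p b)) \<in> Y" "walk (U b) (p b) (dst (last (p b)))"
    "\<forall>a\<in>set (p b). src a \<notin> Y" "last (p b) \<in> gates A Y" "set (p b) \<subseteq> A" "distinct (p b)" "b \<in> T (U b)"
proof -
  show "U b \<notin> Y" "p b \<noteq> []" "dst (last (p b)) \<in> Y" "walk (U b) (p b) (dst (last (p b)))"
    "\<forall>a\<in>set (p b). src a \<notin> Y" and s: "set (p b) \<subseteq> A" "distinct (p b)" "b \<in> T (U b)"
    using assms by (auto simp: entry_def fam_def)
  then show "last (p b) \<in> gates A Y" unfolding gates_def using last_in_set[of "p b"] by auto
qed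

lemma entry_transfer:
  assumes "entry A T Y Ob U p" "\<And>a. a \<in> A \<Longrightarrow> src a \<notin> Y \<Longrightarrow> a \<in> A'" "\<And>v. v \<notin> Y \<Longrightarrow> T v \<subseteq> T' v"
  shows "entry A' T' Y Ob U p"
  unfolding entry_def
proof
  note e = entryD[OF assms(1)]
  show "fam A' T' Ob U p"
    unfolding fam_def
  proof (intro conjI ballI impI)
    fix b assume b: "b \<in> Ob"
    show "b \<in> T' (U b)" using e(9)[OF b] e(1)[OF b] assms(3) by auto
    show "distinct (p b)" using e(8)[OF b] .
    show "set (p b) \<subseteq> A'" using e(5)[OF b] e(7)[OF b] assms(2) by auto
    fix c assume "c \<in> Ob" "b \<noteq> c"
    then show "set (p b) \<inter> set (p c) = {}" using assms(1) b fam_disj[of A T Ob U p b c] unfolding entry_def by auto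
  qed
qed (use assms(1) in \<open>simp add: entry_def\<close>)

end

text \<open>A gate token forms a summand of its own and is no loop; together this says that it is a
  coloop.\<close>

locale gated_network = network cl \<kappa> src dst
  for cl :: "('s + 'a) set \<Rightarrow> ('s + 'a) set" and \<kappa> :: "'s + 'a \<Rightarrow> 'k" and src dst :: "'a \<Rightarrow> 'v" +
  assumes gate_summand: "\<kappa> t = \<kappa> (Inr a) \<Longrightarrow> t = Inr a"
    and gate_not_loop: "Inr a \<notin> cl {}"
begin

lemma gate_cl: "Inr a \<in> cl B \<Longrightarrow> Inr a \<in> B"
proof -
  assume "Inr a \<in> cl B"
  then have m: "Inr a \<in> cl {b \<in> B. \<kappa> b = \<kappa> (Inr a)}" by (rule cl_summand)
  have "{b \<in> B. \<kappa> b = \<kappa> (Inr a)} \<subseteq> {Inr a}" using gate_summand by auto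
  then show "Inr a \<in> B" using m gate_not_loop by (metis (no_types, lifting) mem_Collect_eq subset_singletonD insertI1)
qed

lemma cl_remove_gates: 
  assumes "t \<in> cl B" "t \<notin> Inr ` G"
  shows "t \<in> cl (B - Inr ` G)"
proof -
  have "{b \<in> B. \<kappa> b = \<kappa> t} \<subseteq> B - Inr ` G" using assms gate_summand[of t] by (auto dest!: sym[of "\<kappa> _" "\<kappa> t"])
  then show ?thesis using cl_summand[OF assms(1)] cl_monoD by blast
qed

text \<open>Restricting a network to \<open>X\<close> keeps track of the outside by a token \<open>Inr a\<close> at the head of each arc
  \<open>a\<close> entering \<open>X\<close>. Such tokens are coloops, so every complete family must use all of them.\<close>

definition inner_tokens :: "'a set \<Rightarrow> ('v \<Rightarrow> ('s + 'a) set) \<Rightarrow> 'v set \<Rightarrow> 'v \<Rightarrow> ('s + 'a) set" where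
  "inner_tokens A T X y = (if y \<in> X then T y \<union> Inr ` {a \<in> A. dst a = y \<and> src a \<notin> X} else {})"

text \<open>Keeps the tokens added by a further restriction apart from those already there. The
  property passes to restrictions because a gate of a region is not among its inner arcs.\<close>

definition clean :: "'a set \<Rightarrow> ('v \<Rightarrow> ('s + 'a) set) \<Rightarrow> bool" where
  "clean A T \<longleftrightarrow> (\<forall>a\<in>A. Inr a \<notin> toks T)"

definition sub_ok :: "'a set \<Rightarrow> ('v \<Rightarrow> ('s + 'a) set) \<Rightarrow> 'v set \<Rightarrow> 'v \<Rightarrow> bool" where
  "sub_ok A T X x \<longleftrightarrow> ok (inner_arcs A X) (inner_tokens A T X) x"

lemma toks_inner_tokens: "toks (inner_tokens A T X) = tokX T X \<union> Inr ` gates A X"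
  unfolding toks_def inner_tokens_def tokX_def gates_def by (auto split: if_splits)

text \<open>An arc entering \<open>X\<close> from \<open>Z - X\<close> becomes a gate in the second
  restriction, one from outside \<open>Z\<close> has received its token in the first. Hence regions
  can be nested.\<close>

lemma sub_sub:
  assumes "X \<subseteq> Z"
  shows "inner_arcs (inner_arcs A Z) X = inner_arcs A X" "inner_tokens (inner_arcs A Z) (inner_tokens A T Z) X = inner_tokens A T X"
  using assms unfolding inner_arcs_def inner_tokens_def by (auto simp: fun_eq_iff)

lemma clean_sub: "clean A T \<Longrightarrow> clean (inner_arcs A X) (inner_tokens A T X)"
  unfolding clean_def toks_inner_tokens using tokX_toks by (auto simp: inner_arcs_def gates_def)

lemma clean_add_token: "clean A T \<Longrightarrow> clean (A - {e}) (add_token T h (Inl i))"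
  by (auto simp: clean_def toks_add_token)

lemma inner_add_token:
  assumes "src e \<in> X" "dst e \<in> X"
  shows "inner_arcs (A - {e}) X = inner_arcs A X - {e}"
    "inner_tokens (A - {e}) (add_token T (dst e) i) X = add_token (inner_tokens A T X) (dst e) i"
  using assms unfolding inner_arcs_def inner_tokens_def add_token_def by (auto simp: fun_eq_iff)

lemma sub_family_start:
  assumes "clean A T" "fam (inner_arcs A Y) (inner_tokens A T Y) B U P" "Inr a \<in> B" "a \<in> gates A Y"
  shows "U (Inr a) = dst a"
  using famD(1)[OF assms(2,3)] assms(1,4) toksI[of "Inr a" T "U (Inr a)"]
  unfolding inner_tokens_def clean_def gates_def by (auto split: if_splits)

text \<open>Trails entering \<open>Y\<close> from outside are continued inside by the trail of the gate they use. Restricting to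
  a subset \<open>O'\<close> restores independence.\<close>

lemma hybrid:
  assumes cle: "clean A T" and ent: "entry A T Y Ob U p" and cov: "toks T \<subseteq> cl (Ob \<union> tokX T Y)"
    and com: "complete (inner_arcs A Y) (inner_tokens A T Y) x BF UF PF"
  defines "I \<equiv> BF - Inr ` gates A Y"
  obtains O' where "O' \<subseteq> Ob" "O' \<inter> I = {}"
    "complete A T x (O' \<union> I) (\<lambda>t. if t \<in> I then UF t else U t)
       (\<lambda>t. if t \<in> I then PF t else p t @ PF (Inr (last (p t))))"
    "I \<subseteq> tokX T Y" "tokX T Y \<subseteq> cl I" "Inr ` gates A Y \<subseteq> BF"
proof -
  note F = completeD(1)[OF com] and E = completeD(2)[OF com]
  have gB: "Inr ` gates A Y \<subseteq> BF"
    using completeD(4)[OF com] gate_cl unfolding toks_inner_tokens by auto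
  have IY: "b \<in> T (UF b) \<and> UF b \<in> Y" if "b \<in> I" for b
    using famD(1)[OF F, of b] that unfolding I_def inner_tokens_def gates_def by (auto split: if_splits)
  then have Itok: "I \<subseteq> tokX T Y" unfolding tokX_def by blast
  have tokI: "tokX T Y \<subseteq> cl I"
  proof
    fix t assume t: "t \<in> tokX T Y"
    then have "t \<in> cl BF" using completeD(4)[OF com] unfolding toks_inner_tokens by auto
    moreover have "t \<notin> Inr ` gates A Y" using t cle tokX_toks[of T Y] unfolding clean_def gates_def by auto
    ultimately show "t \<in> cl I" unfolding I_def by (rule cl_remove_gates)
  qed
  have Iind: "indep I" using completeD(3)[OF com] indep_subset unfolding I_def by blast
  \<comment> \<open>The inner tokens are all kept, as they span those of \<open>Y\<close>; only
    outer tokens that have become dependent are dropped.\<close>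
  obtain B where B: "I \<subseteq> B" "B \<subseteq> I \<union> Ob" "indep B" "I \<union> Ob \<subseteq> cl B"
    using extend_indep[OF Iind, of "I \<union> Ob"] by auto
  define O' where "O' = B - I"
  have O': "O' \<subseteq> Ob" "O' \<inter> I = {}" "O' \<union> I = B" using B unfolding O'_def by auto
  let ?U = "\<lambda>t. if t \<in> I then UF t else U t" and ?P = "\<lambda>t. if t \<in> I then PF t else p t @ PF (Inr (last (p t)))"
  have lastB: "Inr (last (p b)) \<in> BF" "Inr (last (p b)) \<notin> I" if "b \<in> O'" for b
    using entryD(6)[OF ent, of b] that O'(1) gB unfolding I_def by auto
  have sF: "set (PF b) \<subseteq> inner_arcs A Y" if "b \<in> BF" for b using famD(3)[OF F that] .
  have srcF: "\<forall>a\<in>set (PF b). src a \<in> Y" if "b \<in> BF" for b using sF[OF that] unfolding inner_arcs_def by auto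
  have IB: "b \<in> BF" if "b \<in> I" for b using that unfolding I_def by simp
  have "fam A T (O' \<union> I) ?U ?P"
    unfolding fam_def
  proof (intro conjI ballI impI)
    fix b assume b: "b \<in> O' \<union> I"
    show "b \<in> T (?U b)" using b IY[of b] entryD(9)[OF ent, of b] O' by auto
    show "distinct (?P b)"
    proof (cases "b \<in> I")
      case True then show ?thesis using famD(2)[OF F] IB by simp
    next
      case False
      then have bO: "b \<in> O'" "b \<in> Ob" using b O' by auto
      have "set (p b) \<inter> set (PF (Inr (last (p b)))) = {}"
        using entryD(5)[OF ent bO(2)] srcF[OF lastB(1)[OF bO(1)]] by auto
      then show ?thesis using False entryD(8)[OF ent bO(2)] famD(2)[OF F lastB(1)[OF bO(1)]] by simp
    qed
    show "set (?P b) \<subseteq> A"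
      using b O' sF[of b] IB[of b] entryD(7)[OF ent, of b] sF[OF lastB(1)[of b]] by (auto simp: inner_arcs_def)
    fix c assume c: "c \<in> O' \<union> I" "b \<noteq> c"
    have key: "set (?P b) \<inter> set (?P c) = {}" if bI: "b \<in> I" and cO: "c \<in> O'" and bc: "b \<noteq> c" for b c
    proof -
      have "set (PF b) \<inter> set (p c) = {}" using srcF[OF IB[OF bI]] entryD(5)[OF ent, of c] cO O' by auto
      moreover have "set (PF b) \<inter> set (PF (Inr (last (p c)))) = {}"
        using fam_disj[OF F IB[OF bI] lastB(1)[OF cO]] lastB(2)[OF cO] bI by auto
      ultimately show ?thesis using bI cO O' by auto
    qed
    show "set (?P b) \<inter> set (?P c) = {}"
    proof (cases "b \<in> I"; cases "c \<in> I")
      assume "b \<in> I" "c \<in> I"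
      then show ?thesis using fam_disj[OF F] IB c(2) by simp
    next
      assume "b \<in> I" "c \<notin> I" then show ?thesis using key[of b c] c by auto
    next
      assume "b \<notin> I" "c \<in> I" then show ?thesis using key[of c b] c b by auto
    next
      assume n: "b \<notin> I" "c \<notin> I"
      then have bO: "b \<in> O'" "c \<in> O'" "b \<in> Ob" "c \<in> Ob" using b c O' by auto
      have pp: "set (p b) \<inter> set (p c) = {}" using ent bO c(2) unfolding entry_def fam_def by auto
      have "last (p b) \<in> set (p b)" "last (p c) \<in> set (p c)"
        using entryD(2)[OF ent] bO by auto
      then have "Inr (last (p b)) \<noteq> (Inr (last (p c)) :: 's + 'a)" using pp by auto
      then have "set (PF (Inr (last (p b)))) \<inter> set (PF (Inr (last (p c)))) = {}"
        using fam_disj[OF F] lastB bO by blast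
      moreover have "set (p b) \<inter> set (PF (Inr (last (p c)))) = {}" "set (p c) \<inter> set (PF (Inr (last (p b)))) = {}"
        using entryD(5)[OF ent] bO srcF lastB by blast+
      ultimately show ?thesis using n pp by auto
    qed
  qed
  moreover have "ends (O' \<union> I) ?U ?P x"
    unfolding ends_def
  proof
    fix b assume b: "b \<in> O' \<union> I"
    show "walk (?U b) (?P b) x"
    proof (cases "b \<in> I")
      case True then show ?thesis using endsD[OF E] IB by simp
    next
      case False
      then have bO: "b \<in> O'" "b \<in> Ob" using b O' by auto
      have "walk (UF (Inr (last (p b)))) (PF (Inr (last (p b)))) x" using endsD[OF E lastB(1)[OF bO(1)]] .
      moreover have "UF (Inr (last (p b))) = dst (last (p b))"
        using sub_family_start[OF cle F lastB(1)[OF bO(1)]] entryD(6)[OF ent bO(2)] .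
      ultimately show ?thesis using False walk_append_iff[OF entryD(4)[OF ent bO(2)]] by simp
    qed
  qed
  moreover have "toks T \<subseteq> cl (O' \<union> I)"
  proof -
    have "Ob \<union> tokX T Y \<subseteq> cl B" using B(4) tokI cl_mono[OF B(1)] by auto
    then show ?thesis using cov cl_least O'(3) by blast
  qed
  ultimately have "complete A T x (O' \<union> I) ?U ?P" using B(3) O'(3) unfolding complete_def by simp
  then show ?thesis using that O' Itok tokI gB by blast
qed

text \<open>Inside and outside communicate only through the gates, and each gate has its own inner
  trail; so the outside may be served by any family that reaches \<open>Y\<close> and spans together
  with its tokens.\<close>

lemma hybrid_ok:
  assumes "clean A T" "entry A T Y Ob U p" "toks T \<subseteq> cl (Ob \<union> tokX T Y)" "sub_ok A T Y x"
  shows "ok A T x"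
proof -
  obtain BF UF PF where "complete (inner_arcs A Y) (inner_tokens A T Y) x BF UF PF"
    using assms(4) unfolding sub_ok_def ok_def by blast
  then obtain O' where "complete A T x (O' \<union> (BF - Inr ` gates A Y)) (\<lambda>t. if t \<in> BF - Inr ` gates A Y then UF t else U t)
       (\<lambda>t. if t \<in> BF - Inr ` gates A Y then PF t else p t @ PF (Inr (last (p t))))"
    by (rule hybrid[OF assms(1-3)])
  then show ?thesis by (rule okI)
qed

lemma complete_into:
  assumes "complete A T w B U P" "w \<in> Y"
  obtains p where "entry A T Y {b \<in> B. U b \<notin> Y} U p" "\<forall>b\<in>B. U b \<notin> Y \<longrightarrow> (\<exists>\<beta>. P b = p b @ \<beta>)"
    "toks T \<subseteq> cl ({b \<in> B. U b \<notin> Y} \<union> tokX T Y)"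
proof -
  note F = completeD(1)[OF assms(1)] 
  have 1: "\<forall>b\<in>B. \<exists>y\<in>Y. walk (U b) (P b) y" using completeD(2)[OF assms(1)] assms(2) unfolding ends_def by blast
  have "B \<subseteq> {b \<in> B. U b \<notin> Y} \<union> tokX T Y" using famD(1)[OF F] unfolding tokX_def by blast
  then have "toks T \<subseteq> cl ({b \<in> B. U b \<notin> Y} \<union> tokX T Y)"
    using completeD(4)[OF assms(1)] cl_mono by blast
  then show ?thesis using entry_of_fam[OF F 1] that by blast
qed

definition suf :: "'a \<Rightarrow> 'a list \<Rightarrow> 'a list" where
  "suf a p = tl (dropWhile (\<lambda>c. c \<noteq> a) p)"

lemma suf_split: "a \<in> set p \<Longrightarrow> \<exists>\<alpha>. p = \<alpha> @ a # suf a p \<and> a \<notin> set \<alpha>"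
  unfolding suf_def
proof (induction p)
  case (Cons c p)
  show ?case
  proof (cases "c = a")
    case True then show ?thesis by (intro exI[of _ "[]"]) auto
  next
    case False
    then obtain \<alpha> where "p = \<alpha> @ a # tl (dropWhile (\<lambda>c. c \<noteq> a) p)" "a \<notin> set \<alpha>" using Cons by auto
    then show ?thesis using False by (intro exI[of _ "c # \<alpha>"]) auto
  qed
qed simp

text \<open>By tightness a trail that has entered \<open>Y\<close> never leaves it. It therefore
  uses at most one gate, and its remainder can serve as the trail of that gate's token. Since all
  gates are used, every gate token receives a trail.\<close>

lemma tight_sub:
  assumes cle: "clean A T" and F: "fam A T B U P" and E: "ends B U P x" and ind: "indep B"
    and x: "x \<in> Y" and ti: "tight A T B U P Y"
  defines "BF \<equiv> {b \<in> B. U b \<in> Y} \<union> Inr ` gates A Y"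
  obtains UF PF where "complete (inner_arcs A Y) (inner_tokens A T Y) x BF UF PF"
    "\<forall>b\<in>B. U b \<in> Y \<longrightarrow> UF b = U b \<and> PF b = P b" "used BF PF \<subseteq> used B P"
    "\<forall>a\<in>used B P. src a \<in> Y \<longrightarrow> a \<in> used BF PF"
proof -
  have g: "gates A Y \<subseteq> used B P" and st: "\<And>a. a \<in> used B P \<Longrightarrow> src a \<in> Y \<Longrightarrow> dst a \<in> Y"
    and token_summand: "tokX T Y \<subseteq> cl {b \<in> B. U b \<in> Y}" using ti unfolding tight_def by auto
  \<comment> \<open>The member whose trail contains \<open>a\<close>; meaningful for used arcs
    only.\<close>
  define ow where "ow a = (THE b. b \<in> B \<and> a \<in> set (P b))" for a
  have ow: "ow a = b" if "b \<in> B" "a \<in> set (P b)" for a b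
    unfolding ow_def using that used_unique[OF F] by (intro the_equality) auto
  have owg: "ow a \<in> B" "a \<in> set (P (ow a))" if "a \<in> used B P" for a
    using that ow unfolding used_def by auto
  define UF where "UF t = (case t of Inr a \<Rightarrow> if a \<in> gates A Y then dst a else U t | _ \<Rightarrow> U t)" for t
  define PF where "PF t = (case t of Inr a \<Rightarrow> if a \<in> gates A Y then suf a (P (ow a)) else P t | _ \<Rightarrow> P t)" for t
  have nB: "Inr a \<notin> B" if "a \<in> gates A Y" for a
    using that famD(1)[OF F, of "Inr a"] cle toksI unfolding clean_def gates_def by blast
  have UFg: "UF (Inr a) = dst a" "PF (Inr a) = suf a (P (ow a))" if "a \<in> gates A Y" for a
    using that unfolding UF_def PF_def by auto
  have UFb: "UF b = U b" "PF b = P b" if "b \<in> B" for b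
    using that nB unfolding UF_def PF_def by (auto split: sum.splits)
  have spl: "\<exists>\<alpha>. P (ow a) = \<alpha> @ a # suf a (P (ow a))" if "a \<in> gates A Y" for a
    using suf_split[OF owg(2)] g that by blast
  have in1: "pverts (U b) (P b) \<subseteq> Y" if "b \<in> B" "U b \<in> Y" for b
    using walk_stays[OF endsD[OF E that(1)] that(2)] st usedI[OF that(1)] by blast
  have wg: "walk (dst a) (suf a (P (ow a))) x" "pverts (dst a) (suf a (P (ow a))) \<subseteq> Y" if a: "a \<in> gates A Y" for a
  proof -
    obtain \<alpha> where al: "P (ow a) = \<alpha> @ a # suf a (P (ow a))" using spl[OF a] by blast
    have "walk (U (ow a)) (\<alpha> @ a # suf a (P (ow a))) x" using endsD[OF E owg(1)] al g a by auto
    then show w: "walk (dst a) (suf a (P (ow a))) x" by (auto simp: arc_walk_append)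
    have "set (suf a (P (ow a))) \<subseteq> used B P"
      using al usedI[OF owg(1), of a] g a by (metis Un_iff set_append list.set_intros(2) subsetD subsetI)
    then show "pverts (dst a) (suf a (P (ow a))) \<subseteq> Y"
      using walk_stays[OF w] st a unfolding gates_def by blast
  qed
  have sg: "set (suf a (P (ow a))) \<subseteq> set (P (ow a))" "distinct (suf a (P (ow a)))" "a \<notin> set (suf a (P (ow a)))"
    if a: "a \<in> gates A Y" for a
  proof -
    obtain \<alpha> where al: "P (ow a) = \<alpha> @ a # suf a (P (ow a))" using spl[OF a] by blast
    have d: "distinct (\<alpha> @ a # suf a (P (ow a)))" using famD(2)[OF F owg(1)] al g a by auto
    show "set (suf a (P (ow a))) \<subseteq> set (P (ow a))" by (subst al) auto
    show "distinct (suf a (P (ow a)))" "a \<notin> set (suf a (P (ow a)))" using d by auto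
  qed
  have inside: "set p \<subseteq> inner_arcs A Y" if "walk u p v" "pverts u p \<subseteq> Y" "set p \<subseteq> A" for u p v
    using that walk_src[OF that(1)] dst_pverts[of _ p u] unfolding inner_arcs_def by blast
  have c1: "fam (inner_arcs A Y) (inner_tokens A T Y) BF UF PF"
    unfolding fam_def
  proof (intro conjI ballI impI)
    fix b assume b: "b \<in> BF"
    then consider (1) "b \<in> B" "U b \<in> Y" | (2) a where "b = Inr a" "a \<in> gates A Y" unfolding BF_def by auto
    then have "b \<in> inner_tokens A T Y (UF b) \<and> distinct (PF b) \<and> set (PF b) \<subseteq> inner_arcs A Y"
    proof cases
      case 1
      then show ?thesis using UFb famD[OF F 1(1)] in1[OF 1] inside[OF endsD[OF E 1(1)]] unfolding inner_tokens_def by auto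
    next
      case 2
      have "set (suf a (P (ow a))) \<subseteq> A" using sg(1)[OF 2(2)] famD(3)[OF F owg(1)] g 2(2) by blast
      then show ?thesis using 2 UFg[OF 2(2)] sg[OF 2(2)] inside[OF wg[OF 2(2)]]
        unfolding inner_tokens_def gates_def by auto
    qed
    then show "b \<in> inner_tokens A T Y (UF b)" "distinct (PF b)" "set (PF b) \<subseteq> inner_arcs A Y" by auto
    fix c assume c: "c \<in> BF" "b \<noteq> c"
    show "set (PF b) \<inter> set (PF c) = {}"
    proof (rule ccontr)
      assume "set (PF b) \<inter> set (PF c) \<noteq> {}"
      then obtain d where d: "d \<in> set (PF b)" "d \<in> set (PF c)" by auto
      have kk: "\<exists>\<alpha>. P (ow a) = \<alpha> @ a # suf a (P (ow a)) \<and> d \<in> set (suf a (P (ow a))) \<and> ow a = ow d \<and> src a \<notin> Y"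
        if "e = Inr a" "a \<in> gates A Y" "d \<in> set (PF e)" for e a
      proof -
        have "d \<in> set (P (ow a))" using that UFg(2) sg(1) by auto
        then have "ow d = ow a" using ow owg(1) g that(2) by blast
        then show ?thesis using spl[OF that(2)] that UFg(2) unfolding gates_def by auto
      qed
      have mixed: False if "e \<in> B" "U e \<in> Y" "a \<in> gates A Y" "d \<in> set (PF e)" "d \<in> set (PF (Inr a))" for e a
      proof -
        have "ow d = e" using ow that UFb by auto
        then have "a \<in> set (P e)" using kk[OF refl that(3,5)] owg(2)[of a] g that(3) by auto
        then have "src a \<in> Y" using in1[OF that(1,2)] walk_src[OF endsD[OF E that(1)]] by blast
        then show False using that(3) unfolding gates_def by simp
      qed
      from b c(1) show False unfolding BF_def
      proof (elim UnE imageE)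
        assume bc: "b \<in> {b \<in> B. U b \<in> Y}" "c \<in> {b \<in> B. U b \<in> Y}"
        then show False using d c(2) UFb fam_disj[OF F, of b c] by auto
      next
        fix a assume "b \<in> {b \<in> B. U b \<in> Y}" "c = Inr a" "a \<in> gates A Y"
        then show False using mixed[of b a] d by auto
      next
        fix a assume "c \<in> {b \<in> B. U b \<in> Y}" "b = Inr a" "a \<in> gates A Y"
        then show False using mixed[of c a] d by auto
      next
        \<comment> \<open>Both gates would lie on one trail, and the later one would have its tail
          in the remainder after the earlier one, hence inside \<open>Y\<close>.\<close>
        fix a1 a2 assume a: "b = Inr a1" "a1 \<in> gates A Y" "c = Inr a2" "a2 \<in> gates A Y"
        have ne: "a1 \<noteq> a2" using a c(2) by auto
        obtain \<alpha>1 where 1: "P (ow a1) = \<alpha>1 @ a1 # suf a1 (P (ow a1))" "ow a1 = ow d" "src a1 \<notin> Y" using kk[OF a(1,2) d(1)] by blast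
        obtain \<alpha>2 where 2: "P (ow a2) = \<alpha>2 @ a2 # suf a2 (P (ow a2))" "ow a2 = ow d" "src a2 \<notin> Y" using kk[OF a(3,4) d(2)] by blast
        have "a2 \<notin> set (suf a1 (P (ow a1)))"
          using wg[OF a(2)] walk_src 2(3) by blast
        moreover have "a1 \<notin> set (suf a2 (P (ow a2)))"
          using wg[OF a(4)] walk_src 1(3) by blast
        moreover have "\<alpha>1 @ a1 # suf a1 (P (ow a1)) = \<alpha>2 @ a2 # suf a2 (P (ow a2))" using 1 2 by metis
        ultimately show False using split_order ne by metis
      qed
    qed
  qed
  have c2: "ends BF UF PF x" unfolding ends_def BF_def using endsD[OF E] UFb UFg wg by auto
  have c3: "indep BF"
    unfolding indep_def
  proof (intro ballI notI)
    fix b assume b: "b \<in> BF" "b \<in> cl (BF - {b})"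
    show False
    proof (cases "b \<in> Inr ` gates A Y")
      case True
      then show False using b gate_cl by blast
    next
      case False
      then have "b \<in> {b \<in> B. U b \<in> Y}" using b unfolding BF_def by auto
      moreover have "b \<in> cl ((BF - {b}) - Inr ` gates A Y)" using cl_remove_gates[OF b(2) False] .
      moreover have "(BF - {b}) - Inr ` gates A Y \<subseteq> B - {b}" unfolding BF_def by auto
      ultimately show False using ind indep_notin cl_monoD by blast
    qed
  qed
  have c4: "toks (inner_tokens A T Y) \<subseteq> cl BF"
  proof -
    have "tokX T Y \<subseteq> cl BF" using token_summand cl_mono[of "{b \<in> B. U b \<in> Y}" BF] unfolding BF_def by auto
    moreover have "Inr ` gates A Y \<subseteq> cl BF" using cl_ext[of BF] unfolding BF_def by blast
    ultimately show ?thesis unfolding toks_inner_tokens by auto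
  qed
  have u1: "used BF PF \<subseteq> used B P"
  proof
    fix d assume "d \<in> used BF PF"
    then obtain b where b: "b \<in> BF" "d \<in> set (PF b)" unfolding used_def by auto
    show "d \<in> used B P"
    proof (cases "b \<in> B")
      case True then show ?thesis using b UFb usedI by auto
    next
      case False
      then obtain a where a: "b = Inr a" "a \<in> gates A Y" using b unfolding BF_def by auto
      then have "d \<in> set (P (ow a))" using b UFg sg by auto
      then show ?thesis using owg(1) g a usedI by blast
    qed
  qed
  have u2: "a \<in> used BF PF" if a: "a \<in> used B P" "src a \<in> Y" for a
  proof -
    let ?b = "ow a"
    have b: "?b \<in> B" "a \<in> set (P ?b)" using owg[OF a(1)] by auto
    show ?thesis
    proof (cases "U ?b \<in> Y")
      case True
      then have "?b \<in> BF" "a \<in> set (PF ?b)" using b UFb unfolding BF_def by auto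
      then show ?thesis by (rule usedI)
    next
      case False
      obtain \<alpha> \<beta> where ab: "P ?b = \<alpha> @ a # \<beta>" using b split_list by fastforce
      have "walk (U ?b) \<alpha> (src a)" using endsD[OF E b(1)] ab by (auto simp: arc_walk_append)
      then obtain q \<beta>' where q: "\<alpha> = q @ \<beta>'" "q \<noteq> []" "dst (last q) \<in> Y" "\<forall>a\<in>set q. src a \<notin> Y"
        using walk_first_entry[of "U ?b" \<alpha> "src a" Y] a(2) False by blast
      let ?g = "last q"
      have qq: "q = butlast q @ [?g]" using q(2) by simp
      have Pb: "P ?b = butlast q @ ?g # (\<beta>' @ a # \<beta>)" using ab q(1) qq by (metis append.assoc append_Cons append_Nil)
      have gP: "?g \<in> set (P ?b)" using Pb by (metis in_set_conv_decomp)
      then have gg: "?g \<in> gates A Y" using q famD(3)[OF F b(1)] last_in_set[OF q(2)] unfolding gates_def by auto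
      have owgg: "ow ?g = ?b" using ow[OF b(1) gP] .
      have dist: "distinct (butlast q @ ?g # (\<beta>' @ a # \<beta>))" using famD(2)[OF F b(1)] Pb by simp
      obtain \<alpha>' where al': "P ?b = \<alpha>' @ ?g # suf ?g (P ?b)" using spl[OF gg] owgg by auto
      have "suf ?g (P ?b) = \<beta>' @ a # \<beta>"
        using split_unique[of "butlast q" ?g "\<beta>' @ a # \<beta>" \<alpha>' "suf ?g (P ?b)"] dist Pb al' by simp
      then have "a \<in> set (PF (Inr ?g))" using UFg(2)[OF gg] owgg by auto
      moreover have "Inr ?g \<in> BF" using gg unfolding BF_def by auto
      ultimately show ?thesis using usedI by blast
    qed
  qed
  show ?thesis
    by (rule that[of UF PF]) (use c1 c2 c3 c4 u1 u2 UFb in \<open>auto simp: complete_def\<close>)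
qed

section \<open>Repairing a family that lacks at most one dimension\<close>

lemma complete_of_augment:
  assumes F: "fam A T B U P" "ends B U P x" "indep B" and cor: "toks T \<subseteq> cl (insert l B)"
    and "\<not> tokX T (resid A T B U P x) \<subseteq> cl B"
  shows "ok A T x"
proof -
  obtain w t where w: "w \<in> resid A T B U P x" "t \<in> T w" "t \<notin> cl B" using assms(5) unfolding tokX_def by auto
  obtain B' U' P' where B': "fam A T B' U' P'" "ends B' U' P' x" "indep B'" "cl B' = cl (insert t B)"
    using augment[OF F w] by blast
  have "toks T \<subseteq> cl B'" using B'(4) corank_one[OF cor toksI[of t T w, OF w(2)] w(3)] by simp
  then show ?thesis using B' unfolding ok_def complete_def by blast
qed

text \<open>Either the residual set has a token outside \<open>cl B\<close>, and one augmentation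
  completes the family, or it is tight. In the latter case its inside is feasible at
  \<open>x\<close>, and a complete family at \<open>w\<close> supplies the entry trails.\<close>

lemma ok_via_resid:
  assumes cle: "clean A T" and F: "fam A T B U P" "ends B U P x" "indep B" and cor: "toks T \<subseteq> cl (insert l B)"
    and w: "w \<in> resid A T B U P x" "ok A T w"
  shows "ok A T x"
proof (cases "tokX T (resid A T B U P x) \<subseteq> cl B")
  case True
  let ?Y = "resid A T B U P x"
  have "tight A T B U P ?Y" using resid_tight[OF F(3) True] .
  then obtain UF PF where "complete (inner_arcs A ?Y) (inner_tokens A T ?Y) x ({b \<in> B. U b \<in> ?Y} \<union> Inr ` gates A ?Y) UF PF"
    by (rule tight_sub[OF cle F resid_refl])
  then have s: "sub_ok A T ?Y x" unfolding sub_ok_def by (rule okI)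
  obtain B' U' P' where c: "complete A T w B' U' P'" using w(2) unfolding ok_def by blast
  obtain p where p: "entry A T ?Y {b \<in> B'. U' b \<notin> ?Y} U' p" "toks T \<subseteq> cl ({b \<in> B'. U' b \<notin> ?Y} \<union> tokX T ?Y)"
    by (rule complete_into[OF c w(1)])
  show ?thesis by (rule hybrid_ok[OF cle p s])
qed (rule complete_of_augment[OF F cor])

text \<open>A complete family at \<open>x\<close> loses at most the member through \<open>e\<close>.
  The rest of the trail of this member after \<open>e\<close> is then free, so the head of
  \<open>e\<close> lies in the residual set, and feasibility is carried over from there.\<close>

lemma ok_ext_if_head_ok:
  assumes cle: "clean A T" and x: "ok A T x" and i: "Inl i \<in> cl (toks T)"
    and e: "e \<in> A" and h: "ok (A - {e}) (add_token T (dst e) (Inl i)) (dst e)"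
  shows "ok (A - {e}) (add_token T (dst e) (Inl i)) x"
proof -
  let ?A = "A - {e}" and ?T = "add_token T (dst e) (Inl i)"
  obtain B U P where c: "complete A T x B U P" using x unfolding ok_def by blast
  note F = completeD(1)[OF c] and E = completeD(2)[OF c]
  have TT: "\<And>v. T v \<subseteq> ?T v" unfolding add_token_def by auto
  have token_summand: "toks ?T \<subseteq> cl B" using completeD(4)[OF c] i cl_least[of "toks T" B] unfolding toks_add_token by auto
  show ?thesis
  proof (cases "e \<in> used B P")
    case False
    then have "fam ?A ?T B U P" using F TT unfolding fam_def used_def by blast
    then show ?thesis using E completeD(3)[OF c] token_summand okI unfolding complete_def by blast
  next
    case True
    then obtain l where l: "l \<in> B" "e \<in> set (P l)" unfolding used_def by auto
    obtain \<alpha> \<beta> where ab: "P l = \<alpha> @ e # \<beta>" using l split_list by fastforce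
    let ?B = "B - {l}"
    have dis: "set (P b) \<inter> set (P l) = {}" if "b \<in> ?B" for b using fam_disj[OF F] that l by blast
    have F': "fam ?A ?T ?B U P" using F TT dis l unfolding fam_def by blast
    have E': "ends ?B U P x" using E unfolding ends_def by auto
    have ind: "indep ?B" using completeD(3)[OF c] indep_subset by blast
    have cor: "toks ?T \<subseteq> cl (insert l ?B)" using token_summand l by (simp add: insert_absorb)
    have wb: "walk (dst e) \<beta> x" using endsD[OF E l(1)] ab by (auto simp: arc_walk_append)
    have "set \<beta> \<subseteq> ?A" using famD(2,3)[OF F l(1)] ab by auto
    moreover have "set \<beta> \<inter> used ?B P = {}" using dis ab unfolding used_def by auto
    ultimately have "dst e \<in> resid ?A ?T ?B U P x"
      using resid_free_walk[OF wb _ _ resid_refl] start_pverts by blast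
    then show ?thesis using ok_via_resid[OF clean_add_token[OF cle] F' E' ind cor] h by blast
  qed
qed

text \<open>Entry trails into \<open>X\<close> do not use \<open>e\<close>, whose tail is inside
  \<open>X\<close>; so a complete family from before the extension still provides them.\<close>

lemma ok_ext_of_sub:
  assumes cle: "clean A T" and h: "ok A T (dst e)" and eX: "src e \<in> X" "dst e \<in> X"
    and s: "sub_ok (A - {e}) (add_token T (dst e) (Inl i)) X (dst e)"
  shows "ok (A - {e}) (add_token T (dst e) (Inl i)) (dst e)"
proof -
  let ?A = "A - {e}" and ?T = "add_token T (dst e) (Inl i)"
  obtain B U P where c: "complete A T (dst e) B U P" using h unfolding ok_def by blast
  obtain p where p: "entry A T X {b \<in> B. U b \<notin> X} U p" "toks T \<subseteq> cl ({b \<in> B. U b \<notin> X} \<union> tokX T X)"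
    by (rule complete_into[OF c eX(2)])
  have 1: "entry ?A ?T X {b \<in> B. U b \<notin> X} U p"
    by (rule entry_transfer[OF p(1)]) (use eX in \<open>auto simp: add_token_def\<close>)
  have "tokX T X \<subseteq> tokX ?T X" "Inl i \<in> tokX ?T X" using eX unfolding tokX_def add_token_def by auto
  then have "toks ?T \<subseteq> cl ({b \<in> B. U b \<notin> X} \<union> tokX ?T X)"
    using p(2) cl_mono[of "{b \<in> B. U b \<notin> X} \<union> tokX T X" "{b \<in> B. U b \<notin> X} \<union> tokX ?T X"] cl_extI[of "Inl i" "{b \<in> B. U b \<notin> X} \<union> tokX ?T X"]
    unfolding toks_add_token by blast
  then show ?thesis using hybrid_ok[OF clean_add_token[OF cle] 1 _ s] by blast
qed

end

section \<open>The region obstructing an extension\<close>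

lemma prefix_before:
  "\<alpha> @ a # \<beta> = p @ \<gamma> \<Longrightarrow> distinct (\<alpha> @ a # \<beta>) \<Longrightarrow> d \<in> set \<beta> \<Longrightarrow> d \<in> set p \<Longrightarrow> a \<in> set p"
proof (induction \<alpha> arbitrary: p)
  case Nil then show ?case by (cases p) auto
next
  case (Cons c \<alpha>)
  then obtain l where l: "p = c # l" "\<alpha> @ a # \<beta> = l @ \<gamma>" by (cases p) auto
  have "d \<noteq> c" using Cons.prems(2,3) by auto
  then have dl: "d \<in> set l" using Cons.prems(4) l(1) by simp
  have "distinct (\<alpha> @ a # \<beta>)" using Cons.prems(2) by (metis append_Cons distinct.simps(2))
  then have "a \<in> set l" using Cons.IH[OF l(2)] Cons.prems(3) dl by blast
  then show ?case using l by simp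
qed

lemma split_unique_prefix: "\<alpha> @ a # \<beta> = \<gamma> @ a # \<delta> \<Longrightarrow> distinct (\<alpha> @ a # \<beta>) \<Longrightarrow> \<alpha> = \<gamma>"
proof (induction \<alpha> arbitrary: \<gamma>)
  case Nil then show ?case by (cases \<gamma>) auto
next
  case (Cons c \<alpha>) then show ?case by (cases \<gamma>) auto
qed

context gated_network begin

text \<open>A variant of \<open>ok_via_resid\<close> in which feasibility at \<open>w\<close> is
  known only inside \<open>X\<close>. The residual set \<open>Y\<close> is united with
  \<open>X\<close>: the inner family of \<open>X\<close> leads into \<open>Y\<close> inside the
  union, and the given entry trails lead into the union.\<close>

lemma ok_via_region:
  assumes cle: "clean A T" and F: "fam A T B U P" "ends B U P z" "indep B" and cor: "toks T \<subseteq> cl (insert l B)"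
    and w: "w \<in> resid A T B U P z" "w \<in> X" "sub_ok A T X w"
    and ent: "entry A T (X \<union> resid A T B U P z) Ob UO pO"
    and cov: "toks T \<subseteq> cl (Ob \<union> tokX T (X \<union> resid A T B U P z))"
  shows "ok A T z"
proof (cases "tokX T (resid A T B U P z) \<subseteq> cl B")
  case True
  let ?Y = "resid A T B U P z"
  let ?Z = "X \<union> ?Y"
  let ?A = "inner_arcs A ?Z" and ?T = "inner_tokens A T ?Z"
  have "tight A T B U P ?Y" using resid_tight[OF F(3) True] .
  then obtain UF' PF' where "complete (inner_arcs A ?Y) (inner_tokens A T ?Y) z ({b \<in> B. U b \<in> ?Y} \<union> Inr ` gates A ?Y) UF' PF'"
    by (rule tight_sub[OF cle F resid_refl])
  then have "ok (inner_arcs A ?Y) (inner_tokens A T ?Y) z" by (rule okI)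
  then have sY: "sub_ok ?A ?T ?Y z" unfolding sub_ok_def by (simp add: sub_sub)
  obtain BF UF PF where c: "complete (inner_arcs A X) (inner_tokens A T X) w BF UF PF" using w(3) unfolding sub_ok_def ok_def by blast
  note FF = completeD(1)[OF c]
  \<comment> \<open>Gates of \<open>X\<close> that come from \<open>Y\<close> are inner arcs of the
    union, so their tokens are absent from its network and are discarded.\<close>
  define B2 where "B2 = {b \<in> BF. b \<in> ?T (UF b)}"
  have "fam ?A ?T B2 UF PF" unfolding fam_def
  proof (intro conjI ballI impI)
    fix b assume b: "b \<in> B2"
    then have bF: "b \<in> BF" unfolding B2_def by simp
    show "b \<in> ?T (UF b)" using b unfolding B2_def by simp
    show "distinct (PF b)" using famD(2)[OF FF bF] .
    show "set (PF b) \<subseteq> ?A" using famD(3)[OF FF bF] unfolding inner_arcs_def by auto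
    fix c assume "c \<in> B2" "b \<noteq> c"
    then show "set (PF b) \<inter> set (PF c) = {}" using fam_disj[OF FF bF] unfolding B2_def by auto
  qed
  moreover have "\<forall>b\<in>B2. \<exists>y\<in>?Y. walk (UF b) (PF b) y"
    using completeD(2)[OF c] w(1) unfolding B2_def ends_def by blast
  ultimately obtain p where e2: "entry ?A ?T ?Y {b \<in> B2. UF b \<notin> ?Y} UF p" by (rule entry_of_fam)
  let ?O = "{b \<in> B2. UF b \<notin> ?Y}"
  have tY: "tokX T ?Y \<subseteq> tokX ?T ?Y" unfolding tokX_def inner_tokens_def by auto
  have inO: "b \<in> ?O \<union> tokX ?T ?Y" if "b \<in> BF" "b \<in> ?T (UF b)" for b
    using that unfolding B2_def tokX_def by auto
  have "toks ?T \<subseteq> cl (?O \<union> tokX ?T ?Y)"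
  proof
    fix t assume "t \<in> toks ?T"
    then consider (1) "t \<in> tokX T X" | (2) "t \<in> tokX T ?Y" | (3) a where "t = Inr a" "a \<in> gates A ?Z"
      unfolding toks_inner_tokens tokX_def by auto
    then show "t \<in> cl (?O \<union> tokX ?T ?Y)"
    proof cases
      case 1
      then have "t \<in> cl BF" using completeD(4)[OF c] unfolding toks_inner_tokens by auto
      moreover have "t \<notin> Inr ` gates A X" using 1 cle tokX_toks[of T X] unfolding clean_def gates_def by auto
      ultimately have "t \<in> cl (BF - Inr ` gates A X)" by (rule cl_remove_gates)
      moreover have "BF - Inr ` gates A X \<subseteq> ?O \<union> tokX ?T ?Y"
      proof
        fix b assume b: "b \<in> BF - Inr ` gates A X"
        then have "b \<in> T (UF b) \<and> UF b \<in> X"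
          using famD(1)[OF FF, of b] unfolding inner_tokens_def gates_def by (auto split: if_splits)
        then show "b \<in> ?O \<union> tokX ?T ?Y" using b inO[of b] unfolding inner_tokens_def by auto
      qed
      ultimately show ?thesis by (rule cl_monoD)
    next
      case 2 then show ?thesis using tY cl_extI[of t "?O \<union> tokX ?T ?Y"] by auto
    next
      case 3
      then have tT: "t \<in> ?T (dst a)" unfolding inner_tokens_def gates_def by auto
      have "t \<in> ?O \<union> tokX ?T ?Y"
      proof (cases "dst a \<in> ?Y")
        case True then show ?thesis using tT unfolding tokX_def by auto
      next
        case False
        then have g: "a \<in> gates A X" using 3 unfolding gates_def by auto
        then have tB: "t \<in> BF" using completeD(4)[OF c] gate_cl 3 unfolding toks_inner_tokens by auto
        have "UF t = dst a" using sub_family_start[OF cle FF, of a] tB g 3 by simp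
        then show ?thesis using inO[OF tB] tT by simp
      qed
      then show ?thesis by (rule cl_extI)
    qed
  qed
  then have "ok ?A ?T z" using hybrid_ok[OF clean_sub[OF cle] e2 _ sY] by blast
  then have "sub_ok A T ?Z z" unfolding sub_ok_def .
  then show ?thesis using hybrid_ok[OF cle ent cov] by blast
qed (rule complete_of_augment[OF F cor])

text \<open>All arcs of \<open>Q\<close> have their heads outside \<open>X\<close>, and so does
  \<open>z\<close> lie outside; the network of \<open>X\<close> is therefore the same with and
  without the reservation, and its feasibility at the head of \<open>e\<close> can be used in the
  reduced network.\<close>

lemma reserved_step:
  assumes cle: "clean A T" and e: "e \<in> A" "src e \<in> X" "dst e \<in> X" and q: "\<forall>a\<in>Q. dst a \<notin> X" and z: "z \<notin> X"
    and i: "Inl i \<in> cl (toks T)" and ok1: "ok (A - Q) (add_token T z (Inl j)) z"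
    and s: "sub_ok (A - {e}) (add_token T (dst e) (Inl i)) X (dst e)"
  shows "ok (A - {e} - Q) (add_token (add_token T (dst e) (Inl i)) z (Inl j)) z"
proof -
  let ?A1 = "A - Q" and ?T1 = "add_token T z (Inl j)"
  let ?A = "A - {e} - Q" and ?T = "add_token (add_token T (dst e) (Inl i)) z (Inl j)"
  have zh: "z \<noteq> dst e" using z e by auto
  have TT: "\<And>v. ?T1 v \<subseteq> ?T v" unfolding add_token_def by auto
  have TTX: "?T1 v = ?T v" if "v \<noteq> dst e" for v using that unfolding add_token_def by auto
  have cle': "clean ?A ?T" using cle unfolding clean_def toks_add_token by auto
  obtain B U P where c: "complete ?A1 ?T1 z B U P" using ok1 unfolding ok_def by blast
  note F = completeD(1)[OF c] and E = completeD(2)[OF c]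
  have tkT: "toks ?T = insert (Inl i) (toks ?T1)" unfolding toks_add_token by auto
  have "toks T \<subseteq> cl B" using completeD(4)[OF c] unfolding toks_add_token by auto
  then have iB: "Inl i \<in> cl B" using i cl_least by blast
  have token_summand: "toks ?T \<subseteq> cl B" using completeD(4)[OF c] iB unfolding tkT by auto
  show ?thesis
  proof (cases "e \<in> used B P")
    case False
    then have "fam ?A ?T B U P" using F TT unfolding fam_def used_def by blast
    then show ?thesis using E completeD(3)[OF c] token_summand okI unfolding complete_def by blast
  next
    case True
    then obtain l where l: "l \<in> B" "e \<in> set (P l)" unfolding used_def by auto
    obtain \<alpha> \<beta> where ab: "P l = \<alpha> @ e # \<beta>" using l split_list by fastforce
    let ?B = "B - {l}"
    have dis: "set (P b) \<inter> set (P l) = {}" if "b \<in> ?B" for b using fam_disj[OF F] that l by blast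
    have F': "fam ?A ?T ?B U P" using F TT dis l unfolding fam_def by blast
    have E': "ends ?B U P z" using E unfolding ends_def by auto
    have ind: "indep ?B" using completeD(3)[OF c] indep_subset by blast
    have cor: "toks ?T \<subseteq> cl (insert l ?B)" using token_summand l by (simp add: insert_absorb)
    have wb: "walk (dst e) \<beta> z" using endsD[OF E l(1)] ab by (auto simp: arc_walk_append)
    have "set \<beta> \<subseteq> ?A" using famD(2,3)[OF F l(1)] ab by auto
    moreover have "set \<beta> \<inter> used ?B P = {}" using dis ab unfolding used_def by auto
    ultimately have hY: "dst e \<in> resid ?A ?T ?B U P z"
      using resid_free_walk[OF wb _ _ resid_refl] start_pverts by blast
    let ?Y = "resid ?A ?T ?B U P z"
    have "inner_arcs ?A X = inner_arcs (A - {e}) X" using q unfolding inner_arcs_def by auto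
    moreover have "inner_tokens ?A ?T X = inner_tokens (A - {e}) (add_token T (dst e) (Inl i)) X"
    proof
      fix y
      have "y \<in> X \<Longrightarrow> {a \<in> ?A. dst a = y \<and> src a \<notin> X} = {a \<in> A - {e}. dst a = y \<and> src a \<notin> X}" using q by auto
      moreover have "y \<in> X \<Longrightarrow> ?T y = add_token T (dst e) (Inl i) y" using z unfolding add_token_def by auto
      ultimately show "inner_tokens ?A ?T X y = inner_tokens (A - {e}) (add_token T (dst e) (Inl i)) X y" unfolding inner_tokens_def by simp
    qed
    ultimately have s': "sub_ok ?A ?T X (dst e)" using s unfolding sub_ok_def by simp
    have zY: "z \<in> X \<union> ?Y" using resid_refl by auto
    obtain p where p: "entry ?A1 ?T1 (X \<union> ?Y) {b \<in> B. U b \<notin> X \<union> ?Y} U p"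
      "toks ?T1 \<subseteq> cl ({b \<in> B. U b \<notin> X \<union> ?Y} \<union> tokX ?T1 (X \<union> ?Y))"
      by (rule complete_into[OF c zY])
    have p1: "entry ?A ?T (X \<union> ?Y) {b \<in> B. U b \<notin> X \<union> ?Y} U p"
      by (rule entry_transfer[OF p(1)]) (use e TT in auto)
    let ?S = "{b \<in> B. U b \<notin> X \<union> ?Y} \<union> tokX ?T (X \<union> ?Y)"
    have "tokX ?T1 (X \<union> ?Y) \<subseteq> tokX ?T (X \<union> ?Y)" using TT unfolding tokX_def by blast
    then have "toks ?T1 \<subseteq> cl ?S" using p(2) cl_mono[of "{b \<in> B. U b \<notin> X \<union> ?Y} \<union> tokX ?T1 (X \<union> ?Y)" ?S] by blast
    moreover have "Inl i \<in> ?S" using e unfolding tokX_def add_token_def by auto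
    ultimately have "toks ?T \<subseteq> cl ?S" using cl_extI[of "Inl i" ?S] unfolding tkT by blast
    then show ?thesis using ok_via_region[OF cle' F' E' ind cor hY e(3) s' p1] by blast
  qed
qed

end

locale obstruction = gated_network cl \<kappa> src dst
  for cl :: "('s + 'a) set \<Rightarrow> ('s + 'a) set" and \<kappa> :: "'s + 'a \<Rightarrow> 'k" and src dst :: "'a \<Rightarrow> 'v" +
  fixes A :: "'a set" and T :: "'v \<Rightarrow> ('s + 'a) set" and e :: 'a and i :: 's
  assumes cle: "clean A T" and eA: "e \<in> A" and icl: "Inl i \<in> cl (toks T)"
    and hok: "ok A T (dst e)" and bad: "\<not> ok (A - {e}) (add_token T (dst e) (Inl i)) (dst e)"
begin

abbreviation "h \<equiv> dst e"
abbreviation "A' \<equiv> A - {e}"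
abbreviation "T' \<equiv> add_token T h (Inl i)"
abbreviation "cf B U P \<equiv> complete A T h B U P"

text \<open>Every complete family at \<open>h\<close> uses \<open>e\<close>, since otherwise it would survive the extension; \<open>lab\<close> is the token
  whose trail does.\<close>

definition "lab B P = (THE l. l \<in> B \<and> e \<in> set (P l))"
definition "Ys B U P = resid A' T' (B - {lab B P}) U P h"
definition "Xs = \<Union>{Ys B U P |B U P. cf B U P}"

lemma cle': "clean A' T'"
  using clean_add_token[OF cle] .

lemma TT: "T v \<subseteq> T' v"
  unfolding add_token_def by auto

lemma toks': "toks T \<subseteq> cl B \<Longrightarrow> toks T' \<subseteq> cl B"
  using icl cl_least[of "toks T" B] unfolding toks_add_token by auto

lemma lab_eq: "fam A T B U P \<Longrightarrow> l \<in> B \<Longrightarrow> e \<in> set (P l) \<Longrightarrow> lab B P = l"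
  unfolding lab_def using used_unique[of A T B U P] by (intro the_equality) blast+

lemma cf_lab:
  assumes "cf B U P"
  shows "lab B P \<in> B" "e \<in> set (P (lab B P))"
proof -
  have "e \<in> used B P"
  proof (rule ccontr)
    assume "e \<notin> used B P"
    then have "fam A' T' B U P" using completeD(1)[OF assms] TT unfolding fam_def used_def by blast
    then have "complete A' T' h B U P" using completeD[OF assms] toks' unfolding complete_def by blast
    then show False using bad okI by blast
  qed
  then obtain l where "l \<in> B" "e \<in> set (P l)" unfolding used_def by auto
  then show "lab B P \<in> B" "e \<in> set (P (lab B P))" using lab_eq[OF completeD(1)[OF assms]] by auto
qed

lemma cf_part:
  assumes c: "cf B U P"
  defines "l \<equiv> lab B P"
  shows "fam A' T' (B - {l}) U P" "ends (B - {l}) U P h" "indep (B - {l})" "toks T' \<subseteq> cl (insert l (B - {l}))"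
    "set (P l) \<inter> used (B - {l}) P = {}"
proof -
  note l = cf_lab[OF c, folded l_def] and F = completeD(1)[OF c]
  have dis: "set (P b) \<inter> set (P l) = {}" if "b \<in> B - {l}" for b using fam_disj[OF F] that l by blast
  show "fam A' T' (B - {l}) U P" using F TT dis l unfolding fam_def by blast
  show "ends (B - {l}) U P h" using completeD(2)[OF c] unfolding ends_def by auto
  show "indep (B - {l})" using completeD(3)[OF c] indep_subset by blast
  show "toks T' \<subseteq> cl (insert l (B - {l}))" using toks'[OF completeD(4)[OF c]] l by (simp add: insert_absorb)
  show "set (P l) \<inter> used (B - {l}) P = {}" using dis unfolding used_def by auto
qed

lemma h_Ys: "h \<in> Ys B U P"
  unfolding Ys_def by (rule resid_refl)

text \<open>If the residual set had an unspanned token, one augmentation would make the head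
  feasible after the extension, against \<open>bad\<close>.\<close>

lemma tight_Ys:
  assumes c: "cf B U P"
  shows "tight A' T' (B - {lab B P}) U P (Ys B U P)"
proof -
  note p = cf_part[OF c]
  have "tokX T' (Ys B U P) \<subseteq> cl (B - {lab B P})"
    using complete_of_augment[OF p(1-4)] bad unfolding Ys_def by blast
  then show ?thesis unfolding Ys_def by (rule resid_tight[OF p(3)])
qed

lemma Ys_tok: "cf B U P \<Longrightarrow> tokX T' (Ys B U P) \<subseteq> cl {b \<in> B - {lab B P}. U b \<in> Ys B U P}"
  using tight_Ys unfolding tight_def by blast

text \<open>The arcs of the abandoned trail before \<open>e\<close> are free. If this part met the
  residual set, its start would belong to the set too, and the token \<open>lab B P\<close> would be
  spanned by the others.\<close>

lemma prefix_Ys: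
  assumes c: "cf B U P" and sp: "P (lab B P) = \<alpha> @ e # \<beta>"
  shows "pverts (U (lab B P)) \<alpha> \<inter> Ys B U P = {}"
proof (rule ccontr)
  let ?l = "lab B P"
  note l = cf_lab[OF c] and F = completeD(1)[OF c] and p = cf_part[OF c]
  assume "pverts (U ?l) \<alpha> \<inter> Ys B U P \<noteq> {}"
  then obtain v where v: "v \<in> pverts (U ?l) \<alpha>" "v \<in> Ys B U P" by auto
  have "walk (U ?l) \<alpha> (src e)" using endsD[OF completeD(2)[OF c] l(1)] sp by (auto simp: arc_walk_append)
  then obtain \<alpha>1 \<alpha>2 where al: "\<alpha> = \<alpha>1 @ \<alpha>2" "walk (U ?l) \<alpha>1 v" using walk_split_vertex[OF _ v(1)] by metis
  have s1: "set \<alpha>1 \<subseteq> A'" "set \<alpha>1 \<inter> used (B - {?l}) P = {}"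
    using famD(2,3)[OF F l(1)] sp al p(5) by auto
  have "pverts (U ?l) \<alpha>1 \<subseteq> Ys B U P"
    unfolding Ys_def by (rule resid_free_walk[OF al(2) s1]) (use v(2) in \<open>simp add: Ys_def\<close>)
  then have "U ?l \<in> Ys B U P" using start_pverts by blast
  then have "?l \<in> tokX T' (Ys B U P)" using famD(1)[OF F l(1)] TT unfolding tokX_def by blast
  then have "?l \<in> cl (B - {?l})" using Ys_tok[OF c] by (blast intro: cl_monoD)
  then show False using completeD(3)[OF c] l(1) indep_notin by blast
qed

lemma
  assumes c: "cf B U P"
  shows src_Ys: "src e \<notin> Ys B U P" and start_Ys: "U (lab B P) \<notin> Ys B U P"
proof -
  obtain \<alpha> \<beta> where ab: "P (lab B P) = \<alpha> @ e # \<beta>" using cf_lab(2)[OF c] split_list by fastforce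
  have w: "walk (U (lab B P)) \<alpha> (src e)" using endsD[OF completeD(2)[OF c] cf_lab(1)[OF c]] ab by (auto simp: arc_walk_append)
  show "src e \<notin> Ys B U P" "U (lab B P) \<notin> Ys B U P"
    using prefix_Ys[OF c ab] walk_end[OF w] start_pverts[of "U (lab B P)" \<alpha>] by auto
qed

lemma i_Ys: "cf B U P \<Longrightarrow> Inl i \<in> tokX T' (Ys B U P)"
  using h_Ys[of B U P] unfolding tokX_def add_token_def by auto

text \<open>\<open>tight_Ys\<close> concerns the network after the extension. This returns to the
  one before it, where \<open>e\<close> is one more gate of the region.\<close>

lemma sub_Ys:
  assumes c: "cf B U P"
  defines "Y \<equiv> Ys B U P"
  defines "BF \<equiv> {b \<in> B. U b \<in> Y} \<union> Inr ` gates A Y"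
  obtains UF PF where "complete (inner_arcs A Y) (inner_tokens A T Y) h BF UF PF"
    "\<forall>b\<in>B. U b \<in> Y \<longrightarrow> UF b = U b \<and> PF b = P b" "used BF PF \<subseteq> used (B - {lab B P}) P"
    "\<forall>a\<in>used (B - {lab B P}) P. src a \<in> Y \<longrightarrow> a \<in> used BF PF"
    "BF - Inr ` gates A Y = {b \<in> B. U b \<in> Y}"
proof -
  let ?l = "lab B P"
  note p = cf_part[OF c] and F = completeD(1)[OF c]
  define B0 where "B0 = {b \<in> B - {?l}. U b \<in> Y} \<union> Inr ` gates A' Y"
  have eg: "e \<in> gates A Y" using eA h_Ys src_Ys[OF c] unfolding gates_def Y_def by auto
  have gg: "gates A Y = insert e (gates A' Y)" using eg unfolding gates_def by auto
  have lY: "{b \<in> B - {?l}. U b \<in> Y} = {b \<in> B. U b \<in> Y}" using start_Ys[OF c] unfolding Y_def by auto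
  have BF: "BF = insert (Inr e) B0" unfolding BF_def B0_def gg lY by auto
  have nB: "Inr a \<notin> B" if "a \<in> A" for a
    using that famD(1)[OF F, of "Inr a"] toksI[of "Inr a" T] cle unfolding clean_def by blast
  have e0: "Inr e \<notin> B0" using nB[OF eA] unfolding B0_def gates_def by auto
  obtain UF PF where c0: "complete (inner_arcs A' Y) (inner_tokens A' T' Y) h B0 UF PF"
    and ag: "\<forall>b\<in>B - {?l}. U b \<in> Y \<longrightarrow> UF b = U b \<and> PF b = P b"
    and u1: "used B0 PF \<subseteq> used (B - {?l}) P" and u2: "\<forall>a\<in>used (B - {?l}) P. src a \<in> Y \<longrightarrow> a \<in> used B0 PF"
    unfolding B0_def Y_def by (rule tight_sub[OF cle' p(1-3) h_Ys tight_Ys[OF c]])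
  have sA: "inner_arcs A' Y = inner_arcs A Y" using src_Ys[OF c] unfolding inner_arcs_def Y_def by auto
  note F0 = completeD(1)[OF c0]
  \<comment> \<open>The gate \<open>e\<close> arrives at \<open>h\<close> itself, so the trail of
    its token is empty.\<close>
  let ?U = "UF(Inr e := h)" and ?P = "PF(Inr e := [])"
  have token_summand: "b \<in> inner_tokens A T Y (UF b)" if b0: "b \<in> B0" for b
  proof (cases "b \<in> B")
    case True
    then have bb: "b \<in> B - {?l}" "U b \<in> Y" using b0 nB unfolding B0_def gates_def by auto
    then show ?thesis using ag famD(1)[OF F, of b] unfolding inner_tokens_def by auto
  next
    case False
    then obtain a where a: "b = Inr a" "a \<in> gates A' Y" using b0 unfolding B0_def by auto
    have "UF (Inr a) = dst a" using sub_family_start[OF cle' F0, of a] b0 a by blast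
    then show ?thesis using a unfolding inner_tokens_def gates_def by auto
  qed
  have f1: "fam (inner_arcs A Y) (inner_tokens A T Y) BF ?U ?P"
    unfolding BF fam_def
  proof (intro conjI ballI impI)
    fix b assume b: "b \<in> insert (Inr e) B0"
    show "b \<in> inner_tokens A T Y (?U b)" using b token_summand[of b] eg unfolding inner_tokens_def gates_def by (auto split: if_splits)
    show "distinct (?P b)" "set (?P b) \<subseteq> inner_arcs A Y" using b famD(2,3)[OF F0, of b] sA by auto
    fix b' assume "b' \<in> insert (Inr e) B0" "b \<noteq> b'"
    then show "set (?P b) \<inter> set (?P b') = {}" using b fam_disj[OF F0, of b b'] by auto
  qed
  have f2: "ends BF ?U ?P h" using completeD(2)[OF c0] unfolding BF ends_def by auto
  have f3: "indep BF" unfolding BF using indep_insert[OF completeD(3)[OF c0], of "Inr e"] gate_cl[of e B0] e0 by blast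
  have f4: "toks (inner_tokens A T Y) \<subseteq> cl BF"
  proof -
    have "tokX T Y \<subseteq> tokX T' Y" using TT unfolding tokX_def by blast
    then have "tokX T Y \<union> Inr ` gates A' Y \<subseteq> cl B0" using completeD(4)[OF c0] unfolding toks_inner_tokens by auto
    then have "tokX T Y \<union> Inr ` gates A' Y \<subseteq> cl BF" using cl_mono[of B0 BF] unfolding BF by auto
    moreover have "Inr e \<in> cl BF" unfolding BF by (rule cl_extI) simp
    ultimately show ?thesis unfolding toks_inner_tokens gg by auto
  qed
  have us: "used BF ?P = used B0 PF" using e0 unfolding BF used_def by (auto split: if_splits)
  have "BF - Inr ` gates A Y = {b \<in> B. U b \<in> Y}" using nB unfolding BF_def gates_def by auto
  moreover have "\<forall>b\<in>B. U b \<in> Y \<longrightarrow> ?U b = U b \<and> ?P b = P b"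
  proof (intro ballI impI)
    fix b assume b: "b \<in> B" "U b \<in> Y"
    then have "b \<in> B - {?l}" using lY by blast
    moreover have "b \<noteq> Inr e" using b nB[OF eA] by auto
    ultimately show "?U b = U b \<and> ?P b = P b" using ag b by simp
  qed
  ultimately show ?thesis
    using that[of ?U ?P] f1 f2 f3 f4 us u1 u2 unfolding complete_def by auto
qed

text \<open>The new family is a hybrid: it follows the given family \<open>Q\<close> up to the region of the old family \<open>B2\<close>
  and then the old family.\<close>

lemma enlarge:
  assumes c2: "cf B2 U2 P2" and x: "x \<in> Ys B2 U2 P2" and cQ: "complete A T x BQ UQ PQ"
  obtains B3 U3 P3 where "cf B3 U3 P3" "Ys B2 U2 P2 \<subseteq> Ys B3 U3 P3"
    "\<forall>a\<in>gates A (Ys B3 U3 P3). \<exists>b\<in>BQ. \<exists>\<alpha> \<beta>. PQ b = \<alpha> @ a # \<beta> \<and> pverts (UQ b) \<alpha> \<inter> Ys B3 U3 P3 = {}"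
    "tokX T' (Ys B3 U3 P3) \<subseteq> cl {b \<in> BQ. UQ b \<in> Ys B3 U3 P3}"
    "x = h \<Longrightarrow> Ys BQ UQ PQ \<subseteq> Ys B3 U3 P3"
proof -
  define X where "X = Ys B2 U2 P2"
  let ?l2 = "lab B2 P2"
  let ?BF = "{b \<in> B2. U2 b \<in> X} \<union> Inr ` gates A X"
  obtain UF PF where cF: "complete (inner_arcs A X) (inner_tokens A T X) h ?BF UF PF"
    and ag: "\<forall>b\<in>B2. U2 b \<in> X \<longrightarrow> UF b = U2 b \<and> PF b = P2 b" and u1: "used ?BF PF \<subseteq> used (B2 - {?l2}) P2"
    and u2: "\<forall>a\<in>used (B2 - {?l2}) P2. src a \<in> X \<longrightarrow> a \<in> used ?BF PF"
    and Ieq: "?BF - Inr ` gates A X = {b \<in> B2. U2 b \<in> X}"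
    unfolding X_def by (rule sub_Ys[OF c2])
  note FF = completeD(1)[OF cF] and FQ = completeD(1)[OF cQ]
  define Ob where "Ob = {b \<in> BQ. UQ b \<notin> X}"
  obtain p where ent: "entry A T X Ob UQ p" and pre: "\<forall>b\<in>BQ. UQ b \<notin> X \<longrightarrow> (\<exists>\<beta>. PQ b = p b @ \<beta>)"
    and cov: "toks T \<subseteq> cl (Ob \<union> tokX T X)"
    unfolding Ob_def by (rule complete_into[OF cQ x[folded X_def]])
  define I where "I = {b \<in> B2. U2 b \<in> X}"
  define U3 where "U3 = (\<lambda>t. if t \<in> I then UF t else UQ t)"
  define P3 where "P3 = (\<lambda>t. if t \<in> I then PF t else p t @ PF (Inr (last (p t))))"
  obtain O' where O': "O' \<subseteq> Ob" "O' \<inter> I = {}" and c3': "complete A T h (O' \<union> I) U3 P3"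
    and tokI: "tokX T X \<subseteq> cl I"
    using hybrid[OF cle ent cov cF, unfolded Ieq, folded I_def, folded U3_def P3_def] .
  define B3 where "B3 = O' \<union> I"
  have c3: "cf B3 U3 P3" using c3' unfolding B3_def .
  define W where "W = Ys B3 U3 P3"
  define l3 where "l3 = lab B3 P3"
  note l3 = cf_lab[OF c3, folded l3_def] and part = cf_part[OF c3, folded l3_def] and F3 = completeD(1)[OF c3]
  have tW: "tight A' T' (B3 - {l3}) U3 P3 W" using tight_Ys[OF c3] unfolding W_def l3_def .
  have srcF: "src a \<in> X" if "t \<in> ?BF" "a \<in> set (PF t)" for a t
    using famD(3)[OF FF that(1)] that(2) unfolding inner_arcs_def by auto
  have lastB: "Inr (last (p b)) \<in> ?BF" if "b \<in> Ob" for b using entryD(6)[OF ent that] by auto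
  have srcp: "src a \<notin> X" if "b \<in> Ob" "a \<in> set (p b)" for a b using entryD(5)[OF ent that(1)] that(2) by blast
  have P3O: "P3 b = p b @ PF (Inr (last (p b)))" "U3 b = UQ b" if "b \<in> O'" for b
    using that O' unfolding P3_def U3_def by auto
  have P3I: "P3 b = PF b" "U3 b = U2 b" if "b \<in> I" for b using that ag unfolding P3_def U3_def I_def by auto
  have eX: "src e \<notin> X" using src_Ys[OF c2] unfolding X_def .
  have l3O: "l3 \<in> O'" "e \<in> set (p l3)"
  proof -
    have "l3 \<notin> I"
    proof
      assume "l3 \<in> I"
      then have "e \<in> set (PF l3)" "l3 \<in> ?BF" using l3 P3I unfolding I_def by auto
      then show False using srcF eX by blast
    qed
    then show a: "l3 \<in> O'" using l3 unfolding B3_def by auto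
    then show "e \<in> set (p l3)" using l3(2) P3O srcF[OF lastB] O' eX by auto
  qed
  have lI: "l3 \<notin> I" using l3O O' by auto
  let ?u3 = "used (B3 - {l3}) P3"
  \<comment> \<open>Inside the old region the new family runs along \<open>PF\<close>, outside it
    along the prefixes \<open>p\<close>; the next three facts separate the two.\<close>
  have ou: "\<exists>b\<in>O' - {l3}. a \<in> set (p b)" if a: "a \<in> ?u3" "src a \<notin> X" for a
  proof -
    obtain b where b: "b \<in> B3 - {l3}" "a \<in> set (P3 b)" using a(1) unfolding used_def by auto
    have "b \<notin> I" using b P3I srcF[of b a] a(2) unfolding I_def by auto
    then have bO: "b \<in> O' - {l3}" using b unfolding B3_def by auto
    then have "a \<in> set (p b)" using b P3O[of b] srcF[OF lastB, of b a] a(2) O' by auto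
    then show ?thesis using bO by blast
  qed
  have pu: "set (p b) \<subseteq> ?u3" if "b \<in> O' - {l3}" for b
    using that P3O[of b] usedI[of b "B3 - {l3}" _ P3] unfolding B3_def by auto
  have inu: "\<exists>t\<in>?BF. a \<in> set (PF t) \<and> set (PF t) \<subseteq> ?u3" if a: "a \<in> ?u3" "src a \<in> X" for a
  proof -
    obtain b where b: "b \<in> B3 - {l3}" "a \<in> set (P3 b)" using a(1) unfolding used_def by auto
    have sb: "set (P3 b) \<subseteq> ?u3" using b(1) usedI by blast
    show ?thesis
    proof (cases "b \<in> I")
      case True
      then have "b \<in> ?BF" "a \<in> set (PF b)" "set (PF b) \<subseteq> ?u3" using b sb P3I unfolding I_def by auto
      then show ?thesis by blast
    next
      case False
      then have bO: "b \<in> O'" "b \<in> Ob" using b O' unfolding B3_def by auto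
      then have "a \<in> set (PF (Inr (last (p b))))" "set (PF (Inr (last (p b)))) \<subseteq> ?u3"
        using b(2) P3O srcp[OF bO(2), of a] a(2) sb by auto
      then show ?thesis using lastB[OF bO(2)] by blast
    qed
  qed
  have hW: "h \<in> W" unfolding W_def by (rule h_Ys)
  have Wfree: "src a \<in> W" if "a \<in> A'" "a \<notin> ?u3" "dst a \<in> W" for a
    using resid_free[OF that(1,2)] that(3) unfolding W_def Ys_def l3_def by blast
  have Wwalk: "pverts u q \<subseteq> W" if "walk u q v" "set q \<subseteq> A'" "set q \<inter> ?u3 = {}" "v \<in> W" for u q v
    using resid_free_walk[OF that(1-3)] that(4) unfolding W_def Ys_def l3_def by blast
  have Wstep: "w \<in> W" if "(w, y) \<in> resid_arc A' T' (B3 - {l3}) U3 P3" "y \<in> W" for w y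
    using resid_step[OF that(1)] that(2) unfolding W_def Ys_def l3_def by blast
  have Wused: "dst a \<in> W" if "a \<in> ?u3" "src a \<in> W" for a using tW that unfolding tight_def by blast
  have Itok': "tokX T' X \<subseteq> cl I"
  proof -
    have "{b \<in> B2 - {?l2}. U2 b \<in> X} \<subseteq> I" unfolding I_def by auto
    then show ?thesis using Ys_tok[OF c2] cl_mono unfolding X_def[symmetric] by blast
  qed
  have XW: "X \<subseteq> W"
  proof
    fix w0 assume w0: "w0 \<in> X"
    show "w0 \<in> W"
    proof (rule resid_induct[where Q = "\<lambda>w. w \<in> W"])
      show "w0 \<in> resid A' T' (B2 - {?l2}) U2 P2 h" using w0 unfolding X_def Ys_def .
      show "h \<in> W" by (rule hW)
      fix w y assume 2: "(w, y) \<in> resid_arc A' T' (B2 - {?l2}) U2 P2" "y \<in> resid A' T' (B2 - {?l2}) U2 P2 h"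
        "w \<in> resid A' T' (B2 - {?l2}) U2 P2 h" "y \<in> W"
      then have yX: "y \<in> X" and wX: "w \<in> X" unfolding X_def Ys_def by auto
      from 2(1) consider (s1) a where "a \<in> A'" "a \<notin> used (B2 - {?l2}) P2" "src a = w" "dst a = y"
        | (s2) a where "a \<in> used (B2 - {?l2}) P2" "dst a = w" "src a = y"
        | (s3) t b where "t \<in> T' y" "t \<in> cl (B2 - {?l2})" "b \<in> circ t (B2 - {?l2})" "U2 b = w"
        unfolding resid_arc_def by blast
      then show "w \<in> W"
      proof cases
        case s1
        have "a \<notin> ?u3"
        proof
          assume "a \<in> ?u3"
          then obtain t where "t \<in> ?BF" "a \<in> set (PF t)" using inu[of a] s1 wX by blast
          then have "a \<in> used ?BF PF" by (rule usedI)
          then show False using u1 s1(2) by blast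
        qed
        then show ?thesis using Wfree[of a] s1 2(4) by simp
      next
        case s2
        show ?thesis
        proof (cases "a \<in> ?u3")
          case True then show ?thesis using Wused[of a] s2 2(4) by simp
        next
          \<comment> \<open>The old trail through \<open>a\<close> has not been taken over at all.
            It is free and leads to \<open>h\<close>, so all its vertices are residual for the new
            family.\<close>
          case False
          have "a \<in> used ?BF PF" using u2 s2 yX by blast
          then obtain t where t: "t \<in> ?BF" "a \<in> set (PF t)" unfolding used_def by blast
          have dj: "set (PF t) \<inter> ?u3 = {}"
          proof (rule ccontr)
            assume "set (PF t) \<inter> ?u3 \<noteq> {}"
            then obtain d where d: "d \<in> set (PF t)" "d \<in> ?u3" by auto
            obtain t' where t': "t' \<in> ?BF" "d \<in> set (PF t')" "set (PF t') \<subseteq> ?u3" using inu[OF d(2)] srcF[OF t(1) d(1)] by blast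
            then have "t' = t" using used_unique[OF FF, of t' t d] t d by blast
            then show False using t' t False by blast
          qed
          have "walk (UF t) (PF t) h" using endsD[OF completeD(2)[OF cF] t(1)] .
          moreover have "set (PF t) \<subseteq> A'" using famD(3)[OF FF t(1)] eX unfolding inner_arcs_def by auto
          ultimately have "pverts (UF t) (PF t) \<subseteq> W" using Wwalk[of "UF t" "PF t" h] dj hW by blast
          then show ?thesis using dst_pverts[OF t(2)] s2 by auto
        qed
      next
        case s3
        \<comment> \<open>The token lies in \<open>cl I\<close>, where \<open>I\<close> is common to
          both families, so its circuit is the same in both.\<close>
        have tI: "t \<in> cl I" using s3(1) yX Itok' unfolding tokX_def by blast
        have I2: "I \<subseteq> B2 - {?l2}" using start_Ys[OF c2] unfolding I_def X_def by auto
        have I3: "I \<subseteq> B3 - {l3}" using lI unfolding B3_def by auto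
        have bI: "b \<in> circ t I" using s3(3) circ_eq[OF cf_part(3)[OF c2] I2 tI] by simp
        then have b3: "b \<in> circ t (B3 - {l3})" using circ_eq[OF part(3) I3 tI] by simp
        have "b \<in> I" using bI circ_subset by blast
        then have "U3 b = w" using P3I s3 by auto
        then have "(w, y) \<in> resid_arc A' T' (B3 - {l3}) U3 P3"
          using s3(1) b3 cl_monoD[OF tI I3] unfolding resid_arc_def by blast
        then show ?thesis using Wstep 2(4) by blast
      qed
    qed
  qed
  have drop: "pverts (UQ b) (p b) \<subseteq> W" if b: "b \<in> Ob" "b \<notin> O'" for b
  proof -
    have bl: "b \<noteq> l3" using l3O b by auto
    have pd: "set (p b) \<inter> set (p c) = {}" if "c \<in> Ob" "b \<noteq> c" for c
      using ent b that unfolding entry_def fam_def by auto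
    have "set (p b) \<subseteq> A'" using entryD(7)[OF ent b(1)] pd[of l3] l3O O' bl by auto
    moreover have "set (p b) \<inter> ?u3 = {}"
    proof (rule ccontr)
      assume "set (p b) \<inter> ?u3 \<noteq> {}"
      then obtain d where d: "d \<in> set (p b)" "d \<in> ?u3" by auto
      then obtain c where "c \<in> O' - {l3}" "d \<in> set (p c)" using ou[of d] srcp[OF b(1)] by blast
      then show False using pd[of c] d b O' by auto
    qed
    moreover have "dst (last (p b)) \<in> W" using entryD(3)[OF ent b(1)] XW by auto
    ultimately show ?thesis using Wwalk[OF entryD(4)[OF ent b(1)]] by blast
  qed
  have PQp: "\<exists>\<beta>. PQ b = p b @ \<beta>" if "b \<in> Ob" for b using pre that unfolding Ob_def by auto
  \<comment> \<open>A gate of \<open>W\<close> has its tail outside \<open>X\<close> and so lies on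
    an entry trail. The part before it avoids \<open>W\<close>, because used arcs do not leave
    \<open>W\<close>.\<close>
  have gate: "\<exists>b\<in>BQ. \<exists>\<alpha> \<beta>. PQ b = \<alpha> @ a # \<beta> \<and> pverts (UQ b) \<alpha> \<inter> W = {}" if a: "a \<in> gates A W" for a
  proof (cases "a = e")
    case True
    obtain \<alpha> \<gamma> where sp: "p l3 = \<alpha> @ e # \<gamma>" using l3O split_list by fastforce
    have lOb: "l3 \<in> Ob" using l3O O' by auto
    then obtain \<beta> where "PQ l3 = p l3 @ \<beta>" using PQp by blast
    then have "PQ l3 = \<alpha> @ e # (\<gamma> @ \<beta>)" using sp by simp
    moreover have "P3 l3 = \<alpha> @ e # (\<gamma> @ PF (Inr (last (p l3))))" using P3O[OF l3O(1)] sp by simp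
    then have "pverts (U3 l3) \<alpha> \<inter> W = {}" using prefix_Ys[OF c3, folded l3_def] unfolding W_def by blast
    then have "pverts (UQ l3) \<alpha> \<inter> W = {}" using P3O[OF l3O(1)] by simp
    ultimately show ?thesis using True lOb unfolding Ob_def by blast
  next
    case False
    then have "a \<in> gates A' W" using a unfolding gates_def by auto
    then have au: "a \<in> ?u3" using tW unfolding tight_def by blast
    have sW: "src a \<notin> W" using a unfolding gates_def by auto
    then have "src a \<notin> X" using XW by auto
    then obtain b where b: "b \<in> O' - {l3}" "a \<in> set (p b)" using ou[OF au] by blast
    then have bO: "b \<in> Ob" using O' by auto
    obtain \<alpha> \<gamma> where sp: "p b = \<alpha> @ a # \<gamma>" using b split_list by fastforce
    obtain \<beta> where PQb: "PQ b = p b @ \<beta>" using PQp[OF bO] by blast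
    have wal: "walk (UQ b) \<alpha> (src a)" using entryD(4)[OF ent bO] unfolding sp by (auto simp: arc_walk_append)
    have "pverts (UQ b) \<alpha> \<inter> W = {}"
    proof (rule ccontr)
      assume "pverts (UQ b) \<alpha> \<inter> W \<noteq> {}"
      then obtain v where v: "v \<in> pverts (UQ b) \<alpha>" "v \<in> W" by auto
      obtain \<alpha>1 \<alpha>2 where al: "\<alpha> = \<alpha>1 @ \<alpha>2" "walk v \<alpha>2 (src a)" using walk_split_vertex[OF wal v(1)] by metis
      have "set \<alpha>2 \<subseteq> ?u3" using pu[OF b(1)] sp al by auto
      then have "pverts v \<alpha>2 \<subseteq> W" using walk_stays[OF al(2) v(2)] Wused by blast
      then show False using walk_end[OF al(2)] sW by auto
    qed
    then show ?thesis using bO PQb sp unfolding Ob_def by auto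
  qed
  \<comment> \<open>Both families carry bases of equal size in each summand, and a member of
    \<open>BQ\<close> starting outside \<open>W\<close> is a member of the new family starting at
    the same vertex. So in each summand at least as many members of \<open>BQ\<close> start in
    \<open>W\<close> as members of the new family do.\<close>
  have Wtok: "tokX T' W \<subseteq> cl {b \<in> BQ. UQ b \<in> W}"
  proof -
    let ?Q = "{b \<in> BQ. UQ b \<in> W}" and ?C = "{b \<in> B3 - {l3}. U3 b \<in> W}"
    have tC: "tokX T' W \<subseteq> cl ?C" using tW unfolding tight_def by blast
    have QW: "?Q \<subseteq> cl ?C"
    proof
      fix b assume "b \<in> ?Q"
      then have "b \<in> tokX T' W" using famD(1)[OF FQ, of b] TT unfolding tokX_def by blast
      then show "b \<in> cl ?C" using tC by blast
    qed
    have iQ: "indep ?Q" and iC: "indep ?C"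
      using completeD(3)[OF cQ] completeD(3)[OF c3] by (auto intro: indep_subset)
    have diff: "BQ - ?Q \<subseteq> B3 - ?C"
    proof
      fix b assume "b \<in> BQ - ?Q"
      then have b: "b \<in> BQ" "UQ b \<notin> W" by auto
      then have bO: "b \<in> Ob" using XW unfolding Ob_def by auto
      have "b \<in> O'" using drop[OF bO] b(2) start_pverts by blast
      then show "b \<in> B3 - ?C" using P3O(2) b(2) unfolding B3_def by auto
    qed
    have "card {c \<in> ?C. \<kappa> c = k} \<le> card {b \<in> ?Q. \<kappa> b = k}" for k
    proof -
      let ?f = "\<lambda>Z. {z \<in> Z. \<kappa> z = k}"
      have BQB3: "BQ \<subseteq> cl B3" "B3 \<subseteq> cl BQ"
        using famD(1)[OF FQ] famD(1)[OF F3] toksI[of _ T] completeD(4)[OF cQ] completeD(4)[OF c3] by blast+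
      have eq: "card (?f BQ) = card (?f B3)"
        using card_summand_le[OF completeD(3)[OF cQ] completeD(3)[OF c3] BQB3(1)]
          card_summand_le[OF completeD(3)[OF c3] completeD(3)[OF cQ] BQB3(2)] by (simp add: le_antisym)
      have fin: "finite (?f BQ)" "finite (?f B3)"
        using indep_finite_summand completeD(3)[OF cQ] completeD(3)[OF c3] by auto
      have sQ: "?f ?Q \<subseteq> ?f BQ" and sC: "?f ?C \<subseteq> ?f B3" by auto
      have "?f BQ - ?f ?Q \<subseteq> ?f B3 - ?f ?C" using diff by auto
      then have "card (?f BQ - ?f ?Q) \<le> card (?f B3 - ?f ?C)" using fin by (intro card_mono) auto
      moreover have "card (?f BQ - ?f ?Q) = card (?f BQ) - card (?f ?Q)"
        using fin sQ by (meson card_Diff_subset finite_subset)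
      moreover have "card (?f B3 - ?f ?C) = card (?f B3) - card (?f ?C)"
        using fin sC by (meson card_Diff_subset finite_subset)
      moreover have "card (?f ?Q) \<le> card (?f BQ)" "card (?f ?C) \<le> card (?f B3)" using fin sQ sC card_mono by blast+
      ultimately show ?thesis using eq by linarith
    qed
    then have "?C \<subseteq> cl ?Q" using summand_spans[OF iQ iC QW] by blast
    then show ?thesis using tC cl_least by blast
  qed
  \<comment> \<open>Outside \<open>X\<close> the new family uses only arcs of the given one, so
    residual steps of the given family that lead out of \<open>X\<close> persist.\<close>
  have hQ: "Ys BQ UQ PQ \<subseteq> W" if xh: "x = h"
  proof
    have cQ': "cf BQ UQ PQ" using cQ xh by simp
    have lOb: "l3 \<in> Ob" using l3O O' by auto
    have lQ: "lab BQ PQ = l3"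
      using lab_eq[OF FQ, of l3] l3O(2) PQp[OF lOb] lOb unfolding Ob_def by auto
    have lW: "UQ l3 \<notin> W" using start_Ys[OF c3, folded l3_def W_def] P3O[OF l3O(1)] by simp
    fix w0 assume w0: "w0 \<in> Ys BQ UQ PQ"
    show "w0 \<in> W"
    proof (rule resid_induct[where Q = "\<lambda>w. w \<in> W"])
      show "w0 \<in> resid A' T' (BQ - {l3}) UQ PQ h" using w0 unfolding Ys_def lQ .
      show "h \<in> W" by (rule hW)
      fix w y assume 2: "(w, y) \<in> resid_arc A' T' (BQ - {l3}) UQ PQ" "y \<in> resid A' T' (BQ - {l3}) UQ PQ h"
        "w \<in> resid A' T' (BQ - {l3}) UQ PQ h" "y \<in> W"
      from 2(1) consider (s1) a where "a \<in> A'" "a \<notin> used (BQ - {l3}) PQ" "src a = w" "dst a = y"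
        | (s2) b a where "b \<in> BQ - {l3}" "a \<in> set (PQ b)" "dst a = w" "src a = y"
        | (s3) t b where "t \<in> T' y" "t \<in> cl (BQ - {l3})" "b \<in> circ t (BQ - {l3})" "UQ b = w"
        unfolding resid_arc_def used_def by blast
      then show "w \<in> W"
      proof cases
        case s1
        show ?thesis
        proof (cases "w \<in> X")
          case True then show ?thesis using XW by auto
        next
          case False
          have "a \<notin> ?u3"
          proof
            assume "a \<in> ?u3"
            then obtain b where b: "b \<in> O' - {l3}" "a \<in> set (p b)" using ou[of a] False s1 by blast
            have bO: "b \<in> Ob" using b O' by auto
            obtain \<beta> where "PQ b = p b @ \<beta>" using PQp[OF bO] by blast
            then have ab: "a \<in> set (PQ b)" using b by auto
            have bB: "b \<in> BQ - {l3}" using b bO unfolding Ob_def by auto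
            have "a \<in> used (BQ - {l3}) PQ" using usedI[of b "BQ - {l3}" a PQ] bB ab by blast
            then show False using s1(2) by blast
          qed
          then show ?thesis using Wfree[of a] s1 2(4) by simp
        qed
      next
        case s2
        show ?thesis
        proof (cases "w \<in> X \<or> a \<in> ?u3")
          case True then show ?thesis using XW Wused[of a] s2(3,4) 2(4) by blast
        next
          case False
          have bB: "b \<in> BQ" using s2(1) by blast
          obtain \<alpha> \<beta> where ab: "PQ b = \<alpha> @ a # \<beta>" using split_list[OF s2(2)] by blast
          have dist: "distinct (\<alpha> @ a # \<beta>)" using famD(2)[OF FQ bB] by (simp only: ab)
          have "walk (UQ b) (\<alpha> @ a # \<beta>) x" using endsD[OF completeD(2)[OF cQ] bB] by (simp only: ab)
          then have "walk w \<beta> x" using s2(3) by (auto simp: arc_walk_append)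
          moreover have "x \<in> X" using x unfolding X_def .
          ultimately obtain q \<beta>' where q: "\<beta> = q @ \<beta>'" "dst (last q) \<in> X" "\<forall>a\<in>set q. src a \<notin> X" "walk w q (dst (last q))"
            using walk_first_entry[of w \<beta> x X] False by blast
          have be: "e \<notin> set (PQ b)" using lab_eq[OF FQ, of b] s2(1) lQ by auto
          have "set q \<subseteq> A'" using famD(3)[OF FQ bB] ab q(1) be by auto
          \<comment> \<open>If the new family used an arc of \<open>q\<close>, it would follow this
            trail from its start and so use \<open>a\<close> as well.\<close>
          moreover have "set q \<inter> ?u3 = {}"
          proof (rule ccontr)
            assume "set q \<inter> ?u3 \<noteq> {}"
            then obtain d where d: "d \<in> set q" "d \<in> ?u3" by auto
            then obtain c where c: "c \<in> O' - {l3}" "d \<in> set (p c)" using ou[of d] q by blast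
            then have cO: "c \<in> Ob" using O' by auto
            obtain \<gamma> where g: "PQ c = p c @ \<gamma>" using PQp[OF cO] by blast
            have dd: "d \<in> set (PQ c)" "d \<in> set (PQ b)" using g c d ab q(1) by auto
            have cB: "c \<in> BQ" using cO unfolding Ob_def by blast
            have cb: "c = b" by (rule used_unique[OF FQ cB bB dd])
            have "\<alpha> @ a # \<beta> = p b @ \<gamma>" using g ab cb by simp
            moreover have "d \<in> set \<beta>" using d(1) q(1) by simp
            moreover have "d \<in> set (p b)" using c(2) cb by simp
            ultimately have "a \<in> set (p b)" by (intro prefix_before[OF _ dist])
            then show False using pu[OF c(1)] cb False by blast
          qed
          moreover have "dst (last q) \<in> W" using q XW by auto
          ultimately have "pverts w q \<subseteq> W" using Wwalk[OF q(4)] by blast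
          then show ?thesis using start_pverts by blast
        qed
      next
        case s3
        have "{b \<in> BQ. UQ b \<in> W} \<subseteq> BQ - {l3}" using lW by auto
        moreover have "t \<in> cl {b \<in> BQ. UQ b \<in> W}" using Wtok s3(1) 2(4) unfolding tokX_def by blast
        ultimately have "circ t (BQ - {l3}) \<subseteq> {b \<in> BQ. UQ b \<in> W}" by (rule circ_subset_if_cl)
        then show ?thesis using s3 by auto
      qed
    qed
  qed
  show ?thesis
    by (rule that[OF c3]) (use XW gate Wtok hQ in \<open>auto simp: W_def X_def\<close>)
qed

section \<open>The directed union of the residual sets\<close>

lemma Ys_directed:
  assumes "cf B1 U1 P1" "cf B2 U2 P2"
  obtains B3 U3 P3 where "cf B3 U3 P3" "Ys B1 U1 P1 \<union> Ys B2 U2 P2 \<subseteq> Ys B3 U3 P3"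
proof -
  show ?thesis
  proof (rule enlarge[OF assms(2) h_Ys assms(1)])
    fix B3 U3 P3 assume "cf B3 U3 P3" "Ys B2 U2 P2 \<subseteq> Ys B3 U3 P3" "h = h \<Longrightarrow> Ys B1 U1 P1 \<subseteq> Ys B3 U3 P3"
    then show ?thesis using that[of B3 U3 P3] by blast
  qed
qed

lemma XsE:
  assumes "v \<in> Xs"
  obtains B U P where "cf B U P" "v \<in> Ys B U P"
  using assms unfolding Xs_def by blast

lemma Ys_Xs: "cf B U P \<Longrightarrow> Ys B U P \<subseteq> Xs"
  unfolding Xs_def by blast

text \<open>Transfers statements from the directed system to its union: whatever concerns the end
  \<open>x\<close> and two further vertices is checked in one set containing all three.\<close>

lemma Xs_cover:
  assumes "x \<in> Xs" "v \<in> Xs" "w \<in> Xs" and cQ: "complete A T x BQ UQ PQ"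
  obtains W where "x \<in> W" "v \<in> W" "w \<in> W" "W \<subseteq> Xs"
    "\<forall>a\<in>gates A W. \<exists>b\<in>BQ. \<exists>\<alpha> \<beta>. PQ b = \<alpha> @ a # \<beta> \<and> pverts (UQ b) \<alpha> \<inter> W = {}"
    "tokX T' W \<subseteq> cl {b \<in> BQ. UQ b \<in> W}"
proof -
  obtain B1 U1 P1 where 1: "cf B1 U1 P1" "x \<in> Ys B1 U1 P1" using XsE[OF assms(1)] .
  obtain B2 U2 P2 where 2: "cf B2 U2 P2" "v \<in> Ys B2 U2 P2" using XsE[OF assms(2)] .
  obtain B3 U3 P3 where 3: "cf B3 U3 P3" "w \<in> Ys B3 U3 P3" using XsE[OF assms(3)] .
  obtain B4 U4 P4 where 4: "cf B4 U4 P4" "Ys B1 U1 P1 \<union> Ys B2 U2 P2 \<subseteq> Ys B4 U4 P4" using Ys_directed[OF 1(1) 2(1)] .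
  obtain B5 U5 P5 where 5: "cf B5 U5 P5" "Ys B4 U4 P4 \<union> Ys B3 U3 P3 \<subseteq> Ys B5 U5 P5" using Ys_directed[OF 4(1) 3(1)] .
  have m: "x \<in> Ys B5 U5 P5" "v \<in> Ys B5 U5 P5" "w \<in> Ys B5 U5 P5" using 1 2 3 4 5 by blast+
  obtain B6 U6 P6 where 6: "cf B6 U6 P6" "Ys B5 U5 P5 \<subseteq> Ys B6 U6 P6"
    "\<forall>a\<in>gates A (Ys B6 U6 P6). \<exists>b\<in>BQ. \<exists>\<alpha> \<beta>. PQ b = \<alpha> @ a # \<beta> \<and> pverts (UQ b) \<alpha> \<inter> Ys B6 U6 P6 = {}"
    "tokX T' (Ys B6 U6 P6) \<subseteq> cl {b \<in> BQ. UQ b \<in> Ys B6 U6 P6}"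
    by (rule enlarge[OF 5(1) m(1) cQ])
  show ?thesis using that[of "Ys B6 U6 P6"] 6 m Ys_Xs[OF 6(1)] by blast
qed

lemma h_Xs: "h \<in> Xs"
  using hok h_Ys unfolding Xs_def ok_def by blast

lemma src_Xs: "src e \<notin> Xs"
  unfolding Xs_def using src_Ys by blast

text \<open>The arc \<open>a\<close> occurs only once in the family, so the prefix before it does
  not depend on the set \<open>W\<close> chosen; each vertex of \<open>Xs\<close> is seen to be
  avoided by means of a suitable \<open>W\<close>.\<close>

lemma gate_Xs:
  assumes x: "x \<in> Xs" and cQ: "complete A T x BQ UQ PQ" and a: "a \<in> gates A Xs"
  shows "\<exists>b\<in>BQ. \<exists>\<alpha> \<beta>. PQ b = \<alpha> @ a # \<beta> \<and> pverts (UQ b) \<alpha> \<inter> Xs = {}"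
proof -
  have d: "dst a \<in> Xs" and g: "\<And>W. W \<subseteq> Xs \<Longrightarrow> dst a \<in> W \<Longrightarrow> a \<in> gates A W" using a unfolding gates_def by auto
  obtain W where W: "x \<in> W" "dst a \<in> W" "dst a \<in> W" "W \<subseteq> Xs"
    "\<forall>a\<in>gates A W. \<exists>b\<in>BQ. \<exists>\<alpha> \<beta>. PQ b = \<alpha> @ a # \<beta> \<and> pverts (UQ b) \<alpha> \<inter> W = {}"
    by (rule Xs_cover[OF x d d cQ])
  then obtain b \<alpha> \<beta> where b: "b \<in> BQ" "PQ b = \<alpha> @ a # \<beta>" using g by blast
  have "v \<notin> pverts (UQ b) \<alpha>" if v: "v \<in> Xs" for v
  proof -
    obtain W where W: "x \<in> W" "dst a \<in> W" "v \<in> W" "W \<subseteq> Xs"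
      "\<forall>a\<in>gates A W. \<exists>b\<in>BQ. \<exists>\<alpha> \<beta>. PQ b = \<alpha> @ a # \<beta> \<and> pverts (UQ b) \<alpha> \<inter> W = {}"
      by (rule Xs_cover[OF x d v cQ])
    then obtain b' \<alpha>' \<beta>' where b': "b' \<in> BQ" "PQ b' = \<alpha>' @ a # \<beta>'" "pverts (UQ b') \<alpha>' \<inter> W = {}" using g by blast
    have "b' = b" using used_unique[OF completeD(1)[OF cQ] b'(1) b(1), of a] b b' by auto
    have d': "distinct (\<alpha>' @ a # \<beta>')" using famD(2)[OF completeD(1)[OF cQ] b'(1)] b'(2) by (simp only:)
    have "\<alpha>' @ a # \<beta>' = \<alpha> @ a # \<beta>" using b(2) b'(2) \<open>b' = b\<close> by (simp only:)
    then have "\<alpha>' = \<alpha>" by (rule split_unique_prefix[OF _ d'])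
    then have "pverts (UQ b) \<alpha> \<inter> W = {}" using b'(3) \<open>b' = b\<close> by (simp only:)
    then show ?thesis using W(3) by blast
  qed
  then show ?thesis using b by blast
qed

text \<open>A trail leaving \<open>Xs\<close> would have to return through a gate, but by
  \<open>gate_Xs\<close> whatever precedes a gate avoids \<open>Xs\<close>. As all complete families
  ending in \<open>Xs\<close> are covered, \<open>Xs\<close> can serve as a region for each of its
  vertices.\<close>

lemma tight_Xs:
  assumes x: "x \<in> Xs" and cQ: "complete A T x BQ UQ PQ"
  shows "tight A T BQ UQ PQ Xs"
proof -
  note F = completeD(1)[OF cQ]
  have 1: "gates A Xs \<subseteq> used BQ PQ"
  proof
    fix a assume "a \<in> gates A Xs"
    then obtain b \<alpha> \<beta> where "b \<in> BQ" "PQ b = \<alpha> @ a # \<beta>" using gate_Xs[OF x cQ] by blast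
    then show "a \<in> used BQ PQ" by (intro usedI[of b]) auto
  qed
  have 2: "dst a \<in> Xs" if a: "a \<in> used BQ PQ" "src a \<in> Xs" for a
  proof (rule ccontr)
    assume n: "dst a \<notin> Xs"
    obtain b where b: "b \<in> BQ" "a \<in> set (PQ b)" using a unfolding used_def by auto
    obtain \<alpha> \<beta> where ab: "PQ b = \<alpha> @ a # \<beta>" using b split_list by fastforce
    have "walk (dst a) \<beta> x" using endsD[OF completeD(2)[OF cQ] b(1)] ab by (auto simp: arc_walk_append)
    then obtain q \<beta>' where q: "\<beta> = q @ \<beta>'" "q \<noteq> []" "dst (last q) \<in> Xs" "\<forall>a\<in>set q. src a \<notin> Xs"
      using walk_first_entry[of "dst a" \<beta> x Xs] x n by blast
    let ?g = "last q"
    have gq: "?g \<in> set q" using q by simp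
    have gP: "?g \<in> set (PQ b)" using ab q gq by auto
    then have "?g \<in> gates A Xs" using gq q famD(3)[OF F b(1)] unfolding gates_def by auto
    then obtain b' \<gamma> \<delta> where g: "b' \<in> BQ" "PQ b' = \<gamma> @ ?g # \<delta>" "pverts (UQ b') \<gamma> \<inter> Xs = {}"
      using gate_Xs[OF x cQ] by blast
    have bb: "b' = b" using used_unique[OF F g(1) b(1), of ?g] g gP by auto
    have dist: "distinct (\<alpha> @ a # \<beta>)" using famD(2)[OF F b(1)] ab by simp
    have "\<alpha> @ a # \<beta> = (\<gamma> @ [?g]) @ \<delta>" using ab g(2) bb by simp
    then have "a \<in> set (\<gamma> @ [?g])" by (rule prefix_before[OF _ dist]) (use gq q in auto)
    moreover have "a \<noteq> ?g" using dist gq q by auto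
    ultimately have "a \<in> set \<gamma>" by auto
    moreover have "walk (UQ b) \<gamma> (src ?g)" using endsD[OF completeD(2)[OF cQ] b(1)] g bb by (auto simp: arc_walk_append)
    ultimately have "src a \<in> pverts (UQ b) \<gamma>" using walk_src by blast
    then show False using g bb a by auto
  qed
  have 3: "tokX T Xs \<subseteq> cl {b \<in> BQ. UQ b \<in> Xs}"
  proof
    fix t assume "t \<in> tokX T Xs"
    then obtain v where v: "v \<in> Xs" "t \<in> T v" unfolding tokX_def by auto
    obtain W where W: "x \<in> W" "v \<in> W" "v \<in> W" "W \<subseteq> Xs" "tokX T' W \<subseteq> cl {b \<in> BQ. UQ b \<in> W}"
      by (rule Xs_cover[OF x v(1) v(1) cQ])
    have "t \<in> T' v" using v(2) TT[of v] by blast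
    then have "t \<in> tokX T' W" using W(2) unfolding tokX_def by blast
    then have "t \<in> cl {b \<in> BQ. UQ b \<in> W}" by (rule subsetD[OF W(5)])
    moreover have "{b \<in> BQ. UQ b \<in> W} \<subseteq> {b \<in> BQ. UQ b \<in> Xs}" using W(4) by blast
    ultimately show "t \<in> cl {b \<in> BQ. UQ b \<in> Xs}" by (rule cl_monoD)
  qed
  show ?thesis unfolding tight_def using 1 2 3 by blast
qed

lemma sub_complete_Xs:
  assumes x: "x \<in> Xs" and cQ: "complete A T x BQ UQ PQ"
  obtains UF PF where "complete (inner_arcs A Xs) (inner_tokens A T Xs) x ({b \<in> BQ. UQ b \<in> Xs} \<union> Inr ` gates A Xs) UF PF"
  by (rule tight_sub[OF cle completeD(1-3)[OF cQ] x tight_Xs[OF x cQ]])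

lemma sub_ok_Xs:
  assumes x: "x \<in> Xs" and o: "ok A T x"
  shows "sub_ok A T Xs x"
proof -
  obtain B U P where c: "complete A T x B U P" using o unfolding ok_def by blast
  obtain UF PF where "complete (inner_arcs A Xs) (inner_tokens A T Xs) x ({b \<in> B. U b \<in> Xs} \<union> Inr ` gates A Xs) UF PF"
    by (rule sub_complete_Xs[OF x c])
  then show ?thesis unfolding sub_ok_def by (rule okI)
qed

text \<open>A gate is reached by a trail from outside that has not met \<open>Xs\<close> before, so
  two gates cannot share a trail. Gates thus correspond to different members starting outside, and
  the region with its gate tokens has a base no larger than \<open>BQ\<close>.\<close>

lemma card_gates_Xs:
  assumes x: "x \<in> Xs" and cQ: "complete A T x BQ UQ PQ" and fin: "finite BQ"
  shows "finite (gates A Xs)" "card {b \<in> BQ. UQ b \<in> Xs} + card (gates A Xs) \<le> card BQ"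
proof -
  let ?O = "{b \<in> BQ. UQ b \<notin> Xs}"
  obtain f where f: "\<And>a. a \<in> gates A Xs \<Longrightarrow> f a \<in> BQ \<and> (\<exists>\<alpha> \<beta>. PQ (f a) = \<alpha> @ a # \<beta> \<and> pverts (UQ (f a)) \<alpha> \<inter> Xs = {})"
    using gate_Xs[OF x cQ] by metis
  have fO: "f ` gates A Xs \<subseteq> ?O"
  proof (intro image_subsetI)
    fix a assume a: "a \<in> gates A Xs"
    then obtain \<alpha> where "pverts (UQ (f a)) \<alpha> \<inter> Xs = {}" using f by blast
    then show "f a \<in> ?O" using f[OF a] start_pverts[of "UQ (f a)" \<alpha>] by auto
  qed
  have inj: "inj_on f (gates A Xs)"
  proof (rule inj_onI, rule ccontr)
    fix a a' assume a: "a \<in> gates A Xs" "a' \<in> gates A Xs" "f a = f a'" "a \<noteq> a'"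
    obtain \<alpha> \<beta> where 1: "PQ (f a) = \<alpha> @ a # \<beta>" "pverts (UQ (f a)) \<alpha> \<inter> Xs = {}" using f[OF a(1)] by blast
    obtain \<alpha>' \<beta>' where 2: "PQ (f a) = \<alpha>' @ a' # \<beta>'" "pverts (UQ (f a)) \<alpha>' \<inter> Xs = {}" using f[OF a(2)] a(3) by auto
    have d: "dst a \<in> Xs" "dst a' \<in> Xs" using a unfolding gates_def by auto
    have "a \<notin> set \<alpha>'" "a' \<notin> set \<alpha>" using 1(2) 2(2) d dst_pverts by blast+
    moreover have dist: "distinct (\<alpha> @ a # \<beta>)" "distinct (\<alpha>' @ a' # \<beta>')"
      using famD(2)[OF completeD(1)[OF cQ], of "f a"] f[OF a(1)] 1(1) 2(1) by (simp_all only:)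
    have "a \<in> set (\<alpha>' @ a' # \<beta>')" "a' \<in> set (\<alpha> @ a # \<beta>)" using 1(1) 2(1) by (metis in_set_conv_decomp)+
    ultimately have ab: "a \<in> set \<beta>'" "a' \<in> set \<beta>" using a(4) by auto
    have "\<alpha> @ a # \<beta> = (\<alpha>' @ [a']) @ \<beta>'" using 1(1) 2(1) by simp
    then have "a \<in> set (\<alpha>' @ [a'])" by (rule prefix_before[OF _ dist(1) ab(2)]) simp
    then show False using \<open>a \<notin> set \<alpha>'\<close> a(4) by auto
  qed
  show fg: "finite (gates A Xs)" 
  proof -
    have "finite ?O" using fin by simp
    then have "finite (f ` gates A Xs)" by (rule finite_subset[OF fO])
    then show ?thesis by (rule finite_imageD[OF _ inj])
  qed
  have "card (gates A Xs) \<le> card ?O" using card_inj_on_le[OF inj fO] fin by auto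
  moreover have "card {b \<in> BQ. UQ b \<in> Xs} + card ?O = card BQ"
  proof -
    have "BQ = {b \<in> BQ. UQ b \<in> Xs} \<union> ?O" "{b \<in> BQ. UQ b \<in> Xs} \<inter> ?O = {}" by auto
    then show ?thesis using card_Un_disjoint[of "{b \<in> BQ. UQ b \<in> Xs}" ?O] fin by simp
  qed
  ultimately show "card {b \<in> BQ. UQ b \<in> Xs} + card (gates A Xs) \<le> card BQ" by linarith
qed

lemma i_Xs: "Inl i \<in> cl (tokX T Xs)"
proof -
  obtain B U P where c: "cf B U P" using hok unfolding ok_def by blast
  have "Inl i \<in> cl {b \<in> B - {lab B P}. U b \<in> Ys B U P}" using Ys_tok[OF c] i_Ys[OF c] by blast
  moreover have "{b \<in> B - {lab B P}. U b \<in> Ys B U P} \<subseteq> tokX T Xs"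
    using famD(1)[OF completeD(1)[OF c]] Ys_Xs[OF c] unfolding tokX_def by blast
  ultimately show ?thesis by (rule cl_monoD)
qed

text \<open>Otherwise the complete family at \<open>z\<close>, which avoids \<open>e\<close>, would
  span everything together with the tokens of \<open>Xs\<close>. Stopped at the first entry, it
  would provide the outside for an inner family at the head that does without the gate
  \<open>e\<close>, against \<open>bad\<close>.\<close>

lemma reserved_notin_cl_Xs:
  assumes A2: "A2 \<subseteq> A'" and ok2: "ok A2 (add_token T z b) z" and z: "z \<in> Xs"
  shows "b \<notin> cl (tokX T Xs)"
proof
  assume b: "b \<in> cl (tokX T Xs)"
  obtain B U P where c: "complete A2 (add_token T z b) z B U P" using ok2 unfolding ok_def by blast
  let ?O = "{b \<in> B. U b \<notin> Xs}"
  obtain p where p: "entry A2 (add_token T z b) Xs ?O U p"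
    "toks (add_token T z b) \<subseteq> cl (?O \<union> tokX (add_token T z b) Xs)"
    by (rule complete_into[OF c z])
  have e1: "entry A' T' Xs ?O U p"
    by (rule entry_transfer[OF p(1)]) (use A2 z TT in \<open>auto simp: add_token_def\<close>)
  let ?S = "?O \<union> tokX T' Xs"
  have sub: "tokX T Xs \<subseteq> tokX T' Xs" using TT unfolding tokX_def by blast
  have "tokX (add_token T z b) Xs \<subseteq> insert b (tokX T Xs)" unfolding tokX_def add_token_def by (auto split: if_splits)
  then have "tokX (add_token T z b) Xs \<subseteq> cl (tokX T Xs)" using b cl_ext[of "tokX T Xs"] by auto
  moreover have "cl (tokX T Xs) \<subseteq> cl ?S" using sub by (intro cl_mono) auto
  ultimately have "?O \<union> tokX (add_token T z b) Xs \<subseteq> cl ?S" using cl_ext[of ?S] by auto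
  then have "toks T \<subseteq> cl ?S" using p(2) cl_least unfolding toks_add_token by blast
  then have cov: "toks T' \<subseteq> cl ?S" by (rule toks')
  obtain B0 U0 P0 where c0: "complete A T h B0 U0 P0" using hok unfolding ok_def by blast
  define BF where "BF = {b \<in> B0. U0 b \<in> Xs} \<union> Inr ` gates A Xs"
  obtain UF PF where cF: "complete (inner_arcs A Xs) (inner_tokens A T Xs) h BF UF PF"
    unfolding BF_def by (rule sub_complete_Xs[OF h_Xs c0])
  let ?B = "BF - {Inr e}"
  have sA: "inner_arcs A' Xs = inner_arcs A Xs" using src_Xs unfolding inner_arcs_def by auto
  have "fam (inner_arcs A' Xs) (inner_tokens A' T' Xs) ?B UF PF"
    unfolding sA fam_def
  proof (intro conjI ballI impI)
    fix b assume b: "b \<in> ?B"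
    then show "b \<in> inner_tokens A' T' Xs (UF b)"
      using famD(1)[OF completeD(1)[OF cF], of b] TT unfolding inner_tokens_def by (auto split: if_splits)
    show "distinct (PF b)" "set (PF b) \<subseteq> inner_arcs A Xs" using b famD(2,3)[OF completeD(1)[OF cF], of b] by auto
    fix d assume "d \<in> ?B" "b \<noteq> d"
    then show "set (PF b) \<inter> set (PF d) = {}" using b fam_disj[OF completeD(1)[OF cF]] by blast
  qed
  moreover have "toks (inner_tokens A' T' Xs) \<subseteq> cl ?B"
  proof -
    have tT: "tokX T Xs \<subseteq> cl ?B"
    proof
      fix t assume t: "t \<in> tokX T Xs"
      then have "t \<in> cl BF" using completeD(4)[OF cF] unfolding toks_inner_tokens by auto
      moreover have "t \<notin> Inr ` {e}" using t cle eA tokX_toks[of T Xs] unfolding clean_def by auto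
      ultimately have "t \<in> cl (BF - Inr ` {e})" by (rule cl_remove_gates)
      then show "t \<in> cl ?B" by simp
    qed
    then have "Inl i \<in> cl ?B" using i_Xs cl_least by blast
    then have "tokX T' Xs \<subseteq> cl ?B" using tT unfolding tokX_def add_token_def by (auto split: if_splits)
    moreover have "Inr ` gates A' Xs \<subseteq> ?B" unfolding BF_def gates_def by auto
    ultimately show ?thesis using cl_ext[of ?B] unfolding toks_inner_tokens by auto
  qed
  ultimately have "complete (inner_arcs A' Xs) (inner_tokens A' T' Xs) h ?B UF PF"
    using completeD(2,3)[OF cF] indep_subset[of BF ?B] unfolding complete_def ends_def by auto
  then have "sub_ok A' T' Xs h" unfolding sub_ok_def by (rule okI)
  then have "ok A' T' h" by (rule hybrid_ok[OF cle' e1 cov])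
  then show False using bad by blast
qed

lemma Xs_subset:
  assumes "\<And>a. a \<in> A \<Longrightarrow> src a \<in> V \<and> dst a \<in> V" "\<And>v. v \<notin> V \<Longrightarrow> T v = {}"
  shows "Xs \<subseteq> V"
proof
  fix v assume "v \<in> Xs"
  then obtain B U P where c: "cf B U P" "v \<in> Ys B U P" using XsE by blast
  note F = completeD(1)[OF c(1)]
  show "v \<in> V"
  proof (rule resid_induct[where Q = "\<lambda>w. w \<in> V"])
    show "v \<in> resid A' T' (B - {lab B P}) U P h" using c(2) unfolding Ys_def .
    show "h \<in> V" using assms(1)[OF eA] by simp
    fix w y assume 2: "(w, y) \<in> resid_arc A' T' (B - {lab B P}) U P"
    from 2(1) consider "\<exists>a\<in>A. src a = w" | "\<exists>a\<in>used B P. dst a = w" | b where "b \<in> B" "U b = w"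
      unfolding resid_arc_def used_def using circ_subset[of _ "B - {lab B P}"] by blast
    then show "w \<in> V"
    proof cases
      case 1 then show ?thesis using assms(1) by auto
    next
      case 2 then show ?thesis using assms(1) famD(3)[OF F] unfolding used_def by blast
    next
      case 3 then show ?thesis using assms(2)[of w] famD(1)[OF F, of b] by auto
    qed
  qed
qed

end

section \<open>Feasible labellings\<close>

context closure_matroid
begin

text \<open>The closure of the direct sum of the label matroid with the free matroid on the
  arcs.\<close>

definition token_cl :: "('t + 'a) set \<Rightarrow> ('t + 'a) set" where
  "token_cl X = Inl ` cl (Inl -` X) \<union> Inr ` (Inr -` X)"

definition token_summand :: "'t + 'a \<Rightarrow> 'k + 'a" where
  "token_summand = map_sum \<kappa> id"

lemma Inl_token_cl: "Inl s \<in> token_cl X \<longleftrightarrow> s \<in> cl (Inl -` X)"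
  unfolding token_cl_def by auto

lemma Inr_token_cl: "Inr a \<in> token_cl X \<longleftrightarrow> Inr a \<in> X"
  unfolding token_cl_def by auto

lemma vimage_Inl_token_cl: "Inl -` token_cl X = cl (Inl -` X)"
  by (auto simp: Inl_token_cl)

lemma vimage_Inl_insert: "Inl -` insert (Inl s) X = insert s (Inl -` X)" "Inl -` insert (Inr a) X = Inl -` X"
  by auto

lemma token_cl_gated: "gated_network (token_cl :: ('t + 'a) set \<Rightarrow> ('t + 'a) set) token_summand"
proof
  fix X Y :: "('t + 'a) set" and x y :: "'t + 'a" and k :: "'k + 'a" and a :: 'a
  show "X \<subseteq> token_cl X" 
  proof
    fix t assume "t \<in> X"
    then show "t \<in> token_cl X" by (cases t) (auto simp: Inl_token_cl Inr_token_cl intro: cl_extI)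
  qed
  show "token_cl X \<subseteq> token_cl Y" if "X \<subseteq> Y"
  proof
    have m: "Inl -` X \<subseteq> Inl -` Y" using that by auto
    fix t assume "t \<in> token_cl X"
    then show "t \<in> token_cl Y" using that by (cases t) (auto simp: Inl_token_cl Inr_token_cl intro: cl_monoD[OF _ m])
  qed
  show "token_cl (token_cl X) = token_cl X"
  proof (rule set_eqI)
    fix t show "t \<in> token_cl (token_cl X) \<longleftrightarrow> t \<in> token_cl X"
      by (cases t) (auto simp: Inl_token_cl Inr_token_cl vimage_Inl_token_cl cl_idem)
  qed
  show "x \<in> token_cl (insert y X)" if "y \<in> token_cl (insert x X)" "y \<notin> token_cl X"
    using that by (cases x; cases y) (auto simp: Inl_token_cl Inr_token_cl vimage_Inl_insert cl_exchange)
  show "x \<in> token_cl {a \<in> X. token_summand a = token_summand x}" if xX: "x \<in> token_cl X"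
  proof (cases x)
    case (Inl s)
    then have "s \<in> cl (Inl -` X)" using xX by (simp add: Inl_token_cl)
    then have "s \<in> cl {a \<in> Inl -` X. \<kappa> a = \<kappa> s}" by (rule cl_summand)
    moreover have "{a \<in> Inl -` X. \<kappa> a = \<kappa> s} = Inl -` {a \<in> X. token_summand a = token_summand x}" using Inl by (auto simp: token_summand_def)
    ultimately show ?thesis using Inl by (simp add: Inl_token_cl)
  next
    case (Inr b) then show ?thesis using xX by (simp add: Inr_token_cl)
  qed
  show "\<exists>n. \<forall>I. (\<forall>x\<in>I. x \<notin> token_cl (I - {x}) \<and> token_summand x = k) \<longrightarrow> finite I \<and> card I \<le> n"
  proof (cases k)
    case (Inl k')
    obtain n where n: "\<And>I. (\<forall>x\<in>I. x \<notin> cl (I - {x}) \<and> \<kappa> x = k') \<Longrightarrow> finite I \<and> card I \<le> n"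
      using bounded_rank[of k'] by blast
    show ?thesis
    proof (intro exI[of _ n] allI impI)
      fix I :: "('t + 'a) set" assume I: "\<forall>x\<in>I. x \<notin> token_cl (I - {x}) \<and> token_summand x = k"
      let ?J = "Inl -` I"
      have IJ: "I = Inl ` ?J"
      proof (rule set_eqI)
        fix t show "t \<in> I \<longleftrightarrow> t \<in> Inl ` ?J" using I Inl by (cases t) (auto simp: token_summand_def)
      qed
      have "\<forall>x\<in>?J. x \<notin> cl (?J - {x}) \<and> \<kappa> x = k'"
      proof
        fix x assume "x \<in> ?J"
        then have "Inl x \<notin> token_cl (I - {Inl x})" "token_summand (Inl x :: 't + 'a) = k" using I by auto
        moreover have "Inl -` (I - {Inl x}) = ?J - {x}" by auto
        ultimately show "x \<notin> cl (?J - {x}) \<and> \<kappa> x = k'" using Inl by (simp add: Inl_token_cl token_summand_def)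
      qed
      then have "finite ?J \<and> card ?J \<le> n" by (rule n)
      then show "finite I \<and> card I \<le> n" using IJ by (metis finite_imageI card_image_le le_trans)
    qed
  next
    case (Inr b)
    show ?thesis
    proof (intro exI[of _ 1] allI impI)
      fix I :: "('t + 'a) set" assume I: "\<forall>x\<in>I. x \<notin> token_cl (I - {x}) \<and> token_summand x = k"
      have "I \<subseteq> {Inr b}"
      proof
        fix t assume "t \<in> I" then show "t \<in> {Inr b}" using I Inr by (cases t) (auto simp: token_summand_def)
      qed
      then have "finite I" "card I \<le> card {Inr b :: 't + 'a}" by (rule finite_subset, simp) (rule card_mono[OF _ \<open>I \<subseteq> {Inr b}\<close>], simp)
      then show "finite I \<and> card I \<le> 1" by simp
    qed
  qed
  show "x = Inr a" if "token_summand x = token_summand (Inr a)" using that by (cases x) (auto simp: token_summand_def)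
  show "Inr a \<notin> token_cl {}" by (simp add: Inr_token_cl)
qed

end

text \<open>The vertices in \<open>Done\<close> have been completed in earlier phases, those in \<open>W\<close> are to be completed now;
  \<open>Sb\<close> are the labels present before the phase.\<close>

locale phase = closure_matroid lc \<kappa> for lc :: "'s set \<Rightarrow> 's set" and \<kappa> :: "'s \<Rightarrow> 'k" +
  fixes src dst :: "'a \<Rightarrow> 'v" and A1 :: "'a set" and Done W :: "'v set"
    and N Sb :: "'v \<Rightarrow> 's set"
  assumes A1: "a \<in> A1 \<Longrightarrow> dst a \<in> W \<and> src a \<in> W \<union> Done"
    and disj: "Done \<inter> W = {}"
    and N_flat: "v \<in> Done \<union> W \<Longrightarrow> lc (N v) = N v"
    and N_mono: "a \<in> A1 \<Longrightarrow> N (src a) \<subseteq> N (dst a)"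
    and Sb_N: "v \<in> Done \<union> W \<Longrightarrow> Sb v \<subseteq> N v"
    and Done_spans: "v \<in> Done \<Longrightarrow> N v \<subseteq> lc (Sb v)"
begin

sublocale tok: gated_network token_cl token_summand src dst
  by (rule token_cl_gated)

definition labels_at :: "('a \<Rightarrow> 's option) \<Rightarrow> 'v \<Rightarrow> 's set" where
  "labels_at lab v = Sb v \<union> {i. \<exists>a\<in>A1. lab a = Some i \<and> dst a = v}"

definition class_arcs :: "('a \<Rightarrow> 's option) \<Rightarrow> 's set \<Rightarrow> 'a set" where
  "class_arcs lab n = {a \<in> A1. lab a = None \<and> N (dst a) = n}"

text \<open>In the network of the flat \<open>n\<close>, completed vertices and vertices with a smaller flat offer their whole
  flat: what they lack now can be supplied independently of this network.\<close>

definition class_labels :: "('a \<Rightarrow> 's option) \<Rightarrow> 's set \<Rightarrow> 'v \<Rightarrow> 's set" where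
  "class_labels lab n v = (if v \<in> W \<and> N v = n then labels_at lab v else if v \<in> Done \<union> W \<and> N v \<subseteq> n then N v else {})"

definition class_tokens :: "('a \<Rightarrow> 's option) \<Rightarrow> 's set \<Rightarrow> 'v \<Rightarrow> ('s + 'a) set" where
  "class_tokens lab n v = Inl ` class_labels lab n v"

definition region_feasible :: "('a \<Rightarrow> 's option) \<Rightarrow> 's set \<Rightarrow> 'v set \<Rightarrow> bool" where
  "region_feasible lab n X \<longleftrightarrow> (\<forall>x\<in>X \<inter> W. N x = n \<longrightarrow> tok.sub_ok (class_arcs lab n) (class_tokens lab n) X x)"

text \<open>\<open>ok\<close> speaks only of the tokens present in a network; the second condition
  says that these span the whole flat.\<close>

definition feasible :: "('a \<Rightarrow> 's option) \<Rightarrow> bool" where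
  "feasible lab \<longleftrightarrow> (\<forall>x\<in>W. tok.ok (class_arcs lab (N x)) (class_tokens lab (N x)) x) \<and>
     (\<forall>x\<in>W. N x \<subseteq> lc (\<Union>v. class_labels lab (N x) v)) \<and> (\<forall>v\<in>Done \<union> W. labels_at lab v \<subseteq> N v)"

definition ext :: "('a \<Rightarrow> 's option) \<Rightarrow> 'a \<Rightarrow> 's \<Rightarrow> bool" where
  "ext lab a i \<longleftrightarrow> a \<in> A1 \<and> lab a = None \<and> i \<in> labels_at lab (src a) \<and> i \<notin> lc (labels_at lab (dst a))"

lemma sub_UNIV: "tok.inner_arcs A UNIV = A" "tok.inner_tokens A T UNIV = T"
  unfolding tok.inner_arcs_def tok.inner_tokens_def by auto

lemma sub_ok_UNIV: "tok.sub_ok A T UNIV x = tok.ok A T x"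
  unfolding tok.sub_ok_def sub_UNIV ..

lemma region_feasible_UNIV: "feasible lab \<Longrightarrow> region_feasible lab n UNIV"
  unfolding region_feasible_def feasible_def sub_ok_UNIV by auto

lemma clean: "tok.clean A (class_tokens lab n)"
  unfolding tok.clean_def tok.toks_def class_tokens_def by auto

lemma clean_sub: "tok.clean (tok.inner_arcs A X) (tok.inner_tokens A (class_tokens lab n) X)"
  by (rule tok.clean_sub[OF clean])

section \<open>Effect of one extension on the networks\<close>

lemma labels_at_upd:
  assumes "ext lab a i"
  shows "labels_at (lab(a \<mapsto> i)) v = (if v = dst a then insert i (labels_at lab v) else labels_at lab v)"
proof -
  have a: "a \<in> A1" "lab a = None" using assms unfolding ext_def by auto
  have "{j. \<exists>c\<in>A1. (lab(a \<mapsto> i)) c = Some j \<and> dst c = v} =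
    {j. \<exists>c\<in>A1. lab c = Some j \<and> dst c = v} \<union> (if v = dst a then {i} else {})" (is "?L = ?R")
  proof (rule set_eqI)
    fix j show "j \<in> ?L \<longleftrightarrow> j \<in> ?R" using a by (cases "j = i") (auto, metis option.distinct(1))
  qed
  then show ?thesis unfolding labels_at_def by auto
qed

lemma class_arcs_upd:
  assumes "ext lab a i"
  shows "class_arcs (lab(a \<mapsto> i)) n = (if N (dst a) = n then class_arcs lab n - {a} else class_arcs lab n)"
  using assms unfolding class_arcs_def ext_def by auto

text \<open>For a flat other than its own, the head offers either its whole flat or nothing; so one
  extension changes a single network.\<close>

lemma class_labels_upd:
  assumes "ext lab a i"
  shows "class_labels (lab(a \<mapsto> i)) n v = (if v = dst a \<and> N v = n then insert i (class_labels lab n v) else class_labels lab n v)"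
  using A1[of a] assms unfolding class_labels_def labels_at_upd[OF assms] by (auto simp: ext_def)

lemma class_tokens_upd:
  assumes "ext lab a i"
  shows "class_tokens (lab(a \<mapsto> i)) n = (if N (dst a) = n then tok.add_token (class_tokens lab n) (dst a) (Inl i) else class_tokens lab n)"
  unfolding class_tokens_def class_labels_upd[OF assms] tok.add_token_def by (auto simp: fun_eq_iff)

lemma ext_class_labels_src:
  assumes "ext lab a i" "feasible lab"
  shows "i \<in> class_labels lab (N (dst a)) (src a)" "i \<in> N (dst a)"
proof -
  have a: "a \<in> A1" "i \<in> labels_at lab (src a)" using assms(1) unfolding ext_def by auto
  have s: "src a \<in> Done \<union> W" using A1[OF a(1)] by auto
  then have "labels_at lab (src a) \<subseteq> N (src a)" using assms(2) unfolding feasible_def by auto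
  then show "i \<in> class_labels lab (N (dst a)) (src a)" "i \<in> N (dst a)"
    using a N_mono[OF a(1)] s unfolding class_labels_def by auto
qed

lemma class_labels_N: "feasible lab \<Longrightarrow> class_labels lab n v \<subseteq> n"
  unfolding class_labels_def feasible_def by auto

text \<open>Only the network of the head's flat changes, and there feasibility at the head implies
  feasibility at all other vertices by \<open>ok_ext_if_head_ok\<close>.\<close>

lemma feasible_upd:
  assumes e: "ext lab a i" and I: "feasible lab" and h: "tok.ok (class_arcs (lab(a \<mapsto> i)) (N (dst a))) (class_tokens (lab(a \<mapsto> i)) (N (dst a))) (dst a)"
  shows "feasible (lab(a \<mapsto> i))"
  unfolding feasible_def
proof (intro conjI ballI)
  let ?l = "lab(a \<mapsto> i)"
  have aA: "a \<in> A1" "a \<in> class_arcs lab (N (dst a))" using e unfolding ext_def class_arcs_def by auto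
  fix x assume x: "x \<in> W"
  have ox: "tok.ok (class_arcs lab (N x)) (class_tokens lab (N x)) x" using I x unfolding feasible_def by blast
  show "tok.ok (class_arcs ?l (N x)) (class_tokens ?l (N x)) x"
  proof (cases "N (dst a) = N x")
    case True
    have "Inl i \<in> class_tokens lab (N x) (src a)" using ext_class_labels_src[OF e I] True unfolding class_tokens_def by auto
    then have "Inl i \<in> tok.toks (class_tokens lab (N x))" by (rule tok.toksI)
    then have ic: "Inl i \<in> token_cl (tok.toks (class_tokens lab (N x)))" by (rule tok.cl_extI)
    show ?thesis using h tok.ok_ext_if_head_ok[OF clean ox ic, of a] aA True
      by (simp add: class_arcs_upd[OF e] class_tokens_upd[OF e])
  next
    case False then show ?thesis using ox by (simp add: class_arcs_upd[OF e] class_tokens_upd[OF e])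
  qed
  have "N x \<subseteq> lc (\<Union>v. class_labels lab (N x) v)" using I x unfolding feasible_def by blast
  also have "... \<subseteq> lc (\<Union>v. class_labels ?l (N x) v)" by (intro cl_mono UN_mono) (simp_all add: class_labels_upd[OF e] subset_insertI)
  finally show "N x \<subseteq> lc (\<Union>v. class_labels ?l (N x) v)" .
next
  fix v assume "v \<in> Done \<union> W"
  then have "labels_at lab v \<subseteq> N v" using I unfolding feasible_def by blast
  then show "labels_at (lab(a \<mapsto> i)) v \<subseteq> N v" using ext_class_labels_src[OF e I] by (auto simp: labels_at_upd[OF e])
qed

lemma region_feasible_upd:
  assumes e: "ext lab a i" and I: "feasible lab" and G: "region_feasible lab n X" and n: "N (dst a) = n"
    and X: "src a \<in> X" "dst a \<in> X"
    and h: "tok.sub_ok (class_arcs lab n - {a}) (tok.add_token (class_tokens lab n) (dst a) (Inl i)) X (dst a)"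
  shows "region_feasible (lab(a \<mapsto> i)) n X"
  unfolding region_feasible_def
proof (intro ballI impI)
  fix x assume x: "x \<in> X \<inter> W" "N x = n"
  let ?A = "tok.inner_arcs (class_arcs lab n) X" and ?T = "tok.inner_tokens (class_arcs lab n) (class_tokens lab n) X"
  have ox: "tok.ok ?A ?T x" using G x unfolding region_feasible_def tok.sub_ok_def by blast
  have aA: "a \<in> ?A" using e n X unfolding ext_def class_arcs_def tok.inner_arcs_def by auto
  have "Inl i \<in> ?T (src a)" using ext_class_labels_src[OF e I] n X unfolding tok.inner_tokens_def class_tokens_def by auto
  then have "Inl i \<in> tok.toks ?T" by (rule tok.toksI)
  then have ic: "Inl i \<in> token_cl (tok.toks ?T)" by (rule tok.cl_extI)
  have eq: "tok.inner_arcs (class_arcs lab n - {a}) X = ?A - {a}"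
    "tok.inner_tokens (class_arcs lab n - {a}) (tok.add_token (class_tokens lab n) (dst a) (Inl i)) X = tok.add_token ?T (dst a) (Inl i)"
    using tok.inner_add_token[OF X] by auto
  have "tok.ok (?A - {a}) (tok.add_token ?T (dst a) (Inl i)) x"
    by (rule tok.ok_ext_if_head_ok[OF clean_sub ox ic aA]) (use h in \<open>simp add: tok.sub_ok_def eq\<close>)
  then show "tok.sub_ok (class_arcs (lab(a \<mapsto> i)) n) (class_tokens (lab(a \<mapsto> i)) n) X x"
    using n by (simp add: class_arcs_upd[OF e] class_tokens_upd[OF e] tok.sub_ok_def eq)
qed

text \<open>The network of \<open>X\<close> is also a restriction of the network of
  \<open>Z\<close>, so \<open>ok_ext_of_sub\<close> lifts feasibility at the head from
  \<open>X\<close> to \<open>Z\<close>.\<close>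

lemma region_feasible_lift:
  assumes e: "ext lab a i" and I: "feasible lab" and G: "region_feasible lab n Z" and n: "N (dst a) = n"
    and X: "src a \<in> X" "dst a \<in> X" "X \<subseteq> Z"
    and h: "region_feasible (lab(a \<mapsto> i)) n X"
  shows "region_feasible (lab(a \<mapsto> i)) n Z"
proof (rule region_feasible_upd[OF e I G n])
  show XZ: "src a \<in> Z" "dst a \<in> Z" using X by auto
  have dW: "dst a \<in> W" using e A1[of a] unfolding ext_def by auto
  let ?A = "tok.inner_arcs (class_arcs lab n) Z" and ?T = "tok.inner_tokens (class_arcs lab n) (class_tokens lab n) Z"
  have oh: "tok.ok ?A ?T (dst a)" using G XZ dW n unfolding region_feasible_def tok.sub_ok_def by blast
  have eq: "tok.inner_arcs (class_arcs lab n - {a}) Z = ?A - {a}"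
    "tok.inner_tokens (class_arcs lab n - {a}) (tok.add_token (class_tokens lab n) (dst a) (Inl i)) Z = tok.add_token ?T (dst a) (Inl i)"
    using tok.inner_add_token[OF XZ] by auto
  have "tok.sub_ok (class_arcs lab n - {a}) (tok.add_token (class_tokens lab n) (dst a) (Inl i)) X (dst a)"
    using h X dW n unfolding region_feasible_def by (auto simp: class_arcs_upd[OF e] class_tokens_upd[OF e])
  then have "tok.sub_ok (?A - {a}) (tok.add_token ?T (dst a) (Inl i)) X (dst a)"
    unfolding tok.sub_ok_def eq[symmetric] using tok.sub_sub[OF X(3)] by simp
  then have "tok.ok (?A - {a}) (tok.add_token ?T (dst a) (Inl i)) (dst a)"
    by (rule tok.ok_ext_of_sub[OF clean_sub oh X(1,2)])
  then show "tok.sub_ok (class_arcs lab n - {a}) (tok.add_token (class_tokens lab n) (dst a) (Inl i)) Z (dst a)"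
    by (simp add: tok.sub_ok_def eq)
qed

lemma feasible_of_region:
  assumes e: "ext lab a i" and I: "feasible lab" and X: "src a \<in> X" "dst a \<in> X"
    and G: "region_feasible (lab(a \<mapsto> i)) (N (dst a)) X"
  shows "feasible (lab(a \<mapsto> i))"
proof (rule feasible_upd[OF e I])
  have dW: "dst a \<in> W" using e A1[of a] unfolding ext_def by auto
  have "region_feasible (lab(a \<mapsto> i)) (N (dst a)) UNIV"
    by (rule region_feasible_lift[OF e I region_feasible_UNIV[OF I] refl X _ G]) simp
  then show "tok.ok (class_arcs (lab(a \<mapsto> i)) (N (dst a))) (class_tokens (lab(a \<mapsto> i)) (N (dst a))) (dst a)"
    using dW unfolding region_feasible_def sub_ok_UNIV by blast
qed

lemma last_visit:
  assumes "tok.walk u p y" "tok.pverts u p \<inter> Y \<noteq> {}"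
  shows "\<exists>p1 p2 w. p = p1 @ p2 \<and> tok.walk u p1 w \<and> tok.walk w p2 y \<and> w \<in> Y \<and> dst ` set p2 \<inter> Y = {}"
  using assms
proof (induction p arbitrary: u)
  case Nil then show ?case by simp
next
  case (Cons a p)
  show ?case
  proof (cases "tok.pverts (dst a) p \<inter> Y = {}")
    case True
    then have "u \<in> Y" "dst ` set (a # p) \<inter> Y = {}" using Cons.prems(2) by (auto simp: tok.pverts_def)
    then show ?thesis using Cons.prems by (intro exI[of _ "[]"] exI[of _ "a # p"] exI[of _ u]) simp
  next
    case False
    then obtain p1 p2 w where "p = p1 @ p2" "tok.walk (dst a) p1 w" "tok.walk w p2 y" "w \<in> Y" "dst ` set p2 \<inter> Y = {}"
      using Cons.IH[of "dst a"] Cons.prems(1) by auto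
    then show ?thesis using Cons.prems(1) by (intro exI[of _ "a # p1"] exI[of _ p2] exI[of _ w]) simp
  qed
qed

section \<open>Labels, rank and reserved arcs of a region\<close>

definition region_labels :: "('a \<Rightarrow> 's option) \<Rightarrow> 's set \<Rightarrow> 'v set \<Rightarrow> 's set" where
  "region_labels lab n X = (\<Union>v\<in>X. class_labels lab n v)"

abbreviation "region_arcs lab n X \<equiv> tok.inner_arcs (class_arcs lab n) X"
abbreviation "region_tokens lab n X \<equiv> tok.inner_tokens (class_arcs lab n) (class_tokens lab n) X"

text \<open>Labels and gates are counted together, each gate as a coloop; a bound for the region
  thus bounds the number of its gates.\<close>

definition rank_at_most :: "('a \<Rightarrow> 's option) \<Rightarrow> 's set \<Rightarrow> 'v set \<Rightarrow> nat \<Rightarrow> bool" where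
  "rank_at_most lab n X c \<longleftrightarrow> (\<exists>J. tok.indep J \<and> finite J \<and> card J \<le> c \<and> tok.toks (region_tokens lab n X) \<subseteq> token_cl J)"

text \<open>The arcs \<open>Q\<close> of a trail bringing \<open>b\<close> to \<open>z\<close> are set aside.\<close>

definition reserved :: "('a \<Rightarrow> 's option) \<Rightarrow> 's set \<Rightarrow> 'v set \<Rightarrow> 'v \<Rightarrow> 's \<Rightarrow> 'a set \<Rightarrow> bool" where
  "reserved lab n X z b Q \<longleftrightarrow> tok.ok (region_arcs lab n X - Q) (tok.add_token (region_tokens lab n X) z (Inl b)) z"

lemma vimage_region_tokens: "Y \<subseteq> X \<Longrightarrow> Inl -` tok.tokX (region_tokens lab n X) Y = region_labels lab n Y"
  unfolding tok.tokX_def tok.inner_tokens_def region_labels_def class_tokens_def by (auto; blast)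

lemma toks_region_tokens: "tok.toks (region_tokens lab n X) = Inl ` region_labels lab n X \<union> Inr ` tok.gates (class_arcs lab n) X"
  unfolding tok.toks_inner_tokens tok.tokX_def region_labels_def class_tokens_def by auto

text \<open>What a failed extension yields for the search: \<open>Y\<close> is the union of the
  residual sets. The rank does not grow because gates replace members from outside, and a
  reservation containing \<open>a\<close> at a vertex of \<open>Y\<close> shows that
  \<open>b\<close> has left the span of the region.\<close>

lemma obstruction_region:
  assumes I: "feasible lab" and G: "region_feasible lab n X" and e: "ext lab a i" and n: "N (dst a) = n"
    and X: "src a \<in> X" "dst a \<in> X"
    and bad: "\<not> tok.ok (region_arcs lab n X - {a}) (tok.add_token (region_tokens lab n X) (dst a) (Inl i)) (dst a)"
  shows "\<exists>Y. Y \<subseteq> X \<and> dst a \<in> Y \<and> src a \<notin> Y \<and> region_feasible lab n Y \<and> i \<in> lc (region_labels lab n Y) \<and>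
    (\<forall>c. rank_at_most lab n X c \<longrightarrow> rank_at_most lab n Y c) \<and>
    (\<forall>Q z b. a \<in> Q \<longrightarrow> reserved lab n X z b Q \<longrightarrow> z \<in> Y \<longrightarrow> b \<notin> lc (region_labels lab n Y))"
proof -
  let ?A = "region_arcs lab n X" and ?T = "region_tokens lab n X"
  have dW: "dst a \<in> W" using e A1[of a] unfolding ext_def by auto
  have aA: "a \<in> ?A" using e n X unfolding ext_def class_arcs_def tok.inner_arcs_def by auto
  have "Inl i \<in> ?T (src a)" using ext_class_labels_src[OF e I] n X unfolding tok.inner_tokens_def class_tokens_def by auto
  then have "Inl i \<in> tok.toks ?T" by (rule tok.toksI)
  then have ic: "Inl i \<in> token_cl (tok.toks ?T)" by (rule tok.cl_extI)
  have oh: "tok.ok ?A ?T (dst a)" using G X dW n unfolding region_feasible_def tok.sub_ok_def by blast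
  interpret ob: obstruction token_cl token_summand src dst ?A ?T a i
    by unfold_locales (rule clean_sub aA ic oh bad)+
  let ?Y = "ob.Xs"
  have YX: "?Y \<subseteq> X" by (rule ob.Xs_subset) (auto simp: tok.inner_arcs_def tok.inner_tokens_def)
  have G': "region_feasible lab n ?Y" unfolding region_feasible_def
  proof (intro ballI impI)
    fix x assume x: "x \<in> ?Y \<inter> W" "N x = n"
    then have "tok.ok ?A ?T x" using G YX unfolding region_feasible_def tok.sub_ok_def by blast
    then have "tok.sub_ok ?A ?T ?Y x" using ob.sub_ok_Xs x by blast
    then show "tok.sub_ok (class_arcs lab n) (class_tokens lab n) ?Y x" unfolding tok.sub_ok_def tok.sub_sub[OF YX] .
  qed
  have iY: "i \<in> lc (region_labels lab n ?Y)" using ob.i_Xs by (simp add: Inl_token_cl vimage_region_tokens[OF YX])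
  have sm: "rank_at_most lab n ?Y c" if s: "rank_at_most lab n X c" for c
  proof -
    obtain J where J: "tok.indep J" "finite J" "card J \<le> c" "tok.toks ?T \<subseteq> token_cl J"
      using s unfolding rank_at_most_def by blast
    obtain BQ UQ PQ where cQ: "tok.complete ?A ?T (dst a) BQ UQ PQ" using oh unfolding tok.ok_def by blast
    have "BQ \<subseteq> tok.toks ?T" using tok.famD(1)[OF tok.completeD(1)[OF cQ]] tok.toksI by blast
    then have BJ: "BQ \<subseteq> token_cl J" using J(4) by blast
    have fB: "finite BQ" "card BQ \<le> card J" using tok.steinitz[OF J(2) tok.completeD(3)[OF cQ] BJ] by auto
    let ?B = "{b \<in> BQ. UQ b \<in> ?Y} \<union> Inr ` tok.gates ?A ?Y"
    obtain UF PF where cF: "tok.complete (tok.inner_arcs ?A ?Y) (tok.inner_tokens ?A ?T ?Y) (dst a) ?B UF PF"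
      by (rule ob.sub_complete_Xs[OF ob.h_Xs cQ])
    have g: "finite (tok.gates ?A ?Y)" "card {b \<in> BQ. UQ b \<in> ?Y} + card (tok.gates ?A ?Y) \<le> card BQ"
      using ob.card_gates_Xs[OF ob.h_Xs cQ fB(1)] by auto
    have "card ?B \<le> card {b \<in> BQ. UQ b \<in> ?Y} + card (Inr ` tok.gates ?A ?Y :: ('s + 'a) set)" by (rule card_Un_le)
    also have "... \<le> card {b \<in> BQ. UQ b \<in> ?Y} + card (tok.gates ?A ?Y)" using card_image_le[OF g(1)] by simp
    finally have "card ?B \<le> c" using g(2) fB(2) J(3) by linarith
    moreover have "finite ?B" using fB(1) g(1) by simp
    moreover have "tok.toks (region_tokens lab n ?Y) \<subseteq> token_cl ?B" using tok.completeD(4)[OF cF] tok.sub_sub(2)[OF YX] by simp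
    ultimately show ?thesis unfolding rank_at_most_def using tok.completeD(3)[OF cF] by blast
  qed
  have resid_arc: "b \<notin> lc (region_labels lab n ?Y)" if "a \<in> Q" "reserved lab n X z b Q" "z \<in> ?Y" for Q z b
  proof -
    have "?A - Q \<subseteq> ?A - {a}" using that by auto
    then have "Inl b \<notin> token_cl (tok.tokX ?T ?Y)" by (rule ob.reserved_notin_cl_Xs[OF _ that(2)[unfolded reserved_def] that(3)])
    then show ?thesis by (simp add: Inl_token_cl vimage_region_tokens[OF YX])
  qed
  show ?thesis
    by (rule exI[of _ ?Y]) (use YX G' iY sm resid_arc ob.h_Xs ob.src_Xs in blast)
qed

end

section \<open>Stuck vertices\<close>

text \<open>\<open>Rich\<close> are the labels one of which is wanted at some vertex; the other labels form a flat.\<close>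

locale rich_phase = phase lc \<kappa> src dst A1 Done W N Sb
  for lc :: "'s set \<Rightarrow> 's set" and \<kappa> :: "'s \<Rightarrow> 'k" and src dst :: "'a \<Rightarrow> 'v" and A1 Done W N Sb +
  fixes Rich :: "'s set" and k0 :: 'k
  assumes poor_flat: "lc (- Rich) \<subseteq> - Rich" and rich_summand: "r \<in> Rich \<Longrightarrow> \<kappa> r = k0"
begin

lemma poor_cl: "X \<inter> Rich = {} \<Longrightarrow> lc X \<inter> Rich = {}"
  using poor_flat cl_mono[of X "- Rich"] by blast

lemma rich_cl: "r \<in> lc X \<Longrightarrow> r \<in> Rich \<Longrightarrow> X \<inter> Rich \<noteq> {}"
  using poor_cl by blast

text \<open>Only rich labels are moved, either within \<open>X\<close> or at vertices of smaller
  flat anywhere; the latter moves do not touch the network of \<open>n\<close>.\<close>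

definition step :: "'s set \<Rightarrow> 'v set \<Rightarrow> ('a \<Rightarrow> 's option) \<Rightarrow> ('a \<Rightarrow> 's option) \<Rightarrow> bool" where
  "step n X lab lab' \<longleftrightarrow> feasible lab' \<and> (\<exists>a i. ext lab a i \<and> i \<in> Rich \<and> lab' = lab(a \<mapsto> i) \<and>
     (N (dst a) = n \<and> src a \<in> X \<and> dst a \<in> X \<and> region_feasible lab' n X \<or> N (dst a) \<subset> n))"

abbreviation "steps n X \<equiv> (step n X)\<^sup>*\<^sup>*"

lemma lower_unchanged:
  assumes e: "ext lab a i" and n: "N (dst a) \<noteq> n"
  shows "class_arcs (lab(a \<mapsto> i)) n = class_arcs lab n" "class_labels (lab(a \<mapsto> i)) n = class_labels lab n" "class_tokens (lab(a \<mapsto> i)) n = class_tokens lab n"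
  using n by (auto simp: class_arcs_upd[OF e] class_labels_upd[OF e] class_tokens_upd[OF e] fun_eq_iff)

lemma step_lift:
  assumes s: "step n X lab lab'" and I: "feasible lab" and G: "region_feasible lab n Z" and XZ: "X \<subseteq> Z"
  shows "step n Z lab lab'" "region_feasible lab' n Z"
proof -
  obtain a i where a: "feasible lab'" "ext lab a i" "i \<in> Rich" "lab' = lab(a \<mapsto> i)"
    "N (dst a) = n \<and> src a \<in> X \<and> dst a \<in> X \<and> region_feasible lab' n X \<or> N (dst a) \<subset> n"
    using s unfolding step_def by blast
  have gz: "region_feasible lab' n Z"
  proof (cases "N (dst a) \<subset> n")
    case True
    then have "N (dst a) \<noteq> n" by blast
    then show ?thesis using G by (simp add: region_feasible_def a(4) lower_unchanged[OF a(2)])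
  next
    case False
    then show ?thesis using region_feasible_lift[OF a(2) I G _ _ _ XZ] a(4,5) by blast
  qed
  then show "step n Z lab lab'" "region_feasible lab' n Z" using a XZ unfolding step_def by blast+
qed

lemma steps_lift:
  assumes "steps n X lab lab'" "feasible lab" "region_feasible lab n Z" "X \<subseteq> Z"
  shows "steps n Z lab lab' \<and> region_feasible lab' n Z \<and> feasible lab'"
  using assms
proof (induction rule: rtranclp_induct)
  case base then show ?case by simp
next
  case (step y w)
  then have y: "steps n Z lab y" "region_feasible y n Z" "feasible y" by auto
  have "step n Z y w" "region_feasible w n Z" using step_lift[OF step.hyps(2) y(3,2)] step.prems by auto
  moreover have "feasible w" using step.hyps(2) unfolding step_def by blast
  ultimately show ?case using y by (meson rtranclp.rtrancl_into_rtrancl)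
qed

lemma steps_lower:
  assumes "steps n' UNIV lab lab'" "n' \<subset> n"
  shows "steps n X lab lab' \<and> class_arcs lab' n = class_arcs lab n \<and> class_labels lab' n = class_labels lab n \<and> class_tokens lab' n = class_tokens lab n"
  using assms
proof (induction rule: rtranclp_induct)
  case base then show ?case by simp
next
  case (step y w)
  obtain a i where a: "feasible w" "ext y a i" "i \<in> Rich" "w = y(a \<mapsto> i)" "N (dst a) \<subseteq> n'"
    using step.hyps(2) unfolding step_def by blast
  have "N (dst a) \<subset> n" using a(5) step.prems by blast
  moreover from this have "N (dst a) \<noteq> n" by blast
  ultimately have "step n X y w" "class_arcs w n = class_arcs y n \<and> class_labels w n = class_labels y n \<and> class_tokens w n = class_tokens y n"
    using a lower_unchanged[OF a(2)] unfolding step_def by blast+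
  then show ?case using step.IH[OF step.prems] by (metis rtranclp.rtrancl_into_rtrancl)
qed

text \<open>A label moved along an arc inside \<open>X\<close> was already in \<open>X\<close>, and
  the arc was no gate; so a region keeps its labels and its gates while steps are taken in
  it.\<close>

lemma step_keeps:
  assumes "step n X lab lab'" "feasible lab"
  shows "region_labels lab' n X = region_labels lab n X" "tok.gates (class_arcs lab' n) X = tok.gates (class_arcs lab n) X" "class_arcs lab' n \<subseteq> class_arcs lab n"
    "v \<notin> X \<Longrightarrow> class_labels lab' n v = class_labels lab n v" "c \<in> class_arcs lab n \<Longrightarrow> src c \<notin> X \<or> dst c \<notin> X \<Longrightarrow> c \<in> class_arcs lab' n"
    "labels_at lab u \<subseteq> labels_at lab' u"
proof -
  obtain a i where a: "ext lab a i" "lab' = lab(a \<mapsto> i)"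
    "N (dst a) = n \<and> src a \<in> X \<and> dst a \<in> X \<or> N (dst a) \<subset> n"
    using assms unfolding step_def by blast
  have i: "N (dst a) = n \<Longrightarrow> i \<in> class_labels lab n (src a)" using ext_class_labels_src[OF a(1) assms(2)] by blast
  show "region_labels lab' n X = region_labels lab n X"
    using a(3) i unfolding region_labels_def a(2) class_labels_upd[OF a(1)] by (auto split: if_splits)
  show "tok.gates (class_arcs lab' n) X = tok.gates (class_arcs lab n) X"
    using a(3) unfolding tok.gates_def a(2) class_arcs_upd[OF a(1)] by auto
  show "class_arcs lab' n \<subseteq> class_arcs lab n" unfolding a(2) class_arcs_upd[OF a(1)] by auto
  show "v \<notin> X \<Longrightarrow> class_labels lab' n v = class_labels lab n v" using a(3) unfolding a(2) class_labels_upd[OF a(1)] by auto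
  show "c \<in> class_arcs lab n \<Longrightarrow> src c \<notin> X \<or> dst c \<notin> X \<Longrightarrow> c \<in> class_arcs lab' n" using a(3) unfolding a(2) class_arcs_upd[OF a(1)] by auto
  show "labels_at lab u \<subseteq> labels_at lab' u" unfolding a(2) labels_at_upd[OF a(1)] by auto
qed

lemma steps_keeps:
  assumes "steps n X lab lab'" "feasible lab"
  shows "region_labels lab' n X = region_labels lab n X \<and> tok.gates (class_arcs lab' n) X = tok.gates (class_arcs lab n) X \<and> class_arcs lab' n \<subseteq> class_arcs lab n \<and>
    (\<forall>v. v \<notin> X \<longrightarrow> class_labels lab' n v = class_labels lab n v) \<and> (\<forall>c\<in>class_arcs lab n. src c \<notin> X \<or> dst c \<notin> X \<longrightarrow> c \<in> class_arcs lab' n) \<and>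
    (\<forall>u. labels_at lab u \<subseteq> labels_at lab' u) \<and> feasible lab'"
  using assms
proof (induction rule: rtranclp_induct)
  case base then show ?case by simp
next
  case (step y w)
  have IH: "region_labels y n X = region_labels lab n X" "tok.gates (class_arcs y n) X = tok.gates (class_arcs lab n) X" "class_arcs y n \<subseteq> class_arcs lab n"
    "\<And>v. v \<notin> X \<Longrightarrow> class_labels y n v = class_labels lab n v" "\<And>c. c \<in> class_arcs lab n \<Longrightarrow> src c \<notin> X \<or> dst c \<notin> X \<Longrightarrow> c \<in> class_arcs y n"
    "\<And>u. labels_at lab u \<subseteq> labels_at y u" "feasible y"
    using step.IH[OF step.prems] by blast+
  note k = step_keeps[OF step.hyps(2) IH(7)]
  have "feasible w" using step.hyps(2) unfolding step_def by blast
  moreover have "\<forall>v. v \<notin> X \<longrightarrow> class_labels w n v = class_labels lab n v" using k(4) IH(4) by simp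
  moreover have "\<forall>c\<in>class_arcs lab n. src c \<notin> X \<or> dst c \<notin> X \<longrightarrow> c \<in> class_arcs w n" using k(5) IH(5) by simp
  moreover have "\<forall>u. labels_at lab u \<subseteq> labels_at w u" using k(6) IH(6) by blast
  moreover have "region_labels w n X = region_labels lab n X" "tok.gates (class_arcs w n) X = tok.gates (class_arcs lab n) X" "class_arcs w n \<subseteq> class_arcs lab n"
    using k(1-3) IH(1-3) by auto
  ultimately show ?case by blast
qed

lemma steps_rank_at_most: "steps n X lab lab' \<Longrightarrow> feasible lab \<Longrightarrow> rank_at_most lab' n X c = rank_at_most lab n X c"
  unfolding rank_at_most_def toks_region_tokens using steps_keeps[of n X lab lab'] by simp

lemma step_reserved:
  assumes s: "step n Y lab lab'" and I: "feasible lab" and YX: "Y \<subseteq> X" and z: "z \<notin> Y" and Q: "\<forall>a\<in>Q. dst a \<notin> Y"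
    and R: "reserved lab n X z b Q"
  shows "reserved lab' n X z b Q"
proof -
  obtain a i where a: "ext lab a i" "lab' = lab(a \<mapsto> i)"
    "N (dst a) = n \<and> src a \<in> Y \<and> dst a \<in> Y \<and> region_feasible lab' n Y \<or> N (dst a) \<subset> n"
    using s unfolding step_def by blast
  show ?thesis
  proof (cases "N (dst a) \<subset> n")
    case True
    then have "N (dst a) \<noteq> n" by blast
    then show ?thesis using R by (simp add: reserved_def a(2) lower_unchanged[OF a(1)])
  next
    case False
    then have n: "N (dst a) = n" and aY: "src a \<in> Y" "dst a \<in> Y" and G: "region_feasible lab' n Y" using a(3) by auto
    have aX: "src a \<in> X" "dst a \<in> X" using aY YX by auto
    let ?A = "region_arcs lab n X" and ?T = "region_tokens lab n X"
    have aA: "a \<in> ?A" using a(1) n aX unfolding ext_def class_arcs_def tok.inner_arcs_def by auto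
    have dW: "dst a \<in> W" using a(1) A1[of a] unfolding ext_def by auto
    have "Inl i \<in> ?T (src a)" using ext_class_labels_src[OF a(1) I] n aX unfolding tok.inner_tokens_def class_tokens_def by auto
    then have "Inl i \<in> tok.toks ?T" by (rule tok.toksI)
    then have ic: "Inl i \<in> token_cl (tok.toks ?T)" by (rule tok.cl_extI)
    have eq: "region_arcs lab' n X = ?A - {a}" "region_tokens lab' n X = tok.add_token ?T (dst a) (Inl i)"
      using tok.inner_add_token[OF aX, of "class_arcs lab n"] n by (simp_all add: a(2) class_arcs_upd[OF a(1)] class_tokens_upd[OF a(1)])
    have "tok.sub_ok (class_arcs lab' n) (class_tokens lab' n) Y (dst a)" using G aY dW n unfolding region_feasible_def by blast
    then have s': "tok.sub_ok (?A - {a}) (tok.add_token ?T (dst a) (Inl i)) Y (dst a)"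
      unfolding tok.sub_ok_def eq[symmetric] tok.sub_sub[OF YX] .
    have "tok.ok (?A - {a} - Q) (tok.add_token (tok.add_token ?T (dst a) (Inl i)) z (Inl b)) z"
      by (rule tok.reserved_step[OF clean_sub aA aY Q z ic R[unfolded reserved_def] s'])
    then show ?thesis unfolding reserved_def eq .
  qed
qed

lemma steps_reserved:
  assumes "steps n Y lab lab'" "feasible lab" "Y \<subseteq> X" "z \<notin> Y" "\<forall>a\<in>Q. dst a \<notin> Y" "reserved lab n X z b Q"
  shows "reserved lab' n X z b Q"
  using assms
proof (induction rule: rtranclp_induct)
  case base then show ?case by simp
next
  case (step y w)
  have "feasible y" using steps_keeps[OF step.hyps(1)] step.prems by blast
  then show ?case using step_reserved[OF step.hyps(2)] step.IH step.prems by blast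
qed

text \<open>Quantifying over sequences of steps instead of single ones makes the property persist
  under steps.\<close>

definition stuck :: "('a \<Rightarrow> 's option) \<Rightarrow> 's set \<Rightarrow> 'v set \<Rightarrow> 'v \<Rightarrow> bool" where
  "stuck lab n X z \<longleftrightarrow> feasible lab \<and> region_feasible lab n X \<and> z \<in> X \<inter> W \<and> N z = n \<and> region_labels lab n X \<inter> Rich \<noteq> {} \<and>
     (\<forall>lab'. steps n X lab lab' \<longrightarrow> labels_at lab' z \<inter> Rich = {})"

lemma stuckD:
  assumes "stuck lab n X z"
  shows "feasible lab" "region_feasible lab n X" "z \<in> X" "z \<in> W" "N z = n" "region_labels lab n X \<inter> Rich \<noteq> {}"
    "steps n X lab lab' \<Longrightarrow> labels_at lab' z \<inter> Rich = {}" "labels_at lab z \<inter> Rich = {}"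
  using assms unfolding stuck_def by auto

lemma stuck_steps:
  assumes B: "stuck lab n X z" and s: "steps n X lab lab'"
  shows "stuck lab' n X z"
proof -
  have "region_feasible lab' n X" using steps_lift[OF s stuckD(1,2)[OF B]] by blast
  moreover have "region_labels lab' n X = region_labels lab n X" "feasible lab'" using steps_keeps[OF s stuckD(1)[OF B]] by auto
  moreover have "labels_at l z \<inter> Rich = {}" if l: "steps n X lab' l" for l
    by (rule stuckD(7)[OF B rtranclp_trans[OF s l]])
  ultimately show ?thesis using B unfolding stuck_def by auto
qed

text \<open>The pieces of which the backward-infinite path is composed: simple, inside
  \<open>W\<close>, and without rich roots.\<close>

definition poor_path :: "'v \<Rightarrow> 'a list \<Rightarrow> 'v \<Rightarrow> bool" where
  "poor_path u p v \<longleftrightarrow> p \<noteq> [] \<and> tok.walk u p v \<and> set p \<subseteq> A1 \<and> distinct (u # map dst p) \<and>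
     (\<forall>w\<in>tok.pverts u p. w \<in> W \<and> Sb w \<inter> Rich = {})"

text \<open>The three ways in which a stuck vertex leads on: a region of smaller rank for the same vertex, a new
  vertex in a smaller region, and a new vertex with a smaller flat.\<close>

definition next_rank :: "('a \<Rightarrow> 's option) \<Rightarrow> 's set \<Rightarrow> 'v set \<Rightarrow> 'v \<Rightarrow> ('a \<Rightarrow> 's option) \<Rightarrow> 's set \<Rightarrow> 'v set \<Rightarrow> 'v \<Rightarrow> bool" where
  "next_rank lab n X z lab' n' X' z' \<longleftrightarrow> n' = n \<and> z' = z \<and> X' \<subseteq> X \<and> steps n X lab lab' \<and>
     (\<forall>c. rank_at_most lab n X c \<longrightarrow> rank_at_most lab' n X' c) \<and> (\<exists>b\<in>Rich. b \<in> region_labels lab n X \<and> b \<notin> lc (region_labels lab' n X'))"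

definition next_region :: "('a \<Rightarrow> 's option) \<Rightarrow> 's set \<Rightarrow> 'v set \<Rightarrow> 'v \<Rightarrow> ('a \<Rightarrow> 's option) \<Rightarrow> 's set \<Rightarrow> 'v set \<Rightarrow> 'v \<Rightarrow> bool" where
  "next_region lab n X z lab' n' X' z' \<longleftrightarrow> n' = n \<and> X' \<subseteq> X \<and> steps n X lab lab' \<and>
     (\<forall>c. rank_at_most lab n X c \<longrightarrow> rank_at_most lab' n X' c) \<and>
     (\<exists>p. poor_path z' p z \<and> tok.pverts z' p \<subseteq> {v \<in> X. N v = n} \<and> dst ` set p \<inter> X' = {}) \<and>
     (\<exists>a\<in>class_arcs lab' n. dst a \<in> X' \<and> src a \<in> X - X')"

definition next_class :: "('a \<Rightarrow> 's option) \<Rightarrow> 's set \<Rightarrow> 'v set \<Rightarrow> 'v \<Rightarrow> ('a \<Rightarrow> 's option) \<Rightarrow> 's set \<Rightarrow> 'v set \<Rightarrow> 'v \<Rightarrow> bool" where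
  "next_class lab n X z lab' n' X' z' \<longleftrightarrow> n' \<subset> n \<and> X' = UNIV \<and>
     (\<exists>p. poor_path z' p z \<and> dst ` set p \<subseteq> {v \<in> X. N v = n})"

text \<open>A rich label is moved along \<open>q\<close> arc by arc. If this is not possible for the first arc of \<open>q\<close>, it is
  moved instead to the last vertex of \<open>q\<close> in the obstructing region, by steps inside this region, which do not
  affect the rest of \<open>q\<close>.\<close>

lemma follow:
  assumes B0: "stuck lab0 n X z" and "steps n X lab0 lab" and "tok.walk v q z" "set q \<subseteq> region_arcs lab n X" "distinct (v # map dst q)"
    and "v \<in> X" "class_labels lab n v \<inter> Rich \<noteq> {}" "\<forall>w\<in>dst ` set q. class_labels lab n w \<inter> Rich = {}"
    and "reserved lab n X z b (set q)" and b: "b \<in> Rich" "b \<in> region_labels lab0 n X"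
  shows "\<exists>lab' n' X' z'. stuck lab' n' X' z' \<and> (next_rank lab0 n X z lab' n' X' z' \<or> next_region lab0 n X z lab' n' X' z'
     \<or> next_class lab0 n X z lab' n' X' z')"
  using assms(2-9)
proof (induction "length q" arbitrary: q v lab rule: less_induct)
  case less
  note I0 = stuckD(1)[OF B0]
  have B: "stuck lab n X z" by (rule stuck_steps[OF B0 less.prems(1)])
  note W1 = less.prems(2) and QA = less.prems(3) and D = less.prems(4) and vX = less.prems(5)
    and vR = less.prems(6) and qP = less.prems(7) and R = less.prems(8)
  have zP: "class_labels lab n z \<inter> Rich = {}" using stuckD(4,5,8)[OF B] unfolding class_labels_def by auto
  then have "q \<noteq> []" using W1 vR by auto
  then obtain a q' where q: "q = a # q'" by (cases q) auto
  have va: "src a = v" using W1 q by simp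
  have qprop: "c \<in> A1 \<and> lab c = None \<and> N (dst c) = n \<and> dst c \<in> X \<and> src c \<in> X \<and> dst c \<in> W \<and> labels_at lab (dst c) \<inter> Rich = {}
     \<and> Sb (dst c) \<inter> Rich = {}" if c: "c \<in> set q" for c
  proof -
    have 1: "c \<in> A1" "lab c = None" "N (dst c) = n" "dst c \<in> X" "src c \<in> X" using QA c unfolding tok.inner_arcs_def class_arcs_def by auto
    have 2: "dst c \<in> W" using A1[OF 1(1)] by blast
    have "class_labels lab n (dst c) \<inter> Rich = {}" using qP c by blast
    then have "labels_at lab (dst c) \<inter> Rich = {}" using 1 2 unfolding class_labels_def by simp
    then show ?thesis using 1 2 unfolding labels_at_def by blast
  qed
  have nsub: "N v \<subseteq> n" using N_mono[of a] qprop[of a] q va by auto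
  have vDW: "v \<in> Done \<union> W" using A1[of a] qprop[of a] q va by auto
  \<comment> \<open>A rich label that \<open>v\<close> offers in the network must become actually
    present at \<open>v\<close>. In the class of \<open>n\<close> it is; at a completed vertex this
    holds because the poor labels form a flat; at a vertex of smaller flat it is achieved by steps
    that leave the network of \<open>n\<close> unchanged, unless \<open>v\<close> is stuck
    there.\<close>
  have "(\<exists>lab1. steps n X lab lab1 \<and> class_arcs lab1 n = class_arcs lab n \<and> class_labels lab1 n = class_labels lab n \<and> class_tokens lab1 n = class_tokens lab n \<and> labels_at lab1 v \<inter> Rich \<noteq> {})
     \<or> (\<exists>n'. stuck lab n' UNIV v \<and> n' \<subset> n)"
  proof -
    consider (cls) "v \<in> W" "N v = n" | (dn) "v \<in> Done" | (low) "v \<in> W" "N v \<subset> n" using vDW nsub by blast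
    then show ?thesis
    proof cases
      case cls
      then have "labels_at lab v \<inter> Rich \<noteq> {}" using vR unfolding class_labels_def by simp
      then show ?thesis by blast
    next
      case dn
      then have "N v \<inter> Rich \<noteq> {}" using vR disj nsub unfolding class_labels_def by (auto split: if_splits)
      then have "Sb v \<inter> Rich \<noteq> {}" using Done_spans[OF dn] rich_cl[of _ "Sb v"] by blast
      then have "labels_at lab v \<inter> Rich \<noteq> {}" unfolding labels_at_def by blast
      then show ?thesis by blast
    next
      case low
      then have "N v \<inter> Rich \<noteq> {}" using vR nsub unfolding class_labels_def by (auto split: if_splits)
      moreover have "N v \<subseteq> lc (region_labels lab (N v) UNIV)" using stuckD(1)[OF B] low unfolding feasible_def region_labels_def by blast
      ultimately have r: "region_labels lab (N v) UNIV \<inter> Rich \<noteq> {}" using rich_cl[of _ "region_labels lab (N v) UNIV"] by blast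
      show ?thesis
      proof (cases "stuck lab (N v) UNIV v")
        case True then show ?thesis using low by blast
      next
        case False
        then obtain lab1 where l: "steps (N v) UNIV lab lab1" "labels_at lab1 v \<inter> Rich \<noteq> {}"
          unfolding stuck_def using stuckD(1)[OF B] region_feasible_UNIV low r by blast
        then show ?thesis using steps_lower[OF l(1) low(2), of X] by blast
      qed
    qed
  qed
  then show ?case
  proof (elim disjE exE conjE)
    fix n' assume Bv: "stuck lab n' UNIV v" and n': "n' \<subset> n"
    have "Sb v \<inter> Rich = {}" "v \<in> W" using stuckD(4,8)[OF Bv] unfolding labels_at_def by auto
    then have "poor_path v q z" using \<open>q \<noteq> []\<close> W1 D qprop unfolding poor_path_def tok.pverts_def by auto
    moreover have "dst ` set q \<subseteq> {v \<in> X. N v = n}" using qprop by auto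
    ultimately have "next_class lab0 n X z lab n' UNIV v" using n' unfolding next_class_def by blast
    then show ?thesis using Bv by blast
  next
    fix lab1 assume s1: "steps n X lab lab1" and NAe: "class_arcs lab1 n = class_arcs lab n" and NLe: "class_labels lab1 n = class_labels lab n"
      and NTe: "class_tokens lab1 n = class_tokens lab n" and vr: "labels_at lab1 v \<inter> Rich \<noteq> {}"
    have s01: "steps n X lab0 lab1" using less.prems(1) s1 by (rule rtranclp_trans)
    have B1: "stuck lab1 n X z" by (rule stuck_steps[OF B s1])
    note I1 = stuckD(1)[OF B1] and G1 = stuckD(2)[OF B1]
    obtain i where i: "i \<in> labels_at lab1 v" "i \<in> Rich" using vr by blast
    let ?h = "dst a"
    have aq: "a \<in> set q" using q by simp
    have hW: "?h \<in> W" "?h \<in> X" "N ?h = n" using qprop[OF aq] by auto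
    have "class_labels lab1 n ?h \<inter> Rich = {}" using qP aq NLe by auto
    then have "labels_at lab1 ?h \<inter> Rich = {}" using hW unfolding class_labels_def by simp
    then have "i \<notin> lc (labels_at lab1 ?h)" using poor_cl i by blast
    moreover have "a \<in> class_arcs lab1 n" using QA aq NAe unfolding tok.inner_arcs_def by auto
    ultimately have e: "ext lab1 a i" using i va unfolding ext_def class_arcs_def by auto
    have R1: "reserved lab1 n X z b (set q)" using R unfolding reserved_def NAe NTe .
    have small1: "rank_at_most lab0 n X c \<Longrightarrow> rank_at_most lab1 n X c" for c using steps_rank_at_most[OF s01 I0] by blast
    let ?A = "region_arcs lab1 n X" and ?T = "region_tokens lab1 n X"
    show ?thesis
    proof (cases "tok.ok (?A - {a}) (tok.add_token ?T ?h (Inl i)) ?h")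
      case True
      let ?l = "lab1(a \<mapsto> i)"
      have eq: "tok.inner_arcs (class_arcs lab1 n - {a}) X = ?A - {a}"
        "tok.inner_tokens (class_arcs lab1 n - {a}) (tok.add_token (class_tokens lab1 n) ?h (Inl i)) X = tok.add_token ?T ?h (Inl i)"
        using tok.inner_add_token[of a X] vX va hW by auto
      have G2: "region_feasible ?l n X"
        by (rule region_feasible_upd[OF e I1 G1 hW(3)]) (use vX va hW True in \<open>auto simp: tok.sub_ok_def eq\<close>)
      have "feasible ?l" by (rule feasible_of_region[OF e I1]) (use vX va hW G2 in auto)
      then have "step n X lab1 ?l" unfolding step_def using e i G2 hW vX va by blast
      then have s2: "steps n X lab0 ?l" using s01 by (rule rtranclp.rtrancl_into_rtrancl[rotated])
      have req: "region_arcs ?l n X = ?A - {a}" "region_tokens ?l n X = tok.add_token ?T ?h (Inl i)"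
        using hW by (simp_all add: class_arcs_upd[OF e] class_tokens_upd[OF e] eq)
      have aq': "a \<notin> set q'" using D q by auto
      have 1: "tok.walk ?h q' z" using W1 q by simp
      have 2: "set q' \<subseteq> region_arcs ?l n X" unfolding req using QA aq' q NAe by auto
      have 3: "distinct (?h # map dst q')" using D q by simp
      have 4: "class_labels ?l n ?h \<inter> Rich \<noteq> {}" using hW i by (auto simp: class_labels_upd[OF e])
      have 5: "\<forall>w\<in>dst ` set q'. class_labels ?l n w \<inter> Rich = {}"
      proof
        fix w assume w: "w \<in> dst ` set q'"
        have "?h \<notin> dst ` set q'" using 3 by simp
        then have "w \<noteq> ?h" using w by metis
        then show "class_labels ?l n w \<inter> Rich = {}" using qP w q NLe by (auto simp: class_labels_upd[OF e])
      qed
      \<comment> \<open>The same family works: the arc \<open>a\<close> had been set aside, and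
        \<open>i\<close> is already spanned.\<close>
      have 6: "reserved ?l n X z b (set q')"
      proof -
        obtain B' U P where c: "tok.complete (?A - set q) (tok.add_token ?T z (Inl b)) z B' U P"
          using R1 unfolding reserved_def tok.ok_def by blast
        have iT: "Inl i \<in> ?T v" using ext_class_labels_src[OF e I1] hW va vX unfolding tok.inner_tokens_def class_tokens_def by auto
        have "Inl i \<in> tok.toks (tok.add_token ?T z (Inl b))" using tok.toksI[of "Inl i" ?T v] iT by (simp add: tok.toks_add_token)
        then have iB: "Inl i \<in> token_cl B'" using tok.completeD(4)[OF c] by blast
        have "tok.complete (?A - {a} - set q') (tok.add_token (tok.add_token ?T ?h (Inl i)) z (Inl b)) z B' U P"
        proof -
          have "?A - {a} - set q' = ?A - set q" using q by auto
          moreover have "tok.fam (?A - set q) (tok.add_token (tok.add_token ?T ?h (Inl i)) z (Inl b)) B' U P"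
            using tok.completeD(1)[OF c] unfolding tok.fam_def tok.add_token_def by auto
          moreover have "tok.toks (tok.add_token (tok.add_token ?T ?h (Inl i)) z (Inl b)) \<subseteq> token_cl B'"
            using tok.completeD(4)[OF c] iB by (auto simp: tok.toks_add_token)
          ultimately show ?thesis using tok.completeD(2,3)[OF c] unfolding tok.complete_def by simp
        qed
        then show ?thesis unfolding reserved_def req by (rule tok.okI)
      qed
      show ?thesis by (rule less.hyps[OF _ s2 1 2 3 hW(2) 4 5 6]) (simp add: q)
    next
      case False
      obtain Y where Y: "Y \<subseteq> X" "?h \<in> Y" "src a \<notin> Y" "region_feasible lab1 n Y" "i \<in> lc (region_labels lab1 n Y)"
        "\<And>c. rank_at_most lab1 n X c \<Longrightarrow> rank_at_most lab1 n Y c"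
        "\<And>Q z b. a \<in> Q \<Longrightarrow> reserved lab1 n X z b Q \<Longrightarrow> z \<in> Y \<Longrightarrow> b \<notin> lc (region_labels lab1 n Y)"
        using obstruction_region[OF I1 G1 e hW(3) _ hW(2) False] vX va by blast
      have YR: "region_labels lab1 n Y \<inter> Rich \<noteq> {}" by (rule rich_cl[OF Y(5) i(2)])
      have smY: "\<forall>c. rank_at_most lab0 n X c \<longrightarrow> rank_at_most lab1 n Y c" using small1 Y(6) by blast
      show ?thesis
      proof (cases "z \<in> Y")
        case True
        have "stuck lab1 n Y z" unfolding stuck_def
        proof (intro conjI allI impI)
          fix l assume "steps n Y lab1 l"
          then have "steps n X lab1 l" using steps_lift[OF _ I1 G1 Y(1)] by blast
          then show "labels_at l z \<inter> Rich = {}" by (rule stuckD(7)[OF B1])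
        qed (use I1 Y True stuckD[OF B1] YR in auto)
        moreover have "b \<notin> lc (region_labels lab1 n Y)" by (rule Y(7)[OF aq R1 True])
        ultimately show ?thesis using s01 Y(1) smY b unfolding next_rank_def by blast
      next
        case False
        \<comment> \<open>\<open>q\<close> meets \<open>Y\<close> in the head of its first arc.
          After its last vertex \<open>z'\<close> in \<open>Y\<close> it stays outside, where steps
          inside \<open>Y\<close> change neither arcs nor labels of the network.\<close>
        have "?h \<in> tok.pverts v q" using aq unfolding tok.pverts_def by auto
        then obtain q1 q2 z' where s: "q = q1 @ q2" "tok.walk v q1 z'" "tok.walk z' q2 z" "z' \<in> Y" "dst ` set q2 \<inter> Y = {}"
          using last_visit[OF W1, of Y] Y(2) by blast
        have q1: "q1 \<noteq> []" using s(2,4) Y(3) va by auto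
        have q2: "q2 \<noteq> []" using s(3,4) False by auto
        have "z' = dst (last q1)" by (rule tok.walk_last[OF s(2) q1])
        moreover have "last q1 \<in> set q" using q1 s(1) by simp
        ultimately obtain c where c: "c \<in> set q" "z' = dst c" by blast
        note pc = qprop[OF c(1), folded c(2)]
        have Dq2: "distinct (z' # map dst q2)"
        proof -
          have "distinct (map dst q1 @ map dst q2)" using D s(1) by simp
          moreover have "z' \<in> set (map dst q1)" using \<open>z' = dst (last q1)\<close> q1 by auto
          ultimately show ?thesis by auto
        qed
        show ?thesis
        proof (cases "stuck lab1 n Y z'")
          case True
          have "poor_path z' q2 z" using q2 s Dq2 qprop pc unfolding poor_path_def tok.pverts_def by auto
          moreover have "tok.pverts z' q2 \<subseteq> {v \<in> X. N v = n}" using qprop pc s(1) unfolding tok.pverts_def by auto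
          moreover have "\<exists>a\<in>class_arcs lab1 n. dst a \<in> Y \<and> src a \<in> X - Y"
            using \<open>a \<in> class_arcs lab1 n\<close> Y vX va by blast
          ultimately have "next_region lab0 n X z lab1 n Y z'" unfolding next_region_def using Y(1) s01 smY s(5) by blast
          then show ?thesis using True by blast
        next
          case nb: False
          have "\<not> (\<forall>l. steps n Y lab1 l \<longrightarrow> labels_at l z' \<inter> Rich = {})"
            using nb I1 Y(4) s(4) pc YR unfolding stuck_def by simp
          then obtain l where l: "steps n Y lab1 l" "labels_at l z' \<inter> Rich \<noteq> {}" by blast
          have sl: "steps n X lab1 l" using steps_lift[OF l(1) I1 G1 Y(1)] by blast
          have s2: "steps n X lab0 l" by (rule rtranclp_trans[OF s01 sl])
          note k = steps_keeps[OF l(1) I1]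
          have 2: "set q2 \<subseteq> region_arcs l n X"
          proof
            fix c assume c: "c \<in> set q2"
            then have "c \<in> region_arcs lab n X" "dst c \<notin> Y" using QA s(1,5) by auto
            then show "c \<in> region_arcs l n X" using k NAe unfolding tok.inner_arcs_def by auto
          qed
          have 4: "class_labels l n z' \<inter> Rich \<noteq> {}" using l(2) pc unfolding class_labels_def by simp
          have 5: "\<forall>w\<in>dst ` set q2. class_labels l n w \<inter> Rich = {}"
          proof
            fix w assume w: "w \<in> dst ` set q2"
            then have "w \<notin> Y" using s(5) by blast
            then have "class_labels l n w = class_labels lab n w" using k NLe by simp
            then show "class_labels l n w \<inter> Rich = {}" using qP w s(1) by auto
          qed
          have "reserved lab1 n X z b (set q2)"
          proof -
            obtain B' U P where c: "tok.complete (?A - set q) (tok.add_token ?T z (Inl b)) z B' U P"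
              using R1 unfolding reserved_def tok.ok_def by blast
            then have "tok.complete (?A - set q2) (tok.add_token ?T z (Inl b)) z B' U P"
              using s(1) unfolding tok.complete_def tok.fam_def by auto
            then show ?thesis unfolding reserved_def by (rule tok.okI)
          qed
          moreover have "\<forall>a\<in>set q2. dst a \<notin> Y" using s(5) by blast
          ultimately have 6: "reserved l n X z b (set q2)" using steps_reserved[OF l(1) I1 Y(1) False] by blast
          have zX: "z' \<in> X" using s(4) Y(1) by blast
          show ?thesis
            by (rule less.hyps[OF _ s2 s(3) 2 Dq2 zX 4 5 6]) (use s(1) q1 in simp)
        qed
      qed
    qed
  qed
qed

text \<open>A complete family at \<open>z\<close> inside \<open>X\<close> has a rich member
  \<open>b\<close>, since the poor labels form a flat. The route for \<open>follow\<close> is a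
  shortest walk to \<open>z\<close> from a vertex offering a rich label, along arcs of the trail of
  \<open>b\<close>; minimality excludes repetitions and further rich labels on the way.\<close>

lemma exists_next:
  assumes B: "stuck lab n X z"
  shows "\<exists>lab' n' X' z'. stuck lab' n' X' z' \<and> (next_rank lab n X z lab' n' X' z' \<or> next_region lab n X z lab' n' X' z'
     \<or> next_class lab n X z lab' n' X' z')"
proof -
  let ?A = "region_arcs lab n X" and ?T = "region_tokens lab n X"
  have "tok.sub_ok (class_arcs lab n) (class_tokens lab n) X z" using stuckD(2-5)[OF B] unfolding region_feasible_def by blast
  then obtain BB U P where c: "tok.complete ?A ?T z BB U P" unfolding tok.sub_ok_def tok.ok_def by blast
  obtain r where r: "r \<in> region_labels lab n X" "r \<in> Rich" using stuckD(6)[OF B] by blast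
  have "Inl r \<in> token_cl BB" using tok.completeD(4)[OF c] r(1) unfolding toks_region_tokens by blast
  then have "r \<in> lc (Inl -` BB)" by (simp add: Inl_token_cl)
  then obtain b where b: "Inl b \<in> BB" "b \<in> Rich" using rich_cl[OF _ r(2)] by blast
  note F = tok.completeD(1)[OF c]
  let ?v0 = "U (Inl b)" and ?p0 = "P (Inl b)"
  have "Inl b \<in> ?T ?v0" using tok.famD(1)[OF F b(1)] .
  then have v0: "?v0 \<in> X" "b \<in> class_labels lab n ?v0" unfolding tok.inner_tokens_def class_tokens_def by (auto split: if_splits)
  then have bL: "b \<in> region_labels lab n X" unfolding region_labels_def by blast
  have p0: "tok.walk ?v0 ?p0 z" by (rule tok.endsD[OF tok.completeD(2)[OF c] b(1)])
  let ?Pq = "\<lambda>q. \<exists>v. tok.walk v q z \<and> set q \<subseteq> set ?p0 \<and> v \<in> X \<and> class_labels lab n v \<inter> Rich \<noteq> {}"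
  have "?Pq ?p0" using p0 v0 b(2) by blast
  then obtain q where q: "?Pq q" and qmin: "\<And>q'. ?Pq q' \<Longrightarrow> length q \<le> length q'"
    using arg_min_natI[of ?Pq ?p0 length] arg_min_nat_le[of ?Pq _ length] by blast
  then obtain v where v: "tok.walk v q z" "set q \<subseteq> set ?p0" "v \<in> X" "class_labels lab n v \<inter> Rich \<noteq> {}" by blast
  have qA: "set q \<subseteq> ?A" using v(2) tok.famD(3)[OF F b(1)] by blast
  have later: "class_labels lab n w \<inter> Rich = {}" if w: "w \<in> dst ` set q" for w
  proof (rule ccontr)
    assume n: "class_labels lab n w \<inter> Rich \<noteq> {}"
    obtain d where d: "d \<in> set q" "w = dst d" using w by blast
    then obtain \<alpha> \<beta> where ab: "q = \<alpha> @ d # \<beta>" using split_list by metis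
    have "tok.walk w \<beta> z" using v(1) ab d(2) by (auto simp: arc_walk_append)
    moreover have "w \<in> X" using qA d unfolding tok.inner_arcs_def by blast
    moreover have "set \<beta> \<subseteq> set ?p0" using v(2) ab by auto
    ultimately have "length q \<le> length \<beta>" using n by (intro qmin) blast
    then show False using ab by simp
  qed
  have "distinct (map dst q)"
  proof (rule ccontr)
    assume "\<not> distinct (map dst q)"
    then obtain xs ys zs w where "map dst q = xs @ [w] @ ys @ [w] @ zs" using not_distinct_decomp by blast
    then have mq: "map dst q = xs @ w # (ys @ w # zs)" by simp
    obtain q1 c1 r where q1: "q = q1 @ c1 # r" "dst c1 = w" "map dst r = ys @ w # zs"
      using split_map[OF mq] by blast
    obtain q2 c2 q3 where q2: "r = q2 @ c2 # q3" "dst c2 = w"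
      using split_map[OF q1(3)] by blast
    have qq: "q = q1 @ c1 # q2 @ c2 # q3" "dst c1 = w" "dst c2 = w" using q1(1,2) q2 by simp_all
    have "tok.walk v (q1 @ c1 # q2 @ c2 # q3) z" using v(1) unfolding qq(1) .
    then have w12: "tok.walk v q1 (src c1)" "tok.walk (dst c2) q3 z" by (auto simp: arc_walk_append)
    have "dst c1 = dst c2" using qq(2,3) by (simp only:)
    then have "tok.walk v (q1 @ c1 # q3) z" using w12 tok.walk_append_iff[OF w12(1), of "c1 # q3" z] by simp
    moreover have "set (q1 @ c1 # q3) \<subseteq> set ?p0" using v(2) qq(1) by auto
    ultimately have "length q \<le> length (q1 @ c1 # q3)" using v(3,4) by (intro qmin) blast
    then show False using qq(1) by simp
  qed
  then have D: "distinct (v # map dst q)" using later v(4) by auto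
  have "reserved lab n X z b (set q)"
  proof -
    \<comment> \<open>With \<open>b\<close> placed at \<open>z\<close> itself its trail becomes
      empty, so the arcs of \<open>q\<close> can be set aside.\<close>
    let ?U = "U(Inl b := z)" and ?P = "P(Inl b := [])"
    have disj: "set (P t) \<inter> set q = {}" if t: "t \<in> BB" "t \<noteq> Inl b" for t
      using tok.fam_disj[OF F t(1) b(1) t(2)] v(2) by blast
    have "tok.fam (?A - set q) (tok.add_token ?T z (Inl b)) BB ?U ?P" unfolding tok.fam_def
    proof (intro conjI ballI impI)
      fix t assume t: "t \<in> BB"
      show "t \<in> tok.add_token ?T z (Inl b) (?U t)" using tok.famD(1)[OF F t] unfolding tok.add_token_def by auto
      show "distinct (?P t)" using tok.famD(2)[OF F t] by simp
      show "set (?P t) \<subseteq> ?A - set q" using tok.famD(3)[OF F t] disj[OF t] by auto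
      fix t' assume "t' \<in> BB" "t \<noteq> t'"
      then show "set (?P t) \<inter> set (?P t') = {}" using tok.fam_disj[OF F t] by auto
    qed
    moreover have "tok.ends BB ?U ?P z" using tok.completeD(2)[OF c] unfolding tok.ends_def by simp
    moreover have "tok.toks (tok.add_token ?T z (Inl b)) \<subseteq> token_cl BB"
      using tok.completeD(4)[OF c] tok.cl_extI[OF b(1)] by (simp add: tok.toks_add_token)
    ultimately have "tok.complete (?A - set q) (tok.add_token ?T z (Inl b)) z BB ?U ?P"
      using tok.completeD(3)[OF c] unfolding tok.complete_def by simp
    then show ?thesis unfolding reserved_def by (rule tok.okI)
  qed
  moreover have "\<forall>w\<in>dst ` set q. class_labels lab n w \<inter> Rich = {}" using later by blast
  ultimately show ?thesis using follow[OF B rtranclp.rtrancl_refl v(1) qA D v(3,4) _ _ b(2) bL] by blast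
qed

text \<open>In the case \<open>next_rank\<close> the label \<open>b\<close> leaves the span of the
  region, so the rank of the region's labels from the summand \<open>k0\<close> decreases; after
  finitely many repetitions another case must occur.\<close>

lemma exists_next_region_or_class:
  assumes "stuck lab n X z"
  shows "\<exists>lab' n' X' z'. stuck lab' n' X' z' \<and> (next_region lab n X z lab' n' X' z' \<or> next_class lab n X z lab' n' X' z')"
proof -
  obtain I where "I \<subseteq> {r \<in> region_labels lab n X. \<kappa> r = k0}" "indep I" "finite I" "{r \<in> region_labels lab n X. \<kappa> r = k0} \<subseteq> lc I"
    by (rule ex_max_indep_summand[of "{r \<in> region_labels lab n X. \<kappa> r = k0}" k0]) auto
  then show ?thesis using assms
  proof (induction "card I" arbitrary: I lab X rule: less_induct)
    case less
    obtain lab1 n1 X1 z1 where 1: "stuck lab1 n1 X1 z1"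
      "next_rank lab n X z lab1 n1 X1 z1 \<or> next_region lab n X z lab1 n1 X1 z1 \<or> next_class lab n X z lab1 n1 X1 z1"
      using exists_next[OF less.prems(5)] by blast
    show ?case
    proof (cases "next_rank lab n X z lab1 n1 X1 z1")
      case False then show ?thesis using 1 by blast
    next
      case True
      then obtain b where A: "n1 = n" "z1 = z" "X1 \<subseteq> X" "steps n X lab lab1" "\<forall>c. rank_at_most lab n X c \<longrightarrow> rank_at_most lab1 n X1 c"
        "b \<in> Rich" "b \<in> region_labels lab n X" "b \<notin> lc (region_labels lab1 n X1)" unfolding next_rank_def by blast
      have B1: "stuck lab1 n X1 z" using 1(1) A by simp
      obtain I1 where I1: "I1 \<subseteq> {r \<in> region_labels lab1 n X1. \<kappa> r = k0}" "indep I1" "finite I1" "{r \<in> region_labels lab1 n X1. \<kappa> r = k0} \<subseteq> lc I1"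
        by (rule ex_max_indep_summand[of "{r \<in> region_labels lab1 n X1. \<kappa> r = k0}" k0]) auto
      have "region_labels lab1 n X1 \<subseteq> region_labels lab1 n X" using A(3) unfolding region_labels_def by blast
      then have sub: "region_labels lab1 n X1 \<subseteq> region_labels lab n X" using steps_keeps[OF A(4) stuckD(1)[OF less.prems(5)]] by simp
      have bI: "b \<notin> lc I1" using A(8) I1(1) cl_mono[of I1 "region_labels lab1 n X1"] by blast
      have "insert b I1 \<subseteq> lc I" using A(6,7) rich_summand I1(1) sub less.prems(4) by blast
      moreover have "indep (insert b I1)" using I1(2) bI by (rule indep_insert)
      ultimately have "card (insert b I1) \<le> card I" using steinitz[OF less.prems(3)] by blast
      moreover have "b \<notin> I1" using bI cl_extI[of b I1] by blast
      ultimately have "card I1 < card I" using I1(3) by simp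
      then obtain lab' n' X' z' where 2: "stuck lab' n' X' z'" "next_region lab1 n X1 z lab' n' X' z' \<or> next_class lab1 n X1 z lab' n' X' z'"
        using less.hyps[OF _ I1 B1] by blast
      have "next_region lab n X z lab' n' X' z' \<or> next_class lab n X z lab' n' X' z'"
        using 2(2)
      proof
        assume nb: "next_region lab1 n X1 z lab' n' X' z'"
        have I: "feasible lab" "region_feasible lab n X" using stuckD[OF less.prems(5)] by auto
        have "region_feasible lab1 n X" "feasible lab1" using steps_lift[OF A(4) I] by auto
        moreover have "steps n X1 lab1 lab'" using nb unfolding next_region_def by blast
        ultimately have "steps n X lab1 lab'" using steps_lift A(3) by blast
        then have "steps n X lab lab'" using A(4) by (meson rtranclp_trans)
        moreover have "n' = n" "X' \<subseteq> X" "\<forall>c. rank_at_most lab n X c \<longrightarrow> rank_at_most lab' n X' c"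
          using nb A(3,5) unfolding next_region_def by auto
        moreover have "\<exists>p. poor_path z' p z \<and> tok.pverts z' p \<subseteq> {v \<in> X. N v = n} \<and> dst ` set p \<inter> X' = {}"
        proof -
          obtain p where "poor_path z' p z" "tok.pverts z' p \<subseteq> {v \<in> X1. N v = n}" "dst ` set p \<inter> X' = {}"
            using nb unfolding next_region_def by blast
          then show ?thesis using A(3) by (intro exI[of _ p]) auto
        qed
        moreover obtain a where "a \<in> class_arcs lab' n" "dst a \<in> X'" "src a \<in> X1 - X'" using nb unfolding next_region_def by blast
        then have "\<exists>a\<in>class_arcs lab' n. dst a \<in> X' \<and> src a \<in> X - X'" using A(3) by blast
        ultimately show ?thesis unfolding next_region_def by simp
      next
        assume nc: "next_class lab1 n X1 z lab' n' X' z'"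
        then obtain p where "n' \<subset> n" "X' = UNIV" "poor_path z' p z" "dst ` set p \<subseteq> {v \<in> X1. N v = n}"
          unfolding next_class_def by blast
        moreover from this have "dst ` set p \<subseteq> {v \<in> X. N v = n}" using A(3) by blast
        ultimately show ?thesis unfolding next_class_def by blast
      qed
      then show ?thesis using 2(1) by blast
    qed
  qed
qed

end

section \<open>Infinite paths\<close>

text \<open>Dependent choice. The sets \<open>Om c\<close> decrease and each leaves out the
  preceding vertex, which makes the vertices distinct.\<close>

lemma infinite_path_by_arcs:
  fixes src dst :: "'a \<Rightarrow> 'v"
  assumes "Q cst"
    and nxt: "\<And>c. Q c \<Longrightarrow> y c \<in> Om c \<and> Pv (y c) \<and>
       (\<exists>c' a. Q c' \<and> a \<in> R \<and> src a = y c \<and> dst a = y c' \<and> Om c' \<subseteq> Om c \<and> y c \<notin> Om c')"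
  obtains x e where "inj x" "\<forall>n::nat. e n \<in> R \<and> src (e n) = x n \<and> dst (e n) = x (Suc n) \<and> Pv (x n)" "x 0 = y cst"
proof -
  let ?S = "\<lambda>c c'. \<exists>a. a \<in> R \<and> src a = y c \<and> dst a = y c' \<and> Om c' \<subseteq> Om c \<and> y c \<notin> Om c'"
  obtain f where f: "f 0 = cst" "\<And>n::nat. Q (f n)" "\<And>n. ?S (f n) (f (Suc n))"
  proof -
    have "\<exists>f. \<forall>n::nat. (Q (f n) \<and> (n = 0 \<longrightarrow> f n = cst)) \<and> ?S (f n) (f (Suc n))"
      by (rule dependent_nat_choice) (use assms in \<open>blast+\<close>)
    then show ?thesis using that by blast
  qed
  obtain e where e: "\<And>n. e n \<in> R \<and> src (e n) = y (f n) \<and> dst (e n) = y (f (Suc n))"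
    using f(3) by metis
  have dec: "Om (f (Suc n + k)) \<subseteq> Om (f (Suc n))" for n k
  proof (induction k)
    case (Suc k) then show ?case using f(3)[of "Suc n + k"] by auto
  qed simp
  have "y (f m) \<noteq> y (f n)" if mn: "m < n" for m n
  proof -
    obtain k where k: "n = Suc m + k" using mn less_iff_Suc_add by auto
    have "y (f n) \<in> Om (f n)" using nxt f(2) by blast
    then have "y (f n) \<in> Om (f (Suc m))" using dec[of m k] k by blast
    moreover have "y (f m) \<notin> Om (f (Suc m))" using f(3) by blast
    ultimately show ?thesis by metis
  qed
  then have "inj (\<lambda>n. y (f n))" by (metis injI linorder_neqE_nat)
  then show ?thesis using that[of "\<lambda>n. y (f n)" e] e nxt[OF f(2)] f(1) by blast
qed

text \<open>Reduction to single arcs: a refined state also records the vertex \<open>v\<close>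
  reached and the rest \<open>p\<close> of the current path, and its set consists of the vertices of
  this rest together with \<open>Om c'\<close>.\<close>

lemma infinite_path_by_paths:
  fixes src dst :: "'a \<Rightarrow> 'v"
  assumes Q0: "Q cst"
    and nxt: "\<And>c. Q c \<Longrightarrow> \<exists>c' p. Q c' \<and> p \<noteq> [] \<and> arc_walk src dst (y c) p (y c') \<and> set p \<subseteq> R \<and> distinct (y c # map dst p) \<and>
       insert (y c) (dst ` set (butlast p)) \<inter> Om c' = {} \<and> insert (y c) (dst ` set p) \<subseteq> Om c \<and> Om c' \<subseteq> Om c \<and>
       (\<forall>w\<in>insert (y c) (dst ` set p). Pv w)"
  obtains x e where "inj x" "\<forall>n::nat. e n \<in> R \<and> src (e n) = x n \<and> dst (e n) = x (Suc n) \<and> Pv (x n)" "x 0 = y cst"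
proof -
  define Qc where "Qc = (\<lambda>(c', p, v). Q c' \<and> p \<noteq> [] \<and> arc_walk src dst v p (y c') \<and> set p \<subseteq> R \<and> distinct (v # map dst p) \<and>
       insert v (dst ` set (butlast p)) \<inter> Om c' = {} \<and> (\<forall>w\<in>insert v (dst ` set p). Pv w))"
  define yc :: "'b \<times> 'a list \<times> 'v \<Rightarrow> 'v" where "yc = (\<lambda>(c', p, v). v)"
  define Oc where "Oc = (\<lambda>(c', p, v). insert v (dst ` set p) \<union> Om c')"
  obtain c1 p1 where start: "Q c1" "p1 \<noteq> []" "arc_walk src dst (y cst) p1 (y c1)" "set p1 \<subseteq> R" "distinct (y cst # map dst p1)"
    "insert (y cst) (dst ` set (butlast p1)) \<inter> Om c1 = {}" "\<forall>w\<in>insert (y cst) (dst ` set p1). Pv w"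
    using nxt[OF Q0] by blast
  have Qs: "Qc (c1, p1, y cst)" using start unfolding Qc_def by simp
  have "\<exists>c' a. Qc c' \<and> a \<in> R \<and> src a = yc c \<and> dst a = yc c' \<and> Oc c' \<subseteq> Oc c \<and> yc c \<notin> Oc c'" if Qcc: "Qc c" for c
  proof -
    obtain d p v where c: "c = (d, p, v)" by (cases c) auto
    have q: "Q d" "p \<noteq> []" "arc_walk src dst v p (y d)" "set p \<subseteq> R" "distinct (v # map dst p)"
      "insert v (dst ` set (butlast p)) \<inter> Om d = {}" "\<forall>w\<in>insert v (dst ` set p). Pv w"
      using Qcc unfolding c Qc_def by auto
    obtain a p2 where p: "p = a # p2" using q(2) by (cases p) auto
    show ?thesis
    proof (cases "p2 = []")
      \<comment> \<open>The current path ends with \<open>a\<close>; the next one is taken up at its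
        head.\<close>
      case True
      then have yd: "y d = dst a" "src a = v" "a \<in> R" using q(3,4) p by auto
      obtain d' p' where d: "Q d'" "p' \<noteq> []" "arc_walk src dst (y d) p' (y d')" "set p' \<subseteq> R" "distinct (y d # map dst p')"
        "insert (y d) (dst ` set (butlast p')) \<inter> Om d' = {}" "insert (y d) (dst ` set p') \<subseteq> Om d" "Om d' \<subseteq> Om d"
        "\<forall>w\<in>insert (y d) (dst ` set p'). Pv w"
        using nxt[OF q(1)] by blast
      have "Qc (d', p', y d)" using d unfolding Qc_def by simp
      moreover have "Oc (d', p', y d) \<subseteq> Om d" using d unfolding Oc_def by auto
      moreover have "v \<notin> Om d" using q(6) by blast
      ultimately show ?thesis using yd unfolding c yc_def Oc_def
        by (intro exI[of _ "(d', p', y d)"] exI[of _ a]) auto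
    next
      case False
      have "Qc (d, p2, dst a)" using q p False unfolding Qc_def by auto
      moreover have "src a = v" "a \<in> R" using q(3,4) p by auto
      moreover have "v \<notin> insert (dst a) (dst ` set p2)" using q(5) p by simp
      moreover have "v \<notin> Om d" using q(6) by blast
      ultimately show ?thesis using p unfolding c yc_def Oc_def
        by (intro exI[of _ "(d, p2, dst a)"] exI[of _ a]) auto
    qed
  qed
  moreover have "yc c \<in> Oc c" "Pv (yc c)" if "Qc c" for c using that unfolding Qc_def yc_def Oc_def by (auto split: prod.splits)
  ultimately have "\<And>c. Qc c \<Longrightarrow> yc c \<in> Oc c \<and> Pv (yc c) \<and>
     (\<exists>c' a. Qc c' \<and> a \<in> R \<and> src a = yc c \<and> dst a = yc c' \<and> Oc c' \<subseteq> Oc c \<and> yc c \<notin> Oc c')" by blast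
  then obtain x e where x: "inj x" "\<forall>n::nat. e n \<in> R \<and> src (e n) = x n \<and> dst (e n) = x (Suc n) \<and> Pv (x n)" "x 0 = yc (c1, p1, y cst)"
    using infinite_path_by_arcs[where Q = Qc and cst = "(c1, p1, y cst)" and y = yc and Om = Oc and Pv = Pv and R = R and src = src and dst = dst, OF Qs]
    by blast
  have "x 0 = y cst" using x(3) unfolding yc_def by simp
  with x(1,2) show ?thesis by (rule that)
qed

context phase
begin

lemma tok_indep_Inl:
  assumes "indep J"
  shows "tok.indep (Inl ` J)"
  unfolding tok.indep_def
proof
  fix t :: "'s + 'a" assume "t \<in> Inl ` J"
  then obtain j where j: "t = Inl j" "j \<in> J" by blast
  have "Inl -` (Inl ` J - {t}) = J - {j}" using j by auto
  then show "t \<notin> token_cl (Inl ` J - {t})" using j assms by (simp add: Inl_token_cl indep_def)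
qed

end

context rich_phase
begin

section \<open>Excluding stuck vertices under (B)\<close>

lemma region_labels_N: "feasible lab \<Longrightarrow> region_labels lab n X \<subseteq> n"
  unfolding region_labels_def using class_labels_N by blast

lemma stuck_rich: "stuck lab n X z \<Longrightarrow> n \<inter> Rich \<noteq> {}"
  using region_labels_N stuckD(1,6) by blast

text \<open>The poor paths are joined, each traversed backwards. The resulting path has no rich
  root, although by \<open>bk\<close> its roots span the flat of its first vertex, which contains a
  rich label; the poor labels being a flat, this is impossible.\<close>

lemma no_stuck_backward:
  assumes bk: "\<And>x e. inj x \<Longrightarrow> (\<And>m::nat. e m \<in> A1 \<and> dst (e m) = x m \<and> src (e m) = x (Suc m)) \<Longrightarrow>
      (\<And>m. x m \<in> W) \<Longrightarrow> N (x 0) \<subseteq> lc (\<Union>m. Sb (x m))"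
  shows "\<not> stuck lab n X z"
proof
  assume B: "stuck lab n X z"
  define Q where "Q = (\<lambda>(lab, n, X, z). stuck lab n X z)"
  define y :: "('a \<Rightarrow> 's option) \<times> 's set \<times> 'v set \<times> 'v \<Rightarrow> 'v" where "y = (\<lambda>(lab, n, X, z). z)"
  \<comment> \<open>The vertices still available: those of smaller flat anywhere, and those of the
    same flat inside the region. Either way of moving on shrinks this set and excludes the path just
    used, except for its new end \<open>z'\<close>.\<close>
  define Om :: "('a \<Rightarrow> 's option) \<times> 's set \<times> 'v set \<times> 'v \<Rightarrow> 'v set" where
    "Om = (\<lambda>(lab, n, X, z). {v \<in> W. N v \<subset> n} \<union> {v \<in> W. N v = n \<and> v \<in> X})"
  have Q0: "Q (lab, n, X, z)" using B unfolding Q_def by simp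
  have nx: "\<exists>c' p. Q c' \<and> p \<noteq> [] \<and> arc_walk dst src (y c) p (y c') \<and> set p \<subseteq> A1 \<and> distinct (y c # map src p) \<and>
       insert (y c) (src ` set (butlast p)) \<inter> Om c' = {} \<and> insert (y c) (src ` set p) \<subseteq> Om c \<and> Om c' \<subseteq> Om c \<and>
       (\<forall>w\<in>insert (y c) (src ` set p). w \<in> W \<and> Sb w \<inter> Rich = {})" if Qc: "Q c" for c
  proof -
    obtain lab n X z where c: "c = (lab, n, X, z)" by (cases c) auto
    have B: "stuck lab n X z" using Qc unfolding c Q_def by simp
    obtain lab' n' X' z' where nb: "stuck lab' n' X' z'" "next_region lab n X z lab' n' X' z' \<or> next_class lab n X z lab' n' X' z'"
      using exists_next_region_or_class[OF B] by blast
    obtain p where p: "poor_path z' p z" "dst ` set p \<subseteq> {v \<in> X. N v = n}"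
      "dst ` set p \<inter> Om (lab', n', X', z') = {}" "z' \<in> Om c" "Om (lab', n', X', z') \<subseteq> Om c"
    proof -
      have z': "z' \<in> W" "z' \<in> X'" "N z' = n'" using stuckD[OF nb(1)] by auto
      show ?thesis using nb(2)
      proof
        assume b: "next_region lab n X z lab' n' X' z'"
        then obtain p where p: "poor_path z' p z" "tok.pverts z' p \<subseteq> {v \<in> X. N v = n}" "dst ` set p \<inter> X' = {}"
          unfolding next_region_def by blast
        have "n' = n" "X' \<subseteq> X" using b unfolding next_region_def by auto
        then show ?thesis using that[OF p(1)] p(2,3) z' unfolding tok.pverts_def c Om_def by blast
      next
        assume b: "next_class lab n X z lab' n' X' z'"
        then obtain p where p: "poor_path z' p z" "dst ` set p \<subseteq> {v \<in> X. N v = n}"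
          unfolding next_class_def by blast
        have "n' \<subset> n" using b unfolding next_class_def by auto
        then show ?thesis using that[OF p(1,2)] p(2) z' unfolding c Om_def by blast
      qed
    qed
    have pp: "p \<noteq> []" "arc_walk src dst z' p z" "set p \<subseteq> A1" "distinct (z' # map dst p)"
      "\<forall>w\<in>insert z' (dst ` set p). w \<in> W \<and> Sb w \<inter> Rich = {}"
      using p(1) unfolding poor_path_def tok.pverts_def by auto
    have ml: "map src p @ [z] = z' # map dst p" by (rule arc_walk_vertices[OF pp(2)])
    have 1: "z # map src (rev p) = rev (z' # map dst p)" unfolding ml[symmetric] by (simp add: rev_map)
    obtain a p2 where ap: "p = a # p2" using pp(1) by (cases p) auto
    have "map src p2 @ [z] = map dst p" using ml ap by simp
    then have "set (map src p2 @ [z]) = set (map dst p)" by (simp only:)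
    then have 2: "insert z (src ` set p2) = dst ` set p" by simp
    have "set (map src p @ [z]) = set (z' # map dst p)" using ml by (simp only:)
    then have 3: "insert z (src ` set p) = insert z' (dst ` set p)" by simp
    let ?c = "(lab', n', X', z')"
    have "Q ?c" using nb(1) unfolding Q_def by simp
    moreover have "arc_walk dst src (y c) (rev p) (y ?c)" using arc_walk_rev[OF pp(2)] unfolding c y_def by simp
    moreover have "distinct (y c # map src (rev p))" unfolding c y_def using 1 pp(4) by (metis case_prod_conv distinct_rev)
    moreover have "insert (y c) (src ` set (butlast (rev p))) = dst ` set p" using 2 ap unfolding c y_def by simp
    moreover have "insert (y c) (src ` set (rev p)) = insert z' (dst ` set p)" using 3 unfolding c y_def by simp
    moreover have "dst ` set p \<subseteq> Om c" using p(2) pp(5) unfolding c Om_def by auto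
    ultimately show ?thesis using p pp(1,3,5) by (intro exI[of _ ?c] exI[of _ "rev p"]) simp
  qed
  obtain x e where x: "inj x" "\<And>m::nat. e m \<in> A1 \<and> dst (e m) = x m \<and> src (e m) = x (Suc m) \<and> (x m \<in> W \<and> Sb (x m) \<inter> Rich = {})"
    "x 0 = y (lab, n, X, z)"
    using infinite_path_by_paths[where Q = Q and cst = "(lab, n, X, z)" and y = y and Om = Om and src = dst and dst = src
        and R = A1 and Pv = "\<lambda>w. w \<in> W \<and> Sb w \<inter> Rich = {}", OF Q0 nx] by blast
  have "N (x 0) \<subseteq> lc (\<Union>m. Sb (x m))" by (rule bk[OF x(1)]) (use x(2) in auto)
  moreover have "N (x 0) = n" using stuckD(5)[OF B] x(3) unfolding y_def by simp
  moreover have "(\<Union>m. Sb (x m)) \<inter> Rich = {}" using x(2) by blast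
  ultimately show False using poor_cl stuck_rich[OF B] by blast
qed

section \<open>Excluding stuck vertices under (F)\<close>

lemma rank_at_most_UNIV:
  assumes I: "feasible lab" and J: "indep J" "finite J" "n \<subseteq> lc J"
  shows "rank_at_most lab n UNIV (card J)"
proof -
  have "tok.indep (Inl ` J)" by (rule tok_indep_Inl[OF J(1)])
  moreover have "tok.toks (region_tokens lab n UNIV) \<subseteq> token_cl (Inl ` J)"
  proof -
    have "Inl -` (Inl ` J :: ('s + 'a) set) = J" by auto
    then have "Inl ` region_labels lab n UNIV \<subseteq> token_cl (Inl ` J :: ('s + 'a) set)" using region_labels_N[OF I, of n UNIV] J(3) by (auto simp: Inl_token_cl)
    moreover have "tok.gates (class_arcs lab n) UNIV = {}" unfolding tok.gates_def by auto
    ultimately show ?thesis unfolding toks_region_tokens by simp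
  qed
  moreover have "card (Inl ` J :: ('s + 'a) set) \<le> card J" using J(2) by (rule card_image_le)
  ultimately show ?thesis unfolding rank_at_most_def using J(2) by blast
qed

lemma rank_at_most_gates:
  assumes "rank_at_most lab n X c"
  shows "finite (tok.gates (class_arcs lab n) X)" "card (tok.gates (class_arcs lab n) X) \<le> c"
proof -
  obtain J where J: "finite J" "card J \<le> c" "tok.toks (region_tokens lab n X) \<subseteq> token_cl J" using assms unfolding rank_at_most_def by blast
  have "Inr ` tok.gates (class_arcs lab n) X \<subseteq> J" using J(3) unfolding toks_region_tokens by (auto simp: Inr_token_cl)
  then have 1: "finite (Inr ` tok.gates (class_arcs lab n) X :: ('s + 'a) set)" "card (Inr ` tok.gates (class_arcs lab n) X :: ('s + 'a) set) \<le> card J"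
    using J(1) finite_subset card_mono by blast+
  have i: "inj_on (Inr :: 'a \<Rightarrow> 's + 'a) (tok.gates (class_arcs lab n) X)" by simp
  show "finite (tok.gates (class_arcs lab n) X)" using 1(1) finite_imageD[OF _ i] by blast
  show "card (tok.gates (class_arcs lab n) X) \<le> c" using 1(2) card_image[OF i] J(2) by simp
qed

text \<open>If the labels of the region span the flat, then a gate would raise the rank above that of the flat.\<close>

lemma rank_at_most_no_gate:
  assumes s: "rank_at_most lab n X (card J)" and J: "indep J" "finite J" "J \<subseteq> lc (region_labels lab n X)"
  shows "tok.gates (class_arcs lab n) X = {}"
proof (rule ccontr)
  assume "tok.gates (class_arcs lab n) X \<noteq> {}"
  then obtain e where e: "e \<in> tok.gates (class_arcs lab n) X" by blast
  obtain K where K: "finite K" "card K \<le> card J" "tok.toks (region_tokens lab n X) \<subseteq> token_cl K" using s unfolding rank_at_most_def by blast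
  let ?I = "insert (Inr e) (Inl ` J)"
  have "tok.indep ?I" unfolding tok.indep_def
  proof
    fix t assume "t \<in> ?I"
    then consider "t = Inr e" | j where "t = Inl j" "j \<in> J" by blast
    then show "t \<notin> token_cl (?I - {t})"
    proof cases
      case 1 then show ?thesis by (auto simp: Inr_token_cl)
    next
      case (2 j)
      have "Inl -` (?I - {t}) = J - {j}" using 2 by auto
      then show ?thesis using 2 J(1) by (simp add: Inl_token_cl indep_def)
    qed
  qed
  moreover have "?I \<subseteq> token_cl K"
  proof -
    have "Inr e \<in> token_cl K" using e K(3) unfolding toks_region_tokens by blast
    moreover have "Inl j \<in> token_cl K" if j: "j \<in> J" for j
    proof -
      have "region_labels lab n X \<subseteq> Inl -` token_cl K" using K(3) unfolding toks_region_tokens by blast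
      then have "region_labels lab n X \<subseteq> lc (Inl -` K)" unfolding vimage_Inl_token_cl .
      then have "lc (region_labels lab n X) \<subseteq> lc (Inl -` K)" by (rule cl_least)
      then show ?thesis using j J(3) by (auto simp: Inl_token_cl)
    qed
    ultimately show ?thesis by blast
  qed
  ultimately have "card ?I \<le> card K" using tok.steinitz[OF K(1)] by blast
  moreover have "card ?I = Suc (card J)" using J(2) by (subst card_insert_disjoint) (auto simp: card_image)
  ultimately show False using K(2) by simp
qed

text \<open>\<open>Ga k\<close> are the gates of the \<open>k\<close>-th region that remain gates of all later regions; from some \<open>K\<close>
  on there are no new ones. A trail starting at another gate leads, through each region in turn, to a gate of
  the next region, which again does not stay forever.\<close>

lemma no_stuck_chain:
  assumes fwd: "\<And>x e. inj x \<Longrightarrow> (\<And>m::nat. e m \<in> A1 \<and> src (e m) = x m \<and> dst (e m) = x (Suc m)) \<Longrightarrow>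
      (\<And>m. x m \<in> W \<and> N (x m) = n) \<Longrightarrow> n \<subseteq> lc (\<Union>m. Sb (x m))"
    and J: "indep J" "finite J" "J \<subseteq> n"
    and B: "\<And>k. stuck (L k) n (X k) (Z k)" and S: "\<And>k. rank_at_most (L k) n (X k) (card J)"
    and nx: "\<And>k::nat. next_region (L k) n (X k) (Z k) (L (Suc k)) n (X (Suc k)) (Z (Suc k))"
  shows False
proof -
  define G where "G k = tok.gates (class_arcs (L k) n) (X k)" for k
  define Xi where "Xi = (\<Inter>k. X k)"
  have XS: "X (Suc k) \<subseteq> X k" for k using nx[of k] unfolding next_region_def by blast
  have Xm: "X j \<subseteq> X i" if "i \<le> j" for i j using that by (rule lift_Suc_antimono_le[of X, OF XS])
  have st: "steps n (X k) (L k) (L (Suc k))" for k using nx[of k] unfolding next_region_def by blast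
  have GS: "tok.gates (class_arcs (L (Suc k)) n) (X k) = G k" for k
    using steps_keeps[OF st stuckD(1)[OF B]] unfolding G_def by blast
  have Gc: "finite (G k)" "card (G k) \<le> card J" for k using rank_at_most_gates[OF S[of k]] unfolding G_def by auto
  have Gkeep: "f \<in> G (Suc k)" if f: "f \<in> G k" "dst f \<in> X (Suc k)" for f k
  proof -
    have "f \<in> class_arcs (L (Suc k)) n" "src f \<notin> X k" using f(1) unfolding GS[symmetric] tok.gates_def by auto
    then show ?thesis using f(2) XS[of k] unfolding G_def tok.gates_def by auto
  qed
  define Ga where "Ga k = {f \<in> G k. dst f \<in> Xi}" for k
  have "Ga k \<subseteq> Ga (Suc k)" for k using Gkeep unfolding Ga_def Xi_def by auto
  then have Gam: "Ga i \<subseteq> Ga j" if "i \<le> j" for i j using that by (rule lift_Suc_mono_le[of Ga])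
  have Gac: "card (Ga k) \<le> card J" for k
    using card_mono[OF Gc(1), of "Ga k" k] Gc(2)[of k] unfolding Ga_def by fastforce
  \<comment> \<open>The sets \<open>Ga k\<close> increase and have at most \<open>card J\<close>
    elements, so from a stage of greatest size on they are constant.\<close>
  obtain K where K: "\<And>m. card (Ga m) \<le> card (Ga K)"
    using ex_has_greatest_nat[of "\<lambda>k. True" 0 "\<lambda>k. card (Ga k)" "Suc (card J)"] Gac by (auto simp: less_Suc_eq_le)
  have GaK: "Ga m = Ga K" if "K \<le> m" for m
  proof -
    have "finite (Ga m)" using Gc(1)[of m] unfolding Ga_def by simp
    then show ?thesis using card_seteq[OF _ Gam[OF that] K] by simp
  qed
  \<comment> \<open>In the labelling of stage \<open>Suc m\<close> the gate \<open>f\<close> of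
    \<open>X m\<close> still has a trail to \<open>Z (Suc m)\<close> inside \<open>X m\<close>. The
    first arc of this trail into \<open>X (Suc m)\<close> is a gate there but an inner arc of
    \<open>X m\<close>; so it is not in \<open>Ga m\<close>, which equals
    \<open>Ga (Suc m)\<close>.\<close>
  have advance: "\<exists>f' p. f' \<in> G (Suc m) \<and> dst f' \<notin> Xi \<and> arc_walk src dst (dst f) p (dst f') \<and> set p \<subseteq> A1 \<and>
     (\<forall>a\<in>set p. src a \<in> X m - X (Suc m) \<and> dst a \<in> X m \<and> dst a \<in> W \<and> N (dst a) = n)"
    if m: "K \<le> m" and f: "f \<in> G m" "dst f \<notin> X (Suc m)" for m f
  proof -
    let ?l = "L (Suc m)" and ?z = "Z (Suc m)"
    have "region_feasible ?l n (X m)" using steps_lift[OF st stuckD(1,2)[OF B]] by blast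
    moreover have z: "?z \<in> X (Suc m)" "?z \<in> W" "N ?z = n" using stuckD(3-5)[OF B] by auto
    moreover have "?z \<in> X m" using z XS by blast
    ultimately obtain BB U P where c: "tok.complete (region_arcs ?l n (X m)) (region_tokens ?l n (X m)) ?z BB U P"
      unfolding region_feasible_def tok.sub_ok_def tok.ok_def by blast
    have fg: "f \<in> tok.gates (class_arcs ?l n) (X m)" using f(1) unfolding GS .
    then have "Inr f \<in> token_cl BB" using tok.completeD(4)[OF c] unfolding toks_region_tokens by blast
    then have fB: "Inr f \<in> BB" by (simp add: Inr_token_cl)
    have "U (Inr f) = dst f" by (rule tok.sub_family_start[OF clean tok.completeD(1)[OF c] fB fg])
    then have w: "tok.walk (dst f) (P (Inr f)) ?z" using tok.endsD[OF tok.completeD(2)[OF c] fB] by simp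
    obtain q \<beta> where q: "P (Inr f) = q @ \<beta>" "q \<noteq> []" "dst (last q) \<in> X (Suc m)" "\<forall>a\<in>set q. src a \<notin> X (Suc m)"
      "tok.walk (dst f) q (dst (last q))"
      using tok.walk_first_entry[OF w z(1) f(2)] by blast
    have qA: "set q \<subseteq> region_arcs ?l n (X m)" using tok.famD(3)[OF tok.completeD(1)[OF c] fB] q(1) by auto
    have lq: "last q \<in> set q" using q(2) by simp
    have lG: "last q \<in> G (Suc m)" using lq qA q(3,4) unfolding G_def tok.gates_def tok.inner_arcs_def by auto
    have "dst (last q) \<notin> Xi"
    proof
      assume "dst (last q) \<in> Xi"
      then have "last q \<in> Ga (Suc m)" using lG unfolding Ga_def by simp
      then have "last q \<in> Ga m" using GaK[of "Suc m"] GaK[of m] m by simp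
      then have "src (last q) \<notin> X m" unfolding Ga_def G_def tok.gates_def by blast
      then show False using lq qA unfolding tok.inner_arcs_def by blast
    qed
    moreover have "set q \<subseteq> A1" using qA unfolding tok.inner_arcs_def class_arcs_def by blast
    moreover have "\<forall>a\<in>set q. src a \<in> X m - X (Suc m) \<and> dst a \<in> X m \<and> dst a \<in> W \<and> N (dst a) = n"
      using qA q(4) A1 unfolding tok.inner_arcs_def class_arcs_def by blast
    ultimately show ?thesis using lG q(5) by blast
  qed
  \<comment> \<open>A gate remains a gate as long as its head remains in the region;
    \<open>m\<close> is the last stage at which it does.\<close>
  have settle: "\<exists>m\<ge>k. f \<in> G m \<and> dst f \<in> X m \<and> dst f \<notin> X (Suc m)" if f: "f \<in> G k" "dst f \<notin> Xi" for f k
  proof -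
    obtain j where j: "dst f \<notin> X j" using f(2) unfolding Xi_def by blast
    have dk: "dst f \<in> X k" using f(1) unfolding G_def tok.gates_def by blast
    then have "k < j" using j Xm[of j k] by (meson not_le subsetD)
    then obtain d where "j = k + d" using less_imp_add_positive by blast
    then have "dst f \<notin> X (k + d)" using j by simp
    then show ?thesis using f(1) dk
    proof (induction d arbitrary: k)
      case 0 then show ?case by simp
    next
      case (Suc d)
      show ?case
      proof (cases "dst f \<in> X (Suc k)")
        case True
        then obtain m where "m \<ge> Suc k" "f \<in> G m" "dst f \<in> X m" "dst f \<notin> X (Suc m)"
          using Suc.IH[of "Suc k"] Suc.prems Gkeep[OF Suc.prems(2)] by auto
        then show ?thesis by (intro exI[of _ m]) simp
      next
        case False then show ?thesis using Suc.prems by blast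
      qed
    qed
  qed
  let ?X = "X (Suc K)"
  define Q where "Q = (\<lambda>(f, m). Suc K \<le> m \<and> f \<in> G m \<and> dst f \<in> X m \<and> dst f \<notin> X (Suc m) \<and> dst f \<in> W \<and> N (dst f) = n)"
  define y where "y = (\<lambda>(f, m::nat). dst f)"
  define Om :: "'a \<times> nat \<Rightarrow> 'v set" where "Om = (\<lambda>(f, m). X m)"
  have GA: "dst f \<in> W \<and> N (dst f) = n" if "f \<in> G m" for f m
    using that A1[of f] unfolding G_def tok.gates_def class_arcs_def by blast
  \<comment> \<open>The starting gate is the one supplied by \<open>next_region\<close> with its
    tail in \<open>X K\<close>. It is no gate of \<open>X K\<close>, hence not one of those that
    stay forever.\<close>
  obtain e where e: "e \<in> class_arcs (L (Suc K)) n" "dst e \<in> ?X" "src e \<in> X K - ?X" using nx[of K] unfolding next_region_def by blast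
  have eG: "e \<in> G (Suc K)" using e unfolding G_def tok.gates_def by blast
  have "dst e \<notin> Xi"
  proof
    assume "dst e \<in> Xi"
    then have "e \<in> Ga (Suc K)" using eG unfolding Ga_def by simp
    then have "e \<in> Ga K" using GaK[of "Suc K"] by simp
    then show False using e(3) unfolding Ga_def G_def tok.gates_def by blast
  qed
  then obtain m0 where m0: "Suc K \<le> m0" "e \<in> G m0" "dst e \<in> X m0" "dst e \<notin> X (Suc m0)" using settle[OF eG] by blast
  have Q0: "Q (e, m0)" using m0 GA[OF eG] unfolding Q_def by simp
  have nxt: "\<exists>c' p. Q c' \<and> p \<noteq> [] \<and> arc_walk src dst (y c) p (y c') \<and> set p \<subseteq> A1 \<and> distinct (y c # map dst p) \<and>
       insert (y c) (dst ` set (butlast p)) \<inter> Om c' = {} \<and> insert (y c) (dst ` set p) \<subseteq> Om c \<and> Om c' \<subseteq> Om c \<and>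
       (\<forall>w\<in>insert (y c) (dst ` set p). w \<in> ?X \<and> w \<in> W \<and> N w = n)" if Qc: "Q c" for c
  proof -
    obtain f m where c: "c = (f, m)" by (cases c)
    have f: "Suc K \<le> m" "f \<in> G m" "dst f \<in> X m" "dst f \<notin> X (Suc m)" "dst f \<in> W" "N (dst f) = n"
      using Qc unfolding c Q_def by auto
    have "K \<le> m" using f(1) by simp
    then obtain f' p0 where p0: "f' \<in> G (Suc m)" "dst f' \<notin> Xi" "arc_walk src dst (dst f) p0 (dst f')" "set p0 \<subseteq> A1"
      "\<forall>a\<in>set p0. src a \<in> X m - X (Suc m) \<and> dst a \<in> X m \<and> dst a \<in> W \<and> N (dst a) = n"
      using advance[OF _ f(2,4)] by blast
    obtain p where p: "arc_walk src dst (dst f) p (dst f')" "set p \<subseteq> set p0" "distinct (dst f # map dst p)"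
      using arc_walk_simple[OF p0(3)] by blast
    obtain m' where m': "m' \<ge> Suc m" "f' \<in> G m'" "dst f' \<in> X m'" "dst f' \<notin> X (Suc m')" using settle[OF p0(1,2)] by blast
    let ?c = "(f', m')"
    have pn: "p \<noteq> []" using p(1) f(4) m'(3) Xm[OF m'(1)] by auto
    have "map src p @ [dst f'] = dst f # map dst p" by (rule arc_walk_vertices[OF p(1)])
    then have "map src p = dst f # map dst (butlast p)" using pn
      by (metis append_butlast_last_id butlast_snoc list.sel(3) map_butlast butlast.simps(2) map_is_Nil_conv)
    then have "set (map src p) = set (dst f # map dst (butlast p))" by (simp only:)
    then have sv: "insert (dst f) (dst ` set (butlast p)) = src ` set p" by simp
    have "src ` set p \<inter> X (Suc m) = {}" using p0(5) p(2) by blast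
    then have "src ` set p \<inter> X m' = {}" using Xm[OF m'(1)] by blast
    then have 1: "insert (y c) (dst ` set (butlast p)) \<inter> Om ?c = {}" using sv unfolding c y_def Om_def by simp
    have 2: "insert (y c) (dst ` set p) \<subseteq> Om c" using p0(5) p(2) f(3) unfolding c y_def Om_def by auto
    have "X m' \<subseteq> X m" using m'(1) by (intro Xm) simp
    then have 3: "Om ?c \<subseteq> Om c" unfolding c Om_def by simp
    have 4: "\<forall>w\<in>insert (y c) (dst ` set p). w \<in> ?X \<and> w \<in> W \<and> N w = n"
      using p0(5) p(2) f Xm[OF f(1)] unfolding c y_def by auto
    have "Q ?c" using m' f(1) GA[OF m'(2)] unfolding Q_def by simp
    moreover have "arc_walk src dst (y c) p (y ?c)" "distinct (y c # map dst p)" using p unfolding c y_def by auto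
    moreover have "set p \<subseteq> A1" using p(2) p0(4) by (rule subset_trans)
    ultimately show ?thesis using pn 1 2 3 4 by (intro exI[of _ ?c] exI[of _ p] conjI)
  qed
  obtain x a where x: "inj x" "\<forall>k::nat. a k \<in> A1 \<and> src (a k) = x k \<and> dst (a k) = x (Suc k) \<and> (x k \<in> ?X \<and> x k \<in> W \<and> N (x k) = n)"
    "x 0 = y (e, m0)"
    by (rule infinite_path_by_paths[where Q = Q and cst = "(e, m0)" and y = y and Om = Om and src = src and dst = dst
        and R = A1 and Pv = "\<lambda>w. w \<in> ?X \<and> w \<in> W \<and> N w = n", OF Q0 nxt])
  \<comment> \<open>All vertices of the path lie in \<open>?X\<close> and have flat
    \<open>n\<close>, so its roots are labels of this region and span \<open>n\<close>. By
    \<open>rank_at_most_no_gate\<close> the region then has no gate, but \<open>e\<close> is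
    one.\<close>
  have "n \<subseteq> lc (\<Union>k. Sb (x k))" by (rule fwd[OF x(1)]) (use x(2) in auto)
  moreover have "(\<Union>k. Sb (x k)) \<subseteq> region_labels (L (Suc K)) n ?X"
  proof
    fix s assume "s \<in> (\<Union>k. Sb (x k))"
    then obtain k where "s \<in> Sb (x k)" by blast
    then have "s \<in> class_labels (L (Suc K)) n (x k)" using x(2)[rule_format, of k] unfolding class_labels_def labels_at_def by simp
    then show "s \<in> region_labels (L (Suc K)) n ?X" using x(2)[rule_format, of k] unfolding region_labels_def by blast
  qed
  ultimately have "J \<subseteq> lc (region_labels (L (Suc K)) n ?X)" using cl_mono J(3) by blast
  then have "G (Suc K) = {}" using rank_at_most_no_gate[OF S J(1,2)] unfolding G_def by blast
  then show False using eG by blast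
qed

text \<open>Induction on the rank of the flat, which is finite because all labels lie in one
  summand. Passing to a smaller flat lowers this rank, so by the induction hypothesis only
  \<open>next_region\<close> can occur, and dependent choice produces the chain excluded
  above.\<close>

lemma no_stuck_forward:
  assumes fwd: "\<And>x e. inj x \<Longrightarrow> (\<And>m::nat. e m \<in> A1 \<and> src (e m) = x m \<and> dst (e m) = x (Suc m)) \<Longrightarrow>
      (\<And>m. x m \<in> W \<and> N (x m) = N (x 0)) \<Longrightarrow> N (x 0) \<subseteq> lc (\<Union>m. Sb (x m))"
    and fin: "\<And>v. v \<in> Done \<union> W \<Longrightarrow> \<forall>i\<in>N v. \<kappa> i = ks"
  shows "\<not> stuck lab n UNIV z"
proof
  assume B: "stuck lab n UNIV z"
  have base: "\<exists>J. J \<subseteq> N v \<and> indep J \<and> finite J \<and> N v \<subseteq> lc J" if "v \<in> W" for v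
    using ex_max_indep_summand[of "N v" ks] fin[of v] that by (metis UnCI)
  obtain J where "J \<subseteq> n \<and> indep J \<and> finite J \<and> n \<subseteq> lc J" using base[of z] stuckD(4,5)[OF B] by blast
  then show False using B
  proof (induction "card J" arbitrary: J lab n z rule: less_induct)
    case less
    have J: "J \<subseteq> n" "indep J" "finite J" "n \<subseteq> lc J" using less.prems(1) by auto
    have flat: "lc (N v) = N v" if "v \<in> W" for v using N_flat that by blast
    have noC: "\<not> next_class l n X y l' n' X' y'" if b: "stuck l' n' X' y'" for l X y l' n' X' y'
    proof
      assume "next_class l n X y l' n' X' y'"
      then have c: "n' \<subset> n" "X' = UNIV" unfolding next_class_def by auto
      have y': "y' \<in> W" "N y' = n'" using stuckD(4,5)[OF b] by auto
      obtain J' where J': "J' \<subseteq> n'" "indep J'" "finite J'" "n' \<subseteq> lc J'" using base[of y'] y' by blast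
      obtain b' where b': "b' \<in> n" "b' \<notin> n'" using c(1) by blast
      have "lc J' \<subseteq> lc n'" using J'(1) by (rule cl_mono)
      then have bl: "b' \<notin> lc J'" using b'(2) flat[OF y'(1)] y'(2) by blast
      then have "indep (insert b' J')" using J'(2) by (intro indep_insert)
      moreover have "insert b' J' \<subseteq> lc J" using b' J' J(4) c(1) by blast
      ultimately have "card (insert b' J') \<le> card J" using steinitz[OF J(3)] by blast
      moreover have "b' \<notin> J'" using J'(1) b'(2) by blast
      ultimately have "card J' < card J" using J'(3) by simp
      then show False using less.hyps[of J' n' l' y'] J' b c(2) by blast
    qed
    let ?P = "\<lambda>(l, X, y). stuck l n X y \<and> rank_at_most l n X (card J)"
    let ?R = "\<lambda>(l, X, y) (l', X', y'). next_region l n X y l' n X' y'"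
    have "\<exists>f. \<forall>k::nat. ?P (f k) \<and> ?R (f k) (f (Suc k))"
    proof (rule dependent_nat_choice)
      show "\<exists>c. ?P c" using less.prems(2) rank_at_most_UNIV[OF stuckD(1)[OF less.prems(2)] J(2-4)] by blast
      fix c assume c: "?P c"
      obtain l X y where cc: "c = (l, X, y)" by (cases c)
      have b: "stuck l n X y" "rank_at_most l n X (card J)" using c cc by auto
      obtain l' n' X' y' where b': "stuck l' n' X' y'" "next_region l n X y l' n' X' y' \<or> next_class l n X y l' n' X' y'"
        using exists_next_region_or_class[OF b(1)] by blast
      then have nb: "next_region l n X y l' n' X' y'" using noC by blast
      then have "n' = n" "rank_at_most l' n X' (card J)" using b(2) unfolding next_region_def by auto
      then show "\<exists>c'. ?P c' \<and> ?R c c'" using nb b' cc by (intro exI[of _ "(l', X', y')"]) auto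
    qed
    then obtain f where f: "\<And>k::nat. ?P (f k) \<and> ?R (f k) (f (Suc k))" by blast
    show False
    proof (rule no_stuck_chain[where n = n and J = J and L = "\<lambda>k. fst (f k)" and X = "\<lambda>k. fst (snd (f k))" and Z = "\<lambda>k. snd (snd (f k))"])
      fix x e assume "inj x" "\<And>m::nat. e m \<in> A1 \<and> src (e m) = x m \<and> dst (e m) = x (Suc m)" "\<And>m. x m \<in> W \<and> N (x m) = n"
      then show "n \<subseteq> lc (\<Union>m. Sb (x m))" using fwd[of x e] by simp
    next
      fix k
      show "stuck (fst (f k)) n (fst (snd (f k))) (snd (snd (f k)))" "rank_at_most (fst (f k)) n (fst (snd (f k))) (card J)"
        using f[of k] by (auto split: prod.splits)
      show "next_region (fst (f k)) n (fst (snd (f k))) (snd (snd (f k))) (fst (f (Suc k))) n (fst (snd (f (Suc k)))) (snd (snd (f (Suc k))))"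
        using f[of k] by (auto split: prod.splits)
    qed (use J in auto)
  qed
qed

end

section \<open>Completing countably many vertices\<close>

context phase
begin

definition exts :: "('a \<Rightarrow> 's option) \<Rightarrow> ('a \<Rightarrow> 's option) \<Rightarrow> bool" where
  "exts = (\<lambda>l l'. feasible l' \<and> (\<exists>a i. ext l a i \<and> l' = l(a \<mapsto> i)))\<^sup>*\<^sup>*"

text \<open>The part of the invariant that passes to unions of chains. The walk back to a vertex of
  \<open>Sb\<close> rules out labels circulating without a root, and later makes every vertex of a
  branching reachable from its roots.\<close>

definition traced :: "('a \<Rightarrow> 's option) \<Rightarrow> bool" where
  "traced lab \<longleftrightarrow> dom lab \<subseteq> A1 \<and> (\<forall>a i. lab a = Some i \<longrightarrow> i \<notin> Sb (dst a) \<and> i \<in> labels_at lab (src a)) \<and>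
     (\<forall>a b i. lab a = Some i \<longrightarrow> lab b = Some i \<longrightarrow> dst a = dst b \<longrightarrow> a = b) \<and>
     (\<forall>v i. i \<in> labels_at lab v \<longrightarrow> (\<exists>u p. i \<in> Sb u \<and> arc_walk src dst u p v \<and> (\<forall>a\<in>set p. lab a = Some i))) \<and>
     (\<forall>v\<in>W. indep (labels_at lab v))"

lemma traced_path: "traced lab \<Longrightarrow> i \<in> labels_at lab v \<Longrightarrow> \<exists>u p. i \<in> Sb u \<and> arc_walk src dst u p v \<and> (\<forall>a\<in>set p. lab a = Some i)"
  unfolding traced_def by simp

lemma tracedD:
  assumes "traced lab"
  shows "lab a = Some i \<Longrightarrow> a \<in> A1" "lab a = Some i \<Longrightarrow> i \<notin> Sb (dst a)" "lab a = Some i \<Longrightarrow> i \<in> labels_at lab (src a)"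
    "lab a = Some i \<Longrightarrow> lab b = Some i \<Longrightarrow> dst a = dst b \<Longrightarrow> a = b" "v \<in> W \<Longrightarrow> indep (labels_at lab v)"
proof -
  have "dom lab \<subseteq> A1" using assms unfolding traced_def by (rule conjunct1)
  then show "lab a = Some i \<Longrightarrow> a \<in> A1" using domI[of lab a i] by (rule subsetD)
  have 2: "\<forall>a i. lab a = Some i \<longrightarrow> i \<notin> Sb (dst a) \<and> i \<in> labels_at lab (src a)" using assms unfolding traced_def by (elim conjE)
  show "lab a = Some i \<Longrightarrow> i \<notin> Sb (dst a)" "lab a = Some i \<Longrightarrow> i \<in> labels_at lab (src a)" using 2[rule_format, of a i] by simp_all
  have 3: "\<forall>a b i. lab a = Some i \<longrightarrow> lab b = Some i \<longrightarrow> dst a = dst b \<longrightarrow> a = b" using assms unfolding traced_def by (elim conjE)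
  show "lab a = Some i \<Longrightarrow> lab b = Some i \<Longrightarrow> dst a = dst b \<Longrightarrow> a = b" using 3[rule_format, of a i b] by simp
  show "v \<in> W \<Longrightarrow> indep (labels_at lab v)" using assms unfolding traced_def by simp
qed

text \<open>The new label is not spanned at the head, so it does not occur there yet: no second arc
  with this label enters the head, and independence is kept.\<close>

lemma traced_ext:
  assumes S: "traced lab" and e: "ext lab a i"
  shows "traced (lab(a \<mapsto> i))"
proof -
  let ?l = "lab(a \<mapsto> i)"
  have a: "a \<in> A1" "lab a = None" "i \<in> labels_at lab (src a)" "i \<notin> lc (labels_at lab (dst a))" using e unfolding ext_def by auto
  have iS: "i \<notin> labels_at lab (dst a)" using a(4) cl_extI[of i "labels_at lab (dst a)"] by blast
  have mono: "labels_at lab v \<subseteq> labels_at ?l v" for v by (auto simp: labels_at_upd[OF e])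
  have inS: "j \<in> labels_at lab (dst b)" if "lab b = Some j" for b j
    using S that unfolding traced_def labels_at_def by blast
  have pth: "\<exists>u p. j \<in> Sb u \<and> arc_walk src dst u p v \<and> (\<forall>b\<in>set p. lab b = Some j)" if "j \<in> labels_at lab v" for j v
    using S that unfolding traced_def by blast
  have up: "?l b = Some j" if "lab b = Some j" for b j using that a(2) by auto
  have 1: "dom ?l \<subseteq> A1" using S a unfolding traced_def by auto
  have 2: "j \<notin> Sb (dst b) \<and> j \<in> labels_at ?l (src b)" if j: "?l b = Some j" for b j
  proof (cases "b = a")
    case True
    then have "j = i" using j by simp
    then show ?thesis using True iS a(3) mono unfolding labels_at_def by blast
  next
    case False
    then have "lab b = Some j" using j by simp
    then show ?thesis using S mono unfolding traced_def by blast
  qed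
  have 3: "b = c" if j: "?l b = Some j" "?l c = Some j" "dst b = dst c" for b c j
  proof (cases "b = a \<or> c = a")
    case True
    show ?thesis
    proof (rule ccontr)
      assume bc: "b \<noteq> c"
      have "j = i" using True j by auto
      then consider "b = a" "lab c = Some i" | "c = a" "lab b = Some i" using True bc j by (auto split: if_splits)
      then show False using inS iS j(3) by cases (metis)+
    qed
  next
    case False
    then show ?thesis using S j unfolding traced_def by (metis fun_upd_other)
  qed
  have 4: "\<exists>u p. j \<in> Sb u \<and> arc_walk src dst u p v \<and> (\<forall>b\<in>set p. ?l b = Some j)" if j: "j \<in> labels_at ?l v" for v j
  proof (cases "j \<in> labels_at lab v")
    case True
    then obtain u p where "j \<in> Sb u" "arc_walk src dst u p v" "\<forall>b\<in>set p. lab b = Some j" using pth by blast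
    then show ?thesis using up by (intro exI[of _ u] exI[of _ p]) blast
  next
    case False
    then have ji: "j = i" "v = dst a" using j by (auto simp: labels_at_upd[OF e] split: if_splits)
    obtain u p where u: "i \<in> Sb u" "arc_walk src dst u p (src a)" "\<forall>b\<in>set p. lab b = Some i" using pth[OF a(3)] by blast
    have "arc_walk src dst u (p @ [a]) v" using u(2) ji by (auto simp: arc_walk_append)
    moreover have "\<forall>b\<in>set (p @ [a]). ?l b = Some i" using u(3) up by auto
    ultimately show ?thesis using u(1) ji by blast
  qed
  have 5: "indep (labels_at ?l v)" if "v \<in> W" for v
    using S that a(4) unfolding traced_def by (auto simp: labels_at_upd[OF e] intro: indep_insert)
  show ?thesis unfolding traced_def using 1 2 3 4 5 by blast
qed

lemma exts_keep:
  assumes "exts lab lab'" "feasible lab" "traced lab"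
  shows "feasible lab' \<and> traced lab' \<and> lab \<subseteq>\<^sub>m lab'"
  using assms unfolding exts_def
proof (induction rule: rtranclp_induct)
  case base then show ?case by simp
next
  case (step y w)
  then have IH: "feasible y" "traced y" "lab \<subseteq>\<^sub>m y" by auto
  obtain a i where a: "feasible w" "ext y a i" "w = y(a \<mapsto> i)" using step.hyps by blast
  have "y \<subseteq>\<^sub>m w" using a unfolding ext_def map_le_def by auto
  then show ?case using a traced_ext[OF IH(2) a(2)] IH(3) map_le_trans by blast
qed

lemma labels_at_mono: "lab \<subseteq>\<^sub>m lab' \<Longrightarrow> labels_at lab v \<subseteq> labels_at lab' v"
proof
  assume l: "lab \<subseteq>\<^sub>m lab'"
  have le: "lab' a = Some i" if "lab a = Some i" for a i
    using l domI[of lab a i] that unfolding map_le_def by simp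
  fix i assume "i \<in> labels_at lab v"
  then consider "i \<in> Sb v" | a where "a \<in> A1" "lab a = Some i" "dst a = v" unfolding labels_at_def by blast
  then show "i \<in> labels_at lab' v"
  proof cases
    case 1 then show ?thesis unfolding labels_at_def by blast
  next
    case (2 a) then show ?thesis using le[OF 2(2)] unfolding labels_at_def by blast
  qed
qed

text \<open>Every condition involves finitely many arcs and so holds by a single stage, except for
  independence, where finitary closure is used.\<close>

lemma traced_Union:
  fixes lab :: "nat \<Rightarrow> 'a \<Rightarrow> 's option"
  assumes S: "\<And>n. traced (lab n)" and chain: "\<And>n. lab n \<subseteq>\<^sub>m lab (Suc n)"
  obtains L where "traced L" "\<And>v. labels_at L v = (\<Union>n. labels_at (lab n) v)"
proof -
  have le: "lab m \<subseteq>\<^sub>m lab n" if "m \<le> n" for m n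
    using that
  proof (induction n rule: dec_induct)
    case base show ?case by simp
  next
    case (step n) then show ?case using chain map_le_trans by blast
  qed
  define L where "L a = (if \<exists>n. lab n a \<noteq> None then lab (LEAST n. lab n a \<noteq> None) a else None)" for a
  have leD: "lab n a = Some i" if "lab m a = Some i" "m \<le> n" for m n a i
    using le[OF that(2)] that(1) domI[of "lab m" a i] unfolding map_le_def by simp
  have L: "L a = Some i \<longleftrightarrow> (\<exists>n. lab n a = Some i)" for a i
  proof
    assume "L a = Some i" then show "\<exists>n. lab n a = Some i" unfolding L_def by (auto split: if_splits)
  next
    assume "\<exists>n. lab n a = Some i"
    then obtain n where n: "lab n a = Some i" by blast
    let ?m = "LEAST n. lab n a \<noteq> None"
    have "lab ?m a \<noteq> None" by (rule LeastI[of _ n]) (simp add: n)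
    then obtain j where j: "lab ?m a = Some j" by blast
    have "lab (max n ?m) a = Some i" by (rule leD[OF n]) (rule max.cobounded1)
    moreover have "lab (max n ?m) a = Some j" by (rule leD[OF j]) (rule max.cobounded2)
    ultimately have "Some i = Some j" by (simp only:)
    then have "i = j" by (simp only: option.inject)
    moreover have "L a = lab ?m a" unfolding L_def using n by (subst if_P) auto
    ultimately show "L a = Some i" using j by simp
  qed
  have labels_at: "labels_at L v = (\<Union>n. labels_at (lab n) v)" for v
  proof (rule set_eqI)
    fix i
    show "i \<in> labels_at L v \<longleftrightarrow> i \<in> (\<Union>n. labels_at (lab n) v)" unfolding labels_at_def by (simp add: L) blast
  qed
  have Sm: "labels_at (lab m) v \<subseteq> labels_at (lab n) v" if "m \<le> n" for m n v by (rule labels_at_mono[OF le[OF that]])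
  have "traced L" unfolding traced_def
  proof (intro conjI allI impI ballI)
    show "dom L \<subseteq> A1"
    proof
      fix a assume "a \<in> dom L"
      then obtain i where "L a = Some i" using domD[of a L] by blast
      then obtain n where "lab n a = Some i" unfolding L by blast
      then show "a \<in> A1" by (rule tracedD(1)[OF S])
    qed
    fix a i assume "L a = Some i"
    then obtain n where n: "lab n a = Some i" unfolding L by blast
    then show "i \<notin> Sb (dst a)" by (rule tracedD(2)[OF S])
    have "i \<in> labels_at (lab n) (src a)" by (rule tracedD(3)[OF S n])
    then show "i \<in> labels_at L (src a)" unfolding labels_at by blast
    fix b assume Lb: "L b = Some i" and "dst a = dst b"
    from Lb obtain m where m: "lab m b = Some i" unfolding L by blast
    have "lab (max n m) a = Some i" by (rule leD[OF n]) (rule max.cobounded1)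
    moreover have "lab (max n m) b = Some i" by (rule leD[OF m]) (rule max.cobounded2)
    ultimately show "a = b" using \<open>dst a = dst b\<close> by (rule tracedD(4)[OF S])
  next
    fix v i assume "i \<in> labels_at L v"
    then obtain n where n: "i \<in> labels_at (lab n) v" unfolding labels_at by blast
    then obtain u p where up: "i \<in> Sb u" "arc_walk src dst u p v" "\<forall>a\<in>set p. lab n a = Some i" using traced_path[OF S n] by blast
    have all: "\<forall>a\<in>set p. L a = Some i"
    proof
      fix a assume "a \<in> set p"
      then have "lab n a = Some i" using up(3) by blast
      then show "L a = Some i" unfolding L by blast
    qed
    show "\<exists>u p. i \<in> Sb u \<and> arc_walk src dst u p v \<and> (\<forall>a\<in>set p. L a = Some i)"
      by (rule exI[of _ u], rule exI[of _ p], rule conjI[OF up(1) conjI[OF up(2) all]])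
  next
    fix v assume v: "v \<in> W"
    have "indep (\<Union>(range (\<lambda>n. labels_at (lab n) v)))"
    proof (rule indep_Union_chain)
      fix I assume "I \<in> range (\<lambda>n. labels_at (lab n) v)" then show "indep I" using tracedD(5)[OF S v] by (elim rangeE) simp
    next
      fix I J assume "I \<in> range (\<lambda>n. labels_at (lab n) v)" "J \<in> range (\<lambda>n. labels_at (lab n) v)"
      then obtain m n where "I = labels_at (lab m) v" "J = labels_at (lab n) v" by blast
      then show "I \<subseteq> J \<or> J \<subseteq> I" using Sm[of m n v] Sm[of n m v] by (cases "m \<le> n") auto
    qed
    then show "indep (labels_at L v)" unfolding labels_at .
  qed
  then show ?thesis using labels_at by (rule that)
qed

end

locale solvable_phase = phase lc \<kappa> src dst A1 Done W N Sb
  for lc :: "'s set \<Rightarrow> 's set" and \<kappa> :: "'s \<Rightarrow> 'k" and src dst :: "'a \<Rightarrow> 'v" and A1 Done W N Sb +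
  assumes cond: "((\<forall>x e. inj x \<longrightarrow> (\<forall>m::nat. e m \<in> A1 \<and> src (e m) = x m \<and> dst (e m) = x (Suc m)) \<longrightarrow>
      (\<forall>m. x m \<in> W \<and> N (x m) = N (x 0)) \<longrightarrow> N (x 0) \<subseteq> lc (\<Union>m. Sb (x m))) \<and>
      (\<exists>ks. \<forall>v\<in>Done \<union> W. \<forall>i\<in>N v. \<kappa> i = ks)) \<or>
     (\<forall>x e. inj x \<longrightarrow> (\<forall>m::nat. e m \<in> A1 \<and> dst (e m) = x m \<and> src (e m) = x (Suc m)) \<longrightarrow>
      (\<forall>m. x m \<in> W) \<longrightarrow> N (x 0) \<subseteq> lc (\<Union>m. Sb (x m)))"
begin

text \<open>\<open>Rich\<close> consists of the labels of the summand of \<open>i\<close> not yet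
  spanned at \<open>z\<close>, so any of them raises the rank there. The other labels form a flat: a
  rich label can depend only on labels of its summand, and the poor ones among these are spanned at
  \<open>z\<close>.\<close>

lemma enrich:
  assumes I: "feasible lab" and z: "z \<in> W" and i: "i \<in> N z" "i \<notin> lc (labels_at lab z)"
  obtains lab' j where "exts lab lab'" "j \<in> labels_at lab' z" "\<kappa> j = \<kappa> i" "j \<notin> lc (labels_at lab z)"
proof -
  define Rich where "Rich = {j. \<kappa> j = \<kappa> i \<and> j \<notin> lc (labels_at lab z)}"
  interpret rp: rich_phase lc \<kappa> src dst A1 Done W N Sb Rich "\<kappa> i"
  proof
    show "\<kappa> r = \<kappa> i" if "r \<in> Rich" for r using that unfolding Rich_def by simp
    show "lc (- Rich) \<subseteq> - Rich"
    proof
      fix x assume x: "x \<in> lc (- Rich)"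
      show "x \<in> - Rich"
      proof
        assume xR: "x \<in> Rich"
        have "x \<in> lc {a \<in> - Rich. \<kappa> a = \<kappa> x}" by (rule cl_summand[OF x])
        moreover have "{a \<in> - Rich. \<kappa> a = \<kappa> x} \<subseteq> lc (labels_at lab z)" using xR unfolding Rich_def by auto
        ultimately have "x \<in> lc (labels_at lab z)" by (rule cl_trans)
        then show False using xR unfolding Rich_def by simp
      qed
    qed
  qed
  have "\<not> rp.stuck lab (N z) UNIV z"
    using cond
  proof (elim disjE conjE exE)
    fix ks assume f: "\<forall>x e. inj x \<longrightarrow> (\<forall>m::nat. e m \<in> A1 \<and> src (e m) = x m \<and> dst (e m) = x (Suc m)) \<longrightarrow>
      (\<forall>m. x m \<in> W \<and> N (x m) = N (x 0)) \<longrightarrow> N (x 0) \<subseteq> lc (\<Union>m. Sb (x m))"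
      and k: "\<forall>v\<in>Done \<union> W. \<forall>i\<in>N v. \<kappa> i = ks"
    show ?thesis
    proof (rule rp.no_stuck_forward)
      show "\<forall>i\<in>N v. \<kappa> i = ks" if "v \<in> Done \<union> W" for v using k that by blast
      fix x e assume "inj x" "\<And>m::nat. e m \<in> A1 \<and> src (e m) = x m \<and> dst (e m) = x (Suc m)" "\<And>m. x m \<in> W \<and> N (x m) = N (x 0)"
      then show "N (x 0) \<subseteq> lc (\<Union>m. Sb (x m))" using f[rule_format, of x e] by blast
    qed
  next
    assume f: "\<forall>x e. inj x \<longrightarrow> (\<forall>m::nat. e m \<in> A1 \<and> dst (e m) = x m \<and> src (e m) = x (Suc m)) \<longrightarrow>
      (\<forall>m. x m \<in> W) \<longrightarrow> N (x 0) \<subseteq> lc (\<Union>m. Sb (x m))"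
    show ?thesis
    proof (rule rp.no_stuck_backward)
      fix x e assume "inj x" "\<And>m::nat. e m \<in> A1 \<and> dst (e m) = x m \<and> src (e m) = x (Suc m)" "\<And>m. x m \<in> W"
      then show "N (x 0) \<subseteq> lc (\<Union>m. Sb (x m))" using f[rule_format, of x e] by blast
    qed
  qed
  moreover have "region_labels lab (N z) UNIV \<inter> Rich \<noteq> {}"
  proof -
    have "N z \<subseteq> lc (region_labels lab (N z) UNIV)" using I z unfolding feasible_def region_labels_def by blast
    moreover have "i \<in> Rich" using i unfolding Rich_def by simp
    ultimately show ?thesis using i rp.rich_cl[of i "region_labels lab (N z) UNIV"] by blast
  qed
  ultimately obtain lab' where l: "rp.steps (N z) UNIV lab lab'" "labels_at lab' z \<inter> Rich \<noteq> {}"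
    unfolding rp.stuck_def using I region_feasible_UNIV[OF I] z by blast
  have "rp.step (N z) UNIV \<le> (\<lambda>l l'. feasible l' \<and> (\<exists>a i. ext l a i \<and> l' = l(a \<mapsto> i)))"
    unfolding rp.step_def by blast
  then have "exts lab lab'" unfolding exts_def using l(1) rtranclp_mono by blast
  then show ?thesis using that l(2) unfolding Rich_def by blast
qed

text \<open>Induction on a bound \<open>d\<close> for the rank still missing in the summand
  \<open>k\<close>; each use of \<open>enrich\<close> lowers it by one.\<close>

lemma saturate:
  assumes "feasible lab" "traced lab" and z: "z \<in> W"
  obtains lab' where "exts lab lab'" "{i \<in> N z. \<kappa> i = k} \<subseteq> lc (labels_at lab' z)"
proof -
  obtain J where J: "indep J" "finite J" "{i \<in> N z. \<kappa> i = k} \<subseteq> lc J"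
    by (rule ex_max_indep_summand[of "{i \<in> N z. \<kappa> i = k}" k]) auto
  have "\<exists>lab'. exts lab lab' \<and> {i \<in> N z. \<kappa> i = k} \<subseteq> lc (labels_at lab' z)"
    if "feasible lab" "traced lab" "indep I" "finite I" "I \<subseteq> {i \<in> labels_at lab z. \<kappa> i = k}" "card J \<le> card I + d" for d I lab
    using that
  proof (induction d arbitrary: I lab)
    case 0
    note I = 0
    have IN: "I \<subseteq> {i \<in> N z. \<kappa> i = k}" using I(1,5) z unfolding feasible_def by blast
    have "{i \<in> N z. \<kappa> i = k} \<subseteq> lc (labels_at lab z)"
    proof (rule ccontr)
      assume "\<not> ?thesis"
      then obtain i where i: "i \<in> N z" "\<kappa> i = k" "i \<notin> lc (labels_at lab z)" by blast
      have il: "i \<notin> lc I" using i(3) I(5) cl_mono[of I "labels_at lab z"] by blast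
      have "indep (insert i I)" using I(3) il by (rule indep_insert)
      moreover have "insert i I \<subseteq> lc J" using i IN J(3) by blast
      ultimately have "card (insert i I) \<le> card J" using steinitz[OF J(2)] by blast
      moreover have "i \<notin> I" using il cl_extI[of i I] by blast
      ultimately show False using I(4,6) by simp
    qed
    then show ?case unfolding exts_def by blast
  next
    case (Suc d)
    show ?case
    proof (cases "{i \<in> N z. \<kappa> i = k} \<subseteq> lc (labels_at lab z)")
      case True then show ?thesis unfolding exts_def by blast
    next
      case False
      then obtain i where i: "i \<in> N z" "\<kappa> i = k" "i \<notin> lc (labels_at lab z)" by blast
      obtain lab1 j where l: "exts lab lab1" "j \<in> labels_at lab1 z" "\<kappa> j = \<kappa> i" "j \<notin> lc (labels_at lab z)"
        using enrich[OF Suc.prems(1) z i(1,3)] by blast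
      have l1: "feasible lab1" "traced lab1" "lab \<subseteq>\<^sub>m lab1" using exts_keep[OF l(1) Suc.prems(1,2)] by auto
      have jl: "j \<notin> lc I" using l(4) Suc.prems(5) cl_mono[of I "labels_at lab z"] by blast
      have "indep (insert j I)" using Suc.prems(3) jl by (rule indep_insert)
      moreover have "insert j I \<subseteq> {i \<in> labels_at lab1 z. \<kappa> i = k}" using Suc.prems(5) labels_at_mono[OF l1(3), of z] l(2,3) i(2) by blast
      moreover have "j \<notin> I" using jl cl_extI[of j I] by blast
      then have "card J \<le> card (insert j I) + d" using Suc.prems(4,6) by simp
      ultimately obtain lab' where "exts lab1 lab'" "{i \<in> N z. \<kappa> i = k} \<subseteq> lc (labels_at lab' z)"
        using Suc.IH[OF l1(1,2)] Suc.prems(4) by blast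
      then show ?thesis using l(1) unfolding exts_def by (meson rtranclp_trans)
    qed
  qed
  from this[OF assms(1,2), of "{}" "card J"] show ?thesis using that by (auto simp: indep_def)
qed

text \<open>The pairs of a vertex and a summand are enumerated, and stage \<open>n\<close> saturates
  the pair \<open>t n\<close>. A saturated pair remains so at all later stages.\<close>

lemma phase_solution:
  assumes I: "feasible Map.empty" and Si: "\<And>v. v \<in> W \<Longrightarrow> indep (Sb v)" and cW: "countable W"
    and K: "countable K" "\<And>v i. v \<in> W \<Longrightarrow> i \<in> N v \<Longrightarrow> \<kappa> i \<in> K"
  obtains L where "traced L" "\<And>v. v \<in> W \<Longrightarrow> labels_at L v \<subseteq> N v \<and> N v \<subseteq> lc (labels_at L v)"
proof -
  define T where "T = W \<times> K"
  define t where "t = from_nat_into T"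
  have cT: "countable T" unfolding T_def using cW K(1) by (rule countable_SIGMA)
  have S0: "traced Map.empty" unfolding traced_def labels_at_def using Si by (auto intro: exI[of _ "[]"])
  let ?P = "\<lambda>lab. feasible lab \<and> traced lab"
  \<comment> \<open>For empty \<open>T\<close> the value \<open>t n\<close> is arbitrary, hence the
    guard.\<close>
  let ?R = "\<lambda>n lab lab'. lab \<subseteq>\<^sub>m lab' \<and> (T \<noteq> {} \<longrightarrow> {i \<in> N (fst (t n)). \<kappa> i = snd (t n)} \<subseteq> lc (labels_at lab' (fst (t n))))"
  have "\<exists>f. \<forall>n::nat. ?P (f n) \<and> ?R n (f n) (f (Suc n))"
  proof (rule dependent_nat_choice)
    show "\<exists>lab. ?P lab" using I S0 by blast
    fix lab :: "'a \<Rightarrow> 's option" and n :: nat assume l: "?P lab"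
    show "\<exists>lab'. ?P lab' \<and> ?R n lab lab'"
    proof (cases "T = {}")
      case True then show ?thesis using l map_le_refl by blast
    next
      case False
      then have "t n \<in> T" unfolding t_def by (rule from_nat_into)
      then have z: "fst (t n) \<in> W" unfolding T_def by auto
      obtain lab' where "exts lab lab'" "{i \<in> N (fst (t n)). \<kappa> i = snd (t n)} \<subseteq> lc (labels_at lab' (fst (t n)))"
        using saturate[of lab "fst (t n)" "snd (t n)"] l z by blast
      then show ?thesis using exts_keep l by blast
    qed
  qed
  then obtain f where f: "\<And>n::nat. ?P (f n) \<and> ?R n (f n) (f (Suc n))" by blast
  obtain L where L: "traced L" "\<And>v. labels_at L v = (\<Union>n. labels_at (f n) v)"
    using traced_Union[of f] f by blast
  have "labels_at L v \<subseteq> N v \<and> N v \<subseteq> lc (labels_at L v)" if v: "v \<in> W" for v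
  proof
    show "labels_at L v \<subseteq> N v" using f v unfolding L(2) feasible_def by blast
    show "N v \<subseteq> lc (labels_at L v)"
    proof
      fix i assume i: "i \<in> N v"
      then have T: "(v, \<kappa> i) \<in> T" using v K(2) unfolding T_def by simp
      then obtain n where n: "t n = (v, \<kappa> i)" unfolding t_def using from_nat_into_surj[OF cT] by blast
      have "i \<in> lc (labels_at (f (Suc n)) v)" using f[of n] T n i by auto
      then show "i \<in> lc (labels_at L v)" by (rule cl_monoD) (auto simp: L(2))
    qed
  qed
  then show ?thesis using that L(1) by blast
qed

end

section \<open>Matroids as closure operators\<close>

context matroid
begin

abbreviation "mspan \<equiv> matroid_span S Ind"
abbreviation "base_of X B \<equiv> maximal_in (restrict_matroid Ind X) B"

lemma base_of_iff: "base_of X B \<longleftrightarrow> B \<in> Ind \<and> B \<subseteq> X \<and> (\<forall>x\<in>X - B. insert x B \<notin> Ind)"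
proof
  assume "base_of X B"
  then show "B \<in> Ind \<and> B \<subseteq> X \<and> (\<forall>x\<in>X - B. insert x B \<notin> Ind)"
    unfolding maximal_in_def restrict_matroid_def by blast
next
  assume B: "B \<in> Ind \<and> B \<subseteq> X \<and> (\<forall>x\<in>X - B. insert x B \<notin> Ind)"
  have "C = B" if C: "C \<in> Ind" "C \<subseteq> X" "B \<subseteq> C" for C
  proof (rule ccontr)
    assume "C \<noteq> B"
    then obtain x where "x \<in> C - B" using C by blast
    then have "insert x B \<subseteq> C" "x \<in> X - B" using C by auto
    then show False using B Ind_down[OF C(1), of "insert x B"] by blast
  qed
  then show "base_of X B" using B unfolding maximal_in_def restrict_matroid_def by blast
qed

lemma max_iff: "maximal_in Ind B \<longleftrightarrow> B \<in> Ind \<and> (\<forall>x\<in>S - B. insert x B \<notin> Ind)"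
proof -
  have "restrict_matroid Ind S = Ind" using Ind_subset unfolding restrict_matroid_def by blast
  then show ?thesis using base_of_iff[of S B] Ind_subset by auto
qed

lemma base_ext:
  assumes "J \<in> Ind" "J \<subseteq> X" "X \<subseteq> S"
  obtains B where "base_of X B" "J \<subseteq> B"
proof -
  obtain B where "maximal_in {J' \<in> Ind. J \<subseteq> J' \<and> J' \<subseteq> X} B" using Ind_maximal[OF assms] by blast
  then have B: "B \<in> Ind" "J \<subseteq> B" "B \<subseteq> X" "\<And>C. C \<in> Ind \<Longrightarrow> J \<subseteq> C \<Longrightarrow> C \<subseteq> X \<Longrightarrow> B \<subseteq> C \<Longrightarrow> C = B"
    unfolding maximal_in_def by auto
  have "insert x B \<notin> Ind" if "x \<in> X - B" for x
  proof
    assume "insert x B \<in> Ind"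
    then have "insert x B = B" using B(2,3) that by (intro B(4)) auto
    then show False using that by blast
  qed
  then show ?thesis using that[of B] B base_of_iff by blast
qed

lemma ex_base: "X \<subseteq> S \<Longrightarrow> \<exists>B. base_of X B"
  using base_ext[OF empty_Ind] by blast

lemma augment_to:
  assumes B: "maximal_in Ind B" and I: "I \<in> Ind"
  obtains J where "maximal_in Ind J" "I \<subseteq> J" "J \<subseteq> I \<union> B"
proof -
  have "I \<union> B \<subseteq> S" using B I Ind_subset unfolding maximal_in_def by blast
  then obtain J where J: "base_of (I \<union> B) J" "I \<subseteq> J" using base_ext[OF I] by blast
  then have J': "J \<in> Ind" "J \<subseteq> I \<union> B" "\<forall>x\<in>I \<union> B - J. insert x J \<notin> Ind" unfolding base_of_iff by auto
  have "maximal_in Ind J"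
  proof (rule ccontr)
    assume "\<not> ?thesis"
    then obtain i where "i \<in> B - J" "J \<union> {i} \<in> Ind" using Ind_augment[OF B J'(1)] by blast
    then show False using J'(3) by auto
  qed
  then show ?thesis using that J J' by blast
qed

text \<open>The augmentation axiom concerns bases of the whole matroid. \<open>B\<close> is extended
  to a base \<open>M\<close>, \<open>I\<close> to a base \<open>J0\<close> within
  \<open>I \<union> M\<close>, and \<open>insert z I\<close> to a base \<open>J2\<close> within
  \<open>insert z I \<union> J0\<close>. Under the contrary assumption \<open>J0\<close> meets
  \<open>X\<close> in \<open>I\<close> only, so \<open>J2\<close> lacks some \<open>k\<close> of
  \<open>M - X\<close>. Then \<open>B \<union> (J2 - X)\<close> is a proper subset of
  \<open>M\<close>, and augmenting it from \<open>J2\<close> adds an element of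
  \<open>X - B\<close>, against the maximality of \<open>B\<close>.\<close>

lemma restrict_augment:
  assumes X: "X \<subseteq> S" and B: "base_of X B" and I: "I \<in> Ind" "I \<subseteq> X" and z: "z \<in> X - I" "insert z I \<in> Ind"
  shows "\<exists>i\<in>B - I. insert i I \<in> Ind"
proof (rule ccontr)
  assume no: "\<not> ?thesis"
  have B': "B \<in> Ind" "B \<subseteq> X" "\<forall>x\<in>X - B. insert x B \<notin> Ind" using B unfolding base_of_iff by auto
  obtain M where M: "base_of S M" "B \<subseteq> M" using base_ext[OF B'(1)] B'(2) X by blast
  have Mm: "maximal_in Ind M" using M(1) unfolding max_iff base_of_iff by blast
  have MI: "M \<in> Ind" using Mm unfolding max_iff by blast
  have MX: "M \<inter> X = B"
  proof (rule ccontr)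
    assume "M \<inter> X \<noteq> B"
    then obtain x where "x \<in> M" "x \<in> X - B" using M(2) B'(2) by blast
    then have "insert x B \<subseteq> M" using M(2) by blast
    then have "insert x B \<in> Ind" by (rule Ind_down[OF MI])
    then show False using B'(3) \<open>x \<in> X - B\<close> by blast
  qed
  obtain J0 where J0: "maximal_in Ind J0" "I \<subseteq> J0" "J0 \<subseteq> I \<union> M" using augment_to[OF Mm I(1)] by blast
  have J0I: "J0 \<in> Ind" using J0(1) unfolding max_iff by blast
  have J0X: "J0 \<inter> X = I"
  proof (rule ccontr)
    assume "J0 \<inter> X \<noteq> I"
    then obtain x where x: "x \<in> J0" "x \<in> X" "x \<notin> I" using J0(2) I(2) by blast
    then have "x \<in> B" using J0(3) MX by blast
    moreover have "insert x I \<in> Ind" by (rule Ind_down[OF J0I]) (use x J0(2) in blast)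
    ultimately show False using no x by blast
  qed
  obtain J2 where J2: "maximal_in Ind J2" "insert z I \<subseteq> J2" "J2 \<subseteq> insert z I \<union> J0" using augment_to[OF J0(1) z(2)] by blast
  have J2I: "J2 \<in> Ind" using J2(1) unfolding max_iff by blast
  have "\<not> J0 \<subseteq> J2"
  proof
    assume "J0 \<subseteq> J2"
    then have "J2 = J0" using J0(1) J2I unfolding maximal_in_def by blast
    then show False using J2(2) J0X z(1) by blast
  qed
  then obtain k where k: "k \<in> J0" "k \<notin> J2" by blast
  have kM: "k \<in> M" "k \<notin> X" using k J0 J0X J2(2) by blast+
  let ?C = "B \<union> (J2 - X)"
  have CM: "insert k ?C \<subseteq> M" using M(2) kM(1) J2(3) J0(3) I(2) z(1) by blast
  then have CI: "?C \<in> Ind" "insert k ?C \<in> Ind" using Ind_down[OF MI, of ?C] Ind_down[OF MI, of "insert k ?C"] by auto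
  have "k \<notin> ?C" using k(2) kM(2) B'(2) by blast
  then have "\<not> maximal_in Ind ?C" using CI(2) unfolding maximal_in_def by blast
  then obtain i where i: "i \<in> J2 - ?C" "?C \<union> {i} \<in> Ind" using Ind_augment[OF J2(1) CI(1)] by blast
  have "i \<in> X - B" using i(1) by blast
  moreover have "insert i B \<in> Ind" by (rule Ind_down[OF i(2)]) blast
  ultimately show False using B'(3) by blast
qed

lemma base_insert_indep:
  assumes X: "X \<subseteq> S" and B: "base_of X B" "base_of X B'" and x: "x \<in> S - X" "insert x B \<in> Ind"
  shows "insert x B' \<in> Ind"
proof (rule ccontr)
  assume n: "insert x B' \<notin> Ind"
  have b: "B \<in> Ind" "B \<subseteq> X" "\<forall>x\<in>X - B. insert x B \<notin> Ind" "B' \<in> Ind" "B' \<subseteq> X" "\<forall>x\<in>X - B'. insert x B' \<notin> Ind"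
    using B unfolding base_of_iff by auto
  have "base_of (insert x X) B'" unfolding base_of_iff using b n by auto
  then obtain i where "i \<in> B' - B" "insert i B \<in> Ind"
    using restrict_augment[of "insert x X" B' B x] X x b by blast
  then show False using b by blast
qed

text \<open>By \<open>base_insert_indep\<close> all bases of \<open>X\<close> agree on which single
  elements can be added, so the span may be computed from a fixed base.\<close>

lemma span_iff:
  assumes X: "X \<subseteq> S" and B: "base_of X B"
  shows "x \<in> mspan X \<longleftrightarrow> x \<in> X \<or> (x \<in> S \<and> insert x B \<notin> Ind)"
proof (cases "x \<in> S - X")
  case False then show ?thesis using X unfolding matroid_span_def matroid_loops_def by auto
next
  case True
  have "{x} \<in> contract_matroid S Ind X \<longleftrightarrow> insert x B \<in> Ind"
    using True B base_insert_indep[OF X] unfolding contract_matroid_def by auto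
  then show ?thesis using True unfolding matroid_span_def matroid_loops_def by auto
qed

lemma span_subset: "X \<subseteq> S \<Longrightarrow> mspan X \<subseteq> S"
  unfolding matroid_span_def matroid_loops_def by auto

lemma span_ext: "X \<subseteq> mspan X"
  unfolding matroid_span_def by auto

lemma span_mono:
  assumes XY: "X \<subseteq> Y" "Y \<subseteq> S"
  shows "mspan X \<subseteq> mspan Y"
proof
  fix x assume x: "x \<in> mspan X"
  have X: "X \<subseteq> S" using XY by blast
  obtain B where B: "base_of X B" using ex_base[OF X] by blast
  have BI: "B \<in> Ind" "B \<subseteq> Y" using B XY unfolding base_of_iff by auto
  obtain B' where B': "base_of Y B'" "B \<subseteq> B'" using base_ext[OF BI XY(2)] by blast
  show "x \<in> mspan Y" using x Ind_down[of "insert x B'" "insert x B"] B'(2) XY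
    unfolding span_iff[OF X B] span_iff[OF XY(2) B'(1)] by blast
qed

lemma base_of_span:
  assumes X: "X \<subseteq> S" and B: "base_of X B"
  shows "base_of (mspan X) B"
  using B span_ext[of X] span_iff[OF X B] unfolding base_of_iff by blast

lemma span_idem:
  assumes X: "X \<subseteq> S"
  shows "mspan (mspan X) = mspan X"
proof -
  obtain B where B: "base_of X B" using ex_base[OF X] by blast
  show ?thesis using span_iff[OF X B] span_iff[OF span_subset[OF X] base_of_span[OF X B]] by blast
qed

lemma base_insert:
  assumes X: "X \<subseteq> S" and B: "base_of X B" and x: "x \<in> S" "insert x B \<in> Ind"
  shows "base_of (insert x X) (insert x B)"
proof -
  have "insert y (insert x B) \<notin> Ind" if "y \<in> X - B" for y
    using B that Ind_down[of "insert y (insert x B)" "insert y B"] unfolding base_of_iff by blast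
  then show ?thesis using B x unfolding base_of_iff by auto
qed

lemma span_exchange:
  assumes A: "A \<subseteq> S" and x: "x \<in> S" and y: "y \<in> mspan (insert x A)" "y \<notin> mspan A"
  shows "x \<in> mspan (insert y A)"
proof -
  obtain B where B: "base_of A B" using ex_base[OF A] by blast
  have xA: "insert x A \<subseteq> S" using A x by blast
  have yS: "y \<in> S" using y(1) span_subset[OF xA] by blast
  have yA: "insert y A \<subseteq> S" using A yS by blast
  have yB: "insert y B \<in> Ind" using y(2) yS unfolding span_iff[OF A B] by blast
  have xB: "insert x B \<in> Ind"
  proof (rule ccontr)
    assume "insert x B \<notin> Ind"
    then have "base_of (insert x A) B" using B unfolding base_of_iff by auto
    then have "y = x \<or> insert y B \<notin> Ind" using y span_iff[OF xA, of B y] span_iff[OF A B, of y] by blast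
    then show False using yB \<open>insert x B \<notin> Ind\<close> by blast
  qed
  have "y = x \<or> y \<in> A \<or> insert y (insert x B) \<notin> Ind" using y(1) span_iff[OF xA base_insert[OF A B x xB]] by blast
  then show ?thesis using span_iff[OF yA base_insert[OF A B yS yB]] x y(2) span_ext[of A] by (auto simp: insert_commute)
qed

lemma Ind_iff:
  assumes I: "I \<subseteq> S"
  shows "I \<in> Ind \<longleftrightarrow> (\<forall>x\<in>I. x \<notin> mspan (I - {x}))"
proof
  assume Ind: "I \<in> Ind"
  show "\<forall>x\<in>I. x \<notin> mspan (I - {x})"
  proof
    fix x assume x: "x \<in> I"
    have "base_of (I - {x}) (I - {x})" using Ind_down[OF Ind, of "I - {x}"] unfolding base_of_iff by blast
    moreover have "I - {x} \<subseteq> S" using I by blast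
    ultimately show "x \<notin> mspan (I - {x})" using span_iff[of "I - {x}" "I - {x}" x] x Ind by (auto simp: insert_absorb)
  qed
next
  assume a: "\<forall>x\<in>I. x \<notin> mspan (I - {x})"
  obtain B where B: "base_of I B" using ex_base[OF I] by blast
  have "B = I"
  proof (rule ccontr)
    assume "B \<noteq> I"
    then obtain x where x: "x \<in> I" "x \<notin> B" using B unfolding base_of_iff by blast
    have "base_of (I - {x}) B" using B x(2) unfolding base_of_iff by blast
    moreover have "insert x B \<notin> Ind" using B x unfolding base_of_iff by blast
    moreover have "I - {x} \<subseteq> S" "x \<in> S" using I x by auto
    ultimately have "x \<in> mspan (I - {x})" using span_iff[of "I - {x}" B x] by simp
    then show False using a x by blast
  qed
  then show "I \<in> Ind" using B unfolding base_of_iff by blast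
qed

text \<open>\<open>C\<close> is the fundamental circuit of \<open>x\<close> in a base
  \<open>B\<close> of \<open>A\<close>. The point for infinite \<open>B\<close> is that it is
  dependent: a base \<open>J\<close> of \<open>insert x B\<close> containing \<open>C\<close> would
  miss some \<open>b\<close> of \<open>B\<close> and, by \<open>restrict_augment\<close>, nothing
  else; but then \<open>b\<close> belongs to \<open>C\<close>.\<close>

lemma span_circuit:
  assumes A: "A \<subseteq> S" and x: "x \<in> mspan A" "x \<notin> A"
  obtains C where "matroid_circuit S Ind C" "x \<in> C" "C - {x} \<subseteq> A"
proof -
  obtain B where B: "base_of A B" using ex_base[OF A] by blast
  have xS: "x \<in> S" "insert x B \<notin> Ind" using x span_iff[OF A B] by auto
  have BI: "B \<in> Ind" "B \<subseteq> A" using B unfolding base_of_iff by auto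
  define C where "C = insert x {b \<in> B. insert x (B - {b}) \<in> Ind}"
  have xB: "x \<notin> B" using BI x by blast
  have BS: "insert x B \<subseteq> S" using xS BI A by blast
  have Bb: "base_of (insert x B) B" unfolding base_of_iff using BI xS by auto
  have "C \<notin> Ind"
  proof
    assume CI: "C \<in> Ind"
    have "C \<subseteq> insert x B" unfolding C_def by blast
    then obtain J where J: "base_of (insert x B) J" "C \<subseteq> J" using base_ext[OF CI _ BS] by blast
    then have J': "J \<in> Ind" "J \<subseteq> insert x B" "x \<in> J" "\<forall>y\<in>insert x B - J. insert y J \<notin> Ind"
      unfolding base_of_iff C_def by auto
    have "\<not> B \<subseteq> J"
    proof
      assume "B \<subseteq> J"
      then have "insert x B \<subseteq> J" using J'(3) by blast
      then show False using Ind_down[OF J'(1), of "insert x B"] xS(2) by blast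
    qed
    then obtain b where b: "b \<in> B" "b \<notin> J" by blast
    have "J = insert x (B - {b})"
    proof (rule ccontr)
      assume "J \<noteq> insert x (B - {b})"
      then obtain c where c: "c \<in> B" "c \<noteq> b" "c \<notin> J" using J' b by blast
      let ?K = "insert b (J - {x})"
      have K: "?K \<in> Ind" "?K \<subseteq> insert x B" using Ind_down[OF BI(1), of ?K] J'(2) b by auto
      have "c \<in> insert x B - ?K" "insert c ?K \<in> Ind" using c xB Ind_down[OF BI(1), of "insert c ?K"] J'(2) b by auto
      then obtain i where i: "i \<in> J - ?K" "insert i ?K \<in> Ind" using restrict_augment[OF BS J(1) K] by blast
      then have "i = x" by blast
      then have "insert i ?K = insert b J" using J'(3) by auto
      then show False using i(2) J'(4) b by auto
    qed
    then have "insert x (B - {b}) \<in> Ind" using J'(1) by simp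
    then have "b \<in> C" using b unfolding C_def by blast
    then show False using b J(2) by blast
  qed
  moreover have "C' \<in> Ind" if C': "C' \<subset> C" for C'
  proof -
    obtain c where c: "c \<in> C" "c \<notin> C'" using C' by blast
    show ?thesis
    proof (cases "c = x")
      case True
      then have "C' \<subseteq> B" using C' c unfolding C_def by blast
      then show ?thesis by (rule Ind_down[OF BI(1)])
    next
      case False
      then have "insert x (B - {c}) \<in> Ind" using c(1) unfolding C_def by blast
      moreover have "C' \<subseteq> insert x (B - {c})" using C' c unfolding C_def by blast
      ultimately show ?thesis by (rule Ind_down)
    qed
  qed
  moreover have "C \<subseteq> S" using BS unfolding C_def by blast
  ultimately have "matroid_circuit S Ind C" unfolding matroid_circuit_def by blast
  then show ?thesis using that[of C] BI(2) unfolding C_def by blast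
qed

lemma card_le_base:
  assumes X: "X \<subseteq> S" and B: "base_of X B" "finite B" and I: "I \<in> Ind" "I \<subseteq> X"
  shows "finite I \<and> card I \<le> card B"
proof -
  have fin: "card I \<le> card B" if "finite I" "I \<in> Ind" "I \<subseteq> X" for I
    using that
  proof (induction "card (I - B)" arbitrary: I rule: less_induct)
    case less
    show ?case
    proof (cases "I \<subseteq> B")
      case True then show ?thesis using B(2) card_mono by blast
    next
      case False
      then obtain y where y: "y \<in> I" "y \<notin> B" by blast
      have "insert y (I - {y}) \<in> Ind" using y less.prems by (simp add: insert_absorb)
      moreover have "I - {y} \<in> Ind" "I - {y} \<subseteq> X" "y \<in> X - (I - {y})" using less.prems y Ind_down[of I "I - {y}"] by auto
      ultimately obtain b where b: "b \<in> B - (I - {y})" "insert b (I - {y}) \<in> Ind" using restrict_augment[OF X B(1)] by blast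
      let ?I = "insert b (I - {y})"
      have "?I - B \<subset> I - B" using b y by auto
      then have "card (?I - B) < card (I - B)" using less.prems(1) by (intro psubset_card_mono) auto
      moreover have "?I \<subseteq> X" using b B(1) less.prems(3) unfolding base_of_iff by blast
      ultimately have "card ?I \<le> card B" using less.hyps[of ?I] b(2) less.prems(1) by blast
      moreover have "card ?I = card I" using b y less.prems(1) by (metis DiffD2 card_Suc_Diff1 card_insert_disjoint finite_Diff)
      ultimately show ?thesis by simp
    qed
  qed
  have "finite I"
  proof (rule ccontr)
    assume "infinite I"
    then obtain F where F: "F \<subseteq> I" "finite F" "card F = Suc (card B)" using infinite_arbitrarily_large by blast
    then have "card F \<le> card B" using fin[of F] Ind_down[OF I(1) F(1)] I(2) by blast
    then show False using F by simp
  qed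
  then show ?thesis using fin I by blast
qed

text \<open>Closure operators are defined on the whole type, so the elements outside \<open>S\<close> are treated as coloops.\<close>

definition mcl :: "'s set \<Rightarrow> 's set" where
  "mcl X = X \<union> mspan (X \<inter> S)"

lemma mcl_span: "X \<subseteq> S \<Longrightarrow> mcl X = mspan X"
  unfolding mcl_def using span_ext[of X] by (auto simp: Int_absorb2)

lemma mcl_Int: "mcl X \<inter> S = mspan (X \<inter> S)"
  unfolding mcl_def using span_ext[of "X \<inter> S"] span_subset[of "X \<inter> S"] by blast

text \<open>Circuits do not cross summands, so an element spanned by others is spanned through a
  circuit inside its own summand; this gives \<open>cl_summand\<close>.\<close>

lemma closure_matroid_mcl:
  fixes \<kappa> :: "'s \<Rightarrow> 's set"
  assumes out: "\<And>i. i \<notin> S \<Longrightarrow> \<kappa> i = {i}" and inn: "\<And>i. i \<in> S \<Longrightarrow> \<kappa> i \<subseteq> S"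
    and circ: "\<And>x y. (x, y) \<in> common_circuit S Ind \<Longrightarrow> \<kappa> x = \<kappa> y"
    and rank: "\<And>k. finite_rank (restrict_matroid Ind {i \<in> S. \<kappa> i = k})"
  shows "closure_matroid mcl \<kappa>"
proof
  fix A B :: "'s set" and x y :: 's and k
  show "A \<subseteq> mcl A" unfolding mcl_def by blast
  show "mcl A \<subseteq> mcl B" if "A \<subseteq> B" using that span_mono[of "A \<inter> S" "B \<inter> S"] unfolding mcl_def by blast
  show "mcl (mcl A) = mcl A"
  proof -
    have "mcl (mcl A) = mcl A \<union> mspan (mspan (A \<inter> S))" unfolding mcl_def[of "mcl A"] mcl_Int ..
    then show ?thesis using span_idem[of "A \<inter> S"] unfolding mcl_def by auto
  qed
  show "x \<in> mcl (insert y A)" if y: "y \<in> mcl (insert x A)" "y \<notin> mcl A"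
  proof (cases "x = y")
    case True then show ?thesis unfolding mcl_def by blast
  next
    case False
    then have ys: "y \<in> mspan (insert x A \<inter> S)" "y \<notin> mspan (A \<inter> S)" using y unfolding mcl_def by auto
    then have xS: "x \<in> S" by (cases "x \<in> S") auto
    have "y \<in> S" using ys(1) span_subset[of "insert x A \<inter> S"] by blast
    then have "insert y A \<inter> S = insert y (A \<inter> S)" by blast
    moreover have "insert x A \<inter> S = insert x (A \<inter> S)" using xS by blast
    ultimately show ?thesis using span_exchange[of "A \<inter> S" x y] xS ys unfolding mcl_def by auto
  qed
  show "x \<in> mcl {a \<in> A. \<kappa> a = \<kappa> x}" if x: "x \<in> mcl A"
  proof (cases "x \<in> A")
    case True then show ?thesis unfolding mcl_def by blast
  next
    case False
    then have xs: "x \<in> mspan (A \<inter> S)" using x unfolding mcl_def by blast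
    obtain C where C: "matroid_circuit S Ind C" "x \<in> C" "C - {x} \<subseteq> A \<inter> S"
      using span_circuit[of "A \<inter> S" x] xs False by blast
    have cc: "\<kappa> c = \<kappa> x" if "c \<in> C" for c using circ[of c x] C that unfolding common_circuit_def by blast
    have CS: "C \<subseteq> S" "C \<notin> Ind" "C - {x} \<in> Ind" using C unfolding matroid_circuit_def by blast+
    have "base_of (C - {x}) (C - {x})" using CS(3) unfolding base_of_iff by blast
    moreover have "C - {x} \<subseteq> S" "insert x (C - {x}) = C" using CS C(2) by auto
    ultimately have "x \<in> mspan (C - {x})" using span_iff[of "C - {x}" "C - {x}" x] CS C(2) by auto
    moreover have "mspan (C - {x}) \<subseteq> mspan ({a \<in> A. \<kappa> a = \<kappa> x} \<inter> S)" using C(3) cc by (intro span_mono) auto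
    ultimately show ?thesis unfolding mcl_def by blast
  qed
  show "\<exists>n. \<forall>I. (\<forall>x\<in>I. x \<notin> mcl (I - {x}) \<and> \<kappa> x = k) \<longrightarrow> finite I \<and> card I \<le> n"
  proof -
    let ?X = "{i \<in> S. \<kappa> i = k}"
    obtain B where B: "base_of ?X B" "finite B" using rank[of k] unfolding finite_rank_def by blast
    show ?thesis
    \<comment> \<open>The value 1 accounts for the singleton summands of elements outside
      \<open>S\<close>.\<close>
    proof (intro exI[of _ "max 1 (card B)"] allI impI)
      fix I assume I: "\<forall>x\<in>I. x \<notin> mcl (I - {x}) \<and> \<kappa> x = k"
      show "finite I \<and> card I \<le> max 1 (card B)"
      proof (cases "I \<subseteq> S")
        case True
        have "\<forall>x\<in>I. x \<notin> mspan (I - {x})"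
        proof
          fix x assume "x \<in> I"
          then have "x \<notin> mcl (I - {x})" using I by blast
          moreover have "I - {x} \<subseteq> S" using True by blast
          ultimately show "x \<notin> mspan (I - {x})" using mcl_span by simp
        qed
        then have "I \<in> Ind" using Ind_iff[OF True] by blast
        moreover have "I \<subseteq> ?X" using True I by blast
        ultimately have "finite I \<and> card I \<le> card B" using card_le_base[of ?X B I] B by blast
        then show ?thesis by auto
      next
        case False
        then obtain i where i: "i \<in> I" "i \<notin> S" by blast
        have k: "k = {i}" using I i out[of i] by auto
        have "I \<subseteq> {i}"
        proof
          fix j assume j: "j \<in> I"
          show "j \<in> {i}"
          proof (cases "j \<in> S")
            case True then have "\<kappa> j \<subseteq> S" by (rule inn) then show ?thesis using I j k i by auto
          next
            case False then show ?thesis using I j k out[of j] by auto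
          qed
        qed
        then have "I = {i}" using i by blast
        then show ?thesis by simp
      qed
    qed
  qed
qed

end

section \<open>Partial packings\<close>

text \<open>The hypotheses in terms of closure alone. In the first alternative of
  \<open>cond\<close> all labels lie in one summand, and the paths considered have constant flat, as
  do those that the search produces.\<close>

locale packing = closure_matroid lc \<kappa> for lc :: "'s set \<Rightarrow> 's set" and \<kappa> :: "'s \<Rightarrow> 'k" +
  fixes src dst :: "'a \<Rightarrow> 'v" and V :: "'v set" and Ar :: "'a set" and S0 N :: "'v \<Rightarrow> 's set" and K :: "'k set"
  assumes Ar: "a \<in> Ar \<Longrightarrow> src a \<in> V \<and> dst a \<in> V"
    and N_flat: "v \<in> V \<Longrightarrow> lc (N v) = N v"
    and N_mono: "a \<in> Ar \<Longrightarrow> N (src a) \<subseteq> N (dst a)"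
    and S0_N: "v \<in> V \<Longrightarrow> S0 v \<subseteq> N v"
    and S0_indep: "v \<in> V \<Longrightarrow> indep (S0 v)"
    and K: "countable K" "v \<in> V \<Longrightarrow> i \<in> N v \<Longrightarrow> \<kappa> i \<in> K"
    and link: "x \<in> V \<Longrightarrow> \<exists>B U P. indep B \<and> N x \<subseteq> lc B \<and>
      (\<forall>b\<in>B. U b \<in> V \<and> b \<in> S0 (U b) \<and> arc_walk src dst (U b) (P b) x \<and> set (P b) \<subseteq> Ar \<and> distinct (P b)) \<and>
      (\<forall>b\<in>B. \<forall>c\<in>B. b \<noteq> c \<longrightarrow> set (P b) \<inter> set (P c) = {})"
    and cond: "((\<forall>x e. inj x \<longrightarrow> (\<forall>m::nat. e m \<in> Ar \<and> src (e m) = x m \<and> dst (e m) = x (Suc m)) \<longrightarrow>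
      (\<forall>m. x m \<in> V \<and> N (x m) = N (x 0)) \<longrightarrow> N (x 0) \<subseteq> lc (\<Union>m. S0 (x m))) \<and>
      (\<exists>ks. \<forall>v\<in>V. \<forall>i\<in>N v. \<kappa> i = ks)) \<or>
     (\<forall>x e. inj x \<longrightarrow> (\<forall>m::nat. e m \<in> Ar \<and> dst (e m) = x m \<and> src (e m) = x (Suc m)) \<longrightarrow>
      (\<forall>m. x m \<in> V) \<longrightarrow> N (x 0) \<subseteq> lc (\<Union>m. S0 (x m)))"
begin

definition packed_labels :: "('a \<times> 's) set \<Rightarrow> 'v \<Rightarrow> 's set" where
  "packed_labels R v = S0 v \<union> {i. \<exists>a. (a, i) \<in> R \<and> dst a = v}"

text \<open>A relation replaces the partial labelling so that extension is inclusion of sets. Each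
  vertex of \<open>U\<close> is complete, so its labels never change again.\<close>

definition partial_packing :: "'v set \<Rightarrow> ('a \<times> 's) set \<Rightarrow> bool" where
  "partial_packing U R \<longleftrightarrow> U \<subseteq> V \<and>
    (\<forall>a i. (a, i) \<in> R \<longrightarrow> a \<in> Ar \<and> dst a \<in> U \<and> src a \<in> U \<and> i \<notin> S0 (dst a) \<and> i \<in> packed_labels R (src a)) \<and>
    (\<forall>a i j. (a, i) \<in> R \<longrightarrow> (a, j) \<in> R \<longrightarrow> i = j) \<and>
    (\<forall>a b i. (a, i) \<in> R \<longrightarrow> (b, i) \<in> R \<longrightarrow> dst a = dst b \<longrightarrow> a = b) \<and>
    (\<forall>v i. i \<in> packed_labels R v \<longrightarrow> (\<exists>u p. i \<in> S0 u \<and> arc_walk src dst u p v \<and> (\<forall>a\<in>set p. (a, i) \<in> R))) \<and>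
    (\<forall>v\<in>U. indep (packed_labels R v) \<and> packed_labels R v \<subseteq> N v \<and> N v \<subseteq> lc (packed_labels R v))"

lemma partial_packingD:
  assumes "partial_packing U R"
  shows "U \<subseteq> V"
    "(a, i) \<in> R \<Longrightarrow> a \<in> Ar \<and> dst a \<in> U \<and> src a \<in> U \<and> i \<notin> S0 (dst a) \<and> i \<in> packed_labels R (src a)"
    "(a, i) \<in> R \<Longrightarrow> (a, j) \<in> R \<Longrightarrow> i = j"
    "(a, i) \<in> R \<Longrightarrow> (b, i) \<in> R \<Longrightarrow> dst a = dst b \<Longrightarrow> a = b"
    "i \<in> packed_labels R v \<Longrightarrow> \<exists>u p. i \<in> S0 u \<and> arc_walk src dst u p v \<and> (\<forall>a\<in>set p. (a, i) \<in> R)"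
    "v \<in> U \<Longrightarrow> indep (packed_labels R v) \<and> packed_labels R v \<subseteq> N v \<and> N v \<subseteq> lc (packed_labels R v)"
proof -
  note d = assms[unfolded partial_packing_def]
  show "U \<subseteq> V" using d by (rule conjunct1)
  have 2: "\<forall>a i. (a, i) \<in> R \<longrightarrow> a \<in> Ar \<and> dst a \<in> U \<and> src a \<in> U \<and> i \<notin> S0 (dst a) \<and> i \<in> packed_labels R (src a)" using d by (elim conjE)
  then show "(a, i) \<in> R \<Longrightarrow> a \<in> Ar \<and> dst a \<in> U \<and> src a \<in> U \<and> i \<notin> S0 (dst a) \<and> i \<in> packed_labels R (src a)" by (elim allE impE)
  have 3: "\<forall>a i j. (a, i) \<in> R \<longrightarrow> (a, j) \<in> R \<longrightarrow> i = j" using d by (elim conjE)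
  show "(a, i) \<in> R \<Longrightarrow> (a, j) \<in> R \<Longrightarrow> i = j" using 3[rule_format, of a i j] .
  have 4: "\<forall>a b i. (a, i) \<in> R \<longrightarrow> (b, i) \<in> R \<longrightarrow> dst a = dst b \<longrightarrow> a = b" using d by (elim conjE)
  show "(a, i) \<in> R \<Longrightarrow> (b, i) \<in> R \<Longrightarrow> dst a = dst b \<Longrightarrow> a = b" using 4[rule_format, of a i b] .
  have 5: "\<forall>v i. i \<in> packed_labels R v \<longrightarrow> (\<exists>u p. i \<in> S0 u \<and> arc_walk src dst u p v \<and> (\<forall>a\<in>set p. (a, i) \<in> R))" using d by (elim conjE)
  show "i \<in> packed_labels R v \<Longrightarrow> \<exists>u p. i \<in> S0 u \<and> arc_walk src dst u p v \<and> (\<forall>a\<in>set p. (a, i) \<in> R)" by (rule 5[rule_format])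
  have 6: "\<forall>v\<in>U. indep (packed_labels R v) \<and> packed_labels R v \<subseteq> N v \<and> N v \<subseteq> lc (packed_labels R v)" using d by (elim conjE)
  show "v \<in> U \<Longrightarrow> indep (packed_labels R v) \<and> packed_labels R v \<subseteq> N v \<and> N v \<subseteq> lc (packed_labels R v)" by (rule bspec[OF 6])
qed

lemma packed_labels_mono: "R \<subseteq> R' \<Longrightarrow> packed_labels R v \<subseteq> packed_labels R' v"
  unfolding packed_labels_def by blast

text \<open>Hence the extension order of partial packings is inclusion.\<close>

lemma partial_packing_eq:
  assumes X: "partial_packing U R" and Y: "partial_packing U' R'" and sub: "U \<subseteq> U'" "R \<subseteq> R'" and v: "v \<in> U"
  shows "packed_labels R' v = packed_labels R v"
proof
  show "packed_labels R v \<subseteq> packed_labels R' v" by (rule packed_labels_mono[OF sub(2)])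
  show "packed_labels R' v \<subseteq> packed_labels R v"
  proof
    fix j assume j: "j \<in> packed_labels R' v"
    show "j \<in> packed_labels R v"
    proof (rule ccontr)
      assume n: "j \<notin> packed_labels R v"
      have v': "v \<in> U'" using v sub(1) by blast
      \<comment> \<open>Both label sets are independent and span \<open>N v\<close>, so neither can
        properly contain the other.\<close>
      have "j \<in> lc (packed_labels R v)" using partial_packingD(6)[OF X v] partial_packingD(6)[OF Y v'] j by blast
      moreover have "packed_labels R v \<subseteq> packed_labels R' v - {j}" using n packed_labels_mono[OF sub(2), of v] by blast
      ultimately have "j \<in> lc (packed_labels R' v - {j})" by (rule cl_monoD)
      moreover have "indep (packed_labels R' v)" using partial_packingD(6)[OF Y v'] by blast
      ultimately show False using j unfolding indep_def by blast
    qed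
  qed
qed

text \<open>Both components in one set, so that Zorn's lemma for inclusion applies.\<close>

definition partial_packing_sum :: "('v + 'a \<times> 's) set \<Rightarrow> bool" where
  "partial_packing_sum X \<longleftrightarrow> partial_packing (Inl -` X) (Inr -` X)"

lemma partial_packing_sum_Union:
  assumes C: "\<And>X. X \<in> C \<Longrightarrow> partial_packing_sum X" and ch: "\<And>X Y. X \<in> C \<Longrightarrow> Y \<in> C \<Longrightarrow> X \<subseteq> Y \<or> Y \<subseteq> X"
  shows "partial_packing_sum (\<Union>C)"
proof -
  let ?U = "Inl -` \<Union>C" and ?R = "Inr -` \<Union>C"
  have ps: "partial_packing (Inl -` X) (Inr -` X)" if "X \<in> C" for X using C[OF that] unfolding partial_packing_sum_def .
  have inR: "\<exists>X\<in>C. r \<in> Inr -` X" if "r \<in> ?R" for r using that by blast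
  have sub: "Inr -` X \<subseteq> ?R" "Inl -` X \<subseteq> ?U" if "X \<in> C" for X using that by auto
  have both: "\<exists>X\<in>C. r \<in> Inr -` X \<and> r' \<in> Inr -` X" if r: "r \<in> ?R" "r' \<in> ?R" for r r'
  proof -
    obtain X Y where XY: "X \<in> C" "r \<in> Inr -` X" "Y \<in> C" "r' \<in> Inr -` Y" using r by blast
    from ch[OF XY(1,3)] show ?thesis
    proof
      assume "X \<subseteq> Y" then have "r \<in> Inr -` Y" using XY(2) by auto
      then show ?thesis using XY by blast
    next
      assume "Y \<subseteq> X" then have "r' \<in> Inr -` X" using XY(4) by auto
      then show ?thesis using XY by blast
    qed
  qed
  \<comment> \<open>By \<open>partial_packing_eq\<close> any element of the chain containing
    \<open>v\<close> already shows all labels of \<open>v\<close>; this carries independence over to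
    the union.\<close>
  have loc: "packed_labels ?R v = packed_labels (Inr -` X) v" if X: "X \<in> C" "v \<in> Inl -` X" for X v
  proof
    show "packed_labels (Inr -` X) v \<subseteq> packed_labels ?R v" by (rule packed_labels_mono[OF sub(1)[OF X(1)]])
    show "packed_labels ?R v \<subseteq> packed_labels (Inr -` X) v"
    proof
      fix i assume "i \<in> packed_labels ?R v"
      then consider "i \<in> S0 v" | a where "(a, i) \<in> ?R" "dst a = v" unfolding packed_labels_def by blast
      then show "i \<in> packed_labels (Inr -` X) v"
      proof cases
        case 1 then show ?thesis unfolding packed_labels_def by blast
      next
        case (2 a)
        obtain Y where Y: "Y \<in> C" "(a, i) \<in> Inr -` Y" using inR[OF 2(1)] by blast
        have iY: "i \<in> packed_labels (Inr -` Y) v" using Y(2) 2(2) unfolding packed_labels_def by blast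
        from ch[OF X(1) Y(1)] show ?thesis
        proof
          assume s: "X \<subseteq> Y"
          have "packed_labels (Inr -` Y) v = packed_labels (Inr -` X) v"
            by (rule partial_packing_eq[OF ps[OF X(1)] ps[OF Y(1)] _ _ X(2)]) (use s in auto)
          then show ?thesis using iY by simp
        next
          assume s: "Y \<subseteq> X"
          then have "Inr -` Y \<subseteq> Inr -` X" by auto
          then show ?thesis using iY packed_labels_mono by blast
        qed
      qed
    qed
  qed
  show ?thesis unfolding partial_packing_sum_def partial_packing_def
  proof (intro conjI allI impI ballI)
    show "?U \<subseteq> V"
    proof
      fix v assume "v \<in> ?U"
      then obtain X where "X \<in> C" "v \<in> Inl -` X" by blast
      then show "v \<in> V" using partial_packingD(1)[OF ps] by blast
    qed
  next
    fix a i assume r: "(a, i) \<in> ?R"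
    obtain X where X: "X \<in> C" "(a, i) \<in> Inr -` X" using inR[OF r] by blast
    note d = partial_packingD(2)[OF ps[OF X(1)] X(2)]
    show "a \<in> Ar" "i \<notin> S0 (dst a)" using d by auto
    show "dst a \<in> ?U" "src a \<in> ?U" using d sub(2)[OF X(1)] by auto
    show "i \<in> packed_labels ?R (src a)" using d packed_labels_mono[OF sub(1)[OF X(1)]] by blast
  next
    fix a i j assume "(a, i) \<in> ?R" "(a, j) \<in> ?R"
    then obtain X where X: "X \<in> C" "(a, i) \<in> Inr -` X" "(a, j) \<in> Inr -` X" using both by meson
    show "i = j" by (rule partial_packingD(3)[OF ps[OF X(1)] X(2,3)])
  next
    fix a b i assume "(a, i) \<in> ?R" "(b, i) \<in> ?R" and d: "dst a = dst b"
    then obtain X where X: "X \<in> C" "(a, i) \<in> Inr -` X" "(b, i) \<in> Inr -` X" using both by meson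
    show "a = b" by (rule partial_packingD(4)[OF ps[OF X(1)] X(2,3) d])
  next
    fix v i assume "i \<in> packed_labels ?R v"
    then consider "i \<in> S0 v" | a where "(a, i) \<in> ?R" "dst a = v" unfolding packed_labels_def by blast
    then show "\<exists>u p. i \<in> S0 u \<and> arc_walk src dst u p v \<and> (\<forall>a\<in>set p. (a, i) \<in> ?R)"
    proof cases
      case 1 then show ?thesis by (intro exI[of _ v] exI[of _ "[]"]) simp
    next
      case (2 a)
      obtain X where X: "X \<in> C" "(a, i) \<in> Inr -` X" using inR[OF 2(1)] by blast
      have "i \<in> packed_labels (Inr -` X) v" using X(2) 2(2) unfolding packed_labels_def by blast
      then obtain u p where up: "i \<in> S0 u" "arc_walk src dst u p v" "\<forall>a\<in>set p. (a, i) \<in> Inr -` X"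
        using partial_packingD(5)[OF ps[OF X(1)]] by blast
      have "\<forall>a\<in>set p. (a, i) \<in> ?R" using up(3) sub(1)[OF X(1)] by blast
      then show ?thesis using up(1,2) by (intro exI[of _ u] exI[of _ p]) simp
    qed
  next
    fix v assume "v \<in> ?U"
    then obtain X where X: "X \<in> C" "v \<in> Inl -` X" by blast
    show "indep (packed_labels ?R v)" "packed_labels ?R v \<subseteq> N v" "N v \<subseteq> lc (packed_labels ?R v)"
      using partial_packingD(6)[OF ps[OF X(1)] X(2)] unfolding loc[OF X] by auto
  qed
qed

lemma indep_countable:
  assumes "indep B" "\<And>b. b \<in> B \<Longrightarrow> \<kappa> b \<in> K"
  shows "countable B"
proof -
  have "B = (\<Union>k\<in>K. {b \<in> B. \<kappa> b = k})" using assms(2) by blast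
  moreover have "countable (\<Union>k\<in>K. {b \<in> B. \<kappa> b = k})"
    by (rule countable_UN[OF K(1)]) (rule countable_finite[OF indep_finite_summand[OF assms(1)]])
  ultimately show ?thesis by simp
qed

lemma walk_N:
  assumes "arc_walk src dst u p v" "set p \<subseteq> Ar"
  shows "N u \<subseteq> N v"
  using assms
proof (induction p arbitrary: u)
  case (Cons a p) then show ?case using N_mono[of a] by auto
qed simp

text \<open>The trails required by feasibility are final segments of the linkage paths, starting at the last vertex
  that is completed or has a smaller flat.\<close>

lemma extend_partial_packing:
  assumes X: "partial_packing Done R" and W: "W \<subseteq> V" "Done \<inter> W = {}" "countable W"
    and closed: "\<And>x. x \<in> W \<Longrightarrow> \<exists>B U P. indep B \<and> N x \<subseteq> lc B \<and>
      (\<forall>b\<in>B. U b \<in> W \<union> Done \<and> b \<in> S0 (U b) \<and> arc_walk src dst (U b) (P b) x \<and> set (P b) \<subseteq> Ar \<and> distinct (P b) \<and> dst ` set (P b) \<subseteq> W \<union> Done) \<and>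
      (\<forall>b\<in>B. \<forall>c\<in>B. b \<noteq> c \<longrightarrow> set (P b) \<inter> set (P c) = {})"
  shows "\<exists>R'. R \<subseteq> R' \<and> partial_packing (Done \<union> W) R'"
proof -
  have DV: "Done \<subseteq> V" by (rule partial_packingD(1)[OF X])
  define A1 where "A1 = {a \<in> Ar. dst a \<in> W \<and> src a \<in> W \<union> Done}"
  define Sb where "Sb = packed_labels R"
  have SbW: "Sb v = S0 v" if v: "v \<in> W" for v
  proof -
    have "\<not> (\<exists>a. (a, i) \<in> R \<and> dst a = v)" for i using partial_packingD(2)[OF X] v W(2) by blast
    then show ?thesis unfolding Sb_def packed_labels_def by blast
  qed
  interpret ph: phase lc \<kappa> src dst A1 Done W N Sb
  proof
    fix a assume a: "a \<in> A1"
    then show "dst a \<in> W \<and> src a \<in> W \<union> Done" unfolding A1_def by blast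
    show "N (src a) \<subseteq> N (dst a)" using a N_mono unfolding A1_def by blast
  next
    show "Done \<inter> W = {}" by (rule W(2))
    fix v
    show "lc (N v) = N v" if "v \<in> Done \<union> W" using that N_flat DV W(1) by blast
    show "Sb v \<subseteq> N v" if "v \<in> Done \<union> W"
    proof (cases "v \<in> Done")
      case True then show ?thesis using partial_packingD(6)[OF X] unfolding Sb_def by blast
    next
      case False then have "v \<in> W" using that by blast
      then show ?thesis using SbW S0_N W(1) by blast
    qed
    show "N v \<subseteq> lc (Sb v)" if "v \<in> Done" using partial_packingD(6)[OF X that] unfolding Sb_def by blast
  qed
  have A1Ar: "A1 \<subseteq> Ar" unfolding A1_def by blast
  interpret sp: solvable_phase lc \<kappa> src dst A1 Done W N Sb
  proof
    have S0Sb: "(\<Union>m. Sb (x m)) = (\<Union>m. S0 (x m))" if "\<And>m. x m \<in> W" for x :: "nat \<Rightarrow> 'v"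
      using SbW[OF that] by simp
    show "((\<forall>x e. inj x \<longrightarrow> (\<forall>m::nat. e m \<in> A1 \<and> src (e m) = x m \<and> dst (e m) = x (Suc m)) \<longrightarrow>
      (\<forall>m. x m \<in> W \<and> N (x m) = N (x 0)) \<longrightarrow> N (x 0) \<subseteq> lc (\<Union>m. Sb (x m))) \<and>
      (\<exists>ks. \<forall>v\<in>Done \<union> W. \<forall>i\<in>N v. \<kappa> i = ks)) \<or>
     (\<forall>x e. inj x \<longrightarrow> (\<forall>m::nat. e m \<in> A1 \<and> dst (e m) = x m \<and> src (e m) = x (Suc m)) \<longrightarrow>
      (\<forall>m. x m \<in> W) \<longrightarrow> N (x 0) \<subseteq> lc (\<Union>m. Sb (x m)))"
      using cond
    proof (elim disjE conjE exE)
      fix ks assume f: "\<forall>x e. inj x \<longrightarrow> (\<forall>m::nat. e m \<in> Ar \<and> src (e m) = x m \<and> dst (e m) = x (Suc m)) \<longrightarrow>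
        (\<forall>m. x m \<in> V \<and> N (x m) = N (x 0)) \<longrightarrow> N (x 0) \<subseteq> lc (\<Union>m. S0 (x m))" and k: "\<forall>v\<in>V. \<forall>i\<in>N v. \<kappa> i = ks"
      show ?thesis
      proof (intro disjI1 conjI allI impI)
        show "\<exists>ks. \<forall>v\<in>Done \<union> W. \<forall>i\<in>N v. \<kappa> i = ks" using k DV W(1) by blast
        fix x e assume x: "inj x" "\<forall>m::nat. e m \<in> A1 \<and> src (e m) = x m \<and> dst (e m) = x (Suc m)" "\<forall>m. x m \<in> W \<and> N (x m) = N (x 0)"
        have "N (x 0) \<subseteq> lc (\<Union>m. S0 (x m))" by (rule f[rule_format, of x e]) (use x A1Ar W(1) in auto)
        then show "N (x 0) \<subseteq> lc (\<Union>m. Sb (x m))" using S0Sb[of x] x(3) by simp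
      qed
    next
      assume f: "\<forall>x e. inj x \<longrightarrow> (\<forall>m::nat. e m \<in> Ar \<and> dst (e m) = x m \<and> src (e m) = x (Suc m)) \<longrightarrow>
        (\<forall>m. x m \<in> V) \<longrightarrow> N (x 0) \<subseteq> lc (\<Union>m. S0 (x m))"
      show ?thesis
      proof (intro disjI2 allI impI)
        fix x e assume x: "inj x" "\<forall>m::nat. e m \<in> A1 \<and> dst (e m) = x m \<and> src (e m) = x (Suc m)" "\<forall>m. x m \<in> W"
        have "N (x 0) \<subseteq> lc (\<Union>m. S0 (x m))" by (rule f[rule_format, of x e]) (use x A1Ar W(1) in auto)
        then show "N (x 0) \<subseteq> lc (\<Union>m. Sb (x m))" using S0Sb[of x] x(3) by simp
      qed
    qed
  qed
  have Sr0: "ph.labels_at Map.empty v = Sb v" for v unfolding ph.labels_at_def by simp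
  have init: "ph.tok.ok (ph.class_arcs Map.empty (N x)) (ph.class_tokens Map.empty (N x)) x \<and> N x \<subseteq> lc (\<Union>v. ph.class_labels Map.empty (N x) v)"
    if x: "x \<in> W" for x
  proof -
    let ?n = "N x" and ?A = "ph.class_arcs Map.empty (N x)" and ?T = "ph.class_tokens Map.empty (N x)"
    obtain B U P where B0: "indep B \<and> ?n \<subseteq> lc B \<and>
      (\<forall>b\<in>B. U b \<in> W \<union> Done \<and> b \<in> S0 (U b) \<and> arc_walk src dst (U b) (P b) x \<and> set (P b) \<subseteq> Ar \<and> distinct (P b) \<and> dst ` set (P b) \<subseteq> W \<union> Done) \<and>
      (\<forall>b\<in>B. \<forall>c\<in>B. b \<noteq> c \<longrightarrow> set (P b) \<inter> set (P c) = {})"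
      using closed[OF x] by (elim exE)
    have B: "indep B" "?n \<subseteq> lc B"
      "\<And>b. b \<in> B \<Longrightarrow> U b \<in> W \<union> Done \<and> b \<in> S0 (U b) \<and> arc_walk src dst (U b) (P b) x \<and> set (P b) \<subseteq> Ar \<and> distinct (P b) \<and> dst ` set (P b) \<subseteq> W \<union> Done"
      "\<And>b c. b \<in> B \<Longrightarrow> c \<in> B \<Longrightarrow> b \<noteq> c \<Longrightarrow> set (P b) \<inter> set (P c) = {}"
      using B0 by simp_all
    \<comment> \<open>On a path to \<open>x\<close> all flats are contained in \<open>?n\<close>, so
      a vertex of the path in \<open>?Y\<close> is completed or has a smaller flat, and it offers
      the whole of its flat.\<close>
    let ?Y = "Done \<union> {v. N v \<noteq> ?n}"
    have "\<exists>u p. b \<in> ph.class_labels Map.empty ?n u \<and> arc_walk src dst u p x \<and> set p \<subseteq> set (P b) \<and> distinct p \<and> set p \<subseteq> ?A" if b: "b \<in> B" for b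
    proof -
      have Bb: "U b \<in> W \<union> Done" "b \<in> S0 (U b)" "arc_walk src dst (U b) (P b) x" "set (P b) \<subseteq> Ar" "distinct (P b)" "dst ` set (P b) \<subseteq> W \<union> Done"
        using B(3)[OF b] by auto
      have w: "ph.tok.walk (U b) (P b) x" using Bb(3) .
      have pv: "ph.tok.pverts (U b) (P b) \<subseteq> W \<union> Done" using Bb(1,6) unfolding ph.tok.pverts_def by simp
      have inA: "a \<in> ?A" if a: "a \<in> set (P b)" "dst a \<notin> ?Y" for a
      proof -
        have "src a \<in> W \<union> Done" "dst a \<in> W \<union> Done" using ph.tok.walk_src[OF w a(1)] pv Bb(6) a(1) by auto
        then have "a \<in> A1" using a Bb(4) unfolding A1_def by auto
        then show ?thesis using a(2) unfolding ph.class_arcs_def by auto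
      qed
      show ?thesis
      proof (cases "ph.tok.pverts (U b) (P b) \<inter> ?Y = {}")
        case True
        have "U b \<in> W" "N (U b) = ?n" using True Bb(1) unfolding ph.tok.pverts_def by auto
        then have "b \<in> ph.class_labels Map.empty ?n (U b)" using Bb(2) SbW unfolding ph.class_labels_def Sr0 by simp
        moreover have "set (P b) \<subseteq> ?A" using inA True unfolding ph.tok.pverts_def by blast
        ultimately show ?thesis using Bb(3,5) by blast
      next
        case False
        obtain p1 p2 u where s: "P b = p1 @ p2" "ph.tok.walk (U b) p1 u" "ph.tok.walk u p2 x" "u \<in> ?Y" "dst ` set p2 \<inter> ?Y = {}"
          using ph.last_visit[OF w False] by blast
        have "u \<in> ph.tok.pverts (U b) (P b)" using ph.tok.walk_end[OF s(2)] unfolding s(1) ph.tok.pverts_def by auto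
        then have u: "u \<in> W \<union> Done" using pv by blast
        have "N (U b) \<subseteq> N u" by (rule walk_N[OF s(2)]) (use Bb(4) s(1) in auto)
        moreover have "U b \<in> V" using Bb(1) W(1) DV by blast
        \<comment> \<open>Flats grow along arcs, so \<open>b\<close> lies in the flat of
          \<open>u\<close>; there it is offered even if \<open>u\<close> does not hold it as a
          label.\<close>
        ultimately have bu: "b \<in> N u" using Bb(2) S0_N by blast
        have "N u \<subseteq> ?n" by (rule walk_N[OF s(3)]) (use Bb(4) s(1) in auto)
        moreover have "\<not> (u \<in> W \<and> N u = ?n)" using s(4) W(2) by blast
        ultimately have "b \<in> ph.class_labels Map.empty ?n u" using bu u unfolding ph.class_labels_def by auto
        moreover have "set p2 \<subseteq> ?A"
        proof
          fix a assume "a \<in> set p2"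
          then show "a \<in> ?A" using s(1,5) by (intro inA) auto
        qed
        moreover have "distinct p2" "set p2 \<subseteq> set (P b)" using Bb(5) s(1) by auto
        ultimately show ?thesis using s(3) by blast
      qed
    qed
    then obtain uf pf where up: "\<And>b. b \<in> B \<Longrightarrow> b \<in> ph.class_labels Map.empty ?n (uf b) \<and> arc_walk src dst (uf b) (pf b) x \<and> set (pf b) \<subseteq> set (P b) \<and> distinct (pf b) \<and> set (pf b) \<subseteq> ?A"
      by metis
    have NLn: "ph.class_labels Map.empty ?n v \<subseteq> ?n" for v
      using ph.Sb_N unfolding ph.class_labels_def Sr0 by auto
    have "ph.tok.complete ?A ?T x (Inl ` B) (\<lambda>t. uf (projl t)) (\<lambda>t. pf (projl t))"
      unfolding ph.tok.complete_def
    proof (intro conjI)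
      show "ph.tok.fam ?A ?T (Inl ` B) (\<lambda>t. uf (projl t)) (\<lambda>t. pf (projl t))" unfolding ph.tok.fam_def
      proof (intro conjI ballI impI)
        fix t :: "'s + 'a" assume "t \<in> Inl ` B"
        then obtain b where b: "t = Inl b" "b \<in> B" by blast
        show "t \<in> ?T (uf (projl t))" "distinct (pf (projl t))" "set (pf (projl t)) \<subseteq> ?A"
          using up[OF b(2)] b(1) unfolding ph.class_tokens_def by auto
        fix t' assume "t' \<in> Inl ` B" "t \<noteq> t'"
        then obtain b' where b': "t' = Inl b'" "b' \<in> B" "b \<noteq> b'" using b by blast
        have "set (P b) \<inter> set (P b') = {}" by (rule B(4)[OF b(2) b'(2,3)])
        then show "set (pf (projl t)) \<inter> set (pf (projl t')) = {}"
          using up[OF b(2)] up[OF b'(2)] b(1) b'(1) by auto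
      qed
      show "ph.tok.ends (Inl ` B) (\<lambda>t. uf (projl t)) (\<lambda>t. pf (projl t)) x"
        unfolding ph.tok.ends_def using up by auto
      show "ph.tok.indep (Inl ` B)" by (rule ph.tok_indep_Inl[OF B(1)])
      have "Inl -` (Inl ` B :: ('s + 'a) set) = B" by auto
      then have "Inl l \<in> token_cl (Inl ` B :: ('s + 'a) set)" if "l \<in> ?n" for l using B(2) that by (auto simp: Inl_token_cl)
      then show "ph.tok.toks ?T \<subseteq> token_cl (Inl ` B)"
        using NLn unfolding ph.tok.toks_def ph.class_tokens_def by blast
    qed
    then have "ph.tok.ok ?A ?T x" by (rule ph.tok.okI)
    moreover have "B \<subseteq> (\<Union>v. ph.class_labels Map.empty ?n v)" using up by blast
    then have "?n \<subseteq> lc (\<Union>v. ph.class_labels Map.empty ?n v)" using B(2) cl_mono by blast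
    ultimately show ?thesis by blast
  qed
  have Inv0: "ph.feasible Map.empty" unfolding ph.feasible_def Sr0 using init ph.Sb_N by blast
  have Si: "indep (Sb v)" if "v \<in> W" for v using SbW[OF that] S0_indep W(1) that by auto
  have KW: "\<kappa> i \<in> K" if "v \<in> W" "i \<in> N v" for v i using K(2) that W(1) by blast
  have "\<exists>L. ph.traced L \<and> (\<forall>v\<in>W. ph.labels_at L v \<subseteq> N v \<and> N v \<subseteq> lc (ph.labels_at L v))"
  proof (rule sp.phase_solution[OF Inv0 _ W(3) K(1)])
    show "indep (Sb v)" if "v \<in> W" for v by (rule Si[OF that])
    show "\<kappa> i \<in> K" if "v \<in> W" "i \<in> N v" for v i by (rule KW[OF that])
    fix L assume "ph.traced L" "\<And>v. v \<in> W \<Longrightarrow> ph.labels_at L v \<subseteq> N v \<and> N v \<subseteq> lc (ph.labels_at L v)"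
    then show ?thesis by (intro exI[of _ L]) simp
  qed
  then obtain L where L: "ph.traced L" and Lv: "\<forall>v\<in>W. ph.labels_at L v \<subseteq> N v \<and> N v \<subseteq> lc (ph.labels_at L v)" by (elim exE conjE)
  let ?L = "{(a, i). L a = Some i}"
  let ?R = "R \<union> ?L"
  note LD = ph.tracedD[OF L]
  have LA: "a \<in> Ar" "dst a \<in> W" "src a \<in> W \<union> Done" if "L a = Some i" for a i using LD(1)[OF that] unfolding A1_def by auto
  have SgW: "packed_labels ?R v = ph.labels_at L v" if v: "v \<in> W" for v
  proof -
    have "(\<exists>a. (a, i) \<in> ?R \<and> dst a = v) \<longleftrightarrow> (\<exists>a\<in>A1. L a = Some i \<and> dst a = v)" for i
      using partial_packingD(2)[OF X] v W(2) LD(1) by blast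
    then show ?thesis unfolding packed_labels_def ph.labels_at_def SbW[OF v] by auto
  qed
  have SgO: "packed_labels ?R v = packed_labels R v" if v: "v \<notin> W" for v
    unfolding packed_labels_def using LA(2) v by auto
  have SbR: "Sb v \<subseteq> packed_labels ?R v" for v unfolding Sb_def by (rule packed_labels_mono) blast
  have SrR: "ph.labels_at L v \<subseteq> packed_labels ?R v" for v
  proof (cases "v \<in> W")
    case True then show ?thesis using SgW by simp
  next
    case False
    then have "ph.labels_at L v = Sb v" unfolding ph.labels_at_def using A1_def by auto
    then show ?thesis using SbR by simp
  qed
  have "partial_packing (Done \<union> W) ?R" unfolding partial_packing_def
  proof (intro conjI allI impI ballI)
    show "Done \<union> W \<subseteq> V" using DV W(1) by blast
  next
    fix a i assume "(a, i) \<in> ?R"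
    then consider (old) "(a, i) \<in> R" | (new) "L a = Some i" by blast
    then have "a \<in> Ar \<and> dst a \<in> Done \<union> W \<and> src a \<in> Done \<union> W \<and> i \<notin> S0 (dst a) \<and> i \<in> packed_labels ?R (src a)"
    proof cases
      case old
      then show ?thesis using partial_packingD(2)[OF X old] packed_labels_mono[of R ?R "src a"] by blast
    next
      case new
      have "i \<notin> S0 (dst a)" using LD(2)[OF new] SbW[OF LA(2)[OF new]] by simp
      then show ?thesis using LA[OF new] LD(3)[OF new] SrR by blast
    qed
    then show "a \<in> Ar" "dst a \<in> Done \<union> W" "src a \<in> Done \<union> W" "i \<notin> S0 (dst a)" "i \<in> packed_labels ?R (src a)" by blast+
  next
    fix a i j assume r: "(a, i) \<in> ?R" "(a, j) \<in> ?R"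
    show "i = j"
    proof (cases "dst a \<in> W")
      case True
      then have "(a, i) \<notin> R" "(a, j) \<notin> R" using partial_packingD(2)[OF X] W(2) by blast+
      then show ?thesis using r by simp
    next
      case False
      then have "L a \<noteq> Some i" "L a \<noteq> Some j" using LA(2) by blast+
      then show ?thesis using r partial_packingD(3)[OF X, of a i j] by simp
    qed
  next
    fix a b i assume r: "(a, i) \<in> ?R" "(b, i) \<in> ?R" "dst a = dst b"
    show "a = b"
    proof (cases "dst a \<in> W")
      case True
      then have "(a, i) \<notin> R" "(b, i) \<notin> R" using partial_packingD(2)[OF X] W(2) r(3) by fastforce+
      then have "L a = Some i" "L b = Some i" using r by simp_all
      then show ?thesis using r(3) by (rule LD(4))
    next
      case False
      then have "L a \<noteq> Some i" "L b \<noteq> Some i" using LA(2) r(3) by metis+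
      then have "(a, i) \<in> R" "(b, i) \<in> R" using r by simp_all
      then show ?thesis using r(3) by (rule partial_packingD(4)[OF X])
    qed
  next
    fix v i assume i: "i \<in> packed_labels ?R v"
    have old: "\<exists>u p. i \<in> S0 u \<and> arc_walk src dst u p w \<and> (\<forall>a\<in>set p. (a, i) \<in> ?R)" if iw: "i \<in> packed_labels R w" for w
    proof -
      obtain u p where up: "i \<in> S0 u" "arc_walk src dst u p w" "\<forall>a\<in>set p. (a, i) \<in> R" using partial_packingD(5)[OF X iw] by blast
      then show ?thesis by (intro exI[of _ u] exI[of _ p]) simp
    qed
    show "\<exists>u p. i \<in> S0 u \<and> arc_walk src dst u p v \<and> (\<forall>a\<in>set p. (a, i) \<in> ?R)"
    proof (cases "v \<in> W")
      case False then show ?thesis using old i SgO by simp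
    next
      case True
      then have "i \<in> ph.labels_at L v" using i SgW by simp
      then obtain u p where up: "i \<in> Sb u" "arc_walk src dst u p v" "\<forall>a\<in>set p. L a = Some i" using ph.traced_path[OF L] by blast
      obtain u0 p0 where u0: "i \<in> S0 u0" "arc_walk src dst u0 p0 u" "\<forall>a\<in>set p0. (a, i) \<in> ?R" using old up(1) unfolding Sb_def by blast
      have "arc_walk src dst u0 (p0 @ p) v" using u0(2) up(2) unfolding arc_walk_append by blast
      moreover have "\<forall>a\<in>set (p0 @ p). (a, i) \<in> ?R" using u0(3) up(3) by auto
      ultimately show ?thesis using u0(1) by (intro exI[of _ u0] exI[of _ "p0 @ p"]) simp
    qed
  next
    fix v assume v: "v \<in> Done \<union> W"
    have "indep (packed_labels ?R v) \<and> packed_labels ?R v \<subseteq> N v \<and> N v \<subseteq> lc (packed_labels ?R v)"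
    proof (cases "v \<in> W")
      case True then show ?thesis unfolding SgW[OF True] using Lv LD(5) by blast
    next
      case False then show ?thesis unfolding SgO[OF False] using partial_packingD(6)[OF X] v by blast
    qed
    then show "indep (packed_labels ?R v)" "packed_labels ?R v \<subseteq> N v" "N v \<subseteq> lc (packed_labels ?R v)" by blast+
  qed
  then show ?thesis by blast
qed

text \<open>In a maximal partial packing no vertex is missing: a missing one lies in a countable set
  of missing vertices whose linkages meet only this set and completed vertices, and such a set can
  be completed in one more phase. A linkage is countable because its base meets countably many
  summands, each in a finite set.\<close>

theorem packing_solution: "\<exists>R. partial_packing V R"
proof -
  have "partial_packing_sum {}" unfolding partial_packing_sum_def partial_packing_def packed_labels_def by (auto intro: exI[of _ "[]"])
  then have ne: "{X. partial_packing_sum X} \<noteq> {}" by blast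
  have "\<exists>M\<in>{X. partial_packing_sum X}. \<forall>X\<in>{X. partial_packing_sum X}. M \<subseteq> X \<longrightarrow> X = M"
  proof (rule subset_Zorn_nonempty[OF ne])
    fix C assume "C \<noteq> {}" "subset.chain {X. partial_packing_sum X} C"
    then have "\<And>X. X \<in> C \<Longrightarrow> partial_packing_sum X" "\<And>X Y. X \<in> C \<Longrightarrow> Y \<in> C \<Longrightarrow> X \<subseteq> Y \<or> Y \<subseteq> X"
      unfolding subset.chain_def by blast+
    then have "partial_packing_sum (\<Union>C)" by (rule partial_packing_sum_Union)
    then show "\<Union>C \<in> {X. partial_packing_sum X}" by simp
  qed
  then obtain M where M: "partial_packing_sum M" "\<And>X. partial_packing_sum X \<Longrightarrow> M \<subseteq> X \<Longrightarrow> X = M" by blast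
  define U where "U = Inl -` M"
  define R where "R = Inr -` M"
  have PUR: "partial_packing U R" using M(1) unfolding partial_packing_sum_def U_def R_def .
  have "U = V"
  proof (rule ccontr)
    assume "U \<noteq> V"
    then obtain v0 where v0: "v0 \<in> V" "v0 \<notin> U" using partial_packingD(1)[OF PUR] by blast
    obtain LB LU LP where l: "\<And>x. x \<in> V \<Longrightarrow> indep (LB x) \<and> N x \<subseteq> lc (LB x) \<and>
      (\<forall>b\<in>LB x. LU x b \<in> V \<and> b \<in> S0 (LU x b) \<and> arc_walk src dst (LU x b) (LP x b) x \<and> set (LP x b) \<subseteq> Ar \<and> distinct (LP x b)) \<and>
      (\<forall>b\<in>LB x. \<forall>c\<in>LB x. b \<noteq> c \<longrightarrow> set (LP x b) \<inter> set (LP x c) = {})"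
      using link by metis
    define f where "f x = (\<Union>b\<in>LB x. insert (LU x b) (dst ` set (LP x b)))" for x
    have fV: "f x \<subseteq> V" if "x \<in> V" for x
      using l[OF that] Ar unfolding f_def by blast
    have fc: "countable (f x)" if x: "x \<in> V" for x
    proof -
      have "countable (LB x)"
      proof (rule indep_countable)
        show "indep (LB x)" using l[OF x] by blast
        fix b assume "b \<in> LB x"
        then have "LU x b \<in> V" "b \<in> S0 (LU x b)" using l[OF x] by blast+
        then show "\<kappa> b \<in> K" using K(2) S0_N by blast
      qed
      then show ?thesis unfolding f_def by (rule countable_UN) (simp add: countable_finite)
    qed
    \<comment> \<open>Vertices of \<open>U\<close> are complete and are not added, so the closure
      process stops at them.\<close>
    define F where "F n = ((\<lambda>A. A \<union> ((\<Union>x\<in>A. f x) - U)) ^^ n) {v0}" for n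
    have FS: "F (Suc n) = F n \<union> ((\<Union>x\<in>F n. f x) - U)" for n unfolding F_def by simp
    have F0: "F 0 = {v0}" unfolding F_def by simp
    have FV: "F n \<subseteq> V - U" for n
    proof (induction n)
      case 0 then show ?case using v0 F0 by simp
    next
      case (Suc n) then show ?case unfolding FS using fV by blast
    qed
    have Fc: "countable (F n)" for n
    proof (induction n)
      case 0 then show ?case using F0 by simp
    next
      case (Suc n)
      have "countable (\<Union>x\<in>F n. f x)" by (rule countable_UN[OF Suc]) (use fc FV[of n] in blast)
      then show ?case unfolding FS using Suc by auto
    qed
    define W where "W = (\<Union>n. F n)"
    have W: "W \<subseteq> V" "U \<inter> W = {}" "countable W" "v0 \<in> W"
      using FV Fc F0 unfolding W_def by (blast, blast, simp, blast)
    have fW: "f x \<subseteq> W \<union> U" if x: "x \<in> W" for x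
    proof -
      obtain n where "x \<in> F n" using x unfolding W_def by blast
      then have "f x \<subseteq> F (Suc n) \<union> U" unfolding FS by blast
      then show ?thesis unfolding W_def by blast
    qed
    have "\<exists>R'. R \<subseteq> R' \<and> partial_packing (U \<union> W) R'"
    proof (rule extend_partial_packing[OF PUR W(1-3)])
      fix x assume x: "x \<in> W"
      then have xV: "x \<in> V" using W(1) by blast
      have "\<forall>b\<in>LB x. LU x b \<in> W \<union> U \<and> dst ` set (LP x b) \<subseteq> W \<union> U" using fW[OF x] unfolding f_def by blast
      then show "\<exists>B Ua P. indep B \<and> N x \<subseteq> lc B \<and>
        (\<forall>b\<in>B. Ua b \<in> W \<union> U \<and> b \<in> S0 (Ua b) \<and> arc_walk src dst (Ua b) (P b) x \<and> set (P b) \<subseteq> Ar \<and> distinct (P b) \<and> dst ` set (P b) \<subseteq> W \<union> U) \<and>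
        (\<forall>b\<in>B. \<forall>c\<in>B. b \<noteq> c \<longrightarrow> set (P b) \<inter> set (P c) = {})"
        using l[OF xV] by (intro exI[of _ "LB x"] exI[of _ "LU x"] exI[of _ "LP x"]) simp
    qed
    then obtain R' where R': "R \<subseteq> R'" "partial_packing (U \<union> W) R'" by blast
    let ?M = "Inl ` (U \<union> W) \<union> Inr ` R'"
    have "Inl -` ?M = U \<union> W" "Inr -` ?M = R'" by auto
    then have "partial_packing_sum ?M" using R'(2) unfolding partial_packing_sum_def by simp
    moreover have "M \<subseteq> ?M"
    proof
      fix t assume "t \<in> M" then show "t \<in> ?M" using R'(1) unfolding U_def R_def by (cases t) auto
    qed
    ultimately have "?M = M" by (rule M(2))
    then have "v0 \<in> U" using W(4) unfolding U_def by blast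
    then show False using v0 by blast
  qed
  then show ?thesis using PUR by blast
qed

end

section \<open>Branchings\<close>

text \<open>Read backwards, a walk is determined by its end when in-degrees are at most one, and it
  can only stop at a vertex that no arc of \<open>R\<close> enters.\<close>

lemma arc_walk_unique:
  assumes deg: "\<And>a b. a \<in> R \<Longrightarrow> b \<in> R \<Longrightarrow> dst a = dst b \<Longrightarrow> a = b"
    and p: "arc_walk src dst u p v" "set p \<subseteq> R" "\<forall>a\<in>R. dst a \<noteq> u" and q: "arc_walk src dst w q v" "set q \<subseteq> R" "\<forall>a\<in>R. dst a \<noteq> w"
  shows "u = w \<and> p = q"
  using p(1,2) q(1,2)
proof (induction p arbitrary: v q rule: rev_induct)
  case Nil
  show ?case
  proof (cases q rule: rev_cases)
    case Nil then show ?thesis using \<open>arc_walk src dst u [] v\<close> \<open>arc_walk src dst w q v\<close> by simp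
  next
    case (snoc q' b)
    then have "dst b = u" "b \<in> R" using \<open>arc_walk src dst u [] v\<close> \<open>arc_walk src dst w q v\<close> \<open>set q \<subseteq> R\<close> by (auto simp: arc_walk_append)
    then show ?thesis using p(3) by blast
  qed
next
  case (snoc a p)
  have a: "arc_walk src dst u p (src a)" "dst a = v" "a \<in> R" "set p \<subseteq> R" using snoc.prems by (auto simp: arc_walk_append)
  show ?case
  proof (cases q rule: rev_cases)
    case Nil
    then have "dst a = w" using a(2) snoc.prems(3) by simp
    then show ?thesis using q(3) a(3) by blast
  next
    case (snoc q' b)
    then have b: "arc_walk src dst w q' (src b)" "dst b = v" "b \<in> R" "set q' \<subseteq> R" using snoc.prems by (auto simp: arc_walk_append)
    have "a = b" using deg a(2,3) b(2,3) by blast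
    then have "u = w \<and> p = q'" using snoc.IH[of "src a" q'] a(1,4) b(1,4) by blast
    then show ?thesis using snoc \<open>a = b\<close> by simp
  qed
qed

lemma (in pre_digraph) cas_arc_walk: "cas u p v = arc_walk (tail G) (head G) u p v"
  by (induction p arbitrary: u) auto

lemma (in pre_digraph) apath_arc_walk:
  "apath u p v \<longleftrightarrow> u \<in> verts G \<and> set p \<subseteq> arcs G \<and> arc_walk (tail G) (head G) u p v \<and> distinct (u # map (head G) p)"
proof (cases "cas u p v")
  case True
  have "awalk_verts u p = u # map (head G) p"
    using True awalk_verts_conv'[OF True] by (cases p) auto
  then show ?thesis using True unfolding apath_def awalk_def cas_arc_walk by auto
next
  case False then show ?thesis unfolding apath_def awalk_def cas_arc_walk by blast
qed

text \<open>The length of the walk from a root is a depth that increases by one along each arc. On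
  an undirected cycle both arcs at a vertex of greatest depth would enter it and hence coincide; the
  cycle would be a loop, which the depth excludes.\<close>

lemma branchingI:
  fixes G :: "('v, 'a) pre_digraph"
  assumes wf: "wf_digraph G"
    and deg: "\<And>a b. a \<in> arcs G \<Longrightarrow> b \<in> arcs G \<Longrightarrow> head G a = head G b \<Longrightarrow> a = b"
    and reach: "\<And>v. v \<in> verts G \<Longrightarrow> \<exists>u p. u \<in> root_set G \<and> arc_walk (tail G) (head G) u p v \<and> set p \<subseteq> arcs G"
  shows "branching G"
proof -
  interpret wf_digraph G by (rule wf)
  have rt: "\<forall>a\<in>arcs G. head G a \<noteq> u" if "u \<in> root_set G" for u using that unfolding root_set_def in_arcs_def by blast
  have rv: "u \<in> verts G" if "u \<in> root_set G" for u using that unfolding root_set_def by blast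
  have uniq: "u = w \<and> p = q" if "arc_walk (tail G) (head G) u p v" "set p \<subseteq> arcs G" "u \<in> root_set G"
    "arc_walk (tail G) (head G) w q v" "set q \<subseteq> arcs G" "w \<in> root_set G" for u p w q v
    by (rule arc_walk_unique[where R = "arcs G" and src = "tail G" and dst = "head G" and v = v, OF deg that(1,2) rt[OF that(3)] that(4,5) rt[OF that(6)]])
  obtain ro pa where rp: "\<And>v. v \<in> verts G \<Longrightarrow> ro v \<in> root_set G \<and> arc_walk (tail G) (head G) (ro v) (pa v) v \<and> set (pa v) \<subseteq> arcs G"
    using reach by metis
  define d where "d v = length (pa v)" for v
  have dS: "d (head G a) = Suc (d (tail G a))" if a: "a \<in> arcs G" for a
  proof -
    have t: "tail G a \<in> verts G" "head G a \<in> verts G" using a by auto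
    note r1 = rp[OF t(1)] and r2 = rp[OF t(2)]
    have "arc_walk (tail G) (head G) (ro (tail G a)) (pa (tail G a) @ [a]) (head G a)" using r1 by (auto simp: arc_walk_append)
    moreover have "set (pa (tail G a) @ [a]) \<subseteq> arcs G" using r1 a by simp
    ultimately have "pa (tail G a) @ [a] = pa (head G a)" using uniq r1 r2 by blast
    then have "length (pa (tail G a) @ [a]) = length (pa (head G a))" by (simp only:)
    then show ?thesis unfolding d_def by simp
  qed
  have "\<not> undirected_cycle G vs es" for vs es
  proof
    assume "undirected_cycle G vs es"
    then have c: "es \<noteq> []" "length vs = length es" "distinct es" "set es \<subseteq> arcs G"
      "\<And>k. k < length es \<Longrightarrow> {tail G (es ! k), head G (es ! k)} = {vs ! k, vs ! (Suc k mod length es)}"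
      unfolding undirected_cycle_def by auto
    let ?n = "length es"
    have n0: "0 < ?n" using c(1) by simp
    define M where "M = Max ((\<lambda>k. d (vs ! k)) ` {..<?n})"
    have "M \<in> (\<lambda>k. d (vs ! k)) ` {..<?n}" unfolding M_def using n0 by (intro Max_in) auto
    then obtain k where k: "k < ?n" "d (vs ! k) = M" by blast
    have le: "d (vs ! j) \<le> d (vs ! k)" if "j < ?n" for j
    proof -
      have "d (vs ! j) \<le> M" unfolding M_def using that by (intro Max_ge) auto
      then show ?thesis using k(2) by simp
    qed
    have top: "head G e = vs ! k \<and> w \<noteq> vs ! k" if e: "e \<in> arcs G" "{tail G e, head G e} = {vs ! k, w}" "d w \<le> d (vs ! k)" for e w
    proof -
      have ds: "d (head G e) = Suc (d (tail G e))" by (rule dS[OF e(1)])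
      from e(2) consider "tail G e = vs ! k" "head G e = w" | "tail G e = w" "head G e = vs ! k" by (auto simp: doubleton_eq_iff)
      then show ?thesis
      proof cases
        case 1 then show ?thesis using ds e(3) by simp
      next
        case 2 then show ?thesis using ds by auto
      qed
    qed
    \<comment> \<open>The cyclic predecessor of \<open>k\<close>; \<open>?n\<close> is added first
      because the subtraction is on natural numbers.\<close>
    define j where "j = (k + ?n - 1) mod ?n"
    have j: "j < ?n" unfolding j_def using n0 by simp
    have Sj: "Suc j mod ?n = k"
    proof -
      have "Suc j mod ?n = Suc (k + ?n - 1) mod ?n" unfolding j_def by (simp add: mod_Suc_eq)
      also have "Suc (k + ?n - 1) = k + ?n" using n0 by simp
      also have "(k + ?n) mod ?n = k" using k(1) by simp
      finally show ?thesis .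
    qed
    have Sk: "Suc k mod ?n < ?n" using n0 by simp
    have 1: "head G (es ! k) = vs ! k \<and> vs ! (Suc k mod ?n) \<noteq> vs ! k"
      by (rule top) (use c(4,5) k(1) le[OF Sk] in auto)
    have "{tail G (es ! j), head G (es ! j)} = {vs ! k, vs ! j}" using c(5)[OF j] Sj by auto
    then have 2: "head G (es ! j) = vs ! k \<and> vs ! j \<noteq> vs ! k"
      by (intro top) (use c(4) j le[OF j] in auto)
    have "es ! k \<in> arcs G" "es ! j \<in> arcs G" using c(4) k(1) j nth_mem by blast+
    then have "es ! k = es ! j" using deg[of "es ! k" "es ! j"] 1 2 by simp
    then have "k = j" using c(3) k(1) j by (simp add: nth_eq_iff_index_eq)
    then show False using 2 by simp
  qed
  then have forest: "directed_forest G" unfolding directed_forest_def using wf by blast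
  have "\<exists>!P. fst P \<in> root_set G \<and> apath (fst P) (snd P) v" if v: "v \<in> verts G" for v
  proof -
    note r = rp[OF v]
    obtain p where p: "arc_walk (tail G) (head G) (ro v) p v" "set p \<subseteq> set (pa v)" "distinct (ro v # map (head G) p)"
      using arc_walk_simple[of "tail G" "head G" "ro v" "pa v" v] r by blast
    have "apath (ro v) p v" unfolding apath_arc_walk using p r rv by blast
    moreover have "P = (ro v, p)" if P: "fst P \<in> root_set G" "apath (fst P) (snd P) v" for P
    proof -
      have "ro v = fst P \<and> p = snd P" using P p r unfolding apath_arc_walk by (intro uniq) auto
      then show ?thesis by (cases P) simp
    qed
    ultimately show ?thesis using r by (intro ex1I[of _ "(ro v, p)"]) auto
  qed
  then show ?thesis unfolding branching_def using forest by blast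
qed

context matroid_rooted_digraph
begin

section \<open>From the matroid-rooted digraph to closure operators and back\<close>

abbreviation "Nv v \<equiv> reach_span D S Ind \<pi> {v}"
abbreviation "Sv v \<equiv> sources S \<pi> {v}"

lemma sources_subset: "sources S \<pi> X \<subseteq> S"
  unfolding sources_def by blast

lemma sources_mono: "X \<subseteq> Y \<Longrightarrow> sources S \<pi> X \<subseteq> sources S \<pi> Y"
  unfolding sources_def by blast

lemma reach_span_subset: "reach_span D S Ind \<pi> X \<subseteq> S"
  unfolding reach_span_def by (rule span_subset[OF sources_subset])

lemma reach_span_mono: "to_set D X \<subseteq> to_set D Y \<Longrightarrow> reach_span D S Ind \<pi> X \<subseteq> reach_span D S Ind \<pi> Y"
  unfolding reach_span_def by (intro span_mono sources_mono sources_subset)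

text \<open>The path conditions speak of the span of everything that reaches the path, which
  contains the flat of its first vertex.\<close>

lemma packing_mcl:
  fixes \<kappa> :: "'s \<Rightarrow> 's set"
  assumes cm: "closure_matroid mcl \<kappa>" and ind: "independent_mrd D S Ind \<pi>" and lnk: "linkage_condition D S Ind \<pi>"
    and cK: "countable (\<kappa> ` S)"
    and cnd: "((\<forall>x e. forward_infinite_path D x e \<longrightarrow> spans S Ind (sources S \<pi> (range x)) (reach_span D S Ind \<pi> (range x))) \<and> (\<forall>i\<in>S. \<kappa> i = S)) \<or>
      (\<forall>x e. backward_infinite_path D x e \<longrightarrow> spans S Ind (sources S \<pi> (range x)) (reach_span D S Ind \<pi> (range x)))"
  shows "packing mcl \<kappa> (tail D) (head D) (verts D) (arcs D) Sv Nv (\<kappa> ` S)"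
proof -
  interpret closure_matroid mcl \<kappa> by (rule cm)
  have indI: "indep I \<longleftrightarrow> I \<in> Ind" if "I \<subseteq> S" for I
  proof -
    have "mcl (I - {x}) = mspan (I - {x})" for x using that by (intro mcl_span) blast
    then show ?thesis unfolding indep_def Ind_iff[OF that] by simp
  qed
  have inf: "Nv (x 0) \<subseteq> mcl (\<Union>m. Sv (x m))"
    if "spans S Ind (sources S \<pi> (range x)) (reach_span D S Ind \<pi> (range x))" for x :: "nat \<Rightarrow> 'v"
  proof -
    have "to_set D {x 0} \<subseteq> to_set D (range x)" unfolding to_set_def by blast
    then have "Nv (x 0) \<subseteq> reach_span D S Ind \<pi> (range x)" by (rule reach_span_mono)
    also have "... \<subseteq> mspan (sources S \<pi> (range x))" using that unfolding spans_def .
    also have "... = mcl (sources S \<pi> (range x))" by (rule mcl_span[OF sources_subset, symmetric])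
    also have "sources S \<pi> (range x) = (\<Union>m. Sv (x m))" unfolding sources_def by blast
    finally show ?thesis .
  qed
  show ?thesis
  proof
    fix a assume a: "a \<in> arcs D"
    then show "tail D a \<in> verts D \<and> head D a \<in> verts D" by simp
    have "tail D a \<rightarrow>\<^bsub>D\<^esub> head D a" using a by (auto simp: arcs_ends_conv)
    then have "to_set D {tail D a} \<subseteq> to_set D {head D a}" unfolding to_set_def using reachable_adj_trans by blast
    then show "Nv (tail D a) \<subseteq> Nv (head D a)" by (rule reach_span_mono)
  next
    fix v assume v: "v \<in> verts D"
    show "mcl (Nv v) = Nv v" unfolding mcl_span[OF reach_span_subset] unfolding reach_span_def
      by (rule span_idem[OF sources_subset])
    have "{v} \<subseteq> to_set D {v}" using v unfolding to_set_def by auto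
    then have "Sv v \<subseteq> sources S \<pi> (to_set D {v})" by (rule sources_mono)
    then show "Sv v \<subseteq> Nv v" unfolding reach_span_def using span_ext by blast
    show "indep (Sv v)" using ind v indI[OF sources_subset] unfolding independent_mrd_def by blast
    show "\<kappa> i \<in> \<kappa> ` S" if "i \<in> Nv v" for i using that reach_span_subset by blast
    obtain B P where B: "base_of (Nv v) B" "linkage D \<pi> B {v} P" using lnk v unfolding linkage_condition_def by blast
    have Bi: "B \<in> Ind" "B \<subseteq> Nv v" "\<forall>x\<in>Nv v - B. insert x B \<notin> Ind" using B(1) unfolding base_of_iff by auto
    have BS: "B \<subseteq> S" using Bi(2) reach_span_subset by blast
    have BB: "base_of B B" using Bi(1) unfolding base_of_iff by blast
    have sp: "Nv v \<subseteq> mcl B"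
    proof
      fix x assume x: "x \<in> Nv v"
      have "x \<in> B \<or> x \<in> S \<and> insert x B \<notin> Ind" using x Bi(3) reach_span_subset by blast
      then show "x \<in> mcl B" unfolding mcl_span[OF BS] span_iff[OF BS BB] .
    qed
    have "\<forall>i\<in>B. \<exists>u. u \<in> \<pi> i \<and> pre_digraph.apath D u (P i) v" using B(2) unfolding linkage_def by blast
    then obtain U where U: "\<forall>i\<in>B. U i \<in> \<pi> i \<and> pre_digraph.apath D (U i) (P i) v" by metis
    have dj: "\<forall>b\<in>B. \<forall>c\<in>B. b \<noteq> c \<longrightarrow> set (P b) \<inter> set (P c) = {}" using B(2) unfolding linkage_def by blast
    have "\<forall>b\<in>B. U b \<in> verts D \<and> b \<in> Sv (U b) \<and> arc_walk (tail D) (head D) (U b) (P b) v \<and> set (P b) \<subseteq> arcs D \<and> distinct (P b)"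
    proof
      fix b assume b: "b \<in> B"
      then have "apath (U b) (P b) v" and ub: "U b \<in> \<pi> b" using U by auto
      then have "U b \<in> verts D" "set (P b) \<subseteq> arcs D" "arc_walk (tail D) (head D) (U b) (P b) v" "distinct (U b # map (head D) (P b))"
        unfolding apath_arc_walk by auto
      moreover from this(4) have "distinct (P b)" by (simp add: distinct_map)
      moreover have "b \<in> Sv (U b)" using b BS ub unfolding sources_def by auto
      ultimately show "U b \<in> verts D \<and> b \<in> Sv (U b) \<and> arc_walk (tail D) (head D) (U b) (P b) v \<and> set (P b) \<subseteq> arcs D \<and> distinct (P b)" by simp
    qed
    then show "\<exists>B U P. indep B \<and> Nv v \<subseteq> mcl B \<and>
      (\<forall>b\<in>B. U b \<in> verts D \<and> b \<in> Sv (U b) \<and> arc_walk (tail D) (head D) (U b) (P b) v \<and> set (P b) \<subseteq> arcs D \<and> distinct (P b)) \<and>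
      (\<forall>b\<in>B. \<forall>c\<in>B. b \<noteq> c \<longrightarrow> set (P b) \<inter> set (P c) = {})"
      using sp dj Bi(1) indI[OF BS] by (intro exI[of _ B] exI[of _ U] exI[of _ P]) simp
  next
    show "countable (\<kappa> ` S)" by (rule cK)
    show "((\<forall>x e. inj x \<longrightarrow> (\<forall>m::nat. e m \<in> arcs D \<and> tail D (e m) = x m \<and> head D (e m) = x (Suc m)) \<longrightarrow>
      (\<forall>m. x m \<in> verts D \<and> Nv (x m) = Nv (x 0)) \<longrightarrow> Nv (x 0) \<subseteq> mcl (\<Union>m. Sv (x m))) \<and>
      (\<exists>ks. \<forall>v\<in>verts D. \<forall>i\<in>Nv v. \<kappa> i = ks)) \<or>
     (\<forall>x e. inj x \<longrightarrow> (\<forall>m::nat. e m \<in> arcs D \<and> head D (e m) = x m \<and> tail D (e m) = x (Suc m)) \<longrightarrow>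
      (\<forall>m. x m \<in> verts D) \<longrightarrow> Nv (x 0) \<subseteq> mcl (\<Union>m. Sv (x m)))"
      using cnd
    proof (elim disjE conjE)
      assume f: "\<forall>x e. forward_infinite_path D x e \<longrightarrow> spans S Ind (sources S \<pi> (range x)) (reach_span D S Ind \<pi> (range x))" and k: "\<forall>i\<in>S. \<kappa> i = S"
      show ?thesis
      proof (intro disjI1 conjI allI impI)
        show "\<exists>ks. \<forall>v\<in>verts D. \<forall>i\<in>Nv v. \<kappa> i = ks" using k reach_span_subset by blast
        fix x e assume "inj x" "\<forall>m::nat. e m \<in> arcs D \<and> tail D (e m) = x m \<and> head D (e m) = x (Suc m)"
        then have "forward_infinite_path D x e" unfolding forward_infinite_path_def by simp
        then show "Nv (x 0) \<subseteq> mcl (\<Union>m. Sv (x m))" using f by (intro inf) blast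
      qed
    next
      assume f: "\<forall>x e. backward_infinite_path D x e \<longrightarrow> spans S Ind (sources S \<pi> (range x)) (reach_span D S Ind \<pi> (range x))"
      show ?thesis
      proof (intro disjI2 allI impI)
        fix x e assume "inj x" "\<forall>m::nat. e m \<in> arcs D \<and> head D (e m) = x m \<and> tail D (e m) = x (Suc m)"
        then have "backward_infinite_path D x e" unfolding backward_infinite_path_def by simp
        then show "Nv (x 0) \<subseteq> mcl (\<Union>m. Sv (x m))" using f by (intro inf) blast
      qed
    qed
  qed
qed

text \<open>The branching of \<open>i\<close> consists of the vertices holding \<open>i\<close> and
  the arcs labelled \<open>i\<close>. A label never enters a vertex where it is a root, so the root
  set is exactly \<open>\<pi> i\<close>.\<close>

lemma packing_of_closure:
  fixes \<kappa> :: "'s \<Rightarrow> 's set"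
  assumes pk: "packing mcl \<kappa> (tail D) (head D) (verts D) (arcs D) Sv Nv (\<kappa> ` S)"
  shows "\<exists>\<B>. branching_packing D S \<pi> \<B> \<and> independent_packing D S Ind \<B> \<and> maximal_packing D S Ind \<pi> \<B>"
proof -
  interpret pk: packing mcl \<kappa> "tail D" "head D" "verts D" "arcs D" Sv Nv "\<kappa> ` S" by (rule pk)
  obtain R where R: "pk.partial_packing (verts D) R" using pk.packing_solution by blast
  note RD = pk.partial_packingD[OF R]
  define \<B> where "\<B> i = \<lparr>verts = {v \<in> verts D. i \<in> pk.packed_labels R v}, arcs = {a. (a, i) \<in> R}, tail = tail D, head = head D\<rparr>" for i
  have sel: "verts (\<B> i) = {v \<in> verts D. i \<in> pk.packed_labels R v}" "arcs (\<B> i) = {a. (a, i) \<in> R}" "tail (\<B> i) = tail D" "head (\<B> i) = head D" for i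
    unfolding \<B>_def by simp_all
  have SgN: "pk.packed_labels R v \<subseteq> S" if "v \<in> verts D" for v using RD(6)[OF that] reach_span_subset by blast
  have wf: "wf_digraph (\<B> i)" for i
  proof
    fix a assume "a \<in> arcs (\<B> i)"
    then have a: "(a, i) \<in> R" unfolding sel by simp
    show "tail (\<B> i) a \<in> verts (\<B> i)" "head (\<B> i) a \<in> verts (\<B> i)"
      using RD(2)[OF a] a unfolding sel pk.packed_labels_def by auto
  qed
  have root: "root_set (\<B> i) = \<pi> i" if i: "i \<in> S" for i
  proof
    show "root_set (\<B> i) \<subseteq> \<pi> i"
    proof
      fix v assume v: "v \<in> root_set (\<B> i)"
      then have "i \<in> pk.packed_labels R v" unfolding root_set_def sel by simp
      moreover have "\<not> (\<exists>a. (a, i) \<in> R \<and> head D a = v)" using v unfolding root_set_def in_arcs_def sel by auto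
      ultimately have "i \<in> Sv v" unfolding pk.packed_labels_def by simp
      then show "v \<in> \<pi> i" unfolding sources_def by simp
    qed
    show "\<pi> i \<subseteq> root_set (\<B> i)"
    proof
      fix v assume v: "v \<in> \<pi> i"
      then have vV: "v \<in> verts D" and iv: "i \<in> Sv v" using pi_subset[OF i] i unfolding sources_def by auto
      have "\<not> (\<exists>a. (a, i) \<in> R \<and> head D a = v)" using RD(2)[of _ i] iv by auto
      then show "v \<in> root_set (\<B> i)" using vV iv unfolding root_set_def in_arcs_def sel pk.packed_labels_def by auto
    qed
  qed
  have br: "branching (\<B> i)" if i: "i \<in> S" for i
  proof (rule branchingI[OF wf])
    fix a b assume "a \<in> arcs (\<B> i)" "b \<in> arcs (\<B> i)" "head (\<B> i) a = head (\<B> i) b"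
    then show "a = b" using RD(4) unfolding sel by blast
  next
    fix v assume "v \<in> verts (\<B> i)"
    then have "i \<in> pk.packed_labels R v" unfolding sel by simp
    then obtain u p where u: "i \<in> Sv u" "arc_walk (tail D) (head D) u p v" "\<forall>a\<in>set p. (a, i) \<in> R" using RD(5) by blast
    have "u \<in> root_set (\<B> i)" unfolding root[OF i] using u(1) unfolding sources_def by blast
    moreover have "set p \<subseteq> arcs (\<B> i)" using u(3) unfolding sel by blast
    ultimately show "\<exists>u p. u \<in> root_set (\<B> i) \<and> arc_walk (tail (\<B> i)) (head (\<B> i)) u p v \<and> set p \<subseteq> arcs (\<B> i)"
      using u(2) unfolding sel by blast
  qed
  have sg: "subgraph (\<B> i) D" for i
    unfolding subgraph_def compatible_def using wf[of i] wf_digraph_axioms RD(2) by (auto simp: sel)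
  have ps: "packing_sources S \<B> v = pk.packed_labels R v" if "v \<in> verts D" for v
    using SgN[OF that] that unfolding packing_sources_def sel by blast
  have "branching_packing D S \<pi> \<B>" unfolding branching_packing_def
  proof (intro conjI ballI impI)
    fix i j :: 's assume "i \<noteq> j"
    then show "arcs (\<B> i) \<inter> arcs (\<B> j) = {}" using RD(3) unfolding sel by blast
  qed (use br sg root in auto)
  moreover have "independent_packing D S Ind \<B>" unfolding independent_packing_def
  proof
    fix v assume v: "v \<in> verts D"
    let ?I = "pk.packed_labels R v"
    have "mcl (?I - {x}) = mspan (?I - {x})" for x using SgN[OF v] by (intro mcl_span) blast
    moreover have "pk.indep ?I" using RD(6)[OF v] by blast
    ultimately have "?I \<in> Ind" unfolding Ind_iff[OF SgN[OF v]] pk.indep_def by simp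
    then show "packing_sources S \<B> v \<in> Ind" unfolding ps[OF v] .
  qed
  moreover have "maximal_packing D S Ind \<pi> \<B>" unfolding maximal_packing_def
  proof
    fix v assume v: "v \<in> verts D"
    have "Nv v \<subseteq> mcl (pk.packed_labels R v)" using RD(6)[OF v] by blast
    then show "spans S Ind (packing_sources S \<B> v) (Nv v)" unfolding spans_def ps[OF v] mcl_span[OF SgN[OF v]] .
  qed
  ultimately show ?thesis by blast
qed

lemma finite_rank_empty: "finite_rank (restrict_matroid Ind {})"
  unfolding finite_rank_def using base_of_iff[of "{}" "{}"] empty_Ind by blast

text \<open>Under (F) the set \<open>S\<close> names the only summand inside the matroid; a
  singleton of an element outside \<open>S\<close> cannot coincide with it.\<close>

lemma closure_matroid_finite_rank:
  assumes "finite_rank Ind"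
  shows "closure_matroid mcl (\<lambda>i. if i \<in> S then S else {i})"
proof (rule closure_matroid_mcl)
  fix x y assume "(x, y) \<in> common_circuit S Ind"
  then have "x \<in> S" "y \<in> S" unfolding common_circuit_def matroid_circuit_def by blast+
  then show "(if x \<in> S then S else {x}) = (if y \<in> S then S else {y})" by simp
next
  fix k
  have "{i \<in> S. (if i \<in> S then S else {i}) = k} = (if k = S then S else {})" by auto
  moreover have "restrict_matroid Ind S = Ind" unfolding restrict_matroid_def using Ind_subset by blast
  ultimately show "finite_rank (restrict_matroid Ind {i \<in> S. (if i \<in> S then S else {i}) = k})"
    using assms finite_rank_empty by simp
qed auto

text \<open>A component serves as its own name, so the elements of \<open>S\<close> with a given
  value of the summand map form a component or the empty set.\<close>

lemma closure_matroid_components: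
  assumes fr: "\<forall>C \<in> matroid_components S Ind. finite_rank (restrict_matroid Ind C)"
  shows "closure_matroid mcl (\<lambda>i. if i \<in> S then component_rel S Ind `` {i} else {i})"
proof (rule closure_matroid_mcl)
  note eq = component_rel_equiv[of S Ind]
  have relS: "component_rel S Ind `` {i} \<subseteq> S" for i using eq unfolding equiv_def refl_on_def by blast
  show "(if i \<in> S then component_rel S Ind `` {i} else {i}) \<subseteq> S" if "i \<in> S" for i using that relS by simp
  fix x y assume c: "(x, y) \<in> common_circuit S Ind"
  then have "x \<in> S" "y \<in> S" unfolding common_circuit_def matroid_circuit_def by blast+
  moreover have "(x, y) \<in> component_rel S Ind" using c unfolding component_rel_def by auto
  ultimately show "(if x \<in> S then component_rel S Ind `` {x} else {x}) = (if y \<in> S then component_rel S Ind `` {y} else {y})"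
    using equiv_class_eq[OF eq] by simp
next
  fix k
  note eq = component_rel_equiv[of S Ind]
  let ?X = "{i \<in> S. (if i \<in> S then component_rel S Ind `` {i} else {i}) = k}"
  show "finite_rank (restrict_matroid Ind ?X)"
  proof (cases "?X = {}")
    case True then show ?thesis using finite_rank_empty by simp
  next
    case False
    then obtain i where i: "i \<in> S" "component_rel S Ind `` {i} = k" by auto
    have "?X = k"
    proof
      show "?X \<subseteq> k" using equiv_class_self[OF eq] by auto
      show "k \<subseteq> ?X"
      proof
        fix j assume "j \<in> k"
        then have ij: "(i, j) \<in> component_rel S Ind" using i(2) by blast
        then have "j \<in> S" using eq unfolding equiv_def refl_on_def by blast
        moreover have "component_rel S Ind `` {j} = k" using equiv_class_eq[OF eq ij] i(2) by simp
        ultimately show "j \<in> ?X" by simp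
      qed
    qed
    moreover have "k \<in> matroid_components S Ind" using quotientI[OF i(1), of "component_rel S Ind"] i(2) unfolding matroid_components_def by simp
    ultimately show ?thesis using fr by simp
  qed
qed simp

end

theorem mainTheorem1:
  fixes D :: "('v, 'a) pre_digraph" and S :: "'s set" and Ind :: "'s set set"
    and \<pi> :: "'s \<Rightarrow> 'v set"
  assumes "matroid_rooted_digraph D S Ind \<pi>"
    and "independent_mrd D S Ind \<pi>"
    and "linkage_condition D S Ind \<pi>"
    and "condition_F D S Ind \<pi> \<or> condition_B D S Ind \<pi>"
  shows "\<exists>\<B>. branching_packing D S \<pi> \<B> \<and> independent_packing D S Ind \<B> \<and>
    maximal_packing D S Ind \<pi> \<B>"
proof -
  interpret matroid_rooted_digraph D S Ind \<pi> by (rule assms(1))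
  show ?thesis using assms(4)
  proof
    assume F: "condition_F D S Ind \<pi>"
    let ?\<kappa> = "\<lambda>i. if i \<in> S then S else {i}"
    have "countable (?\<kappa> ` S)"
    proof -
      have "?\<kappa> ` S \<subseteq> {S}" by auto
      then show ?thesis by (rule countable_subset) simp
    qed
    moreover have "closure_matroid mcl ?\<kappa>" using F closure_matroid_finite_rank unfolding condition_F_def by blast
    ultimately show ?thesis
      using F assms(2,3) by (intro packing_of_closure[of ?\<kappa>] packing_mcl) (auto simp: condition_F_def)
  next
    assume B: "condition_B D S Ind \<pi>"
    let ?\<kappa> = "\<lambda>i. if i \<in> S then component_rel S Ind `` {i} else {i}"
    have "countable (?\<kappa> ` S)"
    proof -
      have "?\<kappa> ` S \<subseteq> matroid_components S Ind" unfolding matroid_components_def by (auto intro: quotientI)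
      then show ?thesis using B unfolding condition_B_def by (meson countable_subset)
    qed
    moreover have "closure_matroid mcl ?\<kappa>" using B closure_matroid_components unfolding condition_B_def by blast
    ultimately show ?thesis
      using B assms(2,3) by (intro packing_of_closure[of ?\<kappa>] packing_mcl) (auto simp: condition_B_def)
  qed
qed

end
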